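(* Assume $p_s\ge 2$, $\widehat{\mathcal S}^{\boldsymbol p_s}_{h_s}\subset C^1(\widehat\Omega)$, $p_t\ge 1$, $\widehat{\mathcal S}^{p_t}_{h_t}\subset C^0([0,1])$, $\mathbf F\in[\widehat{\mathcal S}^{\boldsymbol p_s}_{h_s}]^d$ on the closure of $\widehat\Omega$ with $\Omega=\mathbf F(\widehat\Omega)$, and that $\mathbf F^{-1}$ has piecewise bounded derivatives of any order. Let $f\in L^2(\Omega\times(0,T))$. The minimization problem: find $$u_h=\underset{v_h\in\mathcal V_{h,0}}{\arg\min}\ \tfrac12\|\partial_t v_h-\Delta v_h-f\|^2_{L^2(\Omega\times(0,T))}$$ and the variational problem: find $u_h\in\mathcal V_{h,0}$ such that $\mathcal A(u_h,v_h)=\mathcal F(v_h)$ for all $v_h\in\mathcal V_{h,0}$, are equivalent and admit a unique solution $u_h\in\mathcal V_{h,0}$. Moreover, if $u\in\mathcal V_0$ denotes the unique solution of $\mathcal A(u,v)=\mathcal F(v)$ for all $v\in\mathcal V_0$, then $$\|u-u_h\|_{\mathcal V_0}\le\sqrt2\inf_{v_h\in\mathcal V_{h,0}}\|u-v_h\|_{\mathcal V_0}.$$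
   Context: Setting. Let $d\ge 1$, $\widehat\Omega=(0,1)^d$, $T>0$. An open knot vector of degree $p$ is a non-decreasing sequence $0=\xi_1\le\dots\le\xi_{m+p+1}=1$ with $\xi_1=\dots=\xi_{p+1}=0$ and $\xi_{m+1}=\dots=\xi_{m+p+1}=1$; it defines the usual (Cox–de Boor) B-splines on $(0,1)$. One takes open knot vectors $\Xi_1,\dots,\Xi_d$ of degree $p_s$ in the space directions (maximal knot span length $h_s$) and $\Xi_t$ of degree $p_t$ in the time direction (maximal knot span length $h_t$). $\widehat{\mathcal S}^{\boldsymbol p_s}_{h_s}$ is the span of the products of the univariate B-splines in the $d$ space directions, $\widehat{\mathcal S}^{p_t}_{h_t}$ the univariate spline space in time, and $\widehat{\mathcal S}^{\boldsymbol p}_h=\widehat{\mathcal S}^{\boldsymbol p_s}_{h_s}\otimes\widehat{\mathcal S}^{p_t}_{h_t}$. Geometry. $\mathbf F:\widehat\Omega\to\Omega\subset\mathbb R^d$ is an invertible (non-singular) single-patch map; "piecewise" refers to the partition of $\Omega$ into images under $\mathbf F$ of the mesh elements (products of knot spans). $\mathbf G(\boldsymbol\eta,\tau)=(\mathbf F(\boldsymbol\eta),T\tau)$. Spaces. $H^n(\Omega)\otimes H^m(0,T)$ is identified with $H^m((0,T);H^n(\Omega))$. $\mathcal V_0$ is the set of $v\in[(H^1_0(\Omega)\cap H^2(\Omega))\otimes L^2(0,T)]\cap[L^2(\Omega)\otimes H^1(0,T)]$ with $v=0$ on $\Omega\times\{0\}$, with norm $\|v\|_{\mathcal V_0}^2=\int_0^T\|\Delta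 v(\cdot,t)\|^2_{L^2(\Omega)}dt+\int_0^T\|\partial_t v(\cdot,t)\|^2_{L^2(\Omega)}dt$ ($\Delta$: Laplacian in space). $\mathcal V_{h,0}=\{\widehat v_h\circ\mathbf G^{-1}:\widehat v_h\in\widehat{\mathcal S}^{\boldsymbol p}_h,\ \widehat v_h=0\text{ on }\partial\widehat\Omega\times[0,1]\text{ and on }\widehat\Omega\times\{0\}\}$. Forms. $\mathcal A(v,w)=\int_0^T\int_\Omega(\partial_t v\,\partial_t w+\Delta v\,\Delta w-\partial_t v\,\Delta w-\Delta v\,\partial_t w)\,d\Omega\,dt$ and $\mathcal F(w)=\int_0^T\int_\Omega f(\partial_t w-\Delta w)\,d\Omega\,dt$. *)

theory Defs
  imports "HOL-Analysis.Analysis"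
begin

section \<open>Splines\<close>

definition open_knot_vector :: "nat \<Rightarrow> real list \<Rightarrow> bool" where
  "open_knot_vector p \<xi> \<longleftrightarrow>
     (\<exists>m. length \<xi> = m + p + 1 \<and> sorted \<xi> \<and> (\<forall>i\<le>p. \<xi> ! i = 0 \<and> \<xi> ! (m + i) = 1))"

text \<open>Cox--de Boor recursion with knots and splines indexed from \<open>0\<close>. Quotients with vanishing
  denominator are \<open>0\<close>, as usual. The last non-empty knot span is closed at \<open>1\<close>, so that the value
  at \<open>1\<close> is the left limit.\<close>

fun bspline :: "real list \<Rightarrow> nat \<Rightarrow> nat \<Rightarrow> real \<Rightarrow> real" where
  "bspline \<xi> 0 i x =
     (if \<xi> ! i \<le> x \<and> x < \<xi> ! (i + 1) \<or> x = 1 \<and> \<xi> ! i < 1 \<and> \<xi> ! (i + 1) = 1 then 1 else 0)"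
| "bspline \<xi> (Suc q) i x =
     (x - \<xi> ! i) / (\<xi> ! (i + q + 1) - \<xi> ! i) * bspline \<xi> q i x
   + (\<xi> ! (i + q + 2) - x) / (\<xi> ! (i + q + 2) - \<xi> ! (i + 1)) * bspline \<xi> q (i + 1) x"

definition num_bsplines :: "nat \<Rightarrow> real list \<Rightarrow> nat" where
  "num_bsplines p \<xi> = length \<xi> - (p + 1)"

text \<open>Linear span of the functions \<open>b i\<close>, for a finite index set \<open>I\<close>.\<close>

definition fun_span :: "'i set \<Rightarrow> ('i \<Rightarrow> 'x \<Rightarrow> real) \<Rightarrow> ('x \<Rightarrow> real) set" where
  "fun_span I b = range (\<lambda>c x. \<Sum>i\<in>I. c i * b i x)"

definition space_index :: "('d::finite \<Rightarrow> nat) \<Rightarrow> ('d \<Rightarrow> real list) \<Rightarrow> ('d \<Rightarrow> nat) set" where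
  "space_index p \<Xi> = {i. \<forall>k. i k < num_bsplines (p k) (\<Xi> k)}"

definition space_bspline ::
  "('d::finite \<Rightarrow> nat) \<Rightarrow> ('d \<Rightarrow> real list) \<Rightarrow> ('d \<Rightarrow> nat) \<Rightarrow> real^'d \<Rightarrow> real" where
  "space_bspline p \<Xi> i \<eta> = (\<Prod>k\<in>UNIV. bspline (\<Xi> k) (p k) (i k) (\<eta> $ k))"

definition space_splines ::
  "('d::finite \<Rightarrow> nat) \<Rightarrow> ('d \<Rightarrow> real list) \<Rightarrow> (real^'d \<Rightarrow> real) set" where
  "space_splines p \<Xi> = fun_span (space_index p \<Xi>) (space_bspline p \<Xi>)"

definition time_splines :: "nat \<Rightarrow> real list \<Rightarrow> (real \<Rightarrow> real) set" where
  "time_splines p \<xi> = fun_span {..<num_bsplines p \<xi>} (bspline \<xi> p)"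

definition spacetime_splines ::
  "('d::finite \<Rightarrow> nat) \<Rightarrow> ('d \<Rightarrow> real list) \<Rightarrow> nat \<Rightarrow> real list \<Rightarrow> ((real^'d) \<times> real \<Rightarrow> real) set" where
  "spacetime_splines p \<Xi> q \<xi> =
     fun_span (space_index p \<Xi> \<times> {..<num_bsplines q \<xi>})
       (\<lambda>(i, j) (\<eta>, \<tau>). space_bspline p \<Xi> i \<eta> * bspline \<xi> q j \<tau>)"

text \<open>Open mesh elements: products of the non-empty open knot spans.\<close>

definition mesh_elements :: "('d::finite \<Rightarrow> real list) \<Rightarrow> (real^'d) set set" where
  "mesh_elements \<Xi> =
     {box (\<chi> k. \<Xi> k ! i k) (\<chi> k. \<Xi> k ! (i k + 1)) | i.
        \<forall>k. i k + 1 < length (\<Xi> k) \<and> \<Xi> k ! i k < \<Xi> k ! (i k + 1)}"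

section \<open>Classical derivatives and test functions\<close>

definition dpartial :: "'a::euclidean_space \<Rightarrow> ('a \<Rightarrow> real) \<Rightarrow> 'a \<Rightarrow> real" where
  "dpartial b g x = frechet_derivative g (at x) b"

definition dpartials :: "'a::euclidean_space list \<Rightarrow> ('a \<Rightarrow> real) \<Rightarrow> 'a \<Rightarrow> real" where
  "dpartials bs g = foldr dpartial bs g"

text \<open>The following two notions are meant for open sets \<open>U\<close>.\<close>

definition C1_on :: "'a::euclidean_space set \<Rightarrow> ('a \<Rightarrow> real) \<Rightarrow> bool" where
  "C1_on U g \<longleftrightarrow>
     (\<forall>x\<in>U. g differentiable (at x)) \<and> (\<forall>b\<in>Basis. continuous_on U (dpartial b g))"

definition Cinf_on :: "'a::euclidean_space set \<Rightarrow> ('a \<Rightarrow> real) \<Rightarrow> bool" where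
  "Cinf_on U g \<longleftrightarrow>
     (\<forall>bs. set bs \<subseteq> Basis \<longrightarrow> (\<forall>x\<in>U. dpartials bs g differentiable (at x)))"

definition bounded_derivatives_on :: "'a::euclidean_space set \<Rightarrow> ('a \<Rightarrow> real) \<Rightarrow> bool" where
  "bounded_derivatives_on U g \<longleftrightarrow>
     Cinf_on U g \<and> (\<forall>bs. set bs \<subseteq> Basis \<longrightarrow> bounded (dpartials bs g ` U))"

definition test_functions :: "'a::euclidean_space set \<Rightarrow> ('a \<Rightarrow> real) set" where
  "test_functions U =
     {\<phi>. Cinf_on UNIV \<phi> \<and> (\<exists>K. compact K \<and> K \<subseteq> U \<and> (\<forall>x. x \<notin> K \<longrightarrow> \<phi> x = 0))}"

section \<open>Sobolev spaces\<close>

text \<open>Elements of function spaces are functions on the whole type, of which only the values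
  on the given (open) domain matter. They represent classes modulo equality almost everywhere;
  every such class has a Borel representative.\<close>

definition L2 :: "'a::euclidean_space set \<Rightarrow> ('a \<Rightarrow> real) set" where
  "L2 S = {g. set_borel_measurable lborel S g \<and> set_integrable lborel S (\<lambda>x. (g x)\<^sup>2)}"

definition L2_norm :: "'a::euclidean_space set \<Rightarrow> ('a \<Rightarrow> real) \<Rightarrow> real" where
  "L2_norm S g = sqrt (LINT x:S|lborel. (g x)\<^sup>2)"

definition weak_derivative ::
  "'a::euclidean_space set \<Rightarrow> 'a list \<Rightarrow> ('a \<Rightarrow> real) \<Rightarrow> ('a \<Rightarrow> real) \<Rightarrow> bool" where
  "weak_derivative U bs g w \<longleftrightarrow>
     (\<forall>\<phi>\<in>test_functions U.
        (LINT x:U|lborel. g x * dpartials bs \<phi> x)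
          = (- 1) ^ length bs * (LINT x:U|lborel. w x * \<phi> x))"

definition sobolev :: "nat \<Rightarrow> 'a::euclidean_space set \<Rightarrow> ('a \<Rightarrow> real) set" where
  "sobolev n U =
     {g \<in> L2 U. \<forall>bs. set bs \<subseteq> Basis \<and> length bs \<le> n \<longrightarrow> (\<exists>w\<in>L2 U. weak_derivative U bs g w)}"

text \<open>\<open>H\<^sup>1\<^sub>0\<close>: the closure of the test functions in \<open>H\<^sup>1\<close>.\<close>

definition sobolev1_0 :: "'a::euclidean_space set \<Rightarrow> ('a \<Rightarrow> real) set" where
  "sobolev1_0 U =
     {g \<in> sobolev 1 U. \<exists>\<phi>::nat \<Rightarrow> 'a \<Rightarrow> real.
        (\<forall>n. \<phi> n \<in> test_functions U) \<and>
        (\<lambda>n. L2_norm U (\<lambda>x. \<phi> n x - g x)) \<longlonglongrightarrow> 0 \<and>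
        (\<forall>b\<in>Basis. \<exists>w\<in>L2 U. weak_derivative U [b] g w \<and>
           (\<lambda>n. L2_norm U (\<lambda>x. dpartial b (\<phi> n) x - w x)) \<longlonglongrightarrow> 0)}"

section \<open>Bochner spaces on the space-time cylinder\<close>

text \<open>A function \<open>v\<close> on the cylinder stands for the vector-valued map sending \<open>t\<close> to
  \<open>v(\<cdot>, t)\<close>.\<close>

abbreviation cylinder :: "'a set \<Rightarrow> real \<Rightarrow> ('a \<times> real) set" where
  "cylinder \<Omega> T \<equiv> \<Omega> \<times> {0<..<T}"

text \<open>Derivatives in the space directions are taken slice by slice.\<close>

definition weak_space_derivative ::
  "'a::euclidean_space set \<Rightarrow> real \<Rightarrow> 'a list \<Rightarrow> ('a \<times> real \<Rightarrow> real) \<Rightarrow> ('a \<times> real \<Rightarrow> real) \<Rightarrow> bool"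
  where
  "weak_space_derivative \<Omega> T bs v w \<longleftrightarrow>
     (AE t in lborel. t \<in> {0<..<T} \<longrightarrow>
        weak_derivative \<Omega> bs (\<lambda>x. v (x, t)) (\<lambda>x. w (x, t)))"

text \<open>The defining identity of the time derivative, integrated against a scalar test function of
  \<open>t\<close>, is an identity between elements of \<open>L\<^sup>2(\<Omega>)\<close>, hence holds for almost every \<open>x\<close>.\<close>

definition weak_time_derivative ::
  "'a::euclidean_space set \<Rightarrow> real \<Rightarrow> ('a \<times> real \<Rightarrow> real) \<Rightarrow> ('a \<times> real \<Rightarrow> real) \<Rightarrow> bool" where
  "weak_time_derivative \<Omega> T v w \<longleftrightarrow>
     (\<forall>\<phi>\<in>test_functions {0<..<T}. AE x in lborel. x \<in> \<Omega> \<longrightarrow>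
        (LINT t:{0<..<T}|lborel. v (x, t) * deriv \<phi> t)
          = - (LINT t:{0<..<T}|lborel. w (x, t) * \<phi> t))"

text \<open>\<open>L\<^sup>2((0,T); H\<^sup>1\<^sub>0(\<Omega>) \<inter> H\<^sup>2(\<Omega>))\<close>. Joint measurability and square integrability of the
  derivatives render strong measurability and square integrability in the \<open>H\<^sup>2\<close>-norm.\<close>

definition L2_H1_0_H2 :: "'a::euclidean_space set \<Rightarrow> real \<Rightarrow> ('a \<times> real \<Rightarrow> real) set" where
  "L2_H1_0_H2 \<Omega> T =
     {v \<in> L2 (cylinder \<Omega> T).
        (AE t in lborel. t \<in> {0<..<T} \<longrightarrow> (\<lambda>x. v (x, t)) \<in> sobolev1_0 \<Omega> \<inter> sobolev 2 \<Omega>) \<and>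
        (\<forall>bs. set bs \<subseteq> Basis \<and> length bs \<le> 2 \<longrightarrow>
           (\<exists>w\<in>L2 (cylinder \<Omega> T). weak_space_derivative \<Omega> T bs v w))}"

text \<open>\<open>H\<^sup>1((0,T); L\<^sup>2(\<Omega>))\<close>\<close>

definition H1_L2 :: "'a::euclidean_space set \<Rightarrow> real \<Rightarrow> ('a \<times> real \<Rightarrow> real) set" where
  "H1_L2 \<Omega> T =
     {v \<in> L2 (cylinder \<Omega> T). \<exists>w\<in>L2 (cylinder \<Omega> T). weak_time_derivative \<Omega> T v w}"

text \<open>Vanishing on \<open>\<Omega> \<times> {0}\<close>, through the representative in \<open>C([0,T]; L\<^sup>2(\<Omega>))\<close>.\<close>

definition zero_initial_trace ::
  "'a::euclidean_space set \<Rightarrow> real \<Rightarrow> ('a \<times> real \<Rightarrow> real) \<Rightarrow> bool" where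
  "zero_initial_trace \<Omega> T v \<longleftrightarrow>
     (\<exists>V :: real \<Rightarrow> 'a \<Rightarrow> real.
        (\<forall>t\<in>{0..T}. V t \<in> L2 \<Omega> \<and>
           ((\<lambda>s. L2_norm \<Omega> (\<lambda>x. V s x - V t x)) \<longlongrightarrow> 0) (at t within {0..T})) \<and>
        (AE t in lborel. t \<in> {0<..<T} \<longrightarrow> (AE x in lborel. x \<in> \<Omega> \<longrightarrow> V t x = v (x, t))) \<and>
        (AE x in lborel. x \<in> \<Omega> \<longrightarrow> V 0 x = 0))"

definition V0 :: "'a::euclidean_space set \<Rightarrow> real \<Rightarrow> ('a \<times> real \<Rightarrow> real) set" where
  "V0 \<Omega> T = {v \<in> L2_H1_0_H2 \<Omega> T \<inter> H1_L2 \<Omega> T. zero_initial_trace \<Omega> T v}"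

text \<open>The weak derivatives are unique up to null sets; one representative is chosen.\<close>

definition space_derivative ::
  "'a::euclidean_space set \<Rightarrow> real \<Rightarrow> 'a list \<Rightarrow> ('a \<times> real \<Rightarrow> real) \<Rightarrow> 'a \<times> real \<Rightarrow> real" where
  "space_derivative \<Omega> T bs v =
     (SOME w. w \<in> L2 (cylinder \<Omega> T) \<and> weak_space_derivative \<Omega> T bs v w)"

definition time_derivative ::
  "'a::euclidean_space set \<Rightarrow> real \<Rightarrow> ('a \<times> real \<Rightarrow> real) \<Rightarrow> 'a \<times> real \<Rightarrow> real" where
  "time_derivative \<Omega> T v =
     (SOME w. w \<in> L2 (cylinder \<Omega> T) \<and> weak_time_derivative \<Omega> T v w)"

definition laplacian ::
  "'a::euclidean_space set \<Rightarrow> real \<Rightarrow> ('a \<times> real \<Rightarrow> real) \<Rightarrow> 'a \<times> real \<Rightarrow> real" where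
  "laplacian \<Omega> T v z = (\<Sum>b\<in>Basis. space_derivative \<Omega> T [b, b] v z)"

definition V0_norm :: "'a::euclidean_space set \<Rightarrow> real \<Rightarrow> ('a \<times> real \<Rightarrow> real) \<Rightarrow> real" where
  "V0_norm \<Omega> T v =
     sqrt ((LINT t:{0<..<T}|lborel. (L2_norm \<Omega> (\<lambda>x. laplacian \<Omega> T v (x, t)))\<^sup>2)
         + (LINT t:{0<..<T}|lborel. (L2_norm \<Omega> (\<lambda>x. time_derivative \<Omega> T v (x, t)))\<^sup>2))"

section \<open>The discrete space and the forms\<close>

definition geo_map :: "('a \<Rightarrow> 'b) \<Rightarrow> real \<Rightarrow> 'a \<times> real \<Rightarrow> 'b \<times> real" where
  "geo_map F T = (\<lambda>(\<eta>, \<tau>). (F \<eta>, T * \<tau>))"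

text \<open>Push-forwards are functions on the open cylinder \<open>F(\<Omega>\<^sub>0) \<times> (0,T)\<close>, where
  \<open>\<Omega>\<^sub>0 = (0,1)\<^sup>d\<close>. They are set to \<open>0\<close> elsewhere, so that
  equality of elements of \<open>Vh0\<close> is equality of functions on the cylinder.\<close>

definition Vh0 ::
  "('d::finite \<Rightarrow> nat) \<Rightarrow> ('d \<Rightarrow> real list) \<Rightarrow> nat \<Rightarrow> real list \<Rightarrow> (real^'d \<Rightarrow> real^'d) \<Rightarrow> real
     \<Rightarrow> ((real^'d) \<times> real \<Rightarrow> real) set" where
  "Vh0 p \<Xi> q \<xi> F T =
     {(\<lambda>z. if z \<in> cylinder (F ` box 0 1) T
            then g (inv_into (box 0 1 \<times> {0<..<1}) (geo_map F T) z) else 0) | g.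
        g \<in> spacetime_splines p \<Xi> q \<xi> \<and>
        (\<forall>z \<in> frontier (box 0 1) \<times> {0..1}. g z = 0) \<and>
        (\<forall>z \<in> box 0 1 \<times> {0}. g z = 0)}"

definition form_A ::
  "'a::euclidean_space set \<Rightarrow> real \<Rightarrow> ('a \<times> real \<Rightarrow> real) \<Rightarrow> ('a \<times> real \<Rightarrow> real) \<Rightarrow> real" where
  "form_A \<Omega> T v w =
     (LINT t:{0<..<T}|lborel. LINT x:\<Omega>|lborel.
          time_derivative \<Omega> T v (x, t) * time_derivative \<Omega> T w (x, t)
        + laplacian \<Omega> T v (x, t) * laplacian \<Omega> T w (x, t)
        - time_derivative \<Omega> T v (x, t) * laplacian \<Omega> T w (x, t)
        - laplacian \<Omega> T v (x, t) * time_derivative \<Omega> T w (x, t))"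

definition form_F ::
  "'a::euclidean_space set \<Rightarrow> real \<Rightarrow> ('a \<times> real \<Rightarrow> real) \<Rightarrow> ('a \<times> real \<Rightarrow> real) \<Rightarrow> real" where
  "form_F \<Omega> T f w =
     (LINT t:{0<..<T}|lborel. LINT x:\<Omega>|lborel.
        f (x, t) * (time_derivative \<Omega> T w (x, t) - laplacian \<Omega> T w (x, t)))"

definition ls_functional ::
  "'a::euclidean_space set \<Rightarrow> real \<Rightarrow> ('a \<times> real \<Rightarrow> real) \<Rightarrow> ('a \<times> real \<Rightarrow> real) \<Rightarrow> real" where
  "ls_functional \<Omega> T f v =
     1 / 2 * (L2_norm (cylinder \<Omega> T)
       (\<lambda>z. time_derivative \<Omega> T v z - laplacian \<Omega> T v z - f z))\<^sup>2"

text \<open>The Galerkin problem \<open>A(u, v) = F(v)\<close> for all \<open>v\<close> in the trial space \<open>X\<close>.\<close>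

definition variational_solution ::
  "'a::euclidean_space set \<Rightarrow> real \<Rightarrow> ('a \<times> real \<Rightarrow> real) \<Rightarrow> ('a \<times> real \<Rightarrow> real) set
     \<Rightarrow> ('a \<times> real \<Rightarrow> real) \<Rightarrow> bool" where
  "variational_solution \<Omega> T f X u \<longleftrightarrow> u \<in> X \<and> (\<forall>v\<in>X. form_A \<Omega> T u v = form_F \<Omega> T f v)"

end

theory Submission
  imports Defs
begin

text \<open>The form \<open>\<A>\<close> is the inner product of the residuals \<open>R v = \<partial>\<^sub>t v - \<Delta> v\<close>, so both discrete problems ask for
  the orthogonal projection of \<open>f\<close> onto \<open>R\<close> of the discrete space. Stability is the energy inequality
  \<open>-\<integral>\<integral> \<partial>\<^sub>t v \<Delta> v \<ge> 0\<close> on \<open>V0\<close>, i.e. \<open>\<parallel>v\<parallel>\<^sub>V\<^sup>2 \<le> \<parallel>R v\<parallel>\<^sup>2\<close>; together with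
  \<open>\<parallel>R v\<parallel>\<^sup>2 \<le> 2 \<parallel>v\<parallel>\<^sub>V\<^sup>2\<close> it gives uniqueness and the constant \<open>\<surd>2\<close>. The inequality is proved without
  density arguments in time: the gradients of the slices satisfy
  \<open>-\<langle>v(t) - v(t-h), \<Delta> v(t)\<rangle> \<ge> (\<parallel>\<nabla>v(t)\<parallel>\<^sup>2 - \<parallel>\<nabla>v(t-h)\<parallel>\<^sup>2)/2\<close>, where \<open>v\<close> is extended by \<open>0\<close> to
  negative times; integrate over \<open>t\<close> and let \<open>h\<close> tend to \<open>0\<close>.

  That the discrete space lies in \<open>V0\<close> holds although \<open>F\<^sup>-\<^sup>1\<close> is smooth only piecewise: first
  derivatives of push-forwards are continuous, and they are locally Lipschitz because they are Lipschitz on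
  each mesh element, whence their weak derivatives are the elementwise ones.\<close>

section \<open>Smooth functions and test functions\<close>

text \<open>Two features of the setting shape the details. Weak derivatives are chosen
  representatives, so identities for them hold only almost everywhere, and the weak time derivative
  allows each scalar test function its own null set of points x. For this reason v is first
  identified with the time primitive of its derivative, the zero initial trace fixing the constant
  of integration; backward increments of v are then integrals of translates of its derivative, and
  continuity of translations in L2 takes the place of differentiability in time. The other feature
  is the boundary of the physical domain, about which nothing is assumed: F is injective only on the
  open cube and may glue boundary points. Zero boundary values are therefore expressed through
  compactness of the sets where |v| \<ge> e, a property that F carries over from the cube, and
  membership in the closure of the test functions is obtained by cutting off small values and
  mollifying. Existence of the discrete solution is an orthogonalization in finitely many steps; its
  uniqueness as a function, and not only as a class, rests on continuity of the discrete
  functions.\<close>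

lemma dpartial_eq: "(f has_derivative D) (at x) \<Longrightarrow> dpartial b f x = D b"
  by (simp add: dpartial_def frechet_derivative_at[symmetric])

lemma has_derivative_cong_open:
  assumes "open U" "x \<in> U" "\<And>y. y \<in> U \<Longrightarrow> f y = g y"
  shows "(f has_derivative D) (at x) \<longleftrightarrow> (g has_derivative D) (at x)"
  using has_derivative_transform_within_open[of f D x UNIV U g]
    has_derivative_transform_within_open[of g D x UNIV U f] assms by auto

lemma differentiable_cong_open:
  assumes "open U" "x \<in> U" "\<And>y. y \<in> U \<Longrightarrow> f y = g y"
  shows "f differentiable (at x) \<longleftrightarrow> g differentiable (at x)"
  unfolding differentiable_def using has_derivative_cong_open[OF assms] by auto

lemma dpartial_cong_open:
  assumes "open U" "x \<in> U" "\<And>y. y \<in> U \<Longrightarrow> f y = g y"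
  shows "dpartial b f x = dpartial b g x"
  unfolding dpartial_def frechet_derivative_def using has_derivative_cong_open[OF assms] by simp

lemma dpartial_const [simp]: "dpartial b (\<lambda>x. c) = (\<lambda>x. 0)"
  by (rule ext) (auto intro!: dpartial_eq[where D="\<lambda>_. 0", THEN trans])

lemma dpartial_add:
  assumes "f differentiable (at x)" "g differentiable (at x)"
  shows "dpartial b (\<lambda>x. f x + g x) x = dpartial b f x + dpartial b g x"
  using assms unfolding frechet_derivative_works
  by (subst dpartial_eq[OF has_derivative_add]) (auto simp: dpartial_def)

lemma dpartial_mult:
  assumes "f differentiable (at x)" "g differentiable (at x)"
  shows "dpartial b (\<lambda>x. f x * g x) x = f x * dpartial b g x + dpartial b f x * g x"
  using assms unfolding frechet_derivative_works
  by (subst dpartial_eq[OF has_derivative_mult]) (auto simp: dpartial_def)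

text \<open>The flag \<open>c\<close> adds boundedness, so one set of closure rules serves both
  \<open>Cinf_on\<close> and \<open>bounded_derivatives_on\<close>. Recursion on the order, over all
  directions at once, lets the product rule go through by induction; with derivatives indexed by
  lists it would require a Leibniz formula.\<close>

primrec smooth_upto :: "bool \<Rightarrow> nat \<Rightarrow> 'a::euclidean_space set \<Rightarrow> ('a \<Rightarrow> real) \<Rightarrow> bool" where
  "smooth_upto c 0 U f \<longleftrightarrow> (c \<longrightarrow> bounded (f ` U))"
| "smooth_upto c (Suc n) U f \<longleftrightarrow> (c \<longrightarrow> bounded (f ` U)) \<and> (\<forall>x\<in>U. f differentiable (at x)) \<and>
     (\<forall>b\<in>Basis. smooth_upto c n U (dpartial b f))"

lemma smooth_upto_cong:
  assumes "open U" "\<And>x. x \<in> U \<Longrightarrow> f x = g x"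
  shows "smooth_upto c n U f \<longleftrightarrow> smooth_upto c n U g"
  using assms(2)
proof (induction n arbitrary: f g)
  case 0
  then show ?case by (simp cong: image_cong)
next
  case (Suc n)
  have "smooth_upto c n U (dpartial b f) \<longleftrightarrow> smooth_upto c n U (dpartial b g)" for b
    by (rule Suc.IH) (rule dpartial_cong_open[OF assms(1) _ Suc.prems])
  moreover have "f ` U = g ` U" using Suc.prems by (simp cong: image_cong)
  ultimately show ?case
    using differentiable_cong_open[OF assms(1) _ Suc.prems] by simp
qed

lemma smooth_upto_SucD: "smooth_upto c (Suc n) U f \<Longrightarrow> smooth_upto c n U f"
  by (induction n arbitrary: f) auto

lemma smooth_upto_const [intro, simp]: "smooth_upto c n U (\<lambda>x. k)"
proof (induction n arbitrary: k)
  case (Suc n)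
  then show ?case by (auto simp: bounded_real)
qed (auto simp: bounded_real)

lemma bounded_add_image:
  fixes f g :: "'a \<Rightarrow> real"
  assumes "bounded (f ` U)" "bounded (g ` U)"
  shows "bounded ((\<lambda>x. f x + g x) ` U)"
  by (rule bounded_plus_comp[OF assms])

lemma bounded_mult_image:
  fixes f g :: "'a \<Rightarrow> real"
  assumes "bounded (f ` U)" "bounded (g ` U)"
  shows "bounded ((\<lambda>x. f x * g x) ` U)"
proof -
  obtain A B where "\<forall>x\<in>U. \<bar>f x\<bar> \<le> A" "\<forall>x\<in>U. \<bar>g x\<bar> \<le> B"
    using assms unfolding bounded_real by auto
  then have "\<forall>x\<in>U. \<bar>f x * g x\<bar> \<le> A * B"
    by (auto simp: abs_mult intro!: mult_mono)
  then show ?thesis unfolding bounded_real by auto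
qed

lemma smooth_upto_add:
  assumes "open U" "smooth_upto c n U f" "smooth_upto c n U g"
  shows "smooth_upto c n U (\<lambda>x. f x + g x)"
  using assms(2,3)
proof (induction n arbitrary: f g)
  case 0
  then show ?case by (auto intro: bounded_add_image)
next
  case (Suc n)
  have "smooth_upto c n U (dpartial b (\<lambda>x. f x + g x))" if "b \<in> Basis" for b
    using Suc that
    by (subst smooth_upto_cong[OF assms(1), where g = "\<lambda>x. dpartial b f x + dpartial b g x"])
      (auto intro!: dpartial_add)
  then show ?case using Suc.prems
    by (auto intro: bounded_add_image)
qed

lemma smooth_upto_mult:
  assumes "open U" "smooth_upto c n U f" "smooth_upto c n U g"
  shows "smooth_upto c n U (\<lambda>x. f x * g x)"
  using assms(2,3)
proof (induction n arbitrary: f g)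
  case 0
  then show ?case by (auto intro: bounded_mult_image)
next
  case (Suc n)
  have "smooth_upto c n U (dpartial b (\<lambda>x. f x * g x))" if "b \<in> Basis" for b
    using Suc that smooth_upto_SucD[OF Suc.prems(1)] smooth_upto_SucD[OF Suc.prems(2)]
    by (subst smooth_upto_cong[OF assms(1),
          where g = "\<lambda>x. f x * dpartial b g x + dpartial b f x * g x"])
      (auto intro!: dpartial_mult smooth_upto_add[OF assms(1)])
  then show ?case using Suc.prems
    by (auto intro: bounded_mult_image)
qed

lemma smooth_upto_sum:
  assumes "open U" "\<And>i. i \<in> I \<Longrightarrow> smooth_upto c n U (f i)"
  shows "smooth_upto c n U (\<lambda>x. \<Sum>i\<in>I. f i x)"
  using assms(2) by (induction I rule: infinite_finite_induct) (auto intro: smooth_upto_add[OF assms(1)])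

lemma smooth_upto_prod:
  assumes "open U" "\<And>i. i \<in> I \<Longrightarrow> smooth_upto c n U (f i)"
  shows "smooth_upto c n U (\<lambda>x. \<Prod>i\<in>I. f i x)"
  using assms(2) by (induction I rule: infinite_finite_induct) (auto intro: smooth_upto_mult[OF assms(1)])

lemma smooth_upto_power:
  assumes "open U" "smooth_upto c n U f"
  shows "smooth_upto c n U (\<lambda>x. f x ^ k)"
  by (induction k) (auto intro: smooth_upto_mult[OF assms(1)] assms)

lemma smooth_upto_diff:
  assumes "open U" "smooth_upto c n U f" "smooth_upto c n U g"
  shows "smooth_upto c n U (\<lambda>x. f x - g x)"
  using smooth_upto_add[OF assms(1,2) smooth_upto_mult[OF assms(1) smooth_upto_const[of c n U "-1"] assms(3)]]
  by simp

text \<open>\<open>dpartials\<close> differentiates first in the last direction of the list. Peeling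
  the list at its end therefore matches the recursion of \<open>smooth_upto\<close>.\<close>

lemma dpartials_snoc: "dpartials (bs @ [b]) g = dpartials bs (dpartial b g)"
  by (simp add: dpartials_def)

lemma dpartials_Nil [simp]: "dpartials [] g = g"
  and dpartials_Cons [simp]: "dpartials (b # bs) g = dpartial b (dpartials bs g)"
  by (simp_all add: dpartials_def)

lemma smooth_upto_dpartials:
  assumes "smooth_upto c (length bs + n) U g" "set bs \<subseteq> Basis"
  shows "smooth_upto c n U (dpartials bs g)"
  using assms
proof (induction bs arbitrary: g rule: rev_induct)
  case (snoc b bs)
  then show ?case by (auto simp: dpartials_snoc)
qed simp

lemma Cinf_on_dpartial: "Cinf_on U g \<Longrightarrow> b \<in> Basis \<Longrightarrow> Cinf_on U (dpartial b g)"
  unfolding Cinf_on_def dpartials_snoc[symmetric] by auto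

lemma Cinf_on_smooth_upto: "Cinf_on U g \<longleftrightarrow> (\<forall>n. smooth_upto False n U g)"
proof
  assume "Cinf_on U g"
  then have "smooth_upto False n U g" for n
  proof (induction n arbitrary: g)
    case (Suc n)
    then show ?case using Cinf_on_dpartial[OF Suc.prems]
      by (auto simp: Cinf_on_def dest: spec[of _ "[]"])
  qed simp
  then show "\<forall>n. smooth_upto False n U g" by blast
next
  assume *: "\<forall>n. smooth_upto False n U g"
  show "Cinf_on U g" unfolding Cinf_on_def
  proof (intro allI impI)
    fix bs :: "'a list" assume "set bs \<subseteq> Basis"
    then have "smooth_upto False (Suc 0) U (dpartials bs g)"
      using * by (intro smooth_upto_dpartials) blast+
    then show "\<forall>x\<in>U. dpartials bs g differentiable (at x)" by simp
  qed
qed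

lemma bounded_derivatives_on_dpartial:
  "bounded_derivatives_on U g \<Longrightarrow> b \<in> Basis \<Longrightarrow> bounded_derivatives_on U (dpartial b g)"
  unfolding bounded_derivatives_on_def
  by (auto intro: Cinf_on_dpartial simp: dpartials_snoc[symmetric])

lemma bounded_derivatives_on_smooth_upto:
  "bounded_derivatives_on U g \<Longrightarrow> smooth_upto True n U g"
proof (induction n arbitrary: g)
  case 0
  then show ?case by (auto simp: bounded_derivatives_on_def dest: spec[of _ "[]"])
next
  case (Suc n)
  then show ?case using bounded_derivatives_on_dpartial[OF Suc.prems]
    by (auto simp: bounded_derivatives_on_def Cinf_on_def dest: spec[of _ "[]"])
qed

section \<open>Derivatives in one variable and composition with affine functions\<close>

lemma dpartial_mult_const:
  "dpartial b (\<lambda>x. k * g x) x = k * dpartial b g x" if "g differentiable (at x)"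
  using dpartial_mult[of "\<lambda>_. k" x g b] that by simp

lemma has_real_derivative_dpartial:
  assumes "h differentiable (at (x::real))"
  shows "(h has_real_derivative dpartial 1 h x) (at x)"
proof -
  obtain D where D: "(h has_real_derivative D) (at x)"
    using assms by (auto simp: real_differentiable_def)
  then show ?thesis
    by (subst dpartial_eq[OF D[unfolded has_field_derivative_def]]) simp
qed

lemma dpartial_real_eq: "(h has_real_derivative D) (at x) \<Longrightarrow> dpartial 1 h x = D"
  by (simp add: has_field_derivative_def dpartial_eq)

text \<open>For an affine inner function each differentiation only contributes a constant factor, so
  the induction stays within the same class of functions. This lifts one-variable bumps to the
  coordinates of the space.\<close>

lemma smooth_upto_affine:
  fixes h :: "real \<Rightarrow> real" and v :: "'a::euclidean_space"
  assumes "smooth_upto False n UNIV h"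
  shows "smooth_upto False n UNIV (\<lambda>x. h (x \<bullet> v + k))"
  using assms
proof (induction n arbitrary: h)
  case (Suc n)
  have D: "((\<lambda>x. h (x \<bullet> v + k)) has_derivative (\<lambda>y. dpartial 1 h (x \<bullet> v + k) * (y \<bullet> v))) (at x)" for x
  proof -
    have "(h has_real_derivative dpartial 1 h (x \<bullet> v + k)) (at (x \<bullet> v + k))"
      using Suc.prems by (intro has_real_derivative_dpartial) simp
    then have "(h has_derivative (\<lambda>y. dpartial 1 h (x \<bullet> v + k) * y)) (at (x \<bullet> v + k))"
      by (simp add: has_field_derivative_def)
    moreover have "((\<lambda>x. x \<bullet> v + k) has_derivative (\<lambda>y. y \<bullet> v)) (at x)"
      by (auto intro!: derivative_eq_intros)
    ultimately show ?thesis
      by (rule has_derivative_compose[rotated])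
  qed
  have "dpartial b (\<lambda>x. h (x \<bullet> v + k)) = (\<lambda>x. dpartial 1 h (x \<bullet> v + k) * (b \<bullet> v))" for b
    by (rule ext) (rule dpartial_eq[OF D])
  moreover have "smooth_upto False n UNIV (\<lambda>x. dpartial 1 h (x \<bullet> v + k))"
    using Suc by auto
  moreover have "(\<lambda>x. h (x \<bullet> v + k)) differentiable (at x)" for x
    using D by (auto simp: differentiable_def)
  ultimately show ?case by (auto intro!: smooth_upto_mult)
qed simp

section \<open>Flat exponentials, bumps, and smooth approximations of the indicators of
  boxes\<close>

definition exp_inv :: "real poly \<Rightarrow> real \<Rightarrow> real" where
  "exp_inv p t = (if t > 0 then poly p (1 / t) * exp (- 1 / t) else 0)"

lemma poly_div_exp_tendsto_0: "((\<lambda>y. poly p y / exp y) \<longlongrightarrow> (0::real)) at_top"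
proof -
  have "((\<lambda>y. \<Sum>i\<le>degree p. coeff p i * (y ^ i / exp y)) \<longlongrightarrow> (\<Sum>i\<le>degree p. coeff p i * (0::real))) at_top"
    by (intro tendsto_intros tendsto_power_div_exp_0)
  then show ?thesis by (simp add: poly_altdef sum_divide_distrib)
qed

text \<open>The family P(1/t) exp(-1/t), continued by 0, is closed under differentiation: for t > 0
  the derivative is (P - P')(1/t) exp(-1/t) / t^2, and \<open>[:0, 0, 1:]\<close> supplies the
  factor 1/t^2. Smoothness of all members then follows by induction with the polynomial left
  arbitrary.\<close>

lemma exp_inv_has_derivative:
  "(exp_inv p has_real_derivative exp_inv ([:0, 0, 1:] * (p - pderiv p)) t) (at t)"
proof -
  consider "t > 0" | "t < 0" | "t = 0" by linarith
  then show ?thesis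
  proof cases
    case 1
    have "((\<lambda>t. poly p (1 / t) * exp (- 1 / t)) has_real_derivative
        exp_inv ([:0, 0, 1:] * (p - pderiv p)) t) (at t)"
      using 1 unfolding exp_inv_def
      by (auto intro!: derivative_eq_intros simp: field_simps power2_eq_square)
    then show ?thesis
      using has_field_derivative_transform_within_open[of _ _ t "{0<..}" "exp_inv p"] 1
      by (auto simp: exp_inv_def)
  next
    case 2
    have "((\<lambda>t. 0::real) has_real_derivative 0) (at t)" by simp
    then show ?thesis
      using has_field_derivative_transform_within_open[of "\<lambda>_. 0" _ t "{..<0}" "exp_inv p"] 2
      by (auto simp: exp_inv_def)
  next
    case 3
    \<comment> \<open>At 0 the difference quotient from the right is y P(y) / exp y with y = 1/x,
      hence the polynomial \<open>[:0,1:] * p\<close>; from the left it is 0.\<close>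
    have "filterlim (\<lambda>x. inverse x :: real) at_top (at_right 0)"
      by (rule filterlim_inverse_at_top_right)
    from filterlim_compose[OF poly_div_exp_tendsto_0[of "[:0,1:] * p"] this]
    have r: "((\<lambda>x. exp_inv p x / x) \<longlongrightarrow> 0) (at_right 0)"
      by (rule Lim_transform_eventually)
        (auto simp: eventually_at_filter exp_inv_def exp_minus field_simps)
    have l: "((\<lambda>x. exp_inv p x / x) \<longlongrightarrow> 0) (at_left 0)"
      by (rule tendsto_eventually) (auto simp: eventually_at_filter exp_inv_def)
    show ?thesis using filterlim_split_at[OF l r] 3
      by (simp add: has_field_derivative_iff exp_inv_def)
  qed
qed

lemma exp_inv_smooth: "smooth_upto False n UNIV (exp_inv p)"
proof (induction n arbitrary: p)
  case (Suc n)
  have "dpartial 1 (exp_inv p) = exp_inv ([:0, 0, 1:] * (p - pderiv p))"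
    by (rule ext) (rule dpartial_real_eq[OF exp_inv_has_derivative])
  moreover have "exp_inv p differentiable (at x)" for x
    using exp_inv_has_derivative by (auto simp: real_differentiable_def)
  ultimately show ?case using Suc by simp
qed simp

lemma exp_inv_1: "0 \<le> exp_inv 1 t" "exp_inv 1 t < 1" "exp_inv 1 t = 0 \<longleftrightarrow> t \<le> 0"
  by (auto simp: exp_inv_def)

definition box_bump :: "'a::euclidean_space \<Rightarrow> 'a \<Rightarrow> 'a \<Rightarrow> real" where
  "box_bump a b x = (\<Prod>i\<in>Basis. exp_inv 1 (x \<bullet> i - a \<bullet> i) * exp_inv 1 (b \<bullet> i - x \<bullet> i))"

lemma box_bump_smooth: "smooth_upto False n UNIV (box_bump a b)"
proof -
  have 1: "smooth_upto False n UNIV (\<lambda>x::'a. exp_inv 1 (x \<bullet> i - a \<bullet> i))" for i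
    using smooth_upto_affine[OF exp_inv_smooth[of n 1], of i "- (a \<bullet> i)"] by simp
  have 2: "smooth_upto False n UNIV (\<lambda>x::'a. exp_inv 1 (b \<bullet> i - x \<bullet> i))" for i
    using smooth_upto_affine[OF exp_inv_smooth[of n 1], of "-i" "b \<bullet> i"] by simp
  show ?thesis unfolding box_bump_def[abs_def]
    by (intro smooth_upto_prod smooth_upto_mult 1 2) auto
qed

lemma box_bump_nonneg: "0 \<le> box_bump a b x"
  unfolding box_bump_def by (intro prod_nonneg ballI mult_nonneg_nonneg exp_inv_1)

lemma box_bump_less_1: "box_bump a b x < 1"
proof -
  have "exp_inv 1 s * exp_inv 1 t < 1" for s t
    using mult_strict_mono'[of "exp_inv 1 s" 1 "exp_inv 1 t" 1] by (simp add: exp_inv_1)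
  moreover obtain i :: 'a where i: "i \<in> Basis" using nonempty_Basis by blast
  ultimately have "(\<Prod>i\<in>Basis. exp_inv 1 (x \<bullet> i - a \<bullet> i) * exp_inv 1 (b \<bullet> i - x \<bullet> i))
      < (\<Prod>i\<in>(Basis::'a set). 1)"
    by (intro prod_mono_strict[OF i])
      (auto intro: less_imp_le mult_nonneg_nonneg exp_inv_1)
  then show ?thesis unfolding box_bump_def by simp
qed

lemma box_bump_eq_0: "box_bump a b x = 0 \<longleftrightarrow> x \<notin> box a b"
  unfolding box_bump_def by (force simp: mem_box exp_inv_1 prod_zero_iff not_less)

text \<open>Powers of 1 - bump tend to 0 exactly where the bump is positive. This gives smooth
  functions with values in [0,1] that increase to the indicator of the open box and vanish outside
  it, before mollification is at hand.\<close>

definition box_approx :: "'a::euclidean_space \<Rightarrow> 'a \<Rightarrow> nat \<Rightarrow> 'a \<Rightarrow> real" where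
  "box_approx a b n x = 1 - (1 - box_bump a b x) ^ n"

lemma box_approx_bounds: "0 \<le> box_approx a b n x" "box_approx a b n x \<le> 1"
  unfolding box_approx_def using box_bump_nonneg[of a b x] box_bump_less_1[of a b x]
  by (auto intro: power_le_one)

lemma box_approx_outside: "x \<notin> box a b \<Longrightarrow> box_approx a b n x = 0"
  by (simp add: box_approx_def box_bump_eq_0[THEN iffD2])

lemma box_approx_tendsto: "(\<lambda>n. box_approx a b n x) \<longlonglongrightarrow> indicator (box a b) x"
proof (cases "x \<in> box a b")
  case True
  then have "0 < box_bump a b x"
    using box_bump_nonneg[of a b x] box_bump_eq_0[of a b x] by linarith
  then have "(\<lambda>n. 1 - (1 - box_bump a b x) ^ n) \<longlonglongrightarrow> 1 - 0"
    using box_bump_less_1[of a b x] by (intro tendsto_intros LIMSEQ_realpow_zero) auto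
  then show ?thesis using True by (simp add: box_approx_def)
qed (simp add: box_approx_outside)

lemma box_approx_smooth: "Cinf_on UNIV (box_approx a b n)"
  unfolding Cinf_on_smooth_upto box_approx_def[abs_def]
  by (intro allI smooth_upto_diff smooth_upto_power smooth_upto_const box_bump_smooth open_UNIV)

lemma box_approx_test: "cbox a b \<subseteq> U \<Longrightarrow> box_approx a b n \<in> test_functions U"
  unfolding test_functions_def using box_subset_cbox[of a b]
  by (auto intro!: box_approx_smooth exI[of _ "cbox a b"] box_approx_outside)

lemma box_bump_test: "cbox a b \<subseteq> U \<Longrightarrow> box_bump a b \<in> test_functions U"
  unfolding test_functions_def using box_subset_cbox[of a b]
  by (auto intro!: box_bump_smooth exI[of _ "cbox a b"] simp: Cinf_on_smooth_upto box_bump_eq_0)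

section \<open>Basic properties of test functions\<close>

lemma test_functions_differentiable: "\<phi> \<in> test_functions U \<Longrightarrow> \<phi> differentiable (at x)"
  unfolding test_functions_def Cinf_on_def by (auto dest: spec[of _ "[]"])

lemma test_functions_continuous: "\<phi> \<in> test_functions U \<Longrightarrow> continuous_on A \<phi>"
  by (meson continuous_at_imp_continuous_on differentiable_imp_continuous_within test_functions_differentiable)

lemma test_functions_measurable [measurable_dest]:
  "\<phi> \<in> test_functions U \<Longrightarrow> \<phi> \<in> borel_measurable borel"
  by (intro borel_measurable_continuous_onI test_functions_continuous)

lemma dpartial_zero_outside:
  assumes "closed K" "\<And>x. x \<notin> K \<Longrightarrow> g x = 0" "x \<notin> K"
  shows "dpartial b g x = 0"
  using dpartial_cong_open[of "-K" x g "\<lambda>_. 0" b] assms by auto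

lemma test_functions_dpartial:
  assumes "\<phi> \<in> test_functions U" "b \<in> Basis"
  shows "dpartial b \<phi> \<in> test_functions U"
proof -
  obtain K where "Cinf_on UNIV \<phi>" "compact K" "K \<subseteq> U" "\<And>x. x \<notin> K \<Longrightarrow> \<phi> x = 0"
    using assms(1) unfolding test_functions_def by auto
  then show ?thesis unfolding test_functions_def
    by (auto intro!: Cinf_on_dpartial[OF _ assms(2)] exI[of _ K] dpartial_zero_outside
        compact_imp_closed)
qed

lemma test_functions_dpartials:
  assumes "\<phi> \<in> test_functions U" "set bs \<subseteq> Basis"
  shows "dpartials bs \<phi> \<in> test_functions U"
  using assms by (induction bs) (auto intro: test_functions_dpartial)

lemma bounded_if_compact_support:
  fixes g :: "'a::euclidean_space \<Rightarrow> real"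
  assumes "continuous_on UNIV g" "compact K" "\<And>x. x \<notin> K \<Longrightarrow> g x = 0"
  obtains B where "B > 0" "\<And>x. \<bar>g x\<bar> \<le> B"
proof -
  have "bounded (g ` K)"
    using compact_continuous_image[of K g] assms continuous_on_subset compact_imp_bounded by blast
  then obtain B where "B > 0" "\<And>x. x \<in> K \<Longrightarrow> \<bar>g x\<bar> \<le> B"
    unfolding bounded_pos by auto
  then show ?thesis using assms(3) that[of B] by (metis abs_zero less_imp_le)
qed

lemma test_functions_bounded:
  assumes "\<phi> \<in> test_functions U"
  obtains B where "B > 0" "\<And>x. \<bar>\<phi> x\<bar> \<le> B"
  using assms bounded_if_compact_support[OF test_functions_continuous[OF assms]]
  unfolding test_functions_def by blast

lemma integrable_compact_support:
  fixes g :: "'a::euclidean_space \<Rightarrow> real"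
  assumes "g \<in> borel_measurable borel" "compact K" "\<And>x. x \<notin> K \<Longrightarrow> g x = 0" "\<And>x. \<bar>g x\<bar> \<le> B"
  shows "integrable lborel g"
proof (rule Bochner_Integration.integrable_bound)
  show "integrable lborel (\<lambda>x. indicator K x * B)"
    using emeasure_bounded_finite[OF compact_imp_bounded[OF assms(2)]] compact_imp_closed[OF assms(2)]
    by (intro integrable_mult_left integrable_real_indicator) auto
  show "AE x in lborel. norm (g x) \<le> norm (indicator K x * B)"
  proof (rule AE_I2)
    fix x
    show "norm (g x) \<le> norm (indicator K x * B)"
      using assms(3)[of x] assms(4)[of x] by (cases "x \<in> K") auto
  qed
qed (use assms in auto)

lemma test_functions_integrable:
  assumes "\<phi> \<in> test_functions U"
  shows "integrable lborel \<phi>"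
proof -
  obtain K where K: "compact K" "\<And>x. x \<notin> K \<Longrightarrow> \<phi> x = 0"
    using assms unfolding test_functions_def by auto
  obtain B where B: "\<And>x. \<bar>\<phi> x\<bar> \<le> B" using test_functions_bounded[OF assms] by metis
  show ?thesis by (rule integrable_compact_support[OF test_functions_measurable[OF assms] K B])
qed

lemma test_functions_zero: "\<phi> \<in> test_functions U \<Longrightarrow> x \<notin> U \<Longrightarrow> \<phi> x = 0"
  unfolding test_functions_def by auto

section \<open>Square-integrable functions and weak derivatives\<close>

lemma Int_box: "box a b \<inter> box c d =
    box (\<Sum>i\<in>Basis. max (a \<bullet> i) (c \<bullet> i) *\<^sub>R i) (\<Sum>i\<in>Basis. min (b \<bullet> i) (d \<bullet> i) *\<^sub>R i)"
  for a b :: "'a::euclidean_space"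
  by (auto simp: mem_box)

text \<open>Boxes are stable under intersection and generate the Borel sets, so the vanishing of the
  integral spreads to all Borel sets by the \<pi>-\<lambda> argument; a function whose integral over
  every Borel set is 0 has the same density as the zero function.\<close>

lemma AE_zero_if_box_integrals_zero:
  fixes f :: "'a::euclidean_space \<Rightarrow> real"
  assumes f: "integrable lborel f" and box: "\<And>a b. (LINT x:box a b|lborel. f x) = 0"
  shows "AE x in lborel. f x = 0"
proof -
  have si: "set_integrable lborel A f" if "A \<in> sets borel" for A
    unfolding set_integrable_def using that f by (intro integrable_mult_indicator) auto
  \<comment> \<open>The complement step of the induction refers to the whole space, which is
    exhausted here by growing cubes.\<close>
  have total: "(LINT x|lborel. f x) = 0"
  proof -
    have "(\<lambda>n. LINT x|lborel. indicator (box (- (real n *\<^sub>R One)) (real n *\<^sub>R One)) x *\<^sub>R f x)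
        \<longlonglongrightarrow> (LINT x|lborel. f x)"
    proof (rule integral_dominated_convergence[where w = "\<lambda>x. \<bar>f x\<bar>"])
      show "AE x in lborel. (\<lambda>n. indicator (box (- (real n *\<^sub>R One)) (real n *\<^sub>R One)) x *\<^sub>R f x) \<longlonglongrightarrow> f x"
      proof (rule AE_I2)
        fix x :: 'a
        obtain N where N: "norm x < real N" using reals_Archimedean2 by blast
        have "x \<in> box (- (real n *\<^sub>R One)) (real n *\<^sub>R One)" if "n \<ge> N" for n
        proof -
          have "\<bar>x \<bullet> i\<bar> < real n" if "i \<in> Basis" for i
            using Basis_le_norm[OF that, of x] N \<open>n \<ge> N\<close> by linarith
          then show ?thesis by (fastforce simp: mem_box abs_less_iff)
        qed
        then show "(\<lambda>n. indicator (box (- (real n *\<^sub>R One)) (real n *\<^sub>R One)) x *\<^sub>R f x) \<longlonglongrightarrow> f x"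
          by (intro tendsto_eventually eventually_sequentiallyI[of N]) simp
      qed
    qed (use f in \<open>auto simp: indicator_def\<close>)
    then show ?thesis using box
      by (simp add: set_lebesgue_integral_def LIMSEQ_const_iff)
  qed
  have Int_stable_boxes: "Int_stable (range (\<lambda>(a, b). box a b :: 'a set))"
    by (auto simp: Int_stable_def Int_box)
  have subset_Pow: "range (\<lambda>(a, b). box a b :: 'a set) \<subseteq> Pow UNIV" by simp
  have zero: "(LINT x:A|lborel. f x) = 0" if "A \<in> sets borel" for A
  proof -
    have "A \<in> sigma_sets UNIV (range (\<lambda>(a, b). box a b :: 'a set))"
      using that unfolding borel_eq_box by simp
    with Int_stable_boxes subset_Pow show ?thesis
    proof (induction rule: sigma_sets_induct_disjoint)
      case (compl A)
      then have "A \<in> sets borel" unfolding borel_eq_box by simp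
      then have "(LINT x:UNIV|lborel. f x) = (LINT x:UNIV - A|lborel. f x) + (LINT x:A|lborel. f x)"
        by (subst set_integral_Un[symmetric]) (auto intro: si)
      then show ?case using compl total by (simp add: set_lebesgue_integral_def)
    next
      case (union A)
      then have A: "range A \<subseteq> sets borel" unfolding borel_eq_box by simp
      have "(LINT x:(\<Union>i. A i)|lborel. f x) = (\<Sum>i. (LINT x:(A i)|lborel. f x))"
        using A union(1) by (intro lebesgue_integral_countable_add si)
          (auto simp: disjoint_family_on_def)
      then show ?case using union by simp
    qed (use box in \<open>auto simp: set_lebesgue_integral_def\<close>)
  qed
  show ?thesis by (rule density_unique_real[OF f]) (use zero in \<open>auto simp: set_lebesgue_integral_def\<close>)
qed

lemma null_sets_cbox_diff_box: "cbox a b - box a b \<in> null_sets (lborel :: 'a::euclidean_space measure)"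
proof -
  have "emeasure lborel (cbox a b - box a b) = emeasure lborel (cbox a b) - emeasure lborel (box a b)"
    using box_subset_cbox[of a b] emeasure_lborel_box_finite[of a b] by (intro emeasure_Diff) auto
  then show ?thesis by (auto simp: emeasure_lborel_box_eq emeasure_lborel_cbox_eq)
qed

text \<open>Locally this is the previous lemma for w cut off by a box. Countably many closed boxes
  cover U, and the faces lost in passing to open boxes are null.\<close>

lemma AE_zero_on_open:
  fixes w :: "'a::euclidean_space \<Rightarrow> real"
  assumes "open U" and int: "\<And>a b. cbox a b \<subseteq> U \<Longrightarrow> set_integrable lborel (cbox a b) w"
    and zero: "\<And>a b. cbox a b \<subseteq> U \<Longrightarrow> (LINT x:box a b|lborel. w x) = 0"
  shows "AE x in lborel. x \<in> U \<longrightarrow> w x = 0"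
proof -
  obtain D where D: "countable D" "D \<subseteq> Pow U" "\<And>X. X \<in> D \<Longrightarrow> \<exists>a b. X = cbox a b" "\<Union>D = U"
    using open_countable_Union_open_cbox[OF \<open>open U\<close>] by metis
  have "AE x in lborel. x \<in> X \<longrightarrow> w x = 0" if "X \<in> D" for X
  proof -
    from D(3)[OF that] obtain a b where X: "X = cbox a b" by auto
    have sub: "cbox a b \<subseteq> U" using D(2) that X by auto
    have i: "set_integrable lborel (box a b) w"
      by (rule set_integrable_subset[OF int[OF sub]]) (auto simp: box_subset_cbox)
    have "AE x in lborel. indicator (box a b) x *\<^sub>R w x = 0"
    proof (rule AE_zero_if_box_integrals_zero)
      fix c d
      have "closure (box c d \<inter> box a b) \<subseteq> cbox a b"
        by (rule closure_minimal) (auto intro: set_mp[OF box_subset_cbox])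
      obtain e g where eg: "box c d \<inter> box a b = box e g" using Int_box by blast
      have "(LINT x:box c d|lborel. indicator (box a b) x *\<^sub>R w x) = (LINT x:box e g|lborel. w x)"
        unfolding eg[symmetric] set_lebesgue_integral_def
        by (intro Bochner_Integration.integral_cong) (auto simp: indicator_def)
      also have "\<dots> = 0"
      \<comment> \<open>A nonempty open box has the closed box with the same corners as its closure;
        this keeps the closed box inside U.\<close>
      proof (cases "box e g = {}")
        case False
        then have "cbox e g = closure (box e g)" by (simp add: closure_box)
        then have "cbox e g \<subseteq> U"
          using \<open>closure (box c d \<inter> box a b) \<subseteq> cbox a b\<close> sub eg by simp
        then show ?thesis by (rule zero)
      qed (simp add: set_lebesgue_integral_def)
      finally show "(LINT x:box c d|lborel. indicator (box a b) x *\<^sub>R w x) = 0" .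
    qed (use i in \<open>simp add: set_integrable_def\<close>)
    moreover have "AE x in lborel. x \<notin> cbox a b - box a b"
      by (rule AE_not_in[OF null_sets_cbox_diff_box])
    ultimately show ?thesis by eventually_elim (auto simp: X)
  qed
  then have "AE x in lborel. \<forall>X\<in>D. x \<in> X \<longrightarrow> w x = 0"
    using AE_ball_countable[OF D(1), of "\<lambda>x X. x \<in> X \<longrightarrow> w x = 0"] by blast
  then show ?thesis by eventually_elim (use D(4) in blast)
qed

section \<open>Calculus of square-integrable functions\<close>

definition sqint :: "('a::euclidean_space \<Rightarrow> real) \<Rightarrow> bool" where
  "sqint f \<longleftrightarrow> f \<in> borel_measurable borel \<and> integrable lborel (\<lambda>x. (f x)\<^sup>2)"

text \<open>Cutting a function off by the indicator of U turns membership in L2 of U into square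
  integrability on the whole space, where translations and Fubini apply without reference to a
  domain.\<close>

lemma L2_iff_sqint: "g \<in> L2 U \<longleftrightarrow> sqint (\<lambda>x. indicator U x * g x)"
proof -
  have "(\<lambda>x. indicator U x *\<^sub>R (g x)\<^sup>2) = (\<lambda>x. (indicator U x * g x)\<^sup>2)"
    by (auto simp: indicator_def)
  then show ?thesis
    by (simp add: L2_def sqint_def set_borel_measurable_def set_integrable_def)
qed

lemma sqint_mult: "sqint f \<Longrightarrow> sqint g \<Longrightarrow> integrable lborel (\<lambda>x. f x * g x)"
proof (rule Bochner_Integration.integrable_bound)
  assume "sqint f" "sqint g"
  then show "integrable lborel (\<lambda>x. (f x)\<^sup>2 + (g x)\<^sup>2)" by (simp add: sqint_def)
  have "\<bar>f x * g x\<bar> \<le> (f x)\<^sup>2 + (g x)\<^sup>2" for x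
    using sum_squares_bound[of "\<bar>f x\<bar>" "\<bar>g x\<bar>"] abs_ge_zero[of "f x * g x"] unfolding abs_mult power2_abs by linarith
  then show "AE x in lborel. norm (f x * g x) \<le> norm ((f x)\<^sup>2 + (g x)\<^sup>2)"
    by (intro AE_I2) simp
qed (auto simp: sqint_def)

lemma sqint_add: "sqint f \<Longrightarrow> sqint g \<Longrightarrow> sqint (\<lambda>x. f x + g x)"
  using sqint_mult[of f g] by (auto simp: sqint_def power2_sum mult.assoc)

lemma sqint_cmult: "sqint f \<Longrightarrow> sqint (\<lambda>x. c * f x)"
  by (auto simp: sqint_def power_mult_distrib)

lemma sqint_bounded_mult:
  assumes "sqint f" "g \<in> borel_measurable borel" "\<And>x. \<bar>g x\<bar> \<le> B"
  shows "sqint (\<lambda>x. g x * f x)"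
proof -
  have "integrable lborel (\<lambda>x. (g x * f x)\<^sup>2)"
  proof (rule Bochner_Integration.integrable_bound)
    show "integrable lborel (\<lambda>x. B\<^sup>2 * (f x)\<^sup>2)" using assms by (auto simp: sqint_def)
    have "(g x * f x)\<^sup>2 \<le> B\<^sup>2 * (f x)\<^sup>2" for x
      unfolding power_mult_distrib using assms(3)[of x]
      by (intro mult_right_mono) (auto simp: abs_le_square_iff[symmetric])
    then show "AE x in lborel. norm ((g x * f x)\<^sup>2) \<le> norm (B\<^sup>2 * (f x)\<^sup>2)" by simp
  qed (use assms in \<open>auto simp: sqint_def\<close>)
  then show ?thesis using assms by (auto simp: sqint_def)
qed

lemma L2_add: "f \<in> L2 U \<Longrightarrow> g \<in> L2 U \<Longrightarrow> (\<lambda>x. f x + g x) \<in> L2 U"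
  unfolding L2_iff_sqint distrib_left by (rule sqint_add)

lemma L2_cmult: "f \<in> L2 U \<Longrightarrow> (\<lambda>x. c * f x) \<in> L2 U"
  unfolding L2_iff_sqint mult.left_commute[of _ c] by (rule sqint_cmult)

lemma L2_diff: "f \<in> L2 U \<Longrightarrow> g \<in> L2 U \<Longrightarrow> (\<lambda>x. f x - g x) \<in> L2 U"
  using L2_add[of f U "\<lambda>x. -1 * g x"] L2_cmult[of g U "-1"] by simp

lemma L2_zero: "(\<lambda>x. 0) \<in> L2 U"
  by (simp add: L2_iff_sqint sqint_def)

lemma L2_sum: "(\<And>i. i \<in> I \<Longrightarrow> f i \<in> L2 U) \<Longrightarrow> (\<lambda>x. \<Sum>i\<in>I. f i x) \<in> L2 U"
  by (induction I rule: infinite_finite_induct) (auto intro: L2_add L2_zero)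

lemma L2_mult: "f \<in> L2 U \<Longrightarrow> g \<in> L2 U \<Longrightarrow> set_integrable lborel U (\<lambda>x. f x * g x)"
proof -
  assume "f \<in> L2 U" "g \<in> L2 U"
  then have "integrable lborel (\<lambda>x. (indicator U x * f x) * (indicator U x * g x))"
    unfolding L2_iff_sqint by (rule sqint_mult)
  then show ?thesis unfolding set_integrable_def
    by (rule Bochner_Integration.integrable_cong[THEN iffD1, rotated 2]) (auto simp: indicator_def)
qed

lemma L2_square: "f \<in> L2 U \<Longrightarrow> set_integrable lborel U (\<lambda>x. (f x)\<^sup>2)"
  using L2_mult[of f U f] by (simp add: power2_eq_square)

lemma L2_norm_nonneg: "0 \<le> L2_norm U g"
  by (simp add: L2_norm_def set_lebesgue_integral_def)

lemma L2_norm_square: "(L2_norm U g)\<^sup>2 = (LINT x:U|lborel. (g x)\<^sup>2)"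
  by (simp add: L2_norm_def set_lebesgue_integral_def)

lemma L2_norm_cong_AE:
  assumes "U \<in> sets borel" "f \<in> L2 U" "g \<in> L2 U" "AE x in lborel. x \<in> U \<longrightarrow> f x = g x"
  shows "L2_norm U f = L2_norm U g"
proof -
  have "(LINT x:U|lborel. (f x)\<^sup>2) = (LINT x:U|lborel. (g x)\<^sup>2)"
    using L2_square[OF assms(2)] L2_square[OF assms(3)]
    unfolding set_lebesgue_integral_def set_integrable_def
    by (intro integral_cong_AE borel_measurable_integrable)
      (use assms(4) in \<open>auto elim!: eventually_mono simp: indicator_def\<close>)
  then show ?thesis by (simp add: L2_norm_def)
qed

text \<open>The integral of (s f + t g)^2 is a nonnegative quadratic form in (s, t). Both parameters
  are kept so that the case in which the norm of f vanishes is covered by the same form.\<close>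

lemma L2_Cauchy_Schwarz:
  assumes "f \<in> L2 U" "g \<in> L2 U"
  shows "\<bar>LINT x:U|lborel. f x * g x\<bar> \<le> L2_norm U f * L2_norm U g"
proof -
  let ?I = "\<lambda>h. (LINT x:U|lborel. h x)"
  have q: "0 \<le> s\<^sup>2 * ?I (\<lambda>x. (f x)\<^sup>2) + 2 * s * t * ?I (\<lambda>x. f x * g x) + t\<^sup>2 * ?I (\<lambda>x. (g x)\<^sup>2)" for s t
  proof -
    have i1: "set_integrable lborel U (\<lambda>x. s\<^sup>2 * (f x)\<^sup>2)"
      and i2: "set_integrable lborel U (\<lambda>x. 2 * s * t * (f x * g x))"
      and i3: "set_integrable lborel U (\<lambda>x. t\<^sup>2 * (g x)\<^sup>2)"
      using L2_square[OF assms(1)] L2_square[OF assms(2)] L2_mult[OF assms]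
      by (auto intro: set_integrable_mult_right)
    have "0 \<le> ?I (\<lambda>x. (s * f x + t * g x)\<^sup>2)" by (simp add: set_lebesgue_integral_def)
    also have "\<dots> = ?I (\<lambda>x. (s\<^sup>2 * (f x)\<^sup>2 + 2 * s * t * (f x * g x)) + t\<^sup>2 * (g x)\<^sup>2)"
      by (simp add: power2_eq_square algebra_simps)
    also have "\<dots> = s\<^sup>2 * ?I (\<lambda>x. (f x)\<^sup>2) + 2 * s * t * ?I (\<lambda>x. f x * g x) + t\<^sup>2 * ?I (\<lambda>x. (g x)\<^sup>2)"
      using set_integral_add(2)[OF set_integral_add(1)[OF i1 i2] i3] set_integral_add(2)[OF i1 i2]
      by simp
    finally show ?thesis .
  qed
  define a b p where "a = L2_norm U f" "b = L2_norm U g" "p = ?I (\<lambda>x. f x * g x)"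
  have ab: "0 \<le> a" "0 \<le> b" by (simp_all add: a_b_p_def L2_norm_nonneg)
  have q: "0 \<le> s\<^sup>2 * a\<^sup>2 + 2 * s * t * p + t\<^sup>2 * b\<^sup>2" for s t
    using q[of s t] by (simp add: a_b_p_def L2_norm_square)
  have "p\<^sup>2 \<le> (a * b)\<^sup>2"
  proof (cases "a = 0")
    case True
    have "p = 0"
    proof (rule ccontr)
      assume "p \<noteq> 0"
      \<comment> \<open>For this s and t = 1 the form would equal -1, because its term in s^2
        vanishes.\<close>
      then have "2 * (- (b\<^sup>2 + 1) / (2 * p)) * 1 * p = - (b\<^sup>2 + 1)" by (simp add: field_simps)
      then show False using q[of "- (b\<^sup>2 + 1) / (2 * p)" 1] True by simp
    qed
    then show ?thesis by simp
  next
    case False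
    \<comment> \<open>For t = a^2 the form is minimal at s = -p, and this is its minimum.\<close>
    have "0 \<le> a\<^sup>2 * ((a * b)\<^sup>2 - p\<^sup>2)"
      using q[of "- p" "a\<^sup>2"] by (simp add: power2_eq_square algebra_simps)
    then show ?thesis using False by (simp add: zero_le_mult_iff)
  qed
  then have "\<bar>p\<bar> \<le> \<bar>a * b\<bar>" by (simp add: abs_le_square_iff)
  then show ?thesis using ab by (simp add: a_b_p_def)
qed

text \<open>By Cauchy-Schwarz, convergence in norm permits passing to the limit against a fixed
  factor. Green's formula and the treatment of zero boundary values take their limits in this
  way.\<close>

lemma L2_weak_limit:
  assumes "\<And>n. h n \<in> L2 U" "f \<in> L2 U" "g \<in> L2 U" "(\<lambda>n. L2_norm U (\<lambda>x. h n x - f x)) \<longlonglongrightarrow> 0"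
  shows "(\<lambda>n. LINT x:U|lborel. h n x * g x) \<longlonglongrightarrow> (LINT x:U|lborel. f x * g x)"
proof (rule LIM_zero_cancel, rule tendsto_0_le[where K = "L2_norm U g"])
  show "(\<lambda>n. L2_norm U (\<lambda>x. h n x - f x)) \<longlonglongrightarrow> 0" by fact
  have "(LINT x:U|lborel. h n x * g x) - (LINT x:U|lborel. f x * g x) = (LINT x:U|lborel. (h n x - f x) * g x)" for n
    using L2_mult[OF assms(1,3)] L2_mult[OF assms(2,3)]
    by (simp add: left_diff_distrib set_integral_diff(2))
  then show "\<forall>\<^sub>F n in sequentially. norm ((LINT x:U|lborel. h n x * g x) - (LINT x:U|lborel. f x * g x))
      \<le> norm (L2_norm U (\<lambda>x. h n x - f x)) * L2_norm U g"
    using L2_Cauchy_Schwarz[OF L2_diff[OF assms(1,2)] assms(3)] by (simp add: abs_of_nonneg[OF L2_norm_nonneg])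
qed

lemma L2_bounded:
  assumes "set_borel_measurable lborel U g" "U \<in> sets borel" "bounded U" "\<And>x. x \<in> U \<Longrightarrow> \<bar>g x\<bar> \<le> B"
  shows "g \<in> L2 U"
proof -
  have "integrable lborel (\<lambda>x. indicator U x *\<^sub>R (g x)\<^sup>2)"
  proof (rule Bochner_Integration.integrable_bound)
    show "integrable lborel (\<lambda>x. indicator U x * B\<^sup>2)"
      using emeasure_bounded_finite[OF assms(3)] assms(2)
      by (intro integrable_mult_left integrable_real_indicator) auto
    have "(\<lambda>x. (indicator U x *\<^sub>R g x)\<^sup>2) \<in> borel_measurable lborel"
      using assms(1) unfolding set_borel_measurable_def by measurable
    then show "(\<lambda>x. indicator U x *\<^sub>R (g x)\<^sup>2) \<in> borel_measurable lborel"
      by (rule back_subst[of "\<lambda>h. h \<in> borel_measurable lborel"]) (auto simp: indicator_def)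
    show "AE x in lborel. norm (indicator U x *\<^sub>R (g x)\<^sup>2) \<le> norm (indicator U x * B\<^sup>2)"
    proof (rule AE_I2)
      fix x
      show "norm (indicator U x *\<^sub>R (g x)\<^sup>2) \<le> norm (indicator U x * B\<^sup>2)"
        using assms(4)[of x] power_mono[OF assms(4)[of x], of 2] by (auto simp: indicator_def)
    qed
  qed
  then show ?thesis using assms(1) by (simp add: L2_def set_integrable_def)
qed

lemma test_functions_L2:
  assumes "\<phi> \<in> test_functions U" "open U"
  shows "\<phi> \<in> L2 U"
proof -
  obtain B where B: "\<And>x. \<bar>\<phi> x\<bar> \<le> B" using test_functions_bounded[OF assms(1)] by metis
  have m: "\<phi> \<in> borel_measurable borel" by (rule test_functions_measurable[OF assms(1)])
  have "integrable lborel (\<lambda>x. \<phi> x * \<phi> x)"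
  proof (rule Bochner_Integration.integrable_bound)
    show "integrable lborel (\<lambda>x. B * \<phi> x)" using test_functions_integrable[OF assms(1)] by simp
    show "AE x in lborel. norm (\<phi> x * \<phi> x) \<le> norm (B * \<phi> x)"
    proof (rule AE_I2)
      fix x
      show "norm (\<phi> x * \<phi> x) \<le> norm (B * \<phi> x)"
        using mult_right_mono[OF B[of x] abs_ge_zero[of "\<phi> x"]] B[of x] by (simp add: abs_mult)
    qed
  qed (use m in auto)
  then have "sqint \<phi>" using m by (simp add: sqint_def power2_eq_square)
  moreover have "(\<lambda>x. indicator U x * \<phi> x) = \<phi>"
    using test_functions_zero[OF assms(1)] by (auto simp: indicator_def fun_eq_iff)
  ultimately show ?thesis by (simp add: L2_iff_sqint)
qed

lemma L2_integrable_on_bounded: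
  assumes "w \<in> L2 U" "K \<subseteq> U" "K \<in> sets borel" "bounded K"
  shows "set_integrable lborel K w"
proof -
  have "set_integrable lborel K (\<lambda>x. (indicator U x * w x) * indicator K x)"
  proof (rule set_integrable_subset[OF _ _ subset_UNIV])
    have "sqint (indicator K :: 'a \<Rightarrow> real)"
      using L2_bounded[of K "\<lambda>_. 1" 1] assms by (simp add: L2_iff_sqint set_borel_measurable_def)
    then show "set_integrable lborel UNIV (\<lambda>x. (indicator U x * w x) * indicator K x)"
      using sqint_mult assms(1) by (simp add: L2_iff_sqint set_integrable_def)
  qed (use assms in auto)
  then show ?thesis unfolding set_integrable_def
    by (rule back_subst[of "integrable lborel"]) (use assms(2) in \<open>auto simp: indicator_def fun_eq_iff\<close>)
qed

lemma set_integral_box_approx: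
  assumes "cbox a b \<subseteq> U" "set_integrable lborel (cbox a b) w"
  shows "(\<lambda>n. LINT x:U|lborel. w x * box_approx a b n x) \<longlonglongrightarrow> (LINT x:box a b|lborel. w x)"
proof -
  have o: "box_approx a b n x = 0" if "x \<notin> cbox a b" for n x
    using that box_subset_cbox[of a b] by (intro box_approx_outside) auto
  have e: "(LINT x:U|lborel. w x * box_approx a b n x) =
      (LINT x|lborel. (indicator (cbox a b) x * w x) * box_approx a b n x)" for n
    unfolding set_lebesgue_integral_def
    by (intro Bochner_Integration.integral_cong) (use assms(1) o in \<open>auto simp: indicator_def\<close>)
  have e2: "(LINT x:box a b|lborel. w x) = (LINT x|lborel. (indicator (cbox a b) x * w x) * indicator (box a b) x)"
    unfolding set_lebesgue_integral_def
    by (intro Bochner_Integration.integral_cong) (use box_subset_cbox[of a b] in \<open>auto simp: indicator_def\<close>)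
  have m: "(\<lambda>x. indicator (cbox a b) x * w x) \<in> borel_measurable lborel"
    using assms(2) by (auto simp: set_integrable_def)
  have mb: "box_approx a b n \<in> borel_measurable borel" for n
    by (rule test_functions_measurable[OF box_approx_test[OF subset_UNIV]])
  show ?thesis unfolding e e2
  proof (rule integral_dominated_convergence[where w = "\<lambda>x. \<bar>indicator (cbox a b) x * w x\<bar>"])
    show "AE x in lborel. norm ((indicator (cbox a b) x * w x) * box_approx a b n x) \<le> \<bar>indicator (cbox a b) x * w x\<bar>" for n
      using box_approx_bounds[of a b n] by (intro AE_I2) (simp add: abs_mult mult_left_le)
  qed (use assms(2) m mb in \<open>auto simp: set_integrable_def intro!: tendsto_intros box_approx_tendsto\<close>)
qed

text \<open>The fundamental lemma of the calculus of variations: \<open>box_approx a b n\<close> is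
  a test function as soon as the closed box lies in U, and in the limit it tests against the
  indicator of the open box.\<close>

lemma AE_zero_if_test_integrals_zero:
  assumes "open U" "w \<in> L2 U" "\<And>\<phi>. \<phi> \<in> test_functions U \<Longrightarrow> (LINT x:U|lborel. w x * \<phi> x) = 0"
  shows "AE x in lborel. x \<in> U \<longrightarrow> w x = 0"
proof (rule AE_zero_on_open[OF assms(1)])
  fix a b assume ab: "cbox a b \<subseteq> U"
  show i: "set_integrable lborel (cbox a b) w" by (rule L2_integrable_on_bounded[OF assms(2) ab]) auto
  show "(LINT x:box a b|lborel. w x) = 0"
    using set_integral_box_approx[OF ab i] assms(3)[OF box_approx_test[OF ab]]
    by (simp add: LIMSEQ_const_iff)
qed

lemma weak_derivative_unique:
  assumes "open U" "w1 \<in> L2 U" "w2 \<in> L2 U" "weak_derivative U bs g w1" "weak_derivative U bs g w2"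
  shows "AE x in lborel. x \<in> U \<longrightarrow> w1 x = w2 x"
proof -
  have "AE x in lborel. x \<in> U \<longrightarrow> w1 x - w2 x = 0"
  proof (rule AE_zero_if_test_integrals_zero[OF assms(1) L2_diff[OF assms(2,3)]])
    fix \<phi> :: "'a \<Rightarrow> real" assume p: "\<phi> \<in> test_functions U"
    have "(-1 :: real) ^ length bs * (LINT x:U|lborel. w1 x * \<phi> x) = (-1) ^ length bs * (LINT x:U|lborel. w2 x * \<phi> x)"
      using assms(4,5) p unfolding weak_derivative_def by metis
    then have "(LINT x:U|lborel. w1 x * \<phi> x) = (LINT x:U|lborel. w2 x * \<phi> x)" by simp
    then show "(LINT x:U|lborel. (w1 x - w2 x) * \<phi> x) = 0"
      using L2_mult[OF assms(2) test_functions_L2[OF p assms(1)]] L2_mult[OF assms(3) test_functions_L2[OF p assms(1)]]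
      by (simp add: left_diff_distrib set_integral_diff)
  qed
  then show ?thesis by simp
qed

section \<open>Translation invariance of Lebesgue measure\<close>

lemma lborel_distr_plus_right: "distr lborel borel (\<lambda>x. x + c) = (lborel :: 'a::euclidean_space measure)"
proof -
  have "(\<lambda>x. x + c) = (+) c" by (auto simp: add.commute)
  then show ?thesis using lborel_distr_plus[of c] by simp
qed

lemma
  fixes f :: "'a::euclidean_space \<Rightarrow> real"
  shows integrable_translate: "integrable lborel f \<Longrightarrow> integrable lborel (\<lambda>x. f (x + c))"
    and integral_translate: "f \<in> borel_measurable borel \<Longrightarrow> (LINT x|lborel. f (x + c)) = (LINT x|lborel. f x)"
proof -
  note D = lborel_distr_plus_right[of c]
  show "integrable lborel (\<lambda>x. f (x + c))" if "integrable lborel f"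
    using that integrable_distr_eq[of "\<lambda>x. x + c" lborel borel f] unfolding D by auto
  show "(LINT x|lborel. f (x + c)) = (LINT x|lborel. f x)" if "f \<in> borel_measurable borel"
    using that integral_distr[of "\<lambda>x. x + c" lborel borel f] unfolding D by auto
qed

lemma AE_translate:
  assumes "AE x in lborel. P (x::'a::euclidean_space)"
  shows "AE x in lborel. P (x + c)"
proof -
  have "AE x in distr lborel borel (\<lambda>x. x + c). P x"
    using assms unfolding lborel_distr_plus_right .
  then show ?thesis
    using AE_distrD[of "\<lambda>x. x + c" lborel borel P] by simp
qed

lemma sqint_translate: "sqint f \<Longrightarrow> sqint (\<lambda>x. f (x + c))"
  unfolding sqint_def by (auto dest: integrable_translate[of _ c])

section \<open>Continuity of translations\<close>

text \<open>Stated along sequences of shifts, so that dominated convergence applies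
  directly.\<close>

definition L1_continuous :: "('a::euclidean_space \<Rightarrow> real) \<Rightarrow> bool" where
  "L1_continuous f \<longleftrightarrow> (\<forall>s. s \<longlonglongrightarrow> 0 \<longrightarrow> (\<lambda>n. LINT x|lborel. \<bar>f (x + s n) - f x\<bar>) \<longlonglongrightarrow> 0)"

text \<open>By translation invariance the approximation error counts twice, at x and at the shifted
  point; together with the increment of the approximating function this accounts for the three
  thirds of \<open>e\<close>.\<close>

lemma L1_continuous_closed:
  assumes f: "integrable lborel f"
    and approx: "\<And>e. e > 0 \<Longrightarrow> \<exists>g. integrable lborel g \<and> L1_continuous g \<and> (LINT x|lborel. \<bar>f x - g x\<bar>) < e"
  shows "L1_continuous f"
  unfolding L1_continuous_def
proof (intro allI impI LIMSEQ_I)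
  fix s :: "nat \<Rightarrow> 'a" and e :: real assume s: "s \<longlonglongrightarrow> 0" and e: "e > 0"
  obtain g where g: "integrable lborel g" "L1_continuous g" "(LINT x|lborel. \<bar>f x - g x\<bar>) < e / 3"
    using approx[of "e / 3"] e by auto
  have "(\<lambda>n. LINT x|lborel. \<bar>g (x + s n) - g x\<bar>) \<longlonglongrightarrow> 0"
    using g(2) s unfolding L1_continuous_def by blast
  then obtain N where N: "\<And>n. n \<ge> N \<Longrightarrow> \<bar>LINT x|lborel. \<bar>g (x + s n) - g x\<bar>\<bar> < e / 3"
    using e LIMSEQ_D[of "\<lambda>n. LINT x|lborel. \<bar>g (x + s n) - g x\<bar>" 0 "e / 3"] by auto
  have "norm ((LINT x|lborel. \<bar>f (x + s n) - f x\<bar>) - 0) < e" if "n \<ge> N" for n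
  proof -
    let ?d = "\<lambda>x. \<bar>f x - g x\<bar>"
    have d: "integrable lborel ?d" using f g by auto
    note i = integrable_translate[OF d, of "s n"] integrable_translate[OF f, of "s n"]
      integrable_translate[OF g(1), of "s n"] f g(1) d
    have "(LINT x|lborel. \<bar>f (x + s n) - f x\<bar>) \<le>
        (LINT x|lborel. ?d (x + s n) + (\<bar>g (x + s n) - g x\<bar> + ?d x))"
      using i by (intro integral_mono Bochner_Integration.integrable_add) auto
    also have "\<dots> = (LINT x|lborel. ?d (x + s n)) + ((LINT x|lborel. \<bar>g (x + s n) - g x\<bar>) + (LINT x|lborel. ?d x))"
      using i by simp
    also have "(LINT x|lborel. ?d (x + s n)) = (LINT x|lborel. ?d x)"
      using d by (intro integral_translate) auto
    also have "(LINT x|lborel. ?d x) + ((LINT x|lborel. \<bar>g (x + s n) - g x\<bar>) + (LINT x|lborel. ?d x)) < e"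
      using N[OF that] g(3) by linarith
    finally show ?thesis by simp
  qed
  then show "\<exists>N. \<forall>n\<ge>N. norm ((LINT x|lborel. \<bar>f (x + s n) - f x\<bar>) - 0) < e" by blast
qed

text \<open>The L1-distance of two indicators is the sum of the measures minus twice the measure of
  the intersection. Only the intersection depends on the shift, and openness keeps x + s n in U
  eventually for every x in U, so the boundary of U does no harm.\<close>

lemma L1_continuous_open:
  assumes "open U" "emeasure lborel (U :: 'a::euclidean_space set) < \<infinity>"
  shows "L1_continuous (indicator U :: 'a \<Rightarrow> real)"
  unfolding L1_continuous_def
proof (intro allI impI)
  fix s :: "nat \<Rightarrow> 'a" assume s: "s \<longlonglongrightarrow> 0"
  let ?u = "indicator U :: 'a \<Rightarrow> real"
  have i: "integrable lborel ?u" using assms by (intro integrable_real_indicator) auto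
  have it: "integrable lborel (\<lambda>x. ?u (x + s n))" for n by (rule integrable_translate[OF i])
  have m: "?u \<in> borel_measurable borel" using assms by auto
  have mt: "(\<lambda>x. ?u (x + s n)) \<in> borel_measurable borel" for n
    using borel_measurable_integrable[OF it[of n]] by simp
  have mp: "(\<lambda>x. ?u (x + s n) * ?u x) \<in> borel_measurable borel" for n
    by (intro borel_measurable_times mt m)
  have ip: "integrable lborel (\<lambda>x. ?u (x + s n) * ?u x)" for n
    by (rule Bochner_Integration.integrable_bound[OF i]) (use mp in \<open>auto simp: abs_mult mult_left_le_one_le\<close>)
  have "(LINT x|lborel. \<bar>?u (x + s n) - ?u x\<bar>) = 2 * (LINT x|lborel. ?u x) - 2 * (LINT x|lborel. ?u (x + s n) * ?u x)" for n
  proof -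
    have "(LINT x|lborel. \<bar>?u (x + s n) - ?u x\<bar>) = (LINT x|lborel. (?u (x + s n) + ?u x) - 2 * (?u (x + s n) * ?u x))"
      by (intro Bochner_Integration.integral_cong) (auto simp: indicator_def)
    also have "\<dots> = (LINT x|lborel. ?u (x + s n)) + (LINT x|lborel. ?u x) - 2 * (LINT x|lborel. ?u (x + s n) * ?u x)"
      using i it ip by simp
    finally show ?thesis using integral_translate[OF m, of "s n"] by simp
  qed
  moreover have "(\<lambda>n. LINT x|lborel. ?u (x + s n) * ?u x) \<longlonglongrightarrow> (LINT x|lborel. ?u x)"
  proof (rule integral_dominated_convergence[OF _ _ i])
    show "AE x in lborel. (\<lambda>n. ?u (x + s n) * ?u x) \<longlonglongrightarrow> ?u x"
    proof (rule AE_I2)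
      fix x
      show "(\<lambda>n. ?u (x + s n) * ?u x) \<longlonglongrightarrow> ?u x"
      proof (cases "x \<in> U")
        case True
        have "(\<lambda>n. x + s n) \<longlonglongrightarrow> x + 0" by (intro tendsto_intros s)
        then have "\<forall>\<^sub>F n in sequentially. x + s n \<in> U"
          using topological_tendstoD[OF _ assms(1)] True by fastforce
        then show ?thesis
          by (intro tendsto_eventually) (auto elim!: eventually_mono simp: True)
      qed simp
    qed
  qed (use m mp in \<open>auto simp: abs_mult mult_left_le_one_le\<close>)
  ultimately show "(\<lambda>n. LINT x|lborel. \<bar>?u (x + s n) - ?u x\<bar>) \<longlonglongrightarrow> 0"
    using tendsto_diff[OF tendsto_const tendsto_mult[OF tendsto_const[of 2]],
        of "\<lambda>n. LINT x|lborel. ?u (x + s n) * ?u x" "LINT x|lborel. ?u x" sequentially "2 * (LINT x|lborel. ?u x)"]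
    by simp
qed

text \<open>Induction over indicators, sums and dominated limits. Outer regularity leads from open
  sets to measurable sets of finite measure.\<close>

lemma L1_continuous_integrable:
  fixes f :: "'a::euclidean_space \<Rightarrow> real"
  assumes "integrable lborel f"
  shows "L1_continuous f"
  using assms
proof (induction rule: integrable_induct)
  case (base A c)
  have A: "A \<in> sets borel" using base by simp
  have iA: "integrable lborel (indicator A :: 'a \<Rightarrow> real)"
    using base by (intro integrable_real_indicator) auto
  have "L1_continuous (indicator A :: 'a \<Rightarrow> real)"
  proof (rule L1_continuous_closed[OF iA])
    fix e :: real assume e: "e > 0"
    obtain T where T: "open T" "A \<subseteq> T" "(T - A) \<in> lmeasurable" "emeasure lebesgue (T - A) < ennreal e"
      using sets_lebesgue_outer_open[OF _ e, of A] A by auto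
    have TA: "emeasure lborel (T - A) < ennreal e" using T A by simp
    have "(T - A) \<union> A = T" using T by auto
    then have "emeasure lborel T \<le> emeasure lborel (T - A) + emeasure lborel A"
      using emeasure_subadditive[of "T - A" lborel A] T(1) A by auto
    also have "\<dots> < \<infinity>" using less_trans[OF TA ennreal_less_top] base by simp
    finally have Tf: "emeasure lborel T < \<infinity>" .
    have "(LINT x|lborel. \<bar>indicator A x - indicator T x\<bar>) = (LINT x|lborel. indicator (T - A) x :: real)"
      using T(2) by (intro Bochner_Integration.integral_cong) (auto simp: indicator_def)
    also have "\<dots> = measure lborel (T - A)" by simp
    also have "\<dots> < e" using TA e
      by (metis emeasure_eq_ennreal_measure ennreal_less_iff less_trans ennreal_less_top
          measure_nonneg order.strict_implies_not_eq infinity_ennreal_def)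
    finally have "(LINT x|lborel. \<bar>indicator A x - indicator T x :: real\<bar>) < e" .
    then show "\<exists>g. integrable lborel g \<and> L1_continuous g \<and> (LINT x|lborel. \<bar>indicator A x - g x\<bar>) < e"
      using L1_continuous_open[OF T(1) Tf] T(1) Tf
      by (intro exI[of _ "indicator T"]) (auto intro: integrable_real_indicator)
  qed
  then have "(\<lambda>n. \<bar>c\<bar> * (LINT x|lborel. \<bar>indicator A (x + s n) - indicator A x\<bar>)) \<longlonglongrightarrow> \<bar>c\<bar> * 0"
    if "s \<longlonglongrightarrow> 0" for s :: "nat \<Rightarrow> 'a" using that unfolding L1_continuous_def by (intro tendsto_intros) auto
  moreover have "\<bar>indicator A y *\<^sub>R c - indicator A x *\<^sub>R c\<bar> = \<bar>c\<bar> * \<bar>indicator A y - indicator A x\<bar>"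
    for x y by (simp add: abs_mult[symmetric] algebra_simps)
  ultimately show ?case unfolding L1_continuous_def by simp
next
  case (add f g)
  show ?case unfolding L1_continuous_def
  proof (intro allI impI)
    fix s :: "nat \<Rightarrow> 'a" assume s: "s \<longlonglongrightarrow> 0"
    have lim: "(\<lambda>n. (LINT x|lborel. \<bar>f (x + s n) - f x\<bar>) + (LINT x|lborel. \<bar>g (x + s n) - g x\<bar>)) \<longlonglongrightarrow> 0 + 0"
      using add s unfolding L1_continuous_def by (intro tendsto_intros) auto
    have i: "integrable lborel (\<lambda>x. \<bar>f (x + s n) - f x\<bar>)" "integrable lborel (\<lambda>x. \<bar>g (x + s n) - g x\<bar>)"
        "integrable lborel (\<lambda>x. \<bar>(f (x + s n) + g (x + s n)) - (f x + g x)\<bar>)" for n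
      using add by (auto intro!: integrable_abs Bochner_Integration.integrable_diff
          Bochner_Integration.integrable_add integrable_translate)
    have le: "(LINT x|lborel. \<bar>(f (x + s n) + g (x + s n)) - (f x + g x)\<bar>)
        \<le> (LINT x|lborel. \<bar>f (x + s n) - f x\<bar>) + (LINT x|lborel. \<bar>g (x + s n) - g x\<bar>)" for n
      by (subst Bochner_Integration.integral_add[symmetric, OF i(1,2)])
        (intro integral_mono Bochner_Integration.integrable_add i, linarith)
    show "(\<lambda>n. LINT x|lborel. \<bar>(f (x + s n) + g (x + s n)) - (f x + g x)\<bar>) \<longlonglongrightarrow> 0"
      by (rule real_tendsto_sandwich[OF _ _ tendsto_const lim[simplified]]) (auto intro!: always_eventually le)
  qed
next
  case (lim f s)
  show ?case
  proof (rule L1_continuous_closed[OF lim.hyps(4)])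
    fix e :: real assume e: "e > 0"
    have "(\<lambda>i. LINT x|lborel. \<bar>f x - s i x\<bar>) \<longlonglongrightarrow> (LINT x|(lborel :: 'a measure). (0::real))"
    proof (rule integral_dominated_convergence[where w = "\<lambda>x. 3 * \<bar>f x\<bar>"])
      show "AE x in lborel. (\<lambda>i. \<bar>f x - s i x\<bar>) \<longlonglongrightarrow> 0"
      proof (rule AE_I2)
        fix x :: 'a
        have "(\<lambda>i. s i x) \<longlonglongrightarrow> f x" using lim.hyps(2) by simp
        then have "(\<lambda>i. \<bar>f x - s i x\<bar>) \<longlonglongrightarrow> \<bar>f x - f x\<bar>" by (intro tendsto_intros)
        then show "(\<lambda>i. \<bar>f x - s i x\<bar>) \<longlonglongrightarrow> 0" by simp
      qed
      show "AE x in lborel. norm \<bar>f x - s i x\<bar> \<le> 3 * \<bar>f x\<bar>" for i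
      proof (rule AE_I2)
        fix x :: 'a
        show "norm \<bar>f x - s i x\<bar> \<le> 3 * \<bar>f x\<bar>" using lim.hyps(3)[of x i] by simp
      qed
    qed (use lim.hyps(1,4) in auto)
    then obtain i where "\<bar>LINT x|lborel. \<bar>f x - s i x\<bar>\<bar> < e"
      using LIMSEQ_D[OF _ e] by fastforce
    then show "\<exists>g. integrable lborel g \<and> L1_continuous g \<and> (LINT x|lborel. \<bar>f x - g x\<bar>) < e"
      using lim.hyps(1) lim.IH by (intro exI[of _ "s i"]) auto
  qed
qed

text \<open>For nonnegative g this bounds the squared L2-increment of g by the L1-increment of g^2,
  so that continuity of translations passes from L1 to L2.\<close>

lemma square_diff_le:
  fixes a b :: real assumes "0 \<le> a" "0 \<le> b" shows "(a - b)\<^sup>2 \<le> \<bar>a\<^sup>2 - b\<^sup>2\<bar>"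
proof -
  have "\<bar>a - b\<bar> * \<bar>a - b\<bar> \<le> \<bar>a - b\<bar> * \<bar>a + b\<bar>" using assms by (intro mult_left_mono) auto
  then show ?thesis by (simp add: abs_mult[symmetric] power2_eq_square algebra_simps)
qed

lemma sqint_translation_continuous:
  assumes f: "sqint f" and s: "s \<longlonglongrightarrow> (0::'a::euclidean_space)"
  shows "(\<lambda>n. L2_norm UNIV (\<lambda>x. f (x + s n) - f x)) \<longlonglongrightarrow> 0"
proof -
  have nonneg: "(\<lambda>n. LINT x|lborel. (g (x + s n) - g x)\<^sup>2) \<longlonglongrightarrow> 0"
    if g: "sqint g" "\<And>x. 0 \<le> g x" for g :: "'a \<Rightarrow> real"
  proof -
    have lim: "(\<lambda>n. LINT x|lborel. \<bar>(g (x + s n))\<^sup>2 - (g x)\<^sup>2\<bar>) \<longlonglongrightarrow> 0"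
      using L1_continuous_integrable[of "\<lambda>x. (g x)\<^sup>2"] g s unfolding L1_continuous_def sqint_def by blast
    have "(LINT x|lborel. (g (x + s n) - g x)\<^sup>2) \<le> (LINT x|lborel. \<bar>(g (x + s n))\<^sup>2 - (g x)\<^sup>2\<bar>)" for n
    proof (rule integral_mono)
      have "sqint (\<lambda>x. g (x + s n) + (-1) * g x)"
        by (intro sqint_add sqint_translate sqint_cmult g)
      then show "integrable lborel (\<lambda>x. (g (x + s n) - g x)\<^sup>2)" by (simp add: sqint_def)
      show "integrable lborel (\<lambda>x. \<bar>(g (x + s n))\<^sup>2 - (g x)\<^sup>2\<bar>)"
        using g sqint_translate[OF g(1), of "s n"]
        by (intro integrable_abs Bochner_Integration.integrable_diff) (auto simp: sqint_def)
    qed (rule square_diff_le[OF g(2) g(2)])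
    then show ?thesis
      using real_tendsto_sandwich[OF _ _ tendsto_const lim, of "\<lambda>n. LINT x|lborel. (g (x + s n) - g x)\<^sup>2"] by simp
  qed
  \<comment> \<open>The comparison with squares is for nonnegative functions; the general case is
    split into positive and negative parts at the price of a factor 2.\<close>
  let ?p = "\<lambda>x. max (f x) 0" and ?q = "\<lambda>x. max (- f x) 0"
  have i: "integrable lborel (\<lambda>x. (f x)\<^sup>2)" and m: "f \<in> borel_measurable borel" using f by (auto simp: sqint_def)
  have p: "sqint ?p" and q: "sqint ?q"
    using m unfolding sqint_def
    by (auto intro!: Bochner_Integration.integrable_bound[OF i] simp: abs_le_square_iff[symmetric] max_def)
  have "(\<lambda>n. 2 * (LINT x|lborel. (?p (x + s n) - ?p x)\<^sup>2) + 2 * (LINT x|lborel. (?q (x + s n) - ?q x)\<^sup>2))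
      \<longlonglongrightarrow> 2 * 0 + 2 * 0"
    by (intro tendsto_intros nonneg p q) auto
  note L = this
  have B: "(LINT x|lborel. (f (x + s n) - f x)\<^sup>2) \<le>
     2 * (LINT x|lborel. (?p (x + s n) - ?p x)\<^sup>2) + 2 * (LINT x|lborel. (?q (x + s n) - ?q x)\<^sup>2)" for n
  proof -
    have "sqint (\<lambda>x. g (x + s n) + (-1) * g x)" if "sqint g" for g
      by (intro sqint_add sqint_translate sqint_cmult that)
    then have d: "integrable lborel (\<lambda>x. (g (x + s n) - g x)\<^sup>2)" if "sqint g" for g
      using that by (simp add: sqint_def)
    have "(LINT x|lborel. (f (x + s n) - f x)\<^sup>2) \<le>
       (LINT x|lborel. 2 * (?p (x + s n) - ?p x)\<^sup>2 + 2 * (?q (x + s n) - ?q x)\<^sup>2)"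
    proof (rule integral_mono)
      fix x
      define a b where "a = ?p (x + s n) - ?p x" "b = ?q (x + s n) - ?q x"
      have "f (x + s n) - f x = a - b" unfolding a_b_def by (simp add: max_def)
      moreover have "(a - b)\<^sup>2 \<le> 2 * a\<^sup>2 + 2 * b\<^sup>2"
        using zero_le_power2[of "a + b"] by (simp add: power2_eq_square algebra_simps)
      ultimately show "(f (x + s n) - f x)\<^sup>2 \<le> 2 * (?p (x + s n) - ?p x)\<^sup>2 + 2 * (?q (x + s n) - ?q x)\<^sup>2"
        by (simp add: a_b_def)
    qed (use d[OF f] d[OF p] d[OF q] in auto)
    then show ?thesis using d[OF p] d[OF q] by simp
  qed
  have "(\<lambda>n. LINT x|lborel. (f (x + s n) - f x)\<^sup>2) \<longlonglongrightarrow> 0"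
    using B by (intro real_tendsto_sandwich[OF _ _ tendsto_const L[simplified]] always_eventually allI) auto
  from tendsto_real_sqrt[OF this] show ?thesis
    by (simp add: L2_norm_def set_lebesgue_integral_def)
qed

lemma L2_UNIV: "f \<in> L2 UNIV \<longleftrightarrow> sqint f"
  by (simp add: L2_iff_sqint)

lemma translated_product_tendsto:
  assumes "sqint f" "sqint g" "s \<longlonglongrightarrow> (0::'a::euclidean_space)"
  shows "(\<lambda>n. LINT x|lborel. f (x + s n) * g x) \<longlonglongrightarrow> (LINT x|lborel. f x * g x)"
  using L2_weak_limit[of "\<lambda>n x. f (x + s n)" UNIV f g]
    sqint_translation_continuous[OF assms(1,3)] assms sqint_translate[OF assms(1)]
  by (simp add: L2_UNIV set_lebesgue_integral_def)

section \<open>Fubini on the product with the real line\<close>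

lemma
  fixes f :: "'a::euclidean_space \<times> 'b::euclidean_space \<Rightarrow> real"
  assumes "integrable lborel f"
  shows AE_integrable_slice_fst: "AE x in lborel. integrable lborel (\<lambda>t. f (x, t))"
    and AE_integrable_slice_snd: "AE t in lborel. integrable lborel (\<lambda>x. f (x, t))"
    and integrable_integral_fst: "integrable lborel (\<lambda>x. LINT t|lborel. f (x, t))"
    and integrable_integral_snd: "integrable lborel (\<lambda>t. LINT x|lborel. f (x, t))"
    and iterated_integral_fst: "(LINT x|lborel. LINT t|lborel. f (x, t)) = (LINT z|lborel. f z)"
    and iterated_integral_snd: "(LINT t|lborel. LINT x|lborel. f (x, t)) = (LINT z|lborel. f z)"
proof -
  have f: "integrable (lborel \<Otimes>\<^sub>M lborel) (\<lambda>(x, t). f (x, t))"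
    using assms by (simp add: lborel_prod)
  show "AE x in lborel. integrable lborel (\<lambda>t. f (x, t))"
    "AE t in lborel. integrable lborel (\<lambda>x. f (x, t))"
    "integrable lborel (\<lambda>x. LINT t|lborel. f (x, t))"
    "integrable lborel (\<lambda>t. LINT x|lborel. f (x, t))"
    using lborel_pair.AE_integrable_fst[OF f] lborel_pair.AE_integrable_snd[OF f]
      lborel_pair.integrable_fst[OF f] lborel_pair.integrable_snd[OF f] by simp_all
  show "(LINT x|lborel. LINT t|lborel. f (x, t)) = (LINT z|lborel. f z)"
    "(LINT t|lborel. LINT x|lborel. f (x, t)) = (LINT z|lborel. f z)"
    using lborel_pair.integral_fst[OF f] lborel_pair.integral_snd[OF f] by (simp_all add: lborel_prod)
qed

lemma AE_slice_fst:
  assumes "AE z in lborel. P (z :: 'a::euclidean_space \<times> 'b::euclidean_space)"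
  shows "AE x in lborel. AE t in lborel. P (x, t)"
  using lborel_pair.AE_pair[of P] assms unfolding lborel_prod by simp

lemma AE_from_slices_fst:
  assumes "{z. P z} \<in> sets (borel :: ('a::euclidean_space \<times> 'b::euclidean_space) measure)"
    "AE x in lborel. AE t in lborel. P (x, t)"
  shows "AE z in lborel. P z"
  using lborel_pair.AE_pair_measure[of P] assms unfolding lborel_prod by simp

lemma AE_from_slices_snd:
  assumes "{z. P z} \<in> sets (borel :: ('a::euclidean_space \<times> 'b::euclidean_space) measure)"
    "AE t in lborel. AE x in lborel. P (x, t)"
  shows "AE z in lborel. P z"
proof (rule AE_from_slices_fst[OF assms(1)])
  show "AE x in lborel. AE t in lborel. P (x, t)"
    using lborel_pair.AE_commute[of "\<lambda>x t. P (x, t)"] assms unfolding lborel_prod by simp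
qed

lemma measurable_slice:
  fixes f :: "'a::euclidean_space \<times> 'b::euclidean_space \<Rightarrow> real"
  assumes "f \<in> borel_measurable borel"
  shows "(\<lambda>t. f (x, t)) \<in> borel_measurable borel" "(\<lambda>x. f (x, t)) \<in> borel_measurable borel"
  using assms by (auto intro!: measurable_compose[OF _ assms] borel_measurable_Pair)

lemma sqint_slices:
  fixes f :: "'a::euclidean_space \<times> 'b::euclidean_space \<Rightarrow> real"
  assumes "sqint f"
  shows "AE x in lborel. sqint (\<lambda>t. f (x, t))" "AE t in lborel. sqint (\<lambda>x. f (x, t))"
  using AE_integrable_slice_fst[of "\<lambda>z. (f z)\<^sup>2"] AE_integrable_slice_snd[of "\<lambda>z. (f z)\<^sup>2"]
    measurable_slice[of f] assms
  by (auto simp: sqint_def)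

section \<open>The weak time derivative\<close>

text \<open>To the right of the support of g the primitive is constant and equal to the total
  integral; when this is 0 the primitive has compact support again.\<close>

lemma primitive_test_function:
  assumes g: "g \<in> test_functions {0<..<T}" and total: "(LINT r|lborel. g r) = 0"
  shows "(\<lambda>t. LINT r|lborel. indicator {..t} r * g r) \<in> test_functions {0<..<T}" (is "?\<phi> \<in> _")
    and "deriv (\<lambda>t. LINT r|lborel. indicator {..t} r * g r) t = g t"
proof -
  obtain K where K: "Cinf_on UNIV g" "compact K" "K \<subseteq> {0<..<T}" "\<And>x. x \<notin> K \<Longrightarrow> g x = 0"
    using g unfolding test_functions_def by auto
  \<comment> \<open>The primitive is in general nonzero in the gaps of the support of g, so its
    support is enclosed in the hull, which still lies in (0,T). The interval from 1 to 0 serves for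
    an empty support.\<close>
  have "\<exists>lo hi. {lo..hi} \<subseteq> {0<..<T} \<and> K \<subseteq> {lo..hi}"
  proof (cases "K = {}")
    case False
    obtain lo hi where "lo \<in> K" "\<And>x. x \<in> K \<Longrightarrow> lo \<le> x" "hi \<in> K" "\<And>x. x \<in> K \<Longrightarrow> x \<le> hi"
      using compact_attains_inf[OF K(2) False] compact_attains_sup[OF K(2) False] by metis
    moreover have "lo \<in> {0<..<T}" "hi \<in> {0<..<T}" using calculation K(3) by auto
    ultimately have "{lo..hi} \<subseteq> {0<..<T} \<and> K \<subseteq> {lo..hi}" by auto
    then show ?thesis by blast
  qed (rule exI[of _ 1], rule exI[of _ 0], simp)
  then obtain lo hi where lh: "{lo..hi} \<subseteq> {0<..<T}" and z: "\<And>x. x \<notin> {lo..hi} \<Longrightarrow> g x = 0"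
    using K(4) by (metis subsetD)
  have cont: "continuous_on S g" for S by (rule test_functions_continuous[OF g])
  have ig: "integrable lborel g" by (rule test_functions_integrable[OF g])
  have low: "?\<phi> t = 0" if "t < lo" for t
  proof -
    have "(\<lambda>r. indicator {..t} r * g r) = (\<lambda>r. 0)" using that z by (auto simp: indicator_def fun_eq_iff)
    then show ?thesis by simp
  qed
  have high: "?\<phi> t = 0" if "t > hi" for t
  proof -
    have "(\<lambda>r. indicator {..t} r * g r) = g" using that z by (auto simp: indicator_def fun_eq_iff)
    then show ?thesis using total by simp
  qed
  have der: "(?\<phi> has_real_derivative g t) (at t)" for t
  proof (cases "t < lo")
    case True
    have "((\<lambda>t. 0) has_real_derivative 0) (at t)" by simp
    then have "(?\<phi> has_real_derivative 0) (at t)"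
      by (rule has_field_derivative_transform_within_open[of _ _ _ "{..<lo}"]) (use True low in auto)
    then show ?thesis using z[of t] True by simp
  next
    case False
    \<comment> \<open>Starting one unit before the support makes t an interior point of the
      interval, so the derivative within the interval is the full derivative.\<close>
    have eq: "?\<phi> x = integral {lo - 1..x} g" for x
    proof -
      have "?\<phi> x = (LINT r:{lo - 1..x}|lborel. g r)"
        unfolding set_lebesgue_integral_def
        by (intro Bochner_Integration.integral_cong refl) (use z in \<open>auto simp: indicator_def\<close>)
      also have "\<dots> = integral {lo - 1..x} g"
      proof (rule set_borel_integral_eq_integral)
        have "set_integrable lborel UNIV g" using ig by (simp add: set_integrable_def)
        then show "set_integrable lborel {lo - 1..x} g" by (rule set_integrable_subset) auto
      qed
      finally show ?thesis .
    qed
    have "((\<lambda>x. integral {lo - 1..x} g) has_real_derivative g t) (at t within {lo - 1..t + 1})"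
      using False by (intro integral_has_real_derivative cont) auto
    moreover have "at t within {lo - 1..t + 1} = at t"
      using False by (intro at_within_interior) auto
    ultimately show ?thesis by (simp add: eq)
  qed
  show "deriv ?\<phi> t = g t" for t using der by (rule DERIV_imp_deriv)
  have d1: "dpartial 1 ?\<phi> = g" by (rule ext, rule dpartial_real_eq[OF der])
  have diff: "?\<phi> differentiable (at t)" for t using der by (auto simp: real_differentiable_def)
  have "smooth_upto False n UNIV ?\<phi>" for n
    using K(1) diff d1 by (cases n) (auto simp: Cinf_on_smooth_upto)
  then have "Cinf_on UNIV ?\<phi>" by (simp add: Cinf_on_smooth_upto)
  moreover have "?\<phi> x = 0" if "x \<notin> {lo..hi}" for x
    using that low high by (cases "x < lo") auto
  ultimately show "?\<phi> \<in> test_functions {0<..<T}"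
    unfolding test_functions_def using lh
    by (auto intro!: exI[of _ "{lo..hi}"])
qed

lemma sqint_bounded_support:
  fixes f :: "'a::euclidean_space \<Rightarrow> real"
  assumes "f \<in> borel_measurable borel" "\<And>x. \<bar>f x\<bar> \<le> B" "bounded S" "S \<in> sets borel" "\<And>x. x \<notin> S \<Longrightarrow> f x = 0"
  shows "sqint f"
proof -
  have "f \<in> L2 S"
    by (rule L2_bounded[where B = B]) (use assms in \<open>auto simp: set_borel_measurable_def\<close>)
  then have "sqint (\<lambda>x. indicator S x * f x)" by (simp add: L2_iff_sqint)
  moreover have "(\<lambda>x. indicator S x * f x) = f" using assms(5) by (auto simp: indicator_def fun_eq_iff)
  ultimately show ?thesis by simp
qed

lemma AE_fst_lift:
  assumes "AE x in lborel. P (x::'a::euclidean_space)"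
  shows "AE z in lborel. P (fst (z :: 'a \<times> 'b::euclidean_space))"
proof -
  obtain N where N: "N \<in> null_sets lborel" "{z. \<not> P z} \<subseteq> N"
    using assms by (auto simp: eventually_ae_filter)
  have [measurable]: "N \<in> sets borel" using N by auto
  have "{z \<in> space (borel \<Otimes>\<^sub>M borel). fst (z :: 'a \<times> 'b) \<notin> N} \<in> sets (borel \<Otimes>\<^sub>M borel)"
    by measurable
  then have "{z :: 'a \<times> 'b. fst z \<notin> N} \<in> sets borel"
    unfolding borel_prod by simp
  then have "AE z in lborel. fst (z :: 'a \<times> 'b) \<notin> N"
    by (rule AE_from_slices_fst) (use AE_not_in[OF N(1)] in \<open>auto elim: eventually_mono\<close>)
  then show ?thesis by eventually_elim (use N(2) in auto)
qed

lemma integrable_product: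
  fixes f :: "'a::euclidean_space \<Rightarrow> real" and g :: "'b::euclidean_space \<Rightarrow> real"
  assumes "integrable lborel f" "integrable lborel g"
  shows "integrable lborel (\<lambda>z. f (fst z) * g (snd z))"
proof -
  have [measurable]: "f \<in> borel_measurable borel" "g \<in> borel_measurable borel" using assms by auto
  have m: "(\<lambda>z. f (fst z) * g (snd z)) \<in> borel_measurable (borel \<Otimes>\<^sub>M borel)" by measurable
  have "integrable (lborel \<Otimes>\<^sub>M lborel) (\<lambda>z. f (fst z) * g (snd z))"
    by (rule lborel_pair.Fubini_integrable) (use assms m in \<open>auto simp: abs_mult\<close>)
  then show ?thesis unfolding lborel_prod .
qed

text \<open>Integration starts at minus infinity. For functions supported in (0,T) the primitive
  then vanishes at nonpositive times, in agreement with the extension of v by 0.\<close>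

definition time_primitive :: "('a::euclidean_space \<times> real \<Rightarrow> real) \<Rightarrow> 'a \<times> real \<Rightarrow> real" where
  "time_primitive f z = (LINT s|lborel. (if s < snd z then f (fst z, s) else 0))"

lemma time_primitive_measurable:
  assumes "f \<in> borel_measurable borel"
  shows "time_primitive f \<in> borel_measurable borel"
proof -
  have [measurable]: "f \<in> borel_measurable (borel \<Otimes>\<^sub>M borel)" using assms unfolding borel_prod .
  have "(\<lambda>z. LINT s|lborel. (if s < snd z then f (fst z, s) else 0)) \<in> borel_measurable (borel \<Otimes>\<^sub>M borel)"
    by measurable
  then show ?thesis unfolding borel_prod time_primitive_def[abs_def] .
qed

lemma cylinder_indicator: "indicator (cylinder \<Omega> T) (x, t) = indicator \<Omega> x * (indicator {0<..<T} t :: real)"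
  by (auto simp: indicator_def)

locale supported_in_time =
  fixes T :: real and f :: "'a::euclidean_space \<times> real \<Rightarrow> real"
  assumes T: "0 < T" and f: "sqint f" and support: "\<And>x t. t \<notin> {0<..<T} \<Longrightarrow> f (x, t) = 0"
begin

lemma f_measurable: "f \<in> borel_measurable borel"
  using f by (simp add: sqint_def)

lemma slice_integrable: "sqint (\<lambda>t. f (x, t)) \<Longrightarrow> integrable lborel (\<lambda>t. f (x, t))"
proof -
  assume s: "sqint (\<lambda>t. f (x, t))"
  have "sqint (indicator {0<..<T} :: real \<Rightarrow> real)"
    by (rule sqint_bounded_support[where B = 1 and S = "{0<..<T}"]) (auto simp: indicator_def)
  from sqint_mult[OF s this] show ?thesis
    by (rule back_subst[of "integrable lborel"]) (use support in \<open>auto simp: indicator_def fun_eq_iff\<close>)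
qed

lemma slices_integrable: "AE x in lborel. integrable lborel (\<lambda>t. f (x, t))"
  using sqint_slices(1)[OF f] by eventually_elim (rule slice_integrable)

text \<open>Cauchy-Schwarz against the constant 1 on (0,T), whose squared norm is the factor T. The
  bound is uniform in t, and integrating it over the cylinder gives square integrability.\<close>

lemma time_primitive_bound:
  assumes "sqint (\<lambda>t. f (x, t))"
  shows "(time_primitive f (x, t))\<^sup>2 \<le> T * (LINT s|lborel. (f (x, s))\<^sup>2)"
proof -
  have i: "integrable lborel (\<lambda>t. f (x, t))" by (rule slice_integrable[OF assms])
  have 1: "\<bar>time_primitive f (x, t)\<bar> \<le> (LINT s|lborel. \<bar>f (x, s)\<bar>)"
  proof -
    have m: "(\<lambda>s. if s < t then f (x, s) else 0) \<in> borel_measurable borel"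
      using borel_measurable_integrable[OF i] by simp
    have "integrable lborel (\<lambda>s. if s < t then f (x, s) else 0)"
      by (rule Bochner_Integration.integrable_bound[OF i]) (use m in auto)
    then have "\<bar>LINT s|lborel. (if s < t then f (x, s) else 0)\<bar> \<le> (LINT s|lborel. \<bar>f (x, s)\<bar>)"
      using i by (intro order_trans[OF integral_abs_bound] integral_mono integrable_abs) auto
    then show ?thesis by (simp only: time_primitive_def fst_conv snd_conv)
  qed
  have "\<bar>LINT s:{0<..<T}|lborel. \<bar>f (x, s)\<bar> * 1\<bar> \<le> L2_norm {0<..<T} (\<lambda>s. \<bar>f (x, s)\<bar>) * L2_norm {0<..<T} (\<lambda>s. 1)"
  proof (rule L2_Cauchy_Schwarz)
    show "(\<lambda>s. \<bar>f (x, s)\<bar>) \<in> L2 {0<..<T}"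
      unfolding L2_iff_sqint using assms
      by (intro sqint_bounded_mult[where B = 1]) (auto simp: sqint_def indicator_def)
    show "(\<lambda>s. 1) \<in> L2 {0<..<T}" by (rule L2_bounded[where B = 1]) (auto simp: set_borel_measurable_def)
  qed
  moreover have "(LINT s:{0<..<T}|lborel. \<bar>f (x, s)\<bar> * 1) = (LINT s|lborel. \<bar>f (x, s)\<bar>)"
    unfolding set_lebesgue_integral_def using support
    by (intro Bochner_Integration.integral_cong) (auto simp: indicator_def)
  moreover have "(L2_norm {0<..<T} (\<lambda>s. \<bar>f (x, s)\<bar>))\<^sup>2 = (LINT s|lborel. (f (x, s))\<^sup>2)"
    unfolding L2_norm_square set_lebesgue_integral_def using support
    by (intro Bochner_Integration.integral_cong) (auto simp: indicator_def)
  moreover have "(L2_norm {0<..<T} (\<lambda>s. 1))\<^sup>2 = T"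
    unfolding L2_norm_square set_lebesgue_integral_def using T by simp
  ultimately have "(LINT s|lborel. \<bar>f (x, s)\<bar>)\<^sup>2 \<le> (LINT s|lborel. (f (x, s))\<^sup>2) * T"
  proof -
    define a b where "a = L2_norm {0<..<T} (\<lambda>s. \<bar>f (x, s)\<bar>)" and "b = L2_norm {0<..<T} (\<lambda>s. 1 :: real)"
    define I where "I = (LINT s|lborel. \<bar>f (x, s)\<bar>)"
    assume "\<bar>LINT s:{0<..<T}|lborel. \<bar>f (x, s)\<bar> * 1\<bar> \<le> L2_norm {0<..<T} (\<lambda>s. \<bar>f (x, s)\<bar>) * L2_norm {0<..<T} (\<lambda>s. 1)"
      "(LINT s:{0<..<T}|lborel. \<bar>f (x, s)\<bar> * 1) = (LINT s|lborel. \<bar>f (x, s)\<bar>)"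
      and ab: "(L2_norm {0<..<T} (\<lambda>s. \<bar>f (x, s)\<bar>))\<^sup>2 = (LINT s|lborel. (f (x, s))\<^sup>2)"
      "(L2_norm {0<..<T} (\<lambda>s. 1))\<^sup>2 = T"
    then have "\<bar>I\<bar> \<le> a * b" by (simp add: a_def b_def I_def)
    then have "I\<^sup>2 \<le> (a * b)\<^sup>2" using power_mono[of "\<bar>I\<bar>" "a * b" 2] by simp
    then show ?thesis using ab by (simp add: a_def b_def I_def power_mult_distrib)
  qed
  moreover have "(time_primitive f (x, t))\<^sup>2 \<le> (LINT s|lborel. \<bar>f (x, s)\<bar>)\<^sup>2"
    using power_mono[OF 1, of 2] by simp
  ultimately show ?thesis by (simp add: mult.commute)
qed

lemma time_primitive_sqint:
  assumes [measurable]: "\<Omega> \<in> sets borel"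
  shows "sqint (\<lambda>z. indicator (cylinder \<Omega> T) z * time_primitive f z)"
proof -
  let ?N = "\<lambda>x. LINT s|lborel. (f (x, s))\<^sup>2"
  have [measurable]: "time_primitive f \<in> borel_measurable borel"
    by (rule time_primitive_measurable[OF f_measurable])
  have C[measurable]: "cylinder \<Omega> T \<in> sets borel"
    unfolding borel_prod[symmetric] by measurable
  have N: "integrable lborel ?N" using f by (intro integrable_integral_fst) (simp add: sqint_def)
  have "integrable lborel (\<lambda>z. (T * ?N (fst z)) * indicator {0<..<T} (snd z))"
    using N T by (intro integrable_product integrable_mult_right integrable_real_indicator) auto
  then have "integrable lborel (\<lambda>z. (indicator (cylinder \<Omega> T) z * time_primitive f z)\<^sup>2)"
  proof (rule Bochner_Integration.integrable_bound)
    have "AE z in lborel. sqint (\<lambda>t. f (fst z, t))"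
      by (rule AE_fst_lift[OF sqint_slices(1)[OF f]])
    then show "AE z in lborel. norm ((indicator (cylinder \<Omega> T) z * time_primitive f z)\<^sup>2)
        \<le> norm ((T * ?N (fst z)) * indicator {0<..<T} (snd z))"
    proof eventually_elim
      case (elim z)
      then have b: "(time_primitive f z)\<^sup>2 \<le> T * ?N (fst z)"
        using time_primitive_bound[of "fst z" "snd z"] by simp
      moreover have "0 \<le> T * ?N (fst z)" using b zero_le_power2 order_trans by blast
      ultimately show ?case
        by (cases z) (auto simp: indicator_def)
    qed
  qed measurable
  then show ?thesis by (simp add: sqint_def)
qed

end

text \<open>The weak time derivative is tested by functions of t alone and holds for almost every x.
  The test family has the matching form: smooth in time, but merely the indicator of a box in
  space.\<close>

lemma AE_zero_on_cylinder:
  assumes "open \<Omega>" "D \<in> L2 (cylinder \<Omega> T)"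
    and test: "\<And>a b s t n. cbox a b \<subseteq> \<Omega> \<Longrightarrow> {s..t} \<subseteq> {0<..<T} \<Longrightarrow> s < t \<Longrightarrow>
      (LINT z:cylinder \<Omega> T|lborel. D z * (indicator (box a b) (fst z) * box_approx s t n (snd z))) = 0"
  shows "AE z in lborel. z \<in> cylinder \<Omega> T \<longrightarrow> D z = 0"
proof (rule AE_zero_on_open)
  show "open (cylinder \<Omega> T)" using assms(1) by (intro open_Times) auto
next
  have box_prod: "box (a, s) (b, t) = box a b \<times> box s t" for a b :: 'a and s t :: real
    by (auto simp: box_def Basis_prod_def inner_Pair)
  fix p q :: "'a \<times> real" assume sub: "cbox p q \<subseteq> cylinder \<Omega> T"
  show i: "set_integrable lborel (cbox p q) D" by (rule L2_integrable_on_bounded[OF assms(2) sub]) auto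
  obtain a s b t where pq: "p = (a, s)" "q = (b, t)" by (cases p, cases q)
  have boxeq: "box p q = box a b \<times> box s t" "cbox p q = cbox a b \<times> cbox s t"
    by (auto simp: pq cbox_Pair_eq box_prod)
  show "(LINT z:box p q|lborel. D z) = 0"
  proof (cases "box p q = {}")
    case False
    then have ne: "box a b \<noteq> {}" "s < t" by (auto simp: boxeq)
    then have s: "cbox a b \<subseteq> \<Omega>" "{s..t} \<subseteq> {0<..<T}"
      using sub box_subset_cbox[of a b] ne(2) by (auto simp: boxeq times_subset_iff)
    let ?g = "\<lambda>n z. indicator (cbox p q) z * D z * (indicator (box a b) (fst z) * box_approx s t n (snd z))"
    have cs: "box_approx s t n r = 0" if "r \<notin> cbox s t" for n r
      using that by (intro box_approx_outside) auto
    have m1: "(\<lambda>z. indicator (cbox p q) z * D z) \<in> borel_measurable borel"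
      using i by (auto simp: set_integrable_def dest!: borel_measurable_integrable)
    have [measurable]: "box_approx s t n \<in> borel_measurable borel" for n
      by (rule test_functions_measurable[OF box_approx_test[OF subset_UNIV]])
    have m2: "(\<lambda>z. indicator (box a b) (fst z) * box_approx s t n (snd z)) \<in> borel_measurable (borel :: ('a \<times> real) measure)" for n
      unfolding borel_prod[symmetric] by measurable
    have "(\<lambda>n. LINT z|lborel. ?g n z) \<longlonglongrightarrow> (LINT z|lborel. indicator (box p q) z * D z)"
    proof (rule integral_dominated_convergence[where w = "\<lambda>z. \<bar>indicator (cbox p q) z * D z\<bar>"])
      show "AE z in lborel. (\<lambda>n. ?g n z) \<longlonglongrightarrow> indicator (box p q) z * D z"
      proof (rule AE_I2)
        fix z
        have "(\<lambda>n. ?g n z) \<longlonglongrightarrow> indicator (cbox p q) z * D z * (indicator (box a b) (fst z) * indicator (box s t) (snd z))"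
          by (intro tendsto_intros box_approx_tendsto)
        moreover have "indicator (cbox p q) z * D z * (indicator (box a b) (fst z) * indicator (box s t) (snd z)) = indicator (box p q) z * D z"
          using box_subset_cbox[of a b] unfolding boxeq by (cases z) (auto simp: indicator_def split: if_splits)
        ultimately show "(\<lambda>n. ?g n z) \<longlonglongrightarrow> indicator (box p q) z * D z" by (simp only:)
      qed
      show "AE z in lborel. norm (?g n z) \<le> \<bar>indicator (cbox p q) z * D z\<bar>" for n
      proof (rule AE_I2)
        fix z
        have "\<bar>indicator (box a b) (fst z) * box_approx s t n (snd z)\<bar> \<le> 1"
          using box_approx_bounds[of s t n "snd z"] by (auto simp: indicator_def)
        then show "norm (?g n z) \<le> \<bar>indicator (cbox p q) z * D z\<bar>"
          unfolding real_norm_def abs_mult[of "indicator (cbox p q) z * D z"] by (intro mult_left_le) auto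
      qed
      show "(\<lambda>z. indicator (box p q) z * D z) \<in> borel_measurable lborel"
      proof -
        have "(\<lambda>z. indicator (box p q) z * (indicator (cbox p q) z * D z)) \<in> borel_measurable borel"
          by (rule borel_measurable_times[OF _ m1]) auto
        moreover have "(\<lambda>z. indicator (box p q) z * (indicator (cbox p q) z * D z)) = (\<lambda>z. indicator (box p q) z * D z)"
          using box_subset_cbox[of p q] by (auto simp: indicator_def fun_eq_iff)
        ultimately show ?thesis by (simp only: measurable_lborel2)
      qed
      show "?g n \<in> borel_measurable lborel" for n
        unfolding measurable_lborel2 by (rule borel_measurable_times[OF m1 m2])
      show "integrable lborel (\<lambda>z. \<bar>indicator (cbox p q) z * D z\<bar>)"
        using i by (simp add: set_integrable_def)
    qed
    moreover have "(LINT z|lborel. ?g n z) = (LINT z:cylinder \<Omega> T|lborel. D z * (indicator (box a b) (fst z) * box_approx s t n (snd z)))" for n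
    proof -
      have "?g n z = indicator (cylinder \<Omega> T) z *\<^sub>R (D z * (indicator (box a b) (fst z) * box_approx s t n (snd z)))" for z
      proof (cases "z \<in> cbox p q")
        case True
        then have "z \<in> cylinder \<Omega> T" using sub by blast
        then show ?thesis using True by simp
      next
        case False
        then have "fst z \<notin> box a b \<or> snd z \<notin> cbox s t"
          using box_subset_cbox[of a b] unfolding boxeq by (cases z) auto
        then have "indicator (box a b) (fst z) * box_approx s t n (snd z) = 0" using cs by fastforce
        then show ?thesis by simp
      qed
      then show ?thesis unfolding set_lebesgue_integral_def
        by (rule Bochner_Integration.integral_cong[OF refl])
    qed
    ultimately show ?thesis using test[OF s ne(2)]
      by (simp add: LIMSEQ_const_iff set_lebesgue_integral_def)
  qed (simp add: set_lebesgue_integral_def)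
qed

section \<open>Slices of functions on the cylinder, iterated integrals and tensor products\<close>

lemma L2_slices:
  assumes "v \<in> L2 (cylinder \<Omega> T)"
  shows "AE t in lborel. t \<in> {0<..<T} \<longrightarrow> (\<lambda>x. v (x, t)) \<in> L2 \<Omega>"
    and "AE x in lborel. x \<in> \<Omega> \<longrightarrow> (\<lambda>t. v (x, t)) \<in> L2 {0<..<T}"
proof -
  have s: "sqint (\<lambda>z. indicator (cylinder \<Omega> T) z * v z)" using assms by (simp add: L2_iff_sqint)
  show "AE t in lborel. t \<in> {0<..<T} \<longrightarrow> (\<lambda>x. v (x, t)) \<in> L2 \<Omega>"
    using sqint_slices(2)[OF s] by eventually_elim (auto simp: L2_iff_sqint cylinder_indicator)
  show "AE x in lborel. x \<in> \<Omega> \<longrightarrow> (\<lambda>t. v (x, t)) \<in> L2 {0<..<T}"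
    using sqint_slices(1)[OF s] by eventually_elim (auto simp: L2_iff_sqint cylinder_indicator)
qed

lemma set_integral_cylinder_fst:
  fixes g :: "'a::euclidean_space \<times> real \<Rightarrow> real"
  assumes "set_integrable lborel (cylinder \<Omega> T) g"
  shows "(LINT z:cylinder \<Omega> T|lborel. g z) = (LINT x:\<Omega>|lborel. LINT t:{0<..<T}|lborel. g (x, t))"
  using iterated_integral_fst[OF assms[unfolded set_integrable_def]]
  by (simp add: set_lebesgue_integral_def cylinder_indicator mult.assoc)

lemma set_integral_cylinder_snd:
  fixes g :: "'a::euclidean_space \<times> real \<Rightarrow> real"
  assumes "set_integrable lborel (cylinder \<Omega> T) g"
  shows "(LINT z:cylinder \<Omega> T|lborel. g z) = (LINT t:{0<..<T}|lborel. LINT x:\<Omega>|lborel. g (x, t))"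
proof -
  have "(LINT x|lborel. indicator (cylinder \<Omega> T) (x, t) *\<^sub>R g (x, t)) =
      indicator {0<..<T} t *\<^sub>R (LINT x|lborel. indicator \<Omega> x *\<^sub>R g (x, t))" for t
    by (cases "t \<in> {0<..<T}") (simp_all add: cylinder_indicator)
  then show ?thesis
    using iterated_integral_snd[OF assms[unfolded set_integrable_def]]
    by (simp add: set_lebesgue_integral_def)
qed

lemma sqint_tensor:
  fixes A :: "'a::euclidean_space \<Rightarrow> real" and g :: "'b::euclidean_space \<Rightarrow> real"
  assumes "sqint A" "sqint g"
  shows "sqint (\<lambda>z. A (fst z) * g (snd z))"
proof -
  have [measurable]: "A \<in> borel_measurable borel" "g \<in> borel_measurable borel"
    using assms by (auto simp: sqint_def)
  have "(\<lambda>z. A (fst z) * g (snd z)) \<in> borel_measurable (borel \<Otimes>\<^sub>M borel)" by measurable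
  moreover have "integrable lborel (\<lambda>z :: 'a \<times> 'b. (A (fst z))\<^sup>2 * (g (snd z))\<^sup>2)"
    using assms by (intro integrable_product) (auto simp: sqint_def)
  ultimately show ?thesis
    unfolding sqint_def power_mult_distrib borel_prod by simp
qed

lemma L2_tensor:
  assumes "A \<in> L2 \<Omega>" "g \<in> L2 {0<..<T}"
  shows "(\<lambda>z. A (fst z) * g (snd z)) \<in> L2 (cylinder \<Omega> T)"
proof -
  have "sqint (\<lambda>z. (indicator \<Omega> (fst z) * A (fst z)) * (indicator {0<..<T} (snd z) * g (snd z)))"
    using assms by (intro sqint_tensor[of "\<lambda>x. indicator \<Omega> x * A x" "\<lambda>t. indicator {0<..<T} t * g t"])
      (auto simp: L2_iff_sqint)
  then show ?thesis unfolding L2_iff_sqint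
    by (rule back_subst[of sqint]) (auto simp: indicator_def fun_eq_iff)
qed

text \<open>The exceptional set of points x depends on the test function. For one fixed test
  function it disappears after integration over a box in space; only then do the test functions
  vary, and countability enters through the covering by boxes alone.\<close>

lemma weak_time_derivative_unique:
  assumes "open \<Omega>" "w1 \<in> L2 (cylinder \<Omega> T)" "w2 \<in> L2 (cylinder \<Omega> T)"
    "weak_time_derivative \<Omega> T v w1" "weak_time_derivative \<Omega> T v w2"
  shows "AE z in lborel. z \<in> cylinder \<Omega> T \<longrightarrow> w1 z = w2 z"
proof -
  let ?D = "\<lambda>z. w1 z - w2 z"
  have D: "?D \<in> L2 (cylinder \<Omega> T)" by (rule L2_diff[OF assms(2,3)])
  have "AE z in lborel. z \<in> cylinder \<Omega> T \<longrightarrow> ?D z = 0"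
  proof (rule AE_zero_on_cylinder[OF assms(1) D])
    fix a b :: 'a and s t n assume h: "cbox a b \<subseteq> \<Omega>" "{s..t} \<subseteq> {0<..<T}" "s < t"
    let ?A = "indicator (box a b) :: 'a \<Rightarrow> real" and ?g = "box_approx s t n"
    have g: "?g \<in> test_functions {0<..<T}" using h(2) by (intro box_approx_test) simp
    have gL: "?g \<in> L2 {0<..<T}" by (rule test_functions_L2[OF g]) simp
    have A: "?A \<in> L2 \<Omega>"
      unfolding L2_iff_sqint
      by (rule back_subst[of sqint, OF sqint_bounded_support[where f = ?A and B = 1 and S = "box a b"]])
        (use h(1) box_subset_cbox[of a b] in \<open>auto simp: indicator_def fun_eq_iff\<close>)
    have "(LINT z:cylinder \<Omega> T|lborel. ?D z * (?A (fst z) * ?g (snd z))) =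
       (LINT x:\<Omega>|lborel. LINT t:{0<..<T}|lborel. ?D (x, t) * (?A x * ?g t))"
      using set_integral_cylinder_fst[OF L2_mult[OF D L2_tensor[OF A gL]]] by simp
    also have "\<dots> = (LINT x:\<Omega>|lborel. 0)"
    proof -
      have "AE x in lborel. x \<in> \<Omega> \<longrightarrow> (LINT t:{0<..<T}|lborel. ?D (x, t) * (?A x * ?g t)) = 0"
        using assms(4,5)[unfolded weak_time_derivative_def, rule_format, OF g] L2_slices(2)[OF assms(2)] L2_slices(2)[OF assms(3)]
      proof eventually_elim
        case (elim x)
        show ?case
        proof
          assume x: "x \<in> \<Omega>"
          have "(LINT t:{0<..<T}|lborel. ?D (x, t) * (?A x * ?g t)) =
             (LINT t:{0<..<T}|lborel. ?A x * (w1 (x, t) * ?g t - w2 (x, t) * ?g t))"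
            by (simp add: algebra_simps)
          also have "\<dots> = ?A x * ((LINT t:{0<..<T}|lborel. w1 (x, t) * ?g t) - (LINT t:{0<..<T}|lborel. w2 (x, t) * ?g t))"
            using L2_mult[OF elim(3)[rule_format, OF x] gL] L2_mult[OF elim(4)[rule_format, OF x] gL]
            by (simp add: set_integral_diff(2))
          also have "\<dots> = 0" using elim(1,2) x by simp
          finally show "(LINT t:{0<..<T}|lborel. ?D (x, t) * (?A x * ?g t)) = 0" .
        qed
      qed
      moreover have "(\<lambda>x. indicator \<Omega> x *\<^sub>R (LINT t:{0<..<T}|lborel. ?D (x, t) * (?A x * ?g t))) \<in> borel_measurable lborel"
        using integrable_integral_fst[OF L2_mult[OF D L2_tensor[OF A gL], unfolded set_integrable_def]]
        by (simp add: cylinder_indicator set_lebesgue_integral_def mult.assoc)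
      ultimately show ?thesis unfolding set_lebesgue_integral_def
        by (intro integral_cong_AE) (auto elim!: eventually_mono simp: indicator_def)
    qed
    finally show "(LINT z:cylinder \<Omega> T|lborel. ?D z * (?A (fst z) * ?g (snd z))) = 0"
      by (simp add: set_lebesgue_integral_def)
  qed
  then show ?thesis by simp
qed

text \<open>This is all that the primitive formula takes from the trace condition: continuity of V
  at time 0, transferred to almost every slice of v.\<close>

lemma zero_initial_trace_small:
  assumes "0 < T" "\<Omega> \<in> sets borel" "zero_initial_trace \<Omega> T v" "\<epsilon> > 0"
  obtains \<eta> where "0 < \<eta>" "AE t in lborel. 0 < t \<and> t < \<eta> \<and> t < T \<longrightarrow>
    (\<exists>g\<in>L2 \<Omega>. L2_norm \<Omega> g < \<epsilon> \<and> (AE x in lborel. x \<in> \<Omega> \<longrightarrow> g x = v (x, t)))"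
proof -
  obtain V where V: "\<And>t. t \<in> {0..T} \<Longrightarrow> V t \<in> L2 \<Omega>"
    "\<And>t. t \<in> {0..T} \<Longrightarrow> ((\<lambda>s. L2_norm \<Omega> (\<lambda>x. V s x - V t x)) \<longlongrightarrow> 0) (at t within {0..T})"
    "AE t in lborel. t \<in> {0<..<T} \<longrightarrow> (AE x in lborel. x \<in> \<Omega> \<longrightarrow> V t x = v (x, t))"
    "AE x in lborel. x \<in> \<Omega> \<longrightarrow> V 0 x = 0"
    using assms(3) unfolding zero_initial_trace_def by blast
  have "\<forall>\<^sub>F s in at 0 within {0..T}. dist (L2_norm \<Omega> (\<lambda>x. V s x - V 0 x)) 0 < \<epsilon>"
    using V(2)[of 0] assms(1,4) by (intro tendstoD) auto
  then obtain \<eta> where \<eta>: "\<eta> > 0"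
    "\<And>s. s \<in> {0..T} \<Longrightarrow> s \<noteq> 0 \<Longrightarrow> dist s 0 < \<eta> \<Longrightarrow> dist (L2_norm \<Omega> (\<lambda>x. V s x - V 0 x)) 0 < \<epsilon>"
    unfolding eventually_at by blast
  have small: "L2_norm \<Omega> (V t) < \<epsilon>" if "0 < t" "t < \<eta>" "t < T" for t
  proof -
    have "L2_norm \<Omega> (\<lambda>x. V t x - V 0 x) = L2_norm \<Omega> (V t)"
      using V(1)[of t] V(1)[of 0] V(4) that assms(1)
      by (intro L2_norm_cong_AE[OF assms(2)] L2_diff) (auto elim!: eventually_mono)
    then show ?thesis using \<eta>(2)[of t] that by simp
  qed
  show thesis
  proof (rule that[OF \<eta>(1)])
    show "AE t in lborel. 0 < t \<and> t < \<eta> \<and> t < T \<longrightarrow>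
      (\<exists>g\<in>L2 \<Omega>. L2_norm \<Omega> g < \<epsilon> \<and> (AE x in lborel. x \<in> \<Omega> \<longrightarrow> g x = v (x, t)))"
      using V(3)
    proof eventually_elim
      case (elim t)
      then show ?case using small[of t] V(1)[of t] by (intro impI bexI[of _ "V t"]) auto
    qed
  qed
qed

lemma indicator_L2:
  assumes "S \<in> sets borel" "bounded S" "\<Omega> \<in> sets borel"
  shows "indicator S \<in> L2 \<Omega>"
  unfolding L2_iff_sqint
proof (rule sqint_bounded_support[where B = 1 and S = S])
  show "(\<lambda>x. indicator \<Omega> x * (indicator S x :: real)) \<in> borel_measurable borel"
    using assms by (intro borel_measurable_times) auto
qed (use assms in \<open>auto simp: indicator_def\<close>)

text \<open>For a bump \<open>\<beta>\<close> and a bump \<open>\<kappa>\<close> of the same mass near \<open>t = 0\<close>, the primitive of \<open>\<beta> - \<kappa>\<close> is a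
  test function; the vanishing trace removes the contribution of \<open>\<kappa>\<close> in the limit.\<close>

lemma weak_time_derivative_primitive:
  fixes \<Omega> :: "'a::euclidean_space set"
  assumes T: "0 < T" and \<Omega>: "open \<Omega>"
    and v: "v \<in> L2 (cylinder \<Omega> T)" and w: "w \<in> L2 (cylinder \<Omega> T)"
    and wt: "weak_time_derivative \<Omega> T v w" and zt: "zero_initial_trace \<Omega> T v"
  shows "AE z in lborel. z \<in> cylinder \<Omega> T \<longrightarrow>
    v z = time_primitive (\<lambda>z. indicator (cylinder \<Omega> T) z * w z) z"
proof -
  define w0 where "w0 = (\<lambda>z. indicator (cylinder \<Omega> T) z * w z)"
  let ?Q = "cylinder \<Omega> T" and ?I = "{0<..<T}"
  have \<Omega>s: "\<Omega> \<in> sets borel" using \<Omega> by auto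
  have w0: "sqint w0" using w by (simp add: L2_iff_sqint w0_def)
  interpret supported_in_time T w0
    by standard (use T w0 in \<open>auto simp: w0_def indicator_def\<close>)
  let ?W = "time_primitive w0"
  have WL: "?W \<in> L2 ?Q" unfolding L2_iff_sqint by (rule time_primitive_sqint[OF \<Omega>s])
  have D: "(\<lambda>z. v z - ?W z) \<in> L2 ?Q" by (rule L2_diff[OF v WL])
  have "AE z in lborel. z \<in> ?Q \<longrightarrow> v z - ?W z = 0"
  proof (rule AE_zero_on_cylinder[OF \<Omega> D])
    fix a b :: 'a and s t n assume h: "cbox a b \<subseteq> \<Omega>" "{s..t} \<subseteq> ?I" "s < t"
    define A where "A = (indicator (box a b) :: 'a \<Rightarrow> real)"
    define \<beta> where "\<beta> = box_approx s t n"
    have \<beta>: "\<beta> \<in> test_functions ?I" unfolding \<beta>_def using h(2) by (intro box_approx_test) simp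
    have \<beta>i: "integrable lborel \<beta>" by (rule test_functions_integrable[OF \<beta>])
    have \<beta>0: "0 \<le> \<beta> r" for r unfolding \<beta>_def by (rule box_approx_bounds)
    have A: "A \<in> L2 \<Omega>" unfolding A_def by (rule indicator_L2[OF _ _ \<Omega>s]) auto
    have A01: "0 \<le> A x" "A x \<le> 1" "\<bar>A x\<bar> \<le> 1" for x by (auto simp: A_def indicator_def)
    have [measurable]: "A \<in> borel_measurable borel" unfolding A_def by measurable
    have testL2: "g \<in> L2 ?I" if "g \<in> test_functions ?I" for g by (rule test_functions_L2[OF that]) simp
    have tens: "(\<lambda>z. A (fst z) * g (snd z)) \<in> L2 ?Q" if "g \<in> test_functions ?I" for g
      by (rule L2_tensor[OF A testL2[OF that]])
    define c where "c = (LINT r|lborel. \<beta> r)"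
    have c0: "0 \<le> c" unfolding c_def using \<beta>0 by simp
    \<comment> \<open>The shift by 2 keeps \<open>e k\<close> strictly below T for every k; the bump
      will live on the interval from \<open>e k / 2\<close> to \<open>e k\<close>.\<close>
    define e where "e k = T / real (k + 2)" for k
    have e: "0 < e k" "e k < T" for k
    proof -
      have "T * 1 < T * real (k + 2)" using T by (intro mult_strict_left_mono) auto
      then show "e k < T" unfolding e_def by (subst pos_divide_less_eq) simp_all
    qed (use T in \<open>simp add: e_def\<close>)
    have e_lim: "e \<longlonglongrightarrow> 0" unfolding e_def
      using LIMSEQ_ignore_initial_segment[OF lim_const_over_n[of T], of 2] by simp
    define \<rho> where "\<rho> k = box_bump (e k / 2) (e k)" for k
    have \<rho>: "\<rho> k \<in> test_functions ?I" for k unfolding \<rho>_def using e[of k] by (intro box_bump_test) auto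
    have \<rho>i: "integrable lborel (\<rho> k)" for k by (rule test_functions_integrable[OF \<rho>])
    have \<rho>0: "0 \<le> \<rho> k r" for k r unfolding \<rho>_def by (rule box_bump_nonneg)
    have \<rho>z: "\<rho> k r = 0" if "r \<notin> {e k / 2<..<e k}" for k r
      using that by (simp add: \<rho>_def box_bump_eq_0)
    have mpos: "0 < (LINT r|lborel. \<rho> k r)" for k
    proof -
      have "(LINT r|lborel. \<rho> k r) \<noteq> 0"
      proof
        assume "(LINT r|lborel. \<rho> k r) = 0"
        then have "AE r in lborel. \<rho> k r = 0"
          using integral_nonneg_eq_0_iff_AE[OF \<rho>i] \<rho>0 by auto
        then have "AE r in lborel. r \<notin> {e k / 2<..<e k}"
          by eventually_elim (auto simp: \<rho>_def box_bump_eq_0)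
        then have "emeasure lborel {e k / 2<..<e k} = 0"
          using AE_iff_null_sets[of "{e k / 2<..<e k}" lborel] by auto
        then show False using e(1)[of k] by simp
      qed
      moreover have "0 \<le> (LINT r|lborel. \<rho> k r)" using \<rho>0 by simp
      ultimately show ?thesis by linarith
    qed
    \<comment> \<open>Scaled to the mass c of \<beta>, so that the difference \<beta> - \<kappa> k
      has integral 0 and its primitive is a test function.\<close>
    define \<kappa> where "\<kappa> k r = c / (LINT r|lborel. \<rho> k r) * \<rho> k r" for k r
    have \<kappa>i: "integrable lborel (\<kappa> k)" for k unfolding \<kappa>_def using \<rho>i by simp
    have \<kappa>tot: "(LINT r|lborel. \<kappa> k r) = c" for k unfolding \<kappa>_def using mpos[of k] by simp
    have \<kappa>0: "0 \<le> \<kappa> k r" for k r unfolding \<kappa>_def using mpos[of k] \<rho>0 c0 by simp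
    have \<kappa>z: "\<kappa> k r = 0" if "r \<notin> {e k / 2<..<e k}" for k r using that by (simp add: \<kappa>_def \<rho>z)
    define g where "g k r = \<beta> r - \<kappa> k r" for k r
    have g: "g k \<in> test_functions ?I" for k
    proof -
      obtain K1 where K1: "Cinf_on UNIV \<beta>" "compact K1" "K1 \<subseteq> ?I" "\<And>r. r \<notin> K1 \<Longrightarrow> \<beta> r = 0"
        using \<beta> unfolding test_functions_def by auto
      obtain K2 where K2: "Cinf_on UNIV (\<rho> k)" "compact K2" "K2 \<subseteq> ?I" "\<And>r. r \<notin> K2 \<Longrightarrow> \<rho> k r = 0"
        using \<rho>[of k] unfolding test_functions_def by auto
      have "Cinf_on UNIV (g k)"
        using K1(1) K2(1) unfolding Cinf_on_smooth_upto g_def[abs_def] \<kappa>_def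
        by (intro allI smooth_upto_diff smooth_upto_mult smooth_upto_const open_UNIV) auto
      moreover have "compact (K1 \<union> K2)" "K1 \<union> K2 \<subseteq> ?I" "\<And>r. r \<notin> K1 \<union> K2 \<Longrightarrow> g k r = 0"
        using K1 K2 by (auto simp: g_def \<kappa>_def)
      ultimately show ?thesis unfolding test_functions_def by blast
    qed
    have gtot: "(LINT r|lborel. g k r) = 0" for k
      unfolding g_def using \<beta>i \<kappa>i \<kappa>tot by (simp add: c_def)
    define \<phi> where "\<phi> k t = (LINT r|lborel. indicator {..t} r * g k r)" for k t
    have \<phi>: "\<phi> k \<in> test_functions ?I" "deriv (\<phi> k) = g k" for k
      using primitive_test_function[OF g gtot, of k] by (auto simp: \<phi>_def[abs_def])
    have \<kappa>L: "\<kappa> k \<in> L2 ?I" for k unfolding \<kappa>_def[abs_def] by (intro L2_cmult testL2 \<rho>)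
    have tens\<kappa>: "(\<lambda>z. A (fst z) * \<kappa> k (snd z)) \<in> L2 ?Q" for k by (rule L2_tensor[OF A \<kappa>L])

    \<comment> \<open>The weak derivative is tested with \<phi> k, whose derivative is \<beta> -
      \<kappa> k, and then integrated over the box in space.\<close>
    have eq: "(LINT z:?Q|lborel. v z * (A (fst z) * \<beta> (snd z))) - (LINT z:?Q|lborel. v z * (A (fst z) * \<kappa> k (snd z)))
        = - (LINT z:?Q|lborel. w z * (A (fst z) * \<phi> k (snd z)))" for k
    proof -
      have eq1: "(LINT z:?Q|lborel. v z * (A (fst z) * \<beta> (snd z))) - (LINT z:?Q|lborel. v z * (A (fst z) * \<kappa> k (snd z)))
        = (LINT z:?Q|lborel. v z * (A (fst z) * g k (snd z)))"
        using set_integral_diff(2)[OF L2_mult[OF v tens[OF \<beta>]] L2_mult[OF v tens\<kappa>[of k]]]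
        by (simp add: g_def right_diff_distrib)
      have "(LINT z:?Q|lborel. v z * (A (fst z) * g k (snd z))) + (LINT z:?Q|lborel. w z * (A (fst z) * \<phi> k (snd z)))
        = (LINT z:?Q|lborel. v z * (A (fst z) * g k (snd z)) + w z * (A (fst z) * \<phi> k (snd z)))"
        by (rule set_integral_add(2)[OF L2_mult[OF v tens[OF g[of k]]] L2_mult[OF w tens[OF \<phi>(1)[of k]]], symmetric])
      also have "\<dots> = (LINT x:\<Omega>|lborel. LINT t:?I|lborel. v (x, t) * (A x * g k t) + w (x, t) * (A x * \<phi> k t))"
        using set_integral_cylinder_fst[OF set_integral_add(1)[OF L2_mult[OF v tens[OF g[of k]]] L2_mult[OF w tens[OF \<phi>(1)[of k]]]]]
        by simp
      also have "\<dots> = (LINT x|(lborel :: 'a measure). 0)"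
        unfolding set_lebesgue_integral_def[of lborel \<Omega>]
      proof (rule integral_cong_AE)
        show "(\<lambda>x. indicator \<Omega> x *\<^sub>R (LINT t:?I|lborel. v (x, t) * (A x * g k t) + w (x, t) * (A x * \<phi> k t))) \<in> borel_measurable lborel"
          using integrable_integral_fst[OF set_integral_add(1)[OF L2_mult[OF v tens[OF g[of k]]] L2_mult[OF w tens[OF \<phi>(1)[of k]]], unfolded set_integrable_def]]
          by (simp add: cylinder_indicator set_lebesgue_integral_def mult.assoc)
        show "AE x in lborel. indicator \<Omega> x *\<^sub>R (LINT t:?I|lborel. v (x, t) * (A x * g k t) + w (x, t) * (A x * \<phi> k t)) = 0"
          using wt[unfolded weak_time_derivative_def, rule_format, OF \<phi>(1), of k] L2_slices(2)[OF v] L2_slices(2)[OF w]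
        proof eventually_elim
          case (elim x)
          show ?case
          proof (cases "x \<in> \<Omega>")
            case True
            have "(LINT t:?I|lborel. v (x, t) * (A x * g k t) + w (x, t) * (A x * \<phi> k t))
              = (LINT t:?I|lborel. A x * (v (x, t) * g k t + w (x, t) * \<phi> k t))"
              by (simp add: algebra_simps)
            also have "\<dots> = A x * ((LINT t:?I|lborel. v (x, t) * g k t) + (LINT t:?I|lborel. w (x, t) * \<phi> k t))"
              using L2_mult[OF elim(2)[rule_format, OF True] testL2[OF g]] L2_mult[OF elim(3)[rule_format, OF True] testL2[OF \<phi>(1)]]
              by (simp add: set_integral_add(2))
            also have "\<dots> = 0" using elim(1) True by (simp add: \<phi>(2))
            finally show ?thesis by simp
          qed simp
        qed
      qed simp
      finally have "(LINT z:?Q|lborel. v z * (A (fst z) * g k (snd z))) + (LINT z:?Q|lborel. w z * (A (fst z) * \<phi> k (snd z))) = 0"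
        by simp
      with eq1 show ?thesis by linarith
    qed

    \<comment> \<open>The mass of \<kappa> k stays equal to c while its support moves to t = 0,
      where the slices of v are small in L2.\<close>
    have lim1: "(\<lambda>k. LINT z:?Q|lborel. v z * (A (fst z) * \<kappa> k (snd z))) \<longlonglongrightarrow> 0"
    proof (rule LIMSEQ_I)
      fix r :: real assume r: "r > 0"
      \<comment> \<open>The summand 1 keeps the denominator positive when the norm of A or the mass
        c is 0.\<close>
      define \<epsilon> where "\<epsilon> = r / (2 * (L2_norm \<Omega> A * c + 1))"
      have Ac: "0 \<le> L2_norm \<Omega> A * c" using L2_norm_nonneg[of \<Omega> A] c0 by simp
      have \<epsilon>: "\<epsilon> > 0" "\<epsilon> * (L2_norm \<Omega> A * c) < r"
      proof -
        show "\<epsilon> > 0" using r Ac by (simp add: \<epsilon>_def add_nonneg_pos)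
        then have "\<epsilon> * (L2_norm \<Omega> A * c) \<le> \<epsilon> * (L2_norm \<Omega> A * c + 1)" by (intro mult_left_mono) auto
        also have "\<dots> = r / 2"
        proof -
          have "L2_norm \<Omega> A * c + 1 \<noteq> 0" using Ac by linarith
          moreover have "r / (2 * X) * X = r / 2" if "X \<noteq> 0" for X :: real using that by simp
          ultimately show ?thesis unfolding \<epsilon>_def by blast
        qed
        also have "\<dots> < r" using r by simp
        finally show "\<epsilon> * (L2_norm \<Omega> A * c) < r" .
      qed
      obtain \<eta> where \<eta>: "0 < \<eta>" "AE t in lborel. 0 < t \<and> t < \<eta> \<and> t < T \<longrightarrow>
        (\<exists>g\<in>L2 \<Omega>. L2_norm \<Omega> g < \<epsilon> \<and> (AE x in lborel. x \<in> \<Omega> \<longrightarrow> g x = v (x, t)))"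
        using zero_initial_trace_small[OF T \<Omega>s zt \<epsilon>(1)] by blast
      obtain N where N: "\<And>k. k \<ge> N \<Longrightarrow> e k < \<eta>"
        using LIMSEQ_D[OF e_lim \<eta>(1)] e(1) by (metis abs_of_pos diff_zero real_norm_def)
      have "norm ((LINT z:?Q|lborel. v z * (A (fst z) * \<kappa> k (snd z))) - 0) < r" if k: "k \<ge> N" for k
      proof -
        let ?G = "\<lambda>t. LINT x:\<Omega>|lborel. v (x, t) * (A x * \<kappa> k t)"
        note si = L2_mult[OF v tens\<kappa>[of k]]
        have Geq: "(LINT z:?Q|lborel. v z * (A (fst z) * \<kappa> k (snd z))) = (LINT t:?I|lborel. ?G t)"
          using set_integral_cylinder_snd[OF si] by simp
        have "AE t in lborel. \<bar>indicator ?I t *\<^sub>R ?G t\<bar> \<le> (\<epsilon> * L2_norm \<Omega> A) * \<kappa> k t"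
          using \<eta>(2) L2_slices(1)[OF v]
        proof eventually_elim
          case (elim t)
          show ?case
          proof (cases "t \<in> ?I \<and> t \<in> {e k / 2<..<e k}")
            case True
            then have "0 < t" "t < \<eta>" "t < T" "t \<in> ?I" using N[OF k] by auto
            then obtain q where q: "q \<in> L2 \<Omega>" "L2_norm \<Omega> q < \<epsilon>" "AE x in lborel. x \<in> \<Omega> \<longrightarrow> q x = v (x, t)"
              using elim(1) by blast
            have vt: "(\<lambda>x. v (x, t)) \<in> L2 \<Omega>" using elim(2) \<open>t \<in> ?I\<close> by blast
            have "?G t = \<kappa> k t * (LINT x:\<Omega>|lborel. v (x, t) * A x)"
              by (simp add: set_integral_mult_right[symmetric] ac_simps)
            moreover have "\<bar>LINT x:\<Omega>|lborel. v (x, t) * A x\<bar> \<le> L2_norm \<Omega> (\<lambda>x. v (x, t)) * L2_norm \<Omega> A"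
              by (rule L2_Cauchy_Schwarz[OF vt A])
            moreover have "L2_norm \<Omega> (\<lambda>x. v (x, t)) = L2_norm \<Omega> q"
              by (rule L2_norm_cong_AE[OF \<Omega>s vt q(1)]) (use q(3) in \<open>auto elim: eventually_mono\<close>)
            ultimately have "\<bar>?G t\<bar> \<le> \<kappa> k t * (\<epsilon> * L2_norm \<Omega> A)"
              using q(2) \<kappa>0[of k t] L2_norm_nonneg[of \<Omega> A]
              by (auto simp: abs_mult intro!: mult_left_mono elim!: order_trans intro: mult_right_mono)
            then show ?thesis using \<open>t \<in> ?I\<close> by (simp add: mult.commute)
          next
            case False
            then show ?thesis using \<kappa>z[of t k] \<epsilon>(1) L2_norm_nonneg[of \<Omega> A] \<kappa>0[of k t]
              by (auto simp: set_lebesgue_integral_def)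
          qed
        qed
        then have "\<bar>LINT t:?I|lborel. ?G t\<bar> \<le> (LINT t|lborel. (\<epsilon> * L2_norm \<Omega> A) * \<kappa> k t)"
          unfolding set_lebesgue_integral_def[of lborel ?I]
          using integrable_integral_snd[OF si[unfolded set_integrable_def]] \<kappa>i
          by (intro order_trans[OF integral_abs_bound] integral_mono_AE')
            (auto simp: cylinder_indicator)
        also have "\<dots> = \<epsilon> * (L2_norm \<Omega> A * c)" by (simp add: \<kappa>tot)
        finally show ?thesis using \<epsilon>(2) Geq by simp
      qed
      then show "\<exists>N. \<forall>k\<ge>N. norm ((LINT z:?Q|lborel. v z * (A (fst z) * \<kappa> k (snd z))) - 0) < r" by blast
    qed

    define B where "B t = (LINT r|lborel. indicator {..t} r * \<beta> r)" for t
    have prim_bound: "\<bar>LINT r|lborel. indicator {..t} r * h r\<bar> \<le> (LINT r|lborel. h r)"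
      if "integrable lborel h" "\<And>r. 0 \<le> h r" for h :: "real \<Rightarrow> real" and t
    proof -
      have i: "integrable lborel (\<lambda>r. indicator {..t} r * h r)"
        using integrable_mult_indicator[of "{..t}" lborel h] that(1) by simp
      have "0 \<le> (LINT r|lborel. indicator {..t} r * h r)" using that(2) by simp
      moreover have "(LINT r|lborel. indicator {..t} r * h r) \<le> (LINT r|lborel. h r)"
        using that i by (intro integral_mono) (auto simp: indicator_def)
      ultimately show ?thesis by simp
    qed
    have \<phi>eq: "\<phi> k t = B t - (LINT r|lborel. indicator {..t} r * \<kappa> k r)" for k t
    proof -
      have i: "integrable lborel (\<lambda>r. indicator {..t} r * h r)" if "integrable lborel h" for h :: "real \<Rightarrow> real"
        using integrable_mult_indicator[of "{..t}" lborel h] that by simp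
      show ?thesis unfolding \<phi>_def B_def g_def right_diff_distrib using i[OF \<beta>i] i[OF \<kappa>i]
        by simp
    qed
    have lim2: "(\<lambda>k. LINT z:?Q|lborel. w z * (A (fst z) * \<phi> k (snd z)))
      \<longlonglongrightarrow> (LINT z|lborel. w0 z * (A (fst z) * (B (snd z) - c)))"
    proof -
      have e1: "(LINT z:?Q|lborel. w z * (A (fst z) * \<phi> k (snd z))) = (LINT z|lborel. w0 z * (A (fst z) * \<phi> k (snd z)))" for k
        unfolding set_lebesgue_integral_def w0_def by (simp add: mult.assoc)
      have m1: "(\<lambda>z. w0 z * (A (fst z) * \<phi> k (snd z))) \<in> borel_measurable borel" for k
        using borel_measurable_integrable[OF L2_mult[OF w tens[OF \<phi>(1)[of k]], unfolded set_integrable_def]]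
        by (simp add: w0_def mult.assoc)
      have lim: "(\<lambda>k. w0 z * (A (fst z) * \<phi> k (snd z))) \<longlonglongrightarrow> w0 z * (A (fst z) * (B (snd z) - c))" for z
      proof (cases "snd z \<in> ?I")
        case True
        have "\<forall>\<^sub>F k in sequentially. e k < snd z"
          using e_lim True by (intro order_tendstoD(2)[OF e_lim]) auto
        then have "\<forall>\<^sub>F k in sequentially. \<phi> k (snd z) = B (snd z) - c"
        \<comment> \<open>Past the support of \<kappa> k its primitive has reached the full mass c,
          so \<phi> k already equals its limit there.\<close>
        proof eventually_elim
          case (elim k)
          then have "(\<lambda>r. indicator {..snd z} r * \<kappa> k r) = \<kappa> k"
            using \<kappa>z[of _ k] by (fastforce simp: indicator_def fun_eq_iff)
          then show ?case using \<phi>eq[of k "snd z"] \<kappa>tot[of k] by simp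
        qed
        then show ?thesis
          by (intro tendsto_intros tendsto_eventually)
      next
        case False
        then have "w0 z = 0" using support[of "snd z" "fst z"] by simp
        then show ?thesis by simp
      qed
      \<comment> \<open>Both primitives, of \<beta> and of \<kappa> k, take values between 0 and
        c.\<close>
      have bd: "\<bar>\<phi> k t\<bar> \<le> 2 * c" for k t
        using prim_bound[OF \<beta>i \<beta>0, of t] prim_bound[OF \<kappa>i \<kappa>0, of t k] \<kappa>tot[of k]
        unfolding \<phi>eq B_def c_def[symmetric] by linarith
      have iA: "integrable lborel (\<lambda>z. w0 z * (A (fst z) * (indicator ?I (snd z) * (2 * c))))"
      proof -
        have "(\<lambda>t. indicator ?I t * (2 * c)) \<in> L2 ?I"
          using L2_cmult[OF indicator_L2[of ?I ?I], of "2 * c"] by (simp add: mult.commute)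
        from L2_mult[OF w L2_tensor[OF A this]] show ?thesis
          by (simp add: set_integrable_def w0_def mult.assoc)
      qed
      show ?thesis unfolding e1
      proof (rule integral_dominated_convergence[where w = "\<lambda>z. \<bar>w0 z * (A (fst z) * (indicator ?I (snd z) * (2 * c)))\<bar>"])
        show "(\<lambda>z. w0 z * (A (fst z) * (B (snd z) - c))) \<in> borel_measurable lborel"
          unfolding measurable_lborel2 by (rule borel_measurable_LIMSEQ_real[OF lim m1])
        show "AE z in lborel. norm (w0 z * (A (fst z) * \<phi> k (snd z)))
          \<le> \<bar>w0 z * (A (fst z) * (indicator ?I (snd z) * (2 * c)))\<bar>" for k
        proof (rule AE_I2)
          fix z
          show "norm (w0 z * (A (fst z) * \<phi> k (snd z))) \<le> \<bar>w0 z * (A (fst z) * (indicator ?I (snd z) * (2 * c)))\<bar>"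
          proof (cases "snd z \<in> ?I")
            case True
            then show ?thesis using bd[of k "snd z"] c0
              by (auto simp: abs_mult intro!: mult_left_mono)
          next
            case False
            then show ?thesis using support[of "snd z" "fst z"] by simp
          qed
        qed
      qed (use lim m1 iA in auto)
    qed

    have final: "(LINT z:?Q|lborel. v z * (A (fst z) * \<beta> (snd z))) = (LINT z|lborel. w0 z * (A (fst z) * (c - B (snd z))))"
    proof -
      have "(\<lambda>k. (LINT z:?Q|lborel. v z * (A (fst z) * \<beta> (snd z))) - (LINT z:?Q|lborel. v z * (A (fst z) * \<kappa> k (snd z))))
         \<longlonglongrightarrow> (LINT z:?Q|lborel. v z * (A (fst z) * \<beta> (snd z))) - 0"
        by (intro tendsto_intros lim1)
      moreover have "(\<lambda>k. - (LINT z:?Q|lborel. w z * (A (fst z) * \<phi> k (snd z))))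
         \<longlonglongrightarrow> - (LINT z|lborel. w0 z * (A (fst z) * (B (snd z) - c)))"
        by (intro tendsto_intros lim2)
      ultimately have "(LINT z:?Q|lborel. v z * (A (fst z) * \<beta> (snd z))) = - (LINT z|lborel. w0 z * (A (fst z) * (B (snd z) - c)))"
        unfolding eq using LIMSEQ_unique by fastforce
      then show ?thesis
        by (simp add: integral_minus[symmetric] algebra_simps del: integral_minus)
    qed

    have Bm: "B \<in> borel_measurable borel"
    proof (rule borel_measurable_mono, rule monoI)
      fix t t' :: real assume "t \<le> t'"
      then show "B t \<le> B t'" unfolding B_def
        using integrable_mult_indicator[of "{..t}" lborel \<beta>] integrable_mult_indicator[of "{..t'}" lborel \<beta>] \<beta>i \<beta>0
        by (intro integral_mono) (auto simp: indicator_def)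
    qed
    have iR: "integrable lborel (\<lambda>z. w0 z * (A (fst z) * (c - B (snd z))))"
    proof -
      have "(\<lambda>t. c - B t) \<in> L2 ?I"
        by (rule L2_bounded[where B = "2 * c"])
          (use Bm prim_bound[OF \<beta>i \<beta>0] c0 in \<open>auto simp: set_borel_measurable_def B_def[symmetric] c_def[symmetric] abs_le_iff
             intro!: borel_measurable_times borel_measurable_diff\<close>)
      from L2_mult[OF w L2_tensor[OF A this]] show ?thesis
        by (simp add: set_integrable_def w0_def mult.assoc)
    qed
    \<comment> \<open>Fubini on the triangle where the first time precedes the second: c - B t is
      the integral of \<beta> over the times after t.\<close>
    have inner: "(LINT r|lborel. w0 (x, r) * (c - B r)) = (LINT r:?I|lborel. ?W (x, r) * \<beta> r)"
      if ix: "integrable lborel (\<lambda>t. w0 (x, t))" for x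
    proof -
      let ?h = "\<lambda>z. (if fst z < snd z then w0 (x, fst z) * \<beta> (snd z) else 0)"
      have [measurable]: "\<beta> \<in> borel_measurable borel" by (rule test_functions_measurable[OF \<beta>])
      have "(\<lambda>z. indicator {z. fst z < snd z} z * (w0 (x, fst z) * \<beta> (snd z))) \<in> borel_measurable borel"
      proof (rule borel_measurable_times)
        show "(\<lambda>z. w0 (x, fst z) * \<beta> (snd z)) \<in> borel_measurable borel"
          using borel_measurable_integrable[OF integrable_product[OF ix \<beta>i]] by simp
        show "indicator {z :: real \<times> real. fst z < snd z} \<in> borel_measurable borel"
          by (intro borel_measurable_indicator borel_open open_Collect_less continuous_intros)
      qed
      moreover have "(\<lambda>z. indicator {z. fst z < snd z} z * (w0 (x, fst z) * \<beta> (snd z))) = ?h"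
        by (auto simp: fun_eq_iff)
      ultimately have hm: "?h \<in> borel_measurable borel" by simp
      have h: "integrable lborel ?h"
        by (rule Bochner_Integration.integrable_bound[OF integrable_product[OF ix \<beta>i]])
          (use hm in auto)
      have "(LINT r|lborel. ?h (t, r)) = w0 (x, t) * (c - B t)" for t
      proof -
        have i: "integrable lborel (\<lambda>r. indicator {..t} r * \<beta> r)"
          using integrable_mult_indicator[of "{..t}" lborel \<beta>] \<beta>i by simp
        have "c - B t = (LINT r|lborel. \<beta> r - indicator {..t} r * \<beta> r)"
          unfolding c_def B_def using \<beta>i i by simp
        then have "w0 (x, t) * (c - B t) = (LINT r|lborel. w0 (x, t) * (\<beta> r - indicator {..t} r * \<beta> r))"
          by simp
        also have "\<dots> = (LINT r|lborel. ?h (t, r))"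
          by (intro Bochner_Integration.integral_cong) (auto simp: indicator_def)
        finally show ?thesis by simp
      qed
      then have "(LINT r|lborel. w0 (x, r) * (c - B r)) = (LINT r|lborel. LINT t|lborel. ?h (t, r))"
        using iterated_integral_fst[OF h] iterated_integral_snd[OF h] by simp
      also have "\<dots> = (LINT r|lborel. ?W (x, r) * \<beta> r)"
        unfolding time_primitive_def
        by (intro Bochner_Integration.integral_cong)
          (auto simp: integral_mult_left_zero[symmetric] if_distrib simp del: integral_mult_left_zero intro!: Bochner_Integration.integral_cong)
      also have "\<dots> = (LINT r:?I|lborel. ?W (x, r) * \<beta> r)"
        unfolding set_lebesgue_integral_def using test_functions_zero[OF \<beta>]
        by (intro Bochner_Integration.integral_cong) (auto simp: indicator_def)
      finally show ?thesis .
    qed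
    have "(LINT z|lborel. w0 z * (A (fst z) * (c - B (snd z)))) = (LINT x|lborel. LINT r|lborel. w0 (x, r) * (A x * (c - B r)))"
      using iterated_integral_fst[OF iR] by simp
    also have "\<dots> = (LINT x:\<Omega>|lborel. LINT r:?I|lborel. ?W (x, r) * (A x * \<beta> r))"
      unfolding set_lebesgue_integral_def[of lborel \<Omega>]
    proof (rule integral_cong_AE)
      show "(\<lambda>x. LINT r|lborel. w0 (x, r) * (A x * (c - B r))) \<in> borel_measurable lborel"
        using integrable_integral_fst[OF iR] by simp
      show "(\<lambda>x. indicator \<Omega> x *\<^sub>R (LINT r:?I|lborel. ?W (x, r) * (A x * \<beta> r))) \<in> borel_measurable lborel"
        using integrable_integral_fst[OF L2_mult[OF WL tens[OF \<beta>], unfolded set_integrable_def]]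
        by (simp add: cylinder_indicator set_lebesgue_integral_def mult.assoc)
      show "AE x in lborel. (LINT r|lborel. w0 (x, r) * (A x * (c - B r))) =
         indicator \<Omega> x *\<^sub>R (LINT r:?I|lborel. ?W (x, r) * (A x * \<beta> r))"
        using slices_integrable
      proof eventually_elim
        case (elim x)
        have "(LINT r|lborel. w0 (x, r) * (A x * (c - B r))) = A x * (LINT r|lborel. w0 (x, r) * (c - B r))"
          by (simp add: mult.left_commute integral_mult_right_zero[symmetric] del: integral_mult_right_zero)
        also have "\<dots> = A x * (LINT r:?I|lborel. ?W (x, r) * \<beta> r)" using inner[OF elim] by simp
        also have "\<dots> = (LINT r:?I|lborel. ?W (x, r) * (A x * \<beta> r))"
          by (simp add: mult.left_commute set_integral_mult_right[symmetric] del: set_integral_mult_right)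
        finally have 1: "(LINT r|lborel. w0 (x, r) * (A x * (c - B r))) = (LINT r:?I|lborel. ?W (x, r) * (A x * \<beta> r))" .
        show ?case
        proof (cases "x \<in> \<Omega>")
          case False
          then have "A x = 0" using h(1) box_subset_cbox[of a b] by (auto simp: A_def indicator_def)
          then show ?thesis by simp
        qed (use 1 in simp)
      qed
    qed
    also have "\<dots> = (LINT z:?Q|lborel. ?W z * (A (fst z) * \<beta> (snd z)))"
      using set_integral_cylinder_fst[OF L2_mult[OF WL tens[OF \<beta>]]] by simp
    finally have "(LINT z:?Q|lborel. v z * (A (fst z) * \<beta> (snd z))) = (LINT z:?Q|lborel. ?W z * (A (fst z) * \<beta> (snd z)))"
      using final by simp
    then show "(LINT z:?Q|lborel. (v z - ?W z) * (indicator (box a b) (fst z) * box_approx s t n (snd z))) = 0"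
      unfolding A_def[symmetric] \<beta>_def[symmetric] left_diff_distrib
      using set_integral_diff(2)[OF L2_mult[OF v tens[OF \<beta>]] L2_mult[OF WL tens[OF \<beta>]]] by simp
  qed
  then show ?thesis by (simp add: w0_def)
qed

section \<open>The energy inequality\<close>

lemma L2_integral_cong_AE:
  assumes "f \<in> L2 U" "f' \<in> L2 U" "g \<in> L2 U" "AE x in lborel. x \<in> U \<longrightarrow> f x = f' x"
  shows "(LINT x:U|lborel. f x * g x) = (LINT x:U|lborel. f' x * g x)"
  unfolding set_lebesgue_integral_def
proof (rule integral_cong_AE)
  show "(\<lambda>x. indicator U x *\<^sub>R (f x * g x)) \<in> borel_measurable lborel"
    by (rule borel_measurable_integrable[OF L2_mult[OF assms(1,3), unfolded set_integrable_def]])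
  show "(\<lambda>x. indicator U x *\<^sub>R (f' x * g x)) \<in> borel_measurable lborel"
    by (rule borel_measurable_integrable[OF L2_mult[OF assms(2,3), unfolded set_integrable_def]])
  show "AE x in lborel. indicator U x *\<^sub>R (f x * g x) = indicator U x *\<^sub>R (f' x * g x)"
    using assms(4) by eventually_elim (auto simp: indicator_def)
qed

text \<open>A test function approximating g may be inserted into both weak derivatives of k, where
  it yields the identity; the limit is then taken in L2. All boundary information sits in g, and U
  may be any open set.\<close>

lemma sobolev1_0_Green:
  assumes U: "open U" and b: "b \<in> Basis"
    and g: "g \<in> sobolev1_0 U" "gb \<in> L2 U" "weak_derivative U [b] g gb"
    and kb: "kb \<in> L2 U" "weak_derivative U [b] k kb"
    and kbb: "kbb \<in> L2 U" "weak_derivative U [b, b] k kbb"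
  shows "(LINT x:U|lborel. g x * kbb x) = - (LINT x:U|lborel. gb x * kb x)"
proof -
  from g(1) obtain \<phi> where \<phi>: "\<And>n. \<phi> n \<in> test_functions U" "(\<lambda>n. L2_norm U (\<lambda>x. \<phi> n x - g x)) \<longlonglongrightarrow> 0"
      "\<And>b. b \<in> Basis \<Longrightarrow> \<exists>w\<in>L2 U. weak_derivative U [b] g w \<and>
           (\<lambda>n. L2_norm U (\<lambda>x. dpartial b (\<phi> n) x - w x)) \<longlonglongrightarrow> 0"
    unfolding sobolev1_0_def by blast
  obtain w where w: "w \<in> L2 U" "weak_derivative U [b] g w" "(\<lambda>n. L2_norm U (\<lambda>x. dpartial b (\<phi> n) x - w x)) \<longlonglongrightarrow> 0"
    using \<phi>(3)[OF b] by blast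
  have gL: "g \<in> L2 U" using g(1) unfolding sobolev1_0_def sobolev_def by blast
  have \<phi>b: "dpartial b (\<phi> n) \<in> test_functions U" for n by (rule test_functions_dpartial[OF \<phi>(1) b])
  have eq: "(LINT x:U|lborel. \<phi> n x * kbb x) = - (LINT x:U|lborel. dpartial b (\<phi> n) x * kb x)" for n
  proof -
    have "(LINT x:U|lborel. k x * dpartial b (dpartial b (\<phi> n)) x) = - (LINT x:U|lborel. kb x * dpartial b (\<phi> n) x)"
      using kb(2) \<phi>b[of n] unfolding weak_derivative_def by force
    moreover have "(LINT x:U|lborel. k x * dpartial b (dpartial b (\<phi> n)) x) = (LINT x:U|lborel. kbb x * \<phi> n x)"
      using kbb(2) \<phi>(1)[of n] unfolding weak_derivative_def by force
    ultimately show ?thesis by (simp add: mult.commute)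
  qed
  have "(\<lambda>n. LINT x:U|lborel. \<phi> n x * kbb x) \<longlonglongrightarrow> (LINT x:U|lborel. g x * kbb x)"
    by (rule L2_weak_limit[OF test_functions_L2[OF \<phi>(1) U] gL kbb(1) \<phi>(2)])
  moreover have "(\<lambda>n. - (LINT x:U|lborel. dpartial b (\<phi> n) x * kb x)) \<longlonglongrightarrow> - (LINT x:U|lborel. w x * kb x)"
    by (intro tendsto_minus L2_weak_limit[OF test_functions_L2[OF \<phi>b U] w(1) kb(1) w(3)])
  ultimately have "(LINT x:U|lborel. g x * kbb x) = - (LINT x:U|lborel. w x * kb x)"
    unfolding eq by (rule LIMSEQ_unique)
  \<comment> \<open>The derivatives of the test functions converge to some weak derivative of g,
    which agrees with \<open>gb\<close> almost everywhere.\<close>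
  moreover have "(LINT x:U|lborel. w x * kb x) = (LINT x:U|lborel. gb x * kb x)"
    by (rule L2_integral_cong_AE[OF w(1) g(2) kb(1) weak_derivative_unique[OF U w(1) g(2) w(2) g(3)]])
  ultimately show ?thesis by simp
qed

section \<open>The chosen weak derivatives of elements of \<open>V0\<close>\<close>

lemma space_derivative_props:
  assumes "v \<in> V0 \<Omega> T" "set bs \<subseteq> Basis" "length bs \<le> 2"
  shows "space_derivative \<Omega> T bs v \<in> L2 (cylinder \<Omega> T)"
    and "weak_space_derivative \<Omega> T bs v (space_derivative \<Omega> T bs v)"
proof -
  have *: "\<exists>w. w \<in> L2 (cylinder \<Omega> T) \<and> weak_space_derivative \<Omega> T bs v w"
    using assms unfolding V0_def L2_H1_0_H2_def by blast
  from someI_ex[OF this] show "space_derivative \<Omega> T bs v \<in> L2 (cylinder \<Omega> T)"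
    unfolding space_derivative_def by (rule conjunct1)
  from someI_ex[OF *] show "weak_space_derivative \<Omega> T bs v (space_derivative \<Omega> T bs v)"
    unfolding space_derivative_def by (rule conjunct2)
qed

lemma time_derivative_props:
  assumes "v \<in> V0 \<Omega> T"
  shows "time_derivative \<Omega> T v \<in> L2 (cylinder \<Omega> T)"
    and "weak_time_derivative \<Omega> T v (time_derivative \<Omega> T v)"
proof -
  have *: "\<exists>w. w \<in> L2 (cylinder \<Omega> T) \<and> weak_time_derivative \<Omega> T v w"
    using assms unfolding V0_def H1_L2_def by blast
  from someI_ex[OF this] show "time_derivative \<Omega> T v \<in> L2 (cylinder \<Omega> T)"
    unfolding time_derivative_def by (rule conjunct1)
  from someI_ex[OF *] show "weak_time_derivative \<Omega> T v (time_derivative \<Omega> T v)"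
    unfolding time_derivative_def by (rule conjunct2)
qed

lemma V0_L2: "v \<in> V0 \<Omega> T \<Longrightarrow> v \<in> L2 (cylinder \<Omega> T)"
  unfolding V0_def H1_L2_def by blast

lemma laplacian_L2:
  assumes "v \<in> V0 \<Omega> T" shows "laplacian \<Omega> T v \<in> L2 (cylinder \<Omega> T)"
  unfolding laplacian_def[abs_def] by (intro L2_sum space_derivative_props[OF assms]) auto

lemma sqint_cylinder: "v \<in> L2 (cylinder \<Omega> T) \<Longrightarrow> sqint (\<lambda>z. indicator (cylinder \<Omega> T) z * v z)"
  by (simp add: L2_iff_sqint)

text \<open>Discrete version with backward differences, from
  \<open>(a - c) a \<ge> (a\<^sup>2 - c\<^sup>2) / 2\<close> for the gradients.\<close>

lemma backward_difference_energy:
  fixes \<Omega> :: "'a::euclidean_space set"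
  assumes T: "0 < T" and \<Omega>: "open \<Omega>" and v: "v \<in> V0 \<Omega> T" and h: "0 < h"
  defines "v0 \<equiv> \<lambda>z. indicator (cylinder \<Omega> T) z * v z"
    and "q \<equiv> \<lambda>z. indicator (cylinder \<Omega> T) z * laplacian \<Omega> T v z"
  shows "(LINT z|lborel. (v0 z - v0 (z + (0, - h))) * q z) \<le> 0"
proof -
  let ?Q = "cylinder \<Omega> T" and ?I = "{0<..<T}"
  define D where "D b = space_derivative \<Omega> T [b] v" for b
  define E where "E b = space_derivative \<Omega> T [b, b] v" for b
  have DL: "D b \<in> L2 ?Q" "weak_space_derivative \<Omega> T [b] v (D b)" if "b \<in> Basis" for b
    using space_derivative_props[OF v, of "[b]"] that by (auto simp: D_def)
  have EL: "E b \<in> L2 ?Q" "weak_space_derivative \<Omega> T [b, b] v (E b)" if "b \<in> Basis" for b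
    using space_derivative_props[OF v, of "[b, b]"] that by (auto simp: E_def)
  \<comment> \<open>Collects the times at which all slice conditions hold together, one for each of
    finitely many directions.\<close>
  define good where "good t \<longleftrightarrow> (\<lambda>x. v (x, t)) \<in> sobolev1_0 \<Omega> \<and>
     (\<forall>b\<in>Basis. (\<lambda>x. D b (x, t)) \<in> L2 \<Omega> \<and> weak_derivative \<Omega> [b] (\<lambda>x. v (x, t)) (\<lambda>x. D b (x, t)) \<and>
       (\<lambda>x. E b (x, t)) \<in> L2 \<Omega> \<and> weak_derivative \<Omega> [b, b] (\<lambda>x. v (x, t)) (\<lambda>x. E b (x, t)))" for t
  have good: "AE t in lborel. t \<in> ?I \<longrightarrow> good t"
  proof -
    have 1: "AE t in lborel. t \<in> ?I \<longrightarrow> (\<lambda>x. v (x, t)) \<in> sobolev1_0 \<Omega>"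
      using v unfolding V0_def L2_H1_0_H2_def by (auto elim: eventually_mono)
    have fin: "AE t in lborel. \<forall>b\<in>Basis. P b t" if "\<And>b. b \<in> Basis \<Longrightarrow> AE t in lborel. P b t"
      for P :: "'a \<Rightarrow> real \<Rightarrow> bool"
      using AE_finite_allI[OF finite_Basis that] .
    have 2: "AE t in lborel. \<forall>b\<in>Basis. t \<in> ?I \<longrightarrow> (\<lambda>x. D b (x, t)) \<in> L2 \<Omega>"
      "AE t in lborel. \<forall>b\<in>Basis. t \<in> ?I \<longrightarrow> (\<lambda>x. E b (x, t)) \<in> L2 \<Omega>"
      "AE t in lborel. \<forall>b\<in>Basis. t \<in> ?I \<longrightarrow> weak_derivative \<Omega> [b] (\<lambda>x. v (x, t)) (\<lambda>x. D b (x, t))"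
      "AE t in lborel. \<forall>b\<in>Basis. t \<in> ?I \<longrightarrow> weak_derivative \<Omega> [b, b] (\<lambda>x. v (x, t)) (\<lambda>x. E b (x, t))"
      by (rule fin, rule L2_slices(1)[OF DL(1)], assumption, rule fin, rule L2_slices(1)[OF EL(1)], assumption,
          rule fin, rule DL(2)[unfolded weak_space_derivative_def], assumption,
          rule fin, rule EL(2)[unfolded weak_space_derivative_def], assumption)
    show ?thesis using 1 2 by eventually_elim (auto simp: good_def)
  qed
  \<comment> \<open>The spatial gradient extended by 0 outside the cylinder; N t will be the squared
    L2-norm of the gradient at time t.\<close>
  define d where "d b t x = indicator ?Q (x, t) * D b (x, t)" for b t x
  define N where "N t = (\<Sum>b\<in>Basis. LINT x|lborel. (d b t x)\<^sup>2)" for t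
  have dsq: "sqint (\<lambda>z. d b (snd z) (fst z))" if "b \<in> Basis" for b
    using sqint_cylinder[OF DL(1)[OF that]] by (simp add: d_def)
  have Nint: "integrable lborel N"
    unfolding N_def
  proof (intro Bochner_Integration.integrable_sum)
    fix b :: 'a assume "b \<in> Basis"
    from integrable_integral_snd[of "\<lambda>z. (d b (snd z) (fst z))\<^sup>2"] dsq[OF this]
    show "integrable lborel (\<lambda>t. LINT x|lborel. (d b t x)\<^sup>2)" by (simp add: sqint_def)
  qed
  have N0: "0 \<le> N t" for t unfolding N_def by (intro sum_nonneg) simp
  have Nout: "N t = 0" if "t \<notin> ?I" for t using that by (simp add: N_def d_def cylinder_indicator)
  \<comment> \<open>The earlier time s may be negative. There v, its gradient and N are 0 by
    extension, so \<open>good s\<close> is demanded only inside the interval.\<close>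
  have slice: "(LINT x|lborel. (v0 (x, t) - v0 (x, s)) * q (x, t)) \<le> - (N t - N s) / 2"
    if t: "t \<in> ?I" "good t" and s: "s \<in> ?I \<longrightarrow> good s"
      and int: "integrable lborel (\<lambda>x. v0 (x, t) * q (x, t))" "integrable lborel (\<lambda>x. v0 (x, s) * q (x, t))" for t s
  proof -
    have gd: "d b r \<in> L2 UNIV" if b: "b \<in> Basis" and r: "r \<in> ?I \<longrightarrow> good r" for b r
    proof (cases "r \<in> ?I")
      case True
      then show ?thesis using r b
        by (auto simp: good_def L2_iff_sqint d_def[abs_def] cylinder_indicator)
    qed (simp add: d_def[abs_def] cylinder_indicator L2_zero)
    \<comment> \<open>Green's formula between two times: the value at time r is paired with the
      Laplacian at time t, so regularity in time does not enter.\<close>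
    have key: "(LINT x|lborel. v0 (x, r) * q (x, t)) = - (\<Sum>b\<in>Basis. LINT x|lborel. d b r x * d b t x)"
      if r: "r \<in> ?I \<longrightarrow> good r" for r
    proof (cases "r \<in> ?I")
      case True
      then have gr: "good r" using r by blast
      have vL: "(\<lambda>x. v (x, r)) \<in> L2 \<Omega>" using gr unfolding good_def sobolev1_0_def sobolev_def by blast
      have "(LINT x|lborel. v0 (x, r) * q (x, t)) = (LINT x:\<Omega>|lborel. \<Sum>b\<in>Basis. v (x, r) * E b (x, t))"
        unfolding set_lebesgue_integral_def using True t
        by (intro Bochner_Integration.integral_cong)
          (auto simp: v0_def q_def cylinder_indicator laplacian_def E_def sum_distrib_left indicator_def)
      also have "\<dots> = (\<Sum>b\<in>Basis. LINT x:\<Omega>|lborel. v (x, r) * E b (x, t))"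
        unfolding set_lebesgue_integral_def scaleR_sum_right
        using t(2) L2_mult[OF vL] by (intro Bochner_Integration.integral_sum) (auto simp: good_def set_integrable_def)
      also have "\<dots> = (\<Sum>b\<in>Basis. - (LINT x:\<Omega>|lborel. D b (x, r) * D b (x, t)))"
        using gr t(2) unfolding good_def by (intro sum.cong refl sobolev1_0_Green[OF \<Omega>]) auto
      also have "\<dots> = (\<Sum>b\<in>Basis. - (LINT x|lborel. d b r x * d b t x))"
        unfolding set_lebesgue_integral_def using True t
        by (intro sum.cong refl arg_cong[where f = uminus] Bochner_Integration.integral_cong)
          (auto simp: d_def cylinder_indicator indicator_def)
      finally show ?thesis by (simp add: sum_negf)
    qed (simp add: v0_def d_def cylinder_indicator)
    have "(LINT x|lborel. (v0 (x, t) - v0 (x, s)) * q (x, t)) =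
        (\<Sum>b\<in>Basis. LINT x|lborel. d b s x * d b t x) - (\<Sum>b\<in>Basis. LINT x|lborel. d b t x * d b t x)"
      using int key[of t] key[OF s] t by (simp add: left_diff_distrib)
    also have "\<dots> \<le> (\<Sum>b\<in>Basis. (LINT x|lborel. (d b s x)\<^sup>2) / 2 + (LINT x|lborel. (d b t x)\<^sup>2) / 2)
        - (\<Sum>b\<in>Basis. LINT x|lborel. d b t x * d b t x)"
    proof (intro diff_right_mono sum_mono)
      fix b :: 'a assume b: "b \<in> Basis"
      have ds: "sqint (d b s)" "sqint (d b t)" using gd[OF b] s t by (auto simp: L2_UNIV)
      have "(LINT x|lborel. d b s x * d b t x) \<le> (LINT x|lborel. (d b s x)\<^sup>2 / 2 + (d b t x)\<^sup>2 / 2)"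
        using sqint_mult[OF ds] ds
      proof (intro integral_mono)
        fix x show "d b s x * d b t x \<le> (d b s x)\<^sup>2 / 2 + (d b t x)\<^sup>2 / 2"
          using sum_squares_bound[of "d b s x" "d b t x"] by simp
      qed (auto simp: sqint_def)
      then show "(LINT x|lborel. d b s x * d b t x) \<le> (LINT x|lborel. (d b s x)\<^sup>2) / 2 + (LINT x|lborel. (d b t x)\<^sup>2) / 2"
        using ds by (simp add: sqint_def)
    qed
    also have "\<dots> = - (N t - N s) / 2"
      by (simp add: N_def sum.distrib sum_divide_distrib[symmetric] power2_eq_square)
    finally show ?thesis .
  qed
  have vsq: "sqint v0" "sqint q"
    using sqint_cylinder[OF V0_L2[OF v]] sqint_cylinder[OF laplacian_L2[OF v]] by (simp_all add: v0_def q_def)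
  let ?f = "\<lambda>z. (v0 z - v0 (z + (0, - h))) * q z"
  have i1: "integrable lborel (\<lambda>z. v0 z * q z)" by (rule sqint_mult[OF vsq])
  have i2: "integrable lborel (\<lambda>z. v0 (z + (0, - h)) * q z)" by (rule sqint_mult[OF sqint_translate[OF vsq(1)] vsq(2)])
  have i: "integrable lborel ?f" using i1 i2 by (simp add: left_diff_distrib)
  have "(LINT z|lborel. ?f z) = (LINT t|lborel. LINT x|lborel. ?f (x, t))"
    using iterated_integral_snd[OF i] by simp
  also have "\<dots> \<le> (LINT t|lborel. indicator ?I t * (- (N t - N (t + - h)) / 2))"
  proof (rule integral_mono_AE)
    show "integrable lborel (\<lambda>t. LINT x|lborel. ?f (x, t))" by (rule integrable_integral_snd[OF i])
    show "integrable lborel (\<lambda>t. indicator ?I t * (- (N t - N (t + - h)) / 2))"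
      using integrable_mult_indicator[of ?I lborel "\<lambda>t. - (N t - N (t + - h)) / 2"] Nint integrable_translate[OF Nint, of "- h"]
      by simp
    have gh: "AE t in lborel. t + - h \<in> ?I \<longrightarrow> good (t + - h)" by (rule AE_translate[OF good])
    show "AE t in lborel. (LINT x|lborel. ?f (x, t)) \<le> indicator ?I t * (- (N t - N (t + - h)) / 2)"
      using good gh AE_integrable_slice_snd[OF i1] AE_integrable_slice_snd[OF i2]
    proof eventually_elim
      case (elim t)
      show ?case
      proof (cases "t \<in> ?I")
        case True
        then show ?thesis using slice[of t "t + - h"] elim by simp
      qed (simp add: q_def cylinder_indicator)
    qed
  qed
  \<comment> \<open>The differences of N cancel after integration: translation preserves the
    integral of N, while N is nonnegative and vanishes outside (0,T), so restricting the translate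
    to (0,T) can only lose mass.\<close>
  also have "\<dots> \<le> 0"
  proof -
    have NI: "(\<lambda>t. indicator ?I t * N t) = N" using Nout by (auto simp: fun_eq_iff indicator_def)
    have ith: "integrable lborel (\<lambda>t. N (t + - h))" by (rule integrable_translate[OF Nint])
    have ind: "integrable lborel (\<lambda>t. indicator ?I t * N (t + - h))"
      using integrable_mult_indicator[of ?I lborel "\<lambda>t. N (t + - h)"] ith by simp
    have "(LINT t|lborel. indicator ?I t * N (t + - h)) \<le> (LINT t|lborel. N (t + - h))"
      using ind ith N0 by (intro integral_mono) (auto simp: indicator_def)
    also have "\<dots> = (LINT t|lborel. N t)" using Nint by (intro integral_translate) auto
    finally have "(LINT t|lborel. indicator ?I t * N (t + - h)) \<le> (LINT t|lborel. indicator ?I t * N t)"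
      by (simp add: NI)
    moreover have "(LINT t|lborel. indicator ?I t * (- (N t - N (t + - h)) / 2)) =
        (LINT t|lborel. (indicator ?I t * N (t + - h)) / 2 - N t / 2)"
      using Nout by (intro Bochner_Integration.integral_cong) (auto simp: indicator_def diff_divide_distrib)
    moreover have "\<dots> = (LINT t|lborel. indicator ?I t * N (t + - h)) / 2 - (LINT t|lborel. N t) / 2"
      using ind Nint by simp
    ultimately show ?thesis by (simp add: NI)
  qed
  finally show ?thesis .
qed

text \<open>The substitution \<sigma> = t - s writes the increment over h as an integral of
  translates of f. It reverses the orientation of the half-open interval, whence
  \<open>{0<..h}\<close>.\<close>

lemma time_primitive_increment:
  fixes f :: "'a::euclidean_space \<times> real \<Rightarrow> real"
  assumes "integrable lborel (\<lambda>s. f (x, s))" "0 < h"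
  shows "time_primitive f (x, t) - time_primitive f (x, t - h) = (LINT \<sigma>|lborel. indicator {0<..h} \<sigma> * f (x, t - \<sigma>))"
proof -
  have i: "integrable lborel (\<lambda>s. if s < r then f (x, s) else 0)" for r
  proof -
    have "(\<lambda>s. if s < r then f (x, s) else 0) = (\<lambda>s. indicator {..<r} s *\<^sub>R f (x, s))"
      by (auto simp: fun_eq_iff indicator_def)
    then show ?thesis
      using integrable_mult_indicator[of "{..<r}" lborel "\<lambda>s. f (x, s)"] assms(1) by (simp only: sets_lborel borel_open open_lessThan)
  qed
  have "time_primitive f (x, t) - time_primitive f (x, t - h) =
    (LINT s|lborel. (if s < t then f (x, s) else 0) - (if s < t - h then f (x, s) else 0))"
    unfolding time_primitive_def fst_conv snd_conv
    by (rule Bochner_Integration.integral_diff[OF i i, symmetric])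
  also have "\<dots> = (LINT s|lborel. indicator {t - h..<t} s * f (x, s))"
    using assms(2) by (intro Bochner_Integration.integral_cong) (auto simp: indicator_def)
  also have "\<dots> = (LINT \<sigma>|lborel. indicator {t - h..<t} (t + - 1 * \<sigma>) * f (x, t + - 1 * \<sigma>))"
    using lborel_integral_real_affine[of "-1" "\<lambda>s. indicator {t - h..<t} s * f (x, s)" t] by simp
  also have "\<dots> = (LINT \<sigma>|lborel. indicator {0<..h} \<sigma> * f (x, t - \<sigma>))"
    by (intro Bochner_Integration.integral_cong) (auto simp: indicator_def)
  finally show ?thesis .
qed

text \<open>Translations preserve the L2-norm, so the inner integrals are bounded uniformly in
  \<sigma>; over the bounded range of \<sigma> this yields integrability in all variables
  jointly.\<close>

lemma translated_product_Fubini: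
  fixes w q :: "'a::euclidean_space \<times> real \<Rightarrow> real"
  assumes w: "sqint w" and q: "sqint q"
  shows "integrable lborel (\<lambda>p. indicator {0<..h} (fst p) * (w (snd p - (0, fst p)) * q (snd p)))" (is "integrable lborel ?H")
proof -
  have wm: "w \<in> borel_measurable borel" and qm: "q \<in> borel_measurable borel" using w q by (auto simp: sqint_def)
  have m: "?H \<in> borel_measurable borel"
  proof (intro borel_measurable_times)
    show "(\<lambda>p::real \<times> 'a \<times> real. w (snd p - (0, fst p))) \<in> borel_measurable borel"
      by (rule measurable_compose[OF borel_measurable_continuous_onI wm]) (intro continuous_intros)
    show "(\<lambda>p::real \<times> 'a \<times> real. q (snd p)) \<in> borel_measurable borel"
      by (rule measurable_compose[OF borel_measurable_continuous_onI qm]) (intro continuous_intros)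
    have im: "(indicator {0<..h} :: real \<Rightarrow> real) \<in> borel_measurable borel" by simp
    have fm: "(fst :: real \<times> 'a \<times> real \<Rightarrow> real) \<in> borel_measurable borel"
      by (intro borel_measurable_continuous_onI continuous_intros)
    show "(\<lambda>p::real \<times> 'a \<times> real. indicator {0<..h} (fst p) :: real) \<in> borel_measurable borel"
      by (rule measurable_compose[OF fm im])
  qed
  have wt: "sqint (\<lambda>z. w (z - (0, \<sigma>)))" for \<sigma>
    using sqint_translate[OF w, of "- (0, \<sigma>)"] by (simp only: add_uminus_conv_diff)
  define M where "M = (LINT z|lborel. (w z)\<^sup>2) + (LINT z|lborel. (q z)\<^sup>2)"
  have bound: "(LINT z|lborel. \<bar>w (z - (0, \<sigma>)) * q z\<bar>) \<le> M" for \<sigma>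
  proof -
    have "(LINT z|lborel. \<bar>w (z - (0, \<sigma>)) * q z\<bar>) \<le> (LINT z|lborel. (w (z - (0, \<sigma>)))\<^sup>2 + (q z)\<^sup>2)"
    proof (intro integral_mono)
      fix z
      show "\<bar>w (z - (0, \<sigma>)) * q z\<bar> \<le> (w (z - (0, \<sigma>)))\<^sup>2 + (q z)\<^sup>2"
        using sum_squares_bound[of "\<bar>w (z - (0, \<sigma>))\<bar>" "\<bar>q z\<bar>"] zero_le_power2[of "w (z - (0, \<sigma>))"] zero_le_power2[of "q z"]
        unfolding abs_mult power2_abs by linarith
    qed (use sqint_mult[OF wt q] wt q in \<open>auto simp: sqint_def\<close>)
    also have "\<dots> = (LINT z|lborel. (w (z - (0, \<sigma>)))\<^sup>2) + (LINT z|lborel. (q z)\<^sup>2)"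
      using wt[of \<sigma>] q by (simp add: sqint_def)
    also have "(LINT z|lborel. (w (z - (0, \<sigma>)))\<^sup>2) = (LINT z|lborel. (w z)\<^sup>2)"
      using integral_translate[of "\<lambda>z. (w z)\<^sup>2" "- (0, \<sigma>)"] wm
      by (simp only: add_uminus_conv_diff borel_measurable_power)
    finally show ?thesis by (simp add: M_def)
  qed
  have "integrable (lborel \<Otimes>\<^sub>M lborel) ?H"
  proof (rule lborel_pair.Fubini_integrable)
    show "?H \<in> borel_measurable (lborel \<Otimes>\<^sub>M lborel)" using m unfolding lborel_prod by simp
    show "AE \<sigma> in lborel. integrable lborel (\<lambda>z. ?H (\<sigma>, z))"
      using sqint_mult[OF wt q] by simp
    have "integrable lborel (\<lambda>\<sigma>. indicator {0<..h} \<sigma> * M)"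
      using emeasure_bounded_finite[of "{0<..h}"] by (intro integrable_mult_left integrable_real_indicator) auto
    then show "integrable lborel (\<lambda>\<sigma>. LINT z|lborel. norm (?H (\<sigma>, z)))"
    proof (rule Bochner_Integration.integrable_bound)
      have "(\<lambda>p. norm (?H p)) \<in> borel_measurable (borel \<Otimes>\<^sub>M lborel)"
      proof -
        have "sets (borel \<Otimes>\<^sub>M lborel :: (real \<times> 'a \<times> real) measure) = sets (borel \<Otimes>\<^sub>M borel)"
          by (rule sets_pair_measure_cong[OF refl sets_lborel])
        then have "sets (borel \<Otimes>\<^sub>M lborel :: (real \<times> 'a \<times> real) measure) = sets borel"
          by (simp only: borel_prod)
        from measurable_cong_sets[OF this refl] show ?thesis
          using measurable_compose[OF m borel_measurable_norm] by blast
      qed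
      then have "(\<lambda>\<sigma>. LINT z|lborel. norm (?H (\<sigma>, z))) \<in> borel_measurable borel"
        by (intro lborel.borel_measurable_lebesgue_integral) (simp add: split_beta')
      then show "(\<lambda>\<sigma>. LINT z|lborel. norm (?H (\<sigma>, z))) \<in> borel_measurable lborel" by simp
      show "AE \<sigma> in lborel. norm (LINT z|lborel. norm (?H (\<sigma>, z))) \<le> norm (indicator {0<..h} \<sigma> * M)"
      proof (rule AE_I2)
        fix \<sigma>
        have "0 \<le> (LINT z|lborel. \<bar>w (z - (0, \<sigma>)) * q z\<bar>)" by simp
        then show "norm (LINT z|lborel. norm (?H (\<sigma>, z))) \<le> norm (indicator {0<..h} \<sigma> * M)"
          using bound[of \<sigma>] by (cases "\<sigma> \<in> {0<..h}") (auto simp: abs_mult)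
      qed
    qed
  qed
  then show ?thesis unfolding lborel_prod .
qed

text \<open>C \<sigma> pairs the time derivative delayed by \<sigma> with the Laplacian. Its
  integral over \<sigma> in (0,h] is the backward-difference pairing and so nonpositive for every h.
  Since translations are continuous in L2, C is continuous at 0, and its value there is the integral
  in question.\<close>

lemma energy_inequality:
  fixes \<Omega> :: "'a::euclidean_space set"
  assumes T: "0 < T" and \<Omega>: "open \<Omega>" and v: "v \<in> V0 \<Omega> T"
  shows "(LINT z:cylinder \<Omega> T|lborel. time_derivative \<Omega> T v z * laplacian \<Omega> T v z) \<le> 0"
proof -
  let ?Q = "cylinder \<Omega> T" and ?I = "{0<..<T}"
  define v0 where "v0 = (\<lambda>z. indicator ?Q z * v z)"
  define q where "q = (\<lambda>z. indicator ?Q z * laplacian \<Omega> T v z)"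
  define w where "w = (\<lambda>z. indicator ?Q z * time_derivative \<Omega> T v z)"
  have sq: "sqint v0" "sqint q" "sqint w"
    using sqint_cylinder[OF V0_L2[OF v]] sqint_cylinder[OF laplacian_L2[OF v]] sqint_cylinder[OF time_derivative_props(1)[OF v]]
    by (simp_all add: v0_def q_def w_def)
  interpret supported_in_time T w
    by standard (use T sq in \<open>auto simp: w_def indicator_def\<close>)
  let ?W = "time_primitive w"
  have vW: "AE z in lborel. z \<in> ?Q \<longrightarrow> v0 z = ?W z"
    using weak_time_derivative_primitive[OF T \<Omega> V0_L2[OF v] time_derivative_props[OF v]] v
    by (auto simp: V0_def v0_def w_def elim!: eventually_mono)
  have W0: "?W (x, t) = 0" if "t \<le> 0" for x t
  proof -
    have "?W (x, t) = (LINT s|(lborel :: real measure). 0)"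
      unfolding time_primitive_def fst_conv snd_conv
      by (rule Bochner_Integration.integral_cong[OF refl]) (use that support in auto)
    then show ?thesis by simp
  qed
  define C where "C \<sigma> = (LINT z|lborel. w (z - (0, \<sigma>)) * q z)" for \<sigma>
  have CI: "integrable lborel (\<lambda>\<sigma>. indicator {0<..h} \<sigma> * C \<sigma>)" for h
    using integrable_integral_fst[OF translated_product_Fubini[OF sq(3,2), of h]] by (simp add: C_def)
  have neg: "(LINT \<sigma>|lborel. indicator {0<..h} \<sigma> * C \<sigma>) \<le> 0" if h: "0 < h" for h
  proof -
    let ?H = "\<lambda>p. indicator {0<..h} (fst p) * (w (snd p - (0, fst p)) * q (snd p))"
    have H: "integrable lborel ?H" by (rule translated_product_Fubini[OF sq(3,2)])
    have "(LINT \<sigma>|lborel. indicator {0<..h} \<sigma> * C \<sigma>) = (LINT z|lborel. LINT \<sigma>|lborel. ?H (\<sigma>, z))"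
      using iterated_integral_fst[OF H] iterated_integral_snd[OF H] by (simp add: C_def)
    also have "\<dots> = (LINT z|lborel. (v0 z - v0 (z + (0, - h))) * q z)"
    proof (rule integral_cong_AE)
      show "(\<lambda>z. LINT \<sigma>|lborel. ?H (\<sigma>, z)) \<in> borel_measurable lborel"
        using integrable_integral_snd[OF H] by simp
      have "sqint (\<lambda>z. v0 z + (-1) * v0 (z + (0, - h)))"
        by (intro sqint_add sqint_cmult sqint_translate sq)
      then have "sqint (\<lambda>z. v0 z - v0 (z + (0, - h)))" by simp
      from sqint_mult[OF this sq(2)]
      show "(\<lambda>z. (v0 z - v0 (z + (0, - h))) * q z) \<in> borel_measurable lborel" by (rule borel_measurable_integrable)
      have vWt: "AE z in lborel. z + (0, - h) \<in> ?Q \<longrightarrow> v0 (z + (0, - h)) = ?W (z + (0, - h))"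
        by (rule AE_translate[OF vW])
      have sl: "AE z in lborel. integrable lborel (\<lambda>t. w (fst (z :: 'a \<times> real), t))"
        by (rule AE_fst_lift[OF slices_integrable])
      show "AE z in lborel. (LINT \<sigma>|lborel. ?H (\<sigma>, z)) = (v0 z - v0 (z + (0, - h))) * q z"
        using vW vWt sl
      proof eventually_elim
        case (elim z)
        obtain x t where z: "z = (x, t)" by (cases z)
        show ?case
        proof (cases "z \<in> ?Q")
          case True
          \<comment> \<open>Close to t = 0 the shifted point leaves the cylinder; there the
            extension of v is 0, and so is the primitive at nonpositive times.\<close>
          have 1: "v0 (z + (0, - h)) = ?W (x, t - h)"
          proof (cases "t - h > 0")
            case True
            then have "z + (0, - h) \<in> ?Q" using \<open>z \<in> ?Q\<close> h by (auto simp: z)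
            then show ?thesis using elim(2) by (simp add: z)
          next
            case False
            then show ?thesis using W0[of "t - h" x] by (simp add: z v0_def)
          qed
          have "(LINT \<sigma>|lborel. ?H (\<sigma>, z)) = (LINT \<sigma>|lborel. (indicator {0<..h} \<sigma> * w (x, t - \<sigma>)) * q z)"
            by (simp add: z mult.assoc)
          also have "\<dots> = (LINT \<sigma>|lborel. indicator {0<..h} \<sigma> * w (x, t - \<sigma>)) * q z"
            by (rule integral_mult_left_zero)
          also have "\<dots> = (?W (x, t) - ?W (x, t - h)) * q z"
            using time_primitive_increment[of w x h t] elim(3) h by (simp add: z)
          finally show ?thesis using 1 elim(1) True by (simp add: z)
        next
          case False
          then have "q z = 0" by (simp add: q_def)
          then show ?thesis by simp
        qed
      qed
    qed
    also have "\<dots> \<le> 0"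
      using backward_difference_energy[OF T \<Omega> v h] by (simp add: v0_def q_def)
    finally show ?thesis .
  qed
  have cont: "isCont C 0"
    unfolding continuous_at_sequentially
  proof (intro allI impI)
    fix s :: "nat \<Rightarrow> real" assume "s \<longlonglongrightarrow> 0"
    then have "(\<lambda>n. (0 :: 'a, - s n)) \<longlonglongrightarrow> (0, - 0)" by (intro tendsto_intros)
    then have "(\<lambda>n. (0 :: 'a, - s n)) \<longlonglongrightarrow> 0" by (simp add: zero_prod_def)
    from translated_product_tendsto[OF sq(3,2) this] show "(C \<circ> s) \<longlonglongrightarrow> C 0"
      by (simp add: C_def comp_def minus_prod_def[symmetric] zero_prod_def[symmetric] diff_conv_add_uminus uminus_prod_def
          del: add_uminus_conv_diff)
  qed
  have "C 0 \<le> 0"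
  proof (rule ccontr)
    \<comment> \<open>If C 0 were positive, C would exceed half of it on some interval (0,h], and
      its integral over that interval would be positive.\<close>
    assume pos: "\<not> C 0 \<le> 0"
    have "C \<midarrow>0\<rightarrow> C 0" using cont by (simp add: isCont_def)
    then have "\<forall>\<^sub>F \<sigma> in at 0. C 0 / 2 < C \<sigma>" using pos by (intro order_tendstoD(1)) auto
    then obtain \<delta> where \<delta>: "\<delta> > 0" "\<And>\<sigma>. \<sigma> \<noteq> 0 \<Longrightarrow> \<bar>\<sigma>\<bar> < \<delta> \<Longrightarrow> C 0 / 2 < C \<sigma>"
      unfolding eventually_at by (auto simp: dist_real_def)
    define h where "h = \<delta> / 2"
    have h: "0 < h" "h < \<delta>" using \<delta>(1) by (auto simp: h_def)
    have "h * (C 0 / 2) = (LINT \<sigma>|lborel. indicator {0<..h} \<sigma> * (C 0 / 2))" using h by simp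
    also have "\<dots> \<le> (LINT \<sigma>|lborel. indicator {0<..h} \<sigma> * C \<sigma>)"
    proof (rule integral_mono[OF _ CI])
      show "integrable lborel (\<lambda>\<sigma>. indicator {0<..h} \<sigma> * (C 0 / 2))"
        using emeasure_bounded_finite[of "{0<..h}"] by (intro integrable_mult_left integrable_real_indicator) auto
      fix \<sigma> show "indicator {0<..h} \<sigma> * (C 0 / 2) \<le> indicator {0<..h} \<sigma> * C \<sigma>"
        using \<delta>(2)[of \<sigma>] h by (auto simp: indicator_def)
    qed
    also have "\<dots> \<le> 0" by (rule neg[OF h(1)])
    finally show False using h pos by (simp add: mult_le_0_iff)
  qed
  moreover have "C 0 = (LINT z:?Q|lborel. time_derivative \<Omega> T v z * laplacian \<Omega> T v z)"
    unfolding C_def set_lebesgue_integral_def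
    by (intro Bochner_Integration.integral_cong) (auto simp: w_def q_def indicator_def zero_prod_def[symmetric])
  ultimately show ?thesis by simp
qed

section \<open>Linear structure\<close>

lemma L2_norm_triangle:
  assumes "f \<in> L2 U" "g \<in> L2 U"
  shows "L2_norm U (\<lambda>x. f x + g x) \<le> L2_norm U f + L2_norm U g"
proof (rule power2_le_imp_le)
  have "(L2_norm U (\<lambda>x. f x + g x))\<^sup>2 = (LINT x:U|lborel. ((f x)\<^sup>2 + 2 * (f x * g x)) + (g x)\<^sup>2)"
    unfolding L2_norm_square by (simp add: power2_sum algebra_simps)
  also have "\<dots> = (L2_norm U f)\<^sup>2 + 2 * (LINT x:U|lborel. f x * g x) + (L2_norm U g)\<^sup>2"
    using set_integral_add(2)[OF set_integral_add(1)[OF L2_square[OF assms(1)] set_integrable_mult_right[OF L2_mult[OF assms], of 2]] L2_square[OF assms(2)]]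
      set_integral_add(2)[OF L2_square[OF assms(1)] set_integrable_mult_right[OF L2_mult[OF assms], of 2]]
    by (simp add: L2_norm_square)
  also have "\<dots> \<le> (L2_norm U f)\<^sup>2 + 2 * (L2_norm U f * L2_norm U g) + (L2_norm U g)\<^sup>2"
    using L2_Cauchy_Schwarz[OF assms] by linarith
  finally show "(L2_norm U (\<lambda>x. f x + g x))\<^sup>2 \<le> (L2_norm U f + L2_norm U g)\<^sup>2"
    by (simp add: power2_sum algebra_simps)
qed (simp add: L2_norm_nonneg)

lemma L2_norm_cmult: "L2_norm U (\<lambda>x. c * f x) = \<bar>c\<bar> * L2_norm U f"
  by (simp add: L2_norm_def power_mult_distrib real_sqrt_mult)

lemma L2_lin: "f \<in> L2 U \<Longrightarrow> g \<in> L2 U \<Longrightarrow> (\<lambda>x. f x + c * g x) \<in> L2 U"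
  by (intro L2_add L2_cmult)

lemma L2_integral_lin:
  assumes "f \<in> L2 U" "g \<in> L2 U" "h \<in> L2 U"
  shows "(LINT x:U|lborel. (f x + c * g x) * h x) = (LINT x:U|lborel. f x * h x) + c * (LINT x:U|lborel. g x * h x)"
proof -
  have "(LINT x:U|lborel. (f x + c * g x) * h x) = (LINT x:U|lborel. f x * h x + c * (g x * h x))"
    by (simp add: algebra_simps)
  also have "\<dots> = (LINT x:U|lborel. f x * h x) + (LINT x:U|lborel. c * (g x * h x))"
    by (rule set_integral_add(2)[OF L2_mult[OF assms(1,3)] set_integrable_mult_right[OF L2_mult[OF assms(2,3)]]])
  finally show ?thesis by simp
qed

lemma weak_derivative_lin:
  assumes U: "open U" and bs: "set bs \<subseteq> Basis"
    and L: "f \<in> L2 U" "g \<in> L2 U" "w1 \<in> L2 U" "w2 \<in> L2 U"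
    and w: "weak_derivative U bs f w1" "weak_derivative U bs g w2"
  shows "weak_derivative U bs (\<lambda>x. f x + c * g x) (\<lambda>x. w1 x + c * w2 x)"
  unfolding weak_derivative_def
proof
  fix \<phi> :: "'a \<Rightarrow> real" assume p: "\<phi> \<in> test_functions U"
  have d: "dpartials bs \<phi> \<in> L2 U" "\<phi> \<in> L2 U"
    using test_functions_L2[OF test_functions_dpartials[OF p bs] U] test_functions_L2[OF p U] by auto
  show "(LINT x:U|lborel. (f x + c * g x) * dpartials bs \<phi> x) =
    (- 1) ^ length bs * (LINT x:U|lborel. (w1 x + c * w2 x) * \<phi> x)"
    using w p unfolding L2_integral_lin[OF L(1,2) d(1)] L2_integral_lin[OF L(3,4) d(2)] weak_derivative_def
    by (simp add: algebra_simps)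
qed

lemma sobolev_lin:
  assumes "open U" "f \<in> sobolev n U" "g \<in> sobolev n U"
  shows "(\<lambda>x. f x + c * g x) \<in> sobolev n U"
proof -
  have L: "f \<in> L2 U" "g \<in> L2 U" using assms by (auto simp: sobolev_def)
  have "\<exists>w\<in>L2 U. weak_derivative U bs (\<lambda>x. f x + c * g x) w" if bs: "set bs \<subseteq> Basis" "length bs \<le> n" for bs
  proof -
    obtain w1 w2 where "w1 \<in> L2 U" "weak_derivative U bs f w1" "w2 \<in> L2 U" "weak_derivative U bs g w2"
      using assms(2,3) bs unfolding sobolev_def by blast
    then show ?thesis using weak_derivative_lin[OF assms(1) bs(1) L] L2_lin by blast
  qed
  then show ?thesis using L2_lin[OF L] by (simp add: sobolev_def)
qed

lemma test_functions_lin: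
  assumes "\<phi> \<in> test_functions U" "\<psi> \<in> test_functions U"
  shows "(\<lambda>x. \<phi> x + c * \<psi> x) \<in> test_functions U"
proof -
  obtain K1 where K1: "Cinf_on UNIV \<phi>" "compact K1" "K1 \<subseteq> U" "\<And>r. r \<notin> K1 \<Longrightarrow> \<phi> r = 0"
    using assms(1) unfolding test_functions_def by auto
  obtain K2 where K2: "Cinf_on UNIV \<psi>" "compact K2" "K2 \<subseteq> U" "\<And>r. r \<notin> K2 \<Longrightarrow> \<psi> r = 0"
    using assms(2) unfolding test_functions_def by auto
  have "Cinf_on UNIV (\<lambda>x. \<phi> x + c * \<psi> x)"
    using K1(1) K2(1) unfolding Cinf_on_smooth_upto
    by (intro allI smooth_upto_add smooth_upto_mult smooth_upto_const open_UNIV) auto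
  moreover have "compact (K1 \<union> K2)" "K1 \<union> K2 \<subseteq> U" "\<And>r. r \<notin> K1 \<union> K2 \<Longrightarrow> \<phi> r + c * \<psi> r = 0"
    using K1 K2 by auto
  ultimately show ?thesis unfolding test_functions_def by blast
qed

lemma dpartial_lin:
  assumes "f differentiable (at x)" "g differentiable (at x)"
  shows "dpartial b (\<lambda>x. f x + c * g x) x = dpartial b f x + c * dpartial b g x"
proof -
  have "(\<lambda>x. c * g x) differentiable (at x)" using assms(2) by (intro differentiable_mult) auto
  then show ?thesis using dpartial_add[OF assms(1), of "\<lambda>x. c * g x" b] dpartial_mult_const[OF assms(2)] by simp
qed

text \<open>Stated for an arbitrary filter, since it serves both sequences of test functions and
  limits in time.\<close>

lemma L2_tendsto_lin:
  assumes "\<And>n. f n \<in> L2 U" "\<And>n. g n \<in> L2 U" "F \<in> L2 U" "G \<in> L2 U"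
    "((\<lambda>n. L2_norm U (\<lambda>x. f n x - F x)) \<longlongrightarrow> 0) N" "((\<lambda>n. L2_norm U (\<lambda>x. g n x - G x)) \<longlongrightarrow> 0) N"
  shows "((\<lambda>n. L2_norm U (\<lambda>x. (f n x + c * g n x) - (F x + c * G x))) \<longlongrightarrow> 0) N"
proof (rule real_tendsto_sandwich)
  show "((\<lambda>n. 0) \<longlongrightarrow> (0::real)) N" by simp
  show "\<forall>\<^sub>F n in N. 0 \<le> L2_norm U (\<lambda>x. (f n x + c * g n x) - (F x + c * G x))"
    by (simp add: L2_norm_nonneg)
  have "((\<lambda>n. L2_norm U (\<lambda>x. f n x - F x) + \<bar>c\<bar> * L2_norm U (\<lambda>x. g n x - G x)) \<longlongrightarrow> 0 + \<bar>c\<bar> * 0) N"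
    by (intro tendsto_intros assms)
  then show "((\<lambda>n. L2_norm U (\<lambda>x. f n x - F x) + \<bar>c\<bar> * L2_norm U (\<lambda>x. g n x - G x)) \<longlongrightarrow> 0) N" by simp
  have "L2_norm U (\<lambda>x. (f n x + c * g n x) - (F x + c * G x)) \<le> L2_norm U (\<lambda>x. f n x - F x) + \<bar>c\<bar> * L2_norm U (\<lambda>x. g n x - G x)" for n
  proof -
    have "(\<lambda>x. (f n x + c * g n x) - (F x + c * G x)) = (\<lambda>x. (f n x - F x) + c * (g n x - G x))"
      by (auto simp: fun_eq_iff algebra_simps)
    then show ?thesis
      using L2_norm_triangle[OF L2_diff[OF assms(1,3)] L2_cmult[OF L2_diff[OF assms(2,4)], of c], of n n]
      unfolding L2_norm_cmult by (simp only:)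
  qed
  then show "\<forall>\<^sub>F n in N. L2_norm U (\<lambda>x. (f n x + c * g n x) - (F x + c * G x)) \<le> L2_norm U (\<lambda>x. f n x - F x) + \<bar>c\<bar> * L2_norm U (\<lambda>x. g n x - G x)"
    by simp
qed

lemma sobolev1_0_lin:
  assumes U: "open U" and fg: "f \<in> sobolev1_0 U" "g \<in> sobolev1_0 U"
  shows "(\<lambda>x. f x + c * g x) \<in> sobolev1_0 U"
proof -
  have s: "f \<in> sobolev 1 U" "g \<in> sobolev 1 U" using fg by (auto simp: sobolev1_0_def)
  then have L: "f \<in> L2 U" "g \<in> L2 U" by (auto simp: sobolev_def)
  obtain \<phi> where \<phi>: "\<And>n. \<phi> n \<in> test_functions U" "(\<lambda>n. L2_norm U (\<lambda>x. \<phi> n x - f x)) \<longlonglongrightarrow> 0"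
      "\<And>b. b \<in> Basis \<Longrightarrow> \<exists>w\<in>L2 U. weak_derivative U [b] f w \<and>
           (\<lambda>n. L2_norm U (\<lambda>x. dpartial b (\<phi> n) x - w x)) \<longlonglongrightarrow> 0"
    using fg(1) unfolding sobolev1_0_def by blast
  obtain \<psi> where \<psi>: "\<And>n. \<psi> n \<in> test_functions U" "(\<lambda>n. L2_norm U (\<lambda>x. \<psi> n x - g x)) \<longlonglongrightarrow> 0"
      "\<And>b. b \<in> Basis \<Longrightarrow> \<exists>w\<in>L2 U. weak_derivative U [b] g w \<and>
           (\<lambda>n. L2_norm U (\<lambda>x. dpartial b (\<psi> n) x - w x)) \<longlonglongrightarrow> 0"
    using fg(2) unfolding sobolev1_0_def by blast
  let ?h = "\<lambda>n x. \<phi> n x + c * \<psi> n x"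
  have d: "dpartial b (?h n) = (\<lambda>x. dpartial b (\<phi> n) x + c * dpartial b (\<psi> n) x)" for b n
    using dpartial_lin[OF test_functions_differentiable[OF \<phi>(1)] test_functions_differentiable[OF \<psi>(1)]] by blast
  have "\<exists>w\<in>L2 U. weak_derivative U [b] (\<lambda>x. f x + c * g x) w \<and> (\<lambda>n. L2_norm U (\<lambda>x. dpartial b (?h n) x - w x)) \<longlonglongrightarrow> 0"
    if b: "b \<in> Basis" for b
  proof -
    obtain w1 w2 where w: "w1 \<in> L2 U" "weak_derivative U [b] f w1" "(\<lambda>n. L2_norm U (\<lambda>x. dpartial b (\<phi> n) x - w1 x)) \<longlonglongrightarrow> 0"
      "w2 \<in> L2 U" "weak_derivative U [b] g w2" "(\<lambda>n. L2_norm U (\<lambda>x. dpartial b (\<psi> n) x - w2 x)) \<longlonglongrightarrow> 0"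
      using \<phi>(3)[OF b] \<psi>(3)[OF b] by blast
    have "(\<lambda>n. L2_norm U (\<lambda>x. dpartial b (?h n) x - (w1 x + c * w2 x))) \<longlonglongrightarrow> 0"
      unfolding d by (rule L2_tendsto_lin[OF test_functions_L2[OF test_functions_dpartial[OF \<phi>(1) b] U]
            test_functions_L2[OF test_functions_dpartial[OF \<psi>(1) b] U] w(1,4,3,6)])
    moreover have "weak_derivative U [b] (\<lambda>x. f x + c * g x) (\<lambda>x. w1 x + c * w2 x)"
      using weak_derivative_lin[OF U _ L w(1,4,2,5)] b by simp
    ultimately show ?thesis using L2_lin[OF w(1,4)] by blast
  qed
  moreover have "(\<lambda>n. L2_norm U (\<lambda>x. ?h n x - (f x + c * g x))) \<longlonglongrightarrow> 0"
    by (rule L2_tendsto_lin[OF test_functions_L2[OF \<phi>(1) U] test_functions_L2[OF \<psi>(1) U] L \<phi>(2) \<psi>(2)])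
  ultimately show ?thesis
    using sobolev_lin[OF U s] test_functions_lin[OF \<phi>(1) \<psi>(1)] unfolding sobolev1_0_def
    by (intro CollectI conjI exI[of _ ?h]) auto
qed

lemma weak_space_derivative_lin:
  assumes \<Omega>: "open \<Omega>" and bs: "set bs \<subseteq> Basis"
    and L: "u \<in> L2 (cylinder \<Omega> T)" "v \<in> L2 (cylinder \<Omega> T)" "w1 \<in> L2 (cylinder \<Omega> T)" "w2 \<in> L2 (cylinder \<Omega> T)"
    and w: "weak_space_derivative \<Omega> T bs u w1" "weak_space_derivative \<Omega> T bs v w2"
  shows "weak_space_derivative \<Omega> T bs (\<lambda>z. u z + c * v z) (\<lambda>z. w1 z + c * w2 z)"
  using w L[THEN L2_slices(1)] unfolding weak_space_derivative_def
  by eventually_elim (auto intro!: weak_derivative_lin[OF \<Omega> bs])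

lemma test_functions_deriv_eq:
  assumes "\<phi> \<in> test_functions (U :: real set)" shows "deriv \<phi> = dpartial 1 \<phi>"
  using has_real_derivative_dpartial[OF test_functions_differentiable[OF assms]] DERIV_imp_deriv by blast

lemma test_functions_deriv: "\<phi> \<in> test_functions (U :: real set) \<Longrightarrow> deriv \<phi> \<in> test_functions U"
  using test_functions_deriv_eq test_functions_dpartial[of \<phi> U 1] by simp

lemma weak_time_derivative_lin:
  assumes L: "u \<in> L2 (cylinder \<Omega> T)" "v \<in> L2 (cylinder \<Omega> T)" "w1 \<in> L2 (cylinder \<Omega> T)" "w2 \<in> L2 (cylinder \<Omega> T)"
    and w: "weak_time_derivative \<Omega> T u w1" "weak_time_derivative \<Omega> T v w2"
  shows "weak_time_derivative \<Omega> T (\<lambda>z. u z + c * v z) (\<lambda>z. w1 z + c * w2 z)"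
  unfolding weak_time_derivative_def
proof
  fix \<phi> :: "real \<Rightarrow> real" assume p: "\<phi> \<in> test_functions {0<..<T}"
  have d: "deriv \<phi> \<in> L2 {0<..<T}" "\<phi> \<in> L2 {0<..<T}"
    using test_functions_L2[OF test_functions_deriv[OF p]] test_functions_L2[OF p] by auto
  show "AE x in lborel. x \<in> \<Omega> \<longrightarrow> (LINT t:{0<..<T}|lborel. (u (x, t) + c * v (x, t)) * deriv \<phi> t) =
      - (LINT t:{0<..<T}|lborel. (w1 (x, t) + c * w2 (x, t)) * \<phi> t)"
    using w[unfolded weak_time_derivative_def, rule_format, OF p] L[THEN L2_slices(2)]
    by eventually_elim (auto simp: L2_integral_lin[OF _ _ d(1)] L2_integral_lin[OF _ _ d(2)])
qed

lemma zero_initial_trace_lin: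
  assumes "zero_initial_trace \<Omega> T u" "zero_initial_trace \<Omega> T v" "0 < T"
  shows "zero_initial_trace \<Omega> T (\<lambda>z. u z + c * v z)"
proof -
  obtain V where V: "\<And>t. t \<in> {0..T} \<Longrightarrow> V t \<in> L2 \<Omega>"
    "\<And>t. t \<in> {0..T} \<Longrightarrow> ((\<lambda>s. L2_norm \<Omega> (\<lambda>x. V s x - V t x)) \<longlongrightarrow> 0) (at t within {0..T})"
    "AE t in lborel. t \<in> {0<..<T} \<longrightarrow> (AE x in lborel. x \<in> \<Omega> \<longrightarrow> V t x = u (x, t))"
    "AE x in lborel. x \<in> \<Omega> \<longrightarrow> V 0 x = 0"
    using assms(1) unfolding zero_initial_trace_def by blast
  obtain W where W: "\<And>t. t \<in> {0..T} \<Longrightarrow> W t \<in> L2 \<Omega>"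
    "\<And>t. t \<in> {0..T} \<Longrightarrow> ((\<lambda>s. L2_norm \<Omega> (\<lambda>x. W s x - W t x)) \<longlongrightarrow> 0) (at t within {0..T})"
    "AE t in lborel. t \<in> {0<..<T} \<longrightarrow> (AE x in lborel. x \<in> \<Omega> \<longrightarrow> W t x = v (x, t))"
    "AE x in lborel. x \<in> \<Omega> \<longrightarrow> W 0 x = 0"
    using assms(2) unfolding zero_initial_trace_def by blast
  text \<open>Outside \<open>[0,T]\<close> nothing is known about \<open>V\<close> and \<open>W\<close>; clamping the time makes the
    previous lemma applicable to the filter \<open>at t within {0..T}\<close>.\<close>
  define cl where "cl s = max 0 (min T s)" for s :: real
  have cl: "cl s \<in> {0..T}" for s using assms(3) by (auto simp: cl_def)
  have cl_id: "cl s = s" if "s \<in> {0..T}" for s using that by (auto simp: cl_def)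
  show ?thesis unfolding zero_initial_trace_def
  proof (intro exI[of _ "\<lambda>t x. V t x + c * W t x"] conjI ballI)
    fix t assume t: "t \<in> {0..T}"
    show "(\<lambda>x. V t x + c * W t x) \<in> L2 \<Omega>" by (intro L2_lin V W t)
    have ev: "\<forall>\<^sub>F s in at t within {0..T}. cl s = s"
      using cl_id by (auto simp: eventually_at_filter)
    have "((\<lambda>s. L2_norm \<Omega> (\<lambda>x. V (cl s) x - V t x)) \<longlongrightarrow> 0) (at t within {0..T})"
      by (rule Lim_transform_eventually[OF V(2)[OF t]]) (use ev in \<open>auto elim: eventually_mono\<close>)
    moreover have "((\<lambda>s. L2_norm \<Omega> (\<lambda>x. W (cl s) x - W t x)) \<longlongrightarrow> 0) (at t within {0..T})"
      by (rule Lim_transform_eventually[OF W(2)[OF t]]) (use ev in \<open>auto elim: eventually_mono\<close>)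
    ultimately have "((\<lambda>s. L2_norm \<Omega> (\<lambda>x. (V (cl s) x + c * W (cl s) x) - (V t x + c * W t x))) \<longlongrightarrow> 0) (at t within {0..T})"
      by (rule L2_tendsto_lin[OF V(1)[OF cl] W(1)[OF cl] V(1)[OF t] W(1)[OF t]])
    then show "((\<lambda>s. L2_norm \<Omega> (\<lambda>x. (V s x + c * W s x) - (V t x + c * W t x))) \<longlongrightarrow> 0) (at t within {0..T})"
      by (rule Lim_transform_eventually) (use ev in \<open>auto elim: eventually_mono\<close>)
  next
    show "AE t in lborel. t \<in> {0<..<T} \<longrightarrow> (AE x in lborel. x \<in> \<Omega> \<longrightarrow> V t x + c * W t x = u (x, t) + c * v (x, t))"
      using V(3) W(3)
    proof eventually_elim
      case (elim t)
      show ?case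
      proof
        assume "t \<in> {0<..<T}"
        with elim have "AE x in lborel. x \<in> \<Omega> \<longrightarrow> V t x = u (x, t)" "AE x in lborel. x \<in> \<Omega> \<longrightarrow> W t x = v (x, t)" by auto
        then show "AE x in lborel. x \<in> \<Omega> \<longrightarrow> V t x + c * W t x = u (x, t) + c * v (x, t)"
          by eventually_elim auto
      qed
    qed
    show "AE x in lborel. x \<in> \<Omega> \<longrightarrow> V 0 x + c * W 0 x = 0"
      using V(4) W(4) by eventually_elim auto
  qed
qed

lemma V0_lin:
  assumes T: "0 < T" and \<Omega>: "open \<Omega>" and uv: "u \<in> V0 \<Omega> T" "v \<in> V0 \<Omega> T"
  shows "(\<lambda>z. u z + c * v z) \<in> V0 \<Omega> T"
proof -
  let ?h = "\<lambda>z. u z + c * v z"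
  note L = V0_L2[OF uv(1)] V0_L2[OF uv(2)]
  have hL: "?h \<in> L2 (cylinder \<Omega> T)" by (rule L2_lin[OF L])
  have "AE t in lborel. t \<in> {0<..<T} \<longrightarrow> (\<lambda>x. u (x, t)) \<in> sobolev1_0 \<Omega> \<inter> sobolev 2 \<Omega>"
    "AE t in lborel. t \<in> {0<..<T} \<longrightarrow> (\<lambda>x. v (x, t)) \<in> sobolev1_0 \<Omega> \<inter> sobolev 2 \<Omega>"
    using uv unfolding V0_def L2_H1_0_H2_def by auto
  then have "AE t in lborel. t \<in> {0<..<T} \<longrightarrow> (\<lambda>x. ?h (x, t)) \<in> sobolev1_0 \<Omega> \<inter> sobolev 2 \<Omega>"
    by eventually_elim (auto intro: sobolev1_0_lin[OF \<Omega>] sobolev_lin[OF \<Omega>])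
  moreover have "\<exists>w\<in>L2 (cylinder \<Omega> T). weak_space_derivative \<Omega> T bs ?h w"
    if bs: "set bs \<subseteq> Basis" "length bs \<le> 2" for bs
    using weak_space_derivative_lin[OF \<Omega> bs(1) L space_derivative_props(1)[OF uv(1) bs] space_derivative_props(1)[OF uv(2) bs]
        space_derivative_props(2)[OF uv(1) bs] space_derivative_props(2)[OF uv(2) bs]]
      L2_lin[OF space_derivative_props(1)[OF uv(1) bs] space_derivative_props(1)[OF uv(2) bs]] by blast
  moreover have "\<exists>w\<in>L2 (cylinder \<Omega> T). weak_time_derivative \<Omega> T ?h w"
    using weak_time_derivative_lin[OF L time_derivative_props(1)[OF uv(1)] time_derivative_props(1)[OF uv(2)]
        time_derivative_props(2)[OF uv(1)] time_derivative_props(2)[OF uv(2)]]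
      L2_lin[OF time_derivative_props(1)[OF uv(1)] time_derivative_props(1)[OF uv(2)]] by blast
  moreover have "zero_initial_trace \<Omega> T ?h"
    using uv T by (intro zero_initial_trace_lin) (auto simp: V0_def)
  ultimately show ?thesis using hL by (simp add: V0_def L2_H1_0_H2_def H1_L2_def)
qed

text \<open>Uniqueness in almost every slice gives null sets slice by slice; measurability of the
  set of agreement turns them into one null set of the cylinder.\<close>

lemma weak_space_derivative_unique:
  assumes \<Omega>: "open \<Omega>" and w: "w1 \<in> L2 (cylinder \<Omega> T)" "w2 \<in> L2 (cylinder \<Omega> T)"
    "weak_space_derivative \<Omega> T bs v w1" "weak_space_derivative \<Omega> T bs v w2"
  shows "AE z in lborel. z \<in> cylinder \<Omega> T \<longrightarrow> w1 z = w2 z"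
proof -
  let ?i = "\<lambda>w z. indicator (cylinder \<Omega> T) z * w z"
  have m: "?i w1 \<in> borel_measurable borel" "?i w2 \<in> borel_measurable borel"
    using sqint_cylinder[OF w(1)] sqint_cylinder[OF w(2)] by (auto simp: sqint_def)
  have "AE t in lborel. AE x in lborel. ?i w1 (x, t) = ?i w2 (x, t)"
    using w(3,4)[unfolded weak_space_derivative_def] w(1,2)[THEN L2_slices(1)]
  proof eventually_elim
    case (elim t)
    show ?case
    proof (cases "t \<in> {0<..<T}")
      case True
      then have "AE x in lborel. x \<in> \<Omega> \<longrightarrow> w1 (x, t) = w2 (x, t)"
        using elim by (intro weak_derivative_unique[OF \<Omega>]) auto
      then show ?thesis by eventually_elim (auto simp: cylinder_indicator indicator_def)
    qed (simp add: cylinder_indicator)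
  qed
  moreover have "{z. ?i w1 z = ?i w2 z} \<in> sets borel"
    using borel_measurable_eq[of "?i w1" borel "?i w2"] m by simp
  ultimately have "AE z in lborel. ?i w1 z = ?i w2 z" by (intro AE_from_slices_snd)
  then show ?thesis by eventually_elim (auto simp: indicator_def split: if_splits)
qed

text \<open>The representatives selected by \<open>SOME\<close> need not be linear in v pointwise.
  Uniqueness of the weak derivative restores linearity up to a null set, which integrals do not
  see.\<close>

lemma time_derivative_lin:
  assumes T: "0 < T" and \<Omega>: "open \<Omega>" and uv: "u \<in> V0 \<Omega> T" "v \<in> V0 \<Omega> T"
  shows "AE z in lborel. z \<in> cylinder \<Omega> T \<longrightarrow>
    time_derivative \<Omega> T (\<lambda>z. u z + c * v z) z = time_derivative \<Omega> T u z + c * time_derivative \<Omega> T v z"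
  by (rule weak_time_derivative_unique[OF \<Omega> time_derivative_props(1)[OF V0_lin[OF T \<Omega> uv]]
        L2_lin[OF time_derivative_props(1)[OF uv(1)] time_derivative_props(1)[OF uv(2)]]
        time_derivative_props(2)[OF V0_lin[OF T \<Omega> uv]]
        weak_time_derivative_lin[OF V0_L2[OF uv(1)] V0_L2[OF uv(2)] time_derivative_props(1)[OF uv(1)] time_derivative_props(1)[OF uv(2)]
        time_derivative_props(2)[OF uv(1)] time_derivative_props(2)[OF uv(2)]]])

lemma space_derivative_lin:
  assumes T: "0 < T" and \<Omega>: "open \<Omega>" and uv: "u \<in> V0 \<Omega> T" "v \<in> V0 \<Omega> T"
    and bs: "set bs \<subseteq> Basis" "length bs \<le> 2"
  shows "AE z in lborel. z \<in> cylinder \<Omega> T \<longrightarrow>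
    space_derivative \<Omega> T bs (\<lambda>z. u z + c * v z) z = space_derivative \<Omega> T bs u z + c * space_derivative \<Omega> T bs v z"
  by (rule weak_space_derivative_unique[OF \<Omega> space_derivative_props(1)[OF V0_lin[OF T \<Omega> uv] bs]
        L2_lin[OF space_derivative_props(1)[OF uv(1) bs] space_derivative_props(1)[OF uv(2) bs]]
        space_derivative_props(2)[OF V0_lin[OF T \<Omega> uv] bs]
        weak_space_derivative_lin[OF \<Omega> bs(1) V0_L2[OF uv(1)] V0_L2[OF uv(2)] space_derivative_props(1)[OF uv(1) bs] space_derivative_props(1)[OF uv(2) bs]
        space_derivative_props(2)[OF uv(1) bs] space_derivative_props(2)[OF uv(2) bs]]])

lemma laplacian_lin:
  assumes T: "0 < T" and \<Omega>: "open \<Omega>" and uv: "u \<in> V0 \<Omega> T" "v \<in> V0 \<Omega> T"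
  shows "AE z in lborel. z \<in> cylinder \<Omega> T \<longrightarrow>
    laplacian \<Omega> T (\<lambda>z. u z + c * v z) z = laplacian \<Omega> T u z + c * laplacian \<Omega> T v z"
proof -
  have "AE z in lborel. \<forall>b\<in>Basis. z \<in> cylinder \<Omega> T \<longrightarrow>
    space_derivative \<Omega> T [b, b] (\<lambda>z. u z + c * v z) z = space_derivative \<Omega> T [b, b] u z + c * space_derivative \<Omega> T [b, b] v z"
    by (rule AE_finite_allI[OF finite_Basis], rule space_derivative_lin[OF T \<Omega> uv]) auto
  then show ?thesis
    by eventually_elim (auto simp: laplacian_def sum.distrib sum_distrib_left)
qed

section \<open>The least-squares form\<close>

definition residual :: "'a::euclidean_space set \<Rightarrow> real \<Rightarrow> ('a \<times> real \<Rightarrow> real) \<Rightarrow> 'a \<times> real \<Rightarrow> real" where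
  "residual \<Omega> T v z = time_derivative \<Omega> T v z - laplacian \<Omega> T v z"

lemma residual_L2: "v \<in> V0 \<Omega> T \<Longrightarrow> residual \<Omega> T v \<in> L2 (cylinder \<Omega> T)"
  unfolding residual_def[abs_def] by (intro L2_diff time_derivative_props laplacian_L2)

lemma residual_lin:
  assumes T: "0 < T" and \<Omega>: "open \<Omega>" and uv: "u \<in> V0 \<Omega> T" "v \<in> V0 \<Omega> T"
  shows "AE z in lborel. z \<in> cylinder \<Omega> T \<longrightarrow>
    residual \<Omega> T (\<lambda>z. u z + c * v z) z = residual \<Omega> T u z + c * residual \<Omega> T v z"
  using time_derivative_lin[OF T \<Omega> uv, of c] laplacian_lin[OF T \<Omega> uv, of c]
  by eventually_elim (auto simp: residual_def algebra_simps)

lemma residual_integral_lin: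
  assumes T: "0 < T" and \<Omega>: "open \<Omega>" and uv: "u \<in> V0 \<Omega> T" "v \<in> V0 \<Omega> T" and h: "h \<in> L2 (cylinder \<Omega> T)"
  shows "(LINT z:cylinder \<Omega> T|lborel. residual \<Omega> T (\<lambda>z. u z + c * v z) z * h z) =
    (LINT z:cylinder \<Omega> T|lborel. residual \<Omega> T u z * h z) + c * (LINT z:cylinder \<Omega> T|lborel. residual \<Omega> T v z * h z)"
  using L2_integral_cong_AE[OF residual_L2[OF V0_lin[OF T \<Omega> uv]] L2_lin[OF residual_L2[OF uv(1)] residual_L2[OF uv(2)]] h residual_lin[OF T \<Omega> uv]]
    L2_integral_lin[OF residual_L2[OF uv(1)] residual_L2[OF uv(2)] h] by simp

text \<open>The four terms of the integrand factor into the product of the two residuals; Fubini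
  turns the iterated integral into one over the cylinder.\<close>

lemma form_A_residual:
  assumes "u \<in> V0 \<Omega> T" "v \<in> V0 \<Omega> T"
  shows "form_A \<Omega> T u v = (LINT z:cylinder \<Omega> T|lborel. residual \<Omega> T u z * residual \<Omega> T v z)"
  unfolding set_integral_cylinder_snd[OF L2_mult[OF residual_L2[OF assms(1)] residual_L2[OF assms(2)]]] form_A_def
  by (simp add: residual_def algebra_simps)

lemma form_F_residual:
  assumes "f \<in> L2 (cylinder \<Omega> T)" "v \<in> V0 \<Omega> T"
  shows "form_F \<Omega> T f v = (LINT z:cylinder \<Omega> T|lborel. f z * residual \<Omega> T v z)"
  unfolding set_integral_cylinder_snd[OF L2_mult[OF assms(1) residual_L2[OF assms(2)]]] form_F_def
  by (simp add: residual_def)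

lemma V0_norm_nonneg: "0 \<le> V0_norm \<Omega> T v"
  unfolding V0_norm_def by (simp add: set_lebesgue_integral_def)

lemma V0_norm_square:
  assumes "v \<in> V0 \<Omega> T"
  shows "(V0_norm \<Omega> T v)\<^sup>2 = (LINT z:cylinder \<Omega> T|lborel. (laplacian \<Omega> T v z)\<^sup>2) + (LINT z:cylinder \<Omega> T|lborel. (time_derivative \<Omega> T v z)\<^sup>2)"
proof -
  have "(V0_norm \<Omega> T v)\<^sup>2 = (LINT t:{0<..<T}|lborel. (L2_norm \<Omega> (\<lambda>x. laplacian \<Omega> T v (x, t)))\<^sup>2)
         + (LINT t:{0<..<T}|lborel. (L2_norm \<Omega> (\<lambda>x. time_derivative \<Omega> T v (x, t)))\<^sup>2)"
    unfolding V0_norm_def by (simp add: set_lebesgue_integral_def)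
  then show ?thesis
    using set_integral_cylinder_snd[OF L2_square[OF laplacian_L2[OF assms]]] set_integral_cylinder_snd[OF L2_square[OF time_derivative_props(1)[OF assms]]]
    by (simp add: L2_norm_square)
qed

lemma residual_square:
  assumes "v \<in> V0 \<Omega> T"
  shows "(LINT z:cylinder \<Omega> T|lborel. (residual \<Omega> T v z)\<^sup>2) =
    (V0_norm \<Omega> T v)\<^sup>2 - 2 * (LINT z:cylinder \<Omega> T|lborel. time_derivative \<Omega> T v z * laplacian \<Omega> T v z)"
proof -
  note t = time_derivative_props(1)[OF assms] and l = laplacian_L2[OF assms]
  have "(LINT z:cylinder \<Omega> T|lborel. (residual \<Omega> T v z)\<^sup>2) =
    (LINT z:cylinder \<Omega> T|lborel. ((laplacian \<Omega> T v z)\<^sup>2 + (time_derivative \<Omega> T v z)\<^sup>2) - 2 * (time_derivative \<Omega> T v z * laplacian \<Omega> T v z))"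
    by (simp add: residual_def power2_diff algebra_simps)
  also have "\<dots> = (LINT z:cylinder \<Omega> T|lborel. (laplacian \<Omega> T v z)\<^sup>2 + (time_derivative \<Omega> T v z)\<^sup>2) -
     (LINT z:cylinder \<Omega> T|lborel. 2 * (time_derivative \<Omega> T v z * laplacian \<Omega> T v z))"
    by (rule set_integral_diff(2)[OF set_integral_add(1)[OF L2_square[OF l] L2_square[OF t]] set_integrable_mult_right[OF L2_mult[OF t l]]])
  finally show ?thesis
    using set_integral_add(2)[OF L2_square[OF l] L2_square[OF t]] V0_norm_square[OF assms] by simp
qed

text \<open>The energy inequality gives the cross term in the expanded square the favourable sign,
  so stability holds with constant 1.\<close>

lemma V0_norm_le_residual:
  assumes "0 < T" "open \<Omega>" "v \<in> V0 \<Omega> T"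
  shows "(V0_norm \<Omega> T v)\<^sup>2 \<le> (LINT z:cylinder \<Omega> T|lborel. (residual \<Omega> T v z)\<^sup>2)"
  using residual_square[OF assms(3)] energy_inequality[OF assms] by simp

text \<open>From (a - b)^2 \<le> 2 (a^2 + b^2); this 2 becomes the \<surd>2 of the error
  estimate.\<close>

lemma residual_le_V0_norm:
  assumes v: "v \<in> V0 \<Omega> T"
  shows "(LINT z:cylinder \<Omega> T|lborel. (residual \<Omega> T v z)\<^sup>2) \<le> 2 * (V0_norm \<Omega> T v)\<^sup>2"
proof -
  note t = time_derivative_props(1)[OF v] and l = laplacian_L2[OF v]
  have "(LINT z:cylinder \<Omega> T|lborel. (residual \<Omega> T v z)\<^sup>2) \<le>
     (LINT z:cylinder \<Omega> T|lborel. 2 * ((laplacian \<Omega> T v z)\<^sup>2 + (time_derivative \<Omega> T v z)\<^sup>2))"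
  proof (rule set_integral_mono[OF L2_square[OF residual_L2[OF v]] set_integrable_mult_right[OF set_integral_add(1)[OF L2_square[OF l] L2_square[OF t]]]])
    fix z
    show "(residual \<Omega> T v z)\<^sup>2 \<le> 2 * ((laplacian \<Omega> T v z)\<^sup>2 + (time_derivative \<Omega> T v z)\<^sup>2)"
      using zero_le_power2[of "time_derivative \<Omega> T v z + laplacian \<Omega> T v z"]
      by (simp add: residual_def power2_eq_square algebra_simps)
  qed
  then show ?thesis
    using set_integral_add(2)[OF L2_square[OF l] L2_square[OF t]] V0_norm_square[OF v]
    unfolding set_integral_mult_right by simp
qed

text \<open>Norm 0 makes the time derivative vanish almost everywhere, and v is the time primitive
  of that derivative with zero initial value.\<close>

lemma V0_norm_zero:
  assumes T: "0 < T" and \<Omega>: "open \<Omega>" and v: "v \<in> V0 \<Omega> T" and 0: "V0_norm \<Omega> T v = 0"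
  shows "AE z in lborel. z \<in> cylinder \<Omega> T \<longrightarrow> v z = 0"
proof -
  let ?w = "\<lambda>z. indicator (cylinder \<Omega> T) z * time_derivative \<Omega> T v z"
  note t = time_derivative_props[OF v]
  have "(LINT z:cylinder \<Omega> T|lborel. (time_derivative \<Omega> T v z)\<^sup>2) = 0"
    using V0_norm_square[OF v] 0 by (simp add: set_lebesgue_integral_def add_nonneg_eq_0_iff)
  moreover have "(\<lambda>z. (?w z)\<^sup>2) = (\<lambda>z. indicator (cylinder \<Omega> T) z *\<^sub>R (time_derivative \<Omega> T v z)\<^sup>2)"
    by (auto simp: indicator_def fun_eq_iff)
  ultimately have "(LINT z|lborel. (?w z)\<^sup>2) = 0"
    by (simp only: set_lebesgue_integral_def)
  then have "AE z in lborel. (?w z)\<^sup>2 = 0"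
    using integral_nonneg_eq_0_iff_AE[of lborel "\<lambda>z. (?w z)\<^sup>2"] sqint_cylinder[OF t(1)] by (simp add: sqint_def)
  then have "AE z in lborel. ?w z = 0" by simp
  then have "AE x in lborel. AE s in lborel. ?w (x, s) = 0" by (rule AE_slice_fst)
  then have "AE x in lborel. \<forall>r. time_primitive ?w (x, r) = 0"
  proof eventually_elim
    case (elim x)
    show ?case
    proof
      fix r
      have "AE s in lborel. (if s < r then ?w (x, s) else 0) = 0" using elim by eventually_elim simp
      then show "time_primitive ?w (x, r) = 0"
        unfolding time_primitive_def fst_conv snd_conv by (rule integral_eq_zero_AE)
    qed
  qed
  then have "AE z in lborel. \<forall>r. time_primitive ?w (fst (z :: 'a \<times> real), r) = 0" by (rule AE_fst_lift)
  moreover have "AE z in lborel. z \<in> cylinder \<Omega> T \<longrightarrow> v z = time_primitive ?w z"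
    using weak_time_derivative_primitive[OF T \<Omega> V0_L2[OF v] t] v by (simp add: V0_def)
  ultimately show ?thesis
  proof eventually_elim
    case (elim z)
    then show ?case by (metis prod.collapse)
  qed
qed

section \<open>Galerkin approximation in a subspace\<close>

text \<open>Containing 0 and being closed under u + c v makes X a linear subspace. The equivalence
  of the two problems and the error estimate hold at this generality; finite dimension enters only
  for existence.\<close>

locale galerkin =
  fixes \<Omega> :: "'a::euclidean_space set" and T :: real and X :: "('a \<times> real \<Rightarrow> real) set"
  assumes T: "0 < T" and \<Omega>: "open \<Omega>" and X_V0: "X \<subseteq> V0 \<Omega> T"
    and X_zero: "(\<lambda>z. 0) \<in> X" and X_lin: "\<And>u v c. u \<in> X \<Longrightarrow> v \<in> X \<Longrightarrow> (\<lambda>z. u z + c * v z) \<in> X"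
begin

abbreviation R where "R \<equiv> residual \<Omega> T"
abbreviation ip :: "('a \<times> real \<Rightarrow> real) \<Rightarrow> ('a \<times> real \<Rightarrow> real) \<Rightarrow> real" where "ip f g \<equiv> (LINT z:cylinder \<Omega> T|lborel. f z * g z)"

lemma X_diff: "u \<in> X \<Longrightarrow> v \<in> X \<Longrightarrow> (\<lambda>z. u z - v z) \<in> X"
  using X_lin[of u v "-1"] by simp

lemma RX: "v \<in> X \<Longrightarrow> R v \<in> L2 (cylinder \<Omega> T)"
  using residual_L2 X_V0 by blast

lemma ip_commute: "ip f g = ip g f"
proof -
  have "(\<lambda>z. f z * g z) = (\<lambda>z. g z * f z)" by (auto simp: mult.commute)
  then show ?thesis by (simp only:)
qed

lemma ip_R_lin: "u \<in> V0 \<Omega> T \<Longrightarrow> v \<in> V0 \<Omega> T \<Longrightarrow> h \<in> L2 (cylinder \<Omega> T) \<Longrightarrow> ip (R (\<lambda>z. u z + c * v z)) h = ip (R u) h + c * ip (R v) h"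
  by (rule residual_integral_lin[OF T \<Omega>])

lemma ip_square_nonneg: "0 \<le> ip f f"
  unfolding set_lebesgue_integral_def by (rule Bochner_Integration.integral_nonneg) simp

lemma ip_R_square:
  assumes u: "u \<in> V0 \<Omega> T" and v: "v \<in> V0 \<Omega> T"
  shows "ip (R (\<lambda>z. u z + c * v z)) (R (\<lambda>z. u z + c * v z)) = ip (R u) (R u) + 2 * c * ip (R u) (R v) + c\<^sup>2 * ip (R v) (R v)"
proof -
  note l = residual_L2[OF V0_lin[OF T \<Omega> u v]] residual_L2[OF u] residual_L2[OF v]
  have "ip (R (\<lambda>z. u z + c * v z)) (R (\<lambda>z. u z + c * v z)) = ip (R (\<lambda>z. u z + c * v z)) (R u) + c * ip (R (\<lambda>z. u z + c * v z)) (R v)"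
    unfolding ip_R_lin[OF u v l(1)] by (simp add: ip_commute)
  then show ?thesis
    unfolding ip_R_lin[OF u v l(2)] ip_R_lin[OF u v l(3)]
    by (simp add: ip_commute[of "R v" "R u"] algebra_simps power2_eq_square)
qed

lemma variational_solution_iff:
  assumes f: "f \<in> L2 (cylinder \<Omega> T)"
  shows "variational_solution \<Omega> T f X u \<longleftrightarrow> u \<in> X \<and> (\<forall>v\<in>X. ip (R u) (R v) = ip f (R v))"
proof -
  have "form_A \<Omega> T u v = ip (R u) (R v)" "form_F \<Omega> T f v = ip f (R v)" if "u \<in> X" "v \<in> X" for v
    using form_A_residual[of u \<Omega> T v] form_F_residual[OF f, of v] that X_V0 by auto
  then show ?thesis unfolding variational_solution_def by auto
qed

lemma ls_functional_eq:
  assumes f: "f \<in> L2 (cylinder \<Omega> T)" and u: "u \<in> V0 \<Omega> T"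
  shows "ls_functional \<Omega> T f u = 1 / 2 * (ip (R u) (R u) - 2 * ip f (R u) + ip f f)"
proof -
  note l = residual_L2[OF u]
  have "(L2_norm (cylinder \<Omega> T) (\<lambda>z. R u z - f z))\<^sup>2 =
    (LINT z:cylinder \<Omega> T|lborel. (R u z * R u z - 2 * (f z * R u z)) + f z * f z)"
    unfolding L2_norm_square by (simp add: power2_eq_square algebra_simps)
  also have "\<dots> = ip (R u) (R u) - 2 * ip f (R u) + ip f f"
    using set_integral_add(2)[OF set_integral_diff(1)[OF L2_mult[OF l l] set_integrable_mult_right[OF L2_mult[OF f l], of 2]] L2_mult[OF f f]]
      set_integral_diff(2)[OF L2_mult[OF l l] set_integrable_mult_right[OF L2_mult[OF f l], of 2]]
    by simp
  finally show ?thesis by (simp add: ls_functional_def residual_def)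
qed

text \<open>The exact second-order expansion in direction v: the linear coefficient is the defect in
  the variational equation, and the quadratic one is nonnegative.\<close>

lemma ls_functional_lin:
  assumes f: "f \<in> L2 (cylinder \<Omega> T)" and uv: "u \<in> V0 \<Omega> T" "v \<in> V0 \<Omega> T"
  shows "ls_functional \<Omega> T f (\<lambda>z. u z + c * v z) =
    ls_functional \<Omega> T f u + c * (ip (R u) (R v) - ip f (R v)) + c\<^sup>2 / 2 * ip (R v) (R v)"
proof -
  have "ip f (R (\<lambda>z. u z + c * v z)) = ip f (R u) + c * ip f (R v)"
    using ip_R_lin[OF uv f, of c] by (simp add: ip_commute)
  then show ?thesis
    unfolding ls_functional_eq[OF f uv(1)] ls_functional_eq[OF f V0_lin[OF T \<Omega> uv]] ip_R_square[OF uv]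
    by (simp add: algebra_simps)
qed

lemma arg_min_iff_variational:
  assumes f: "f \<in> L2 (cylinder \<Omega> T)"
  shows "is_arg_min (ls_functional \<Omega> T f) (\<lambda>v. v \<in> X) u \<longleftrightarrow> variational_solution \<Omega> T f X u"
proof
  assume min: "is_arg_min (ls_functional \<Omega> T f) (\<lambda>v. v \<in> X) u"
  then have u: "u \<in> X" and le: "\<And>v. v \<in> X \<Longrightarrow> ls_functional \<Omega> T f u \<le> ls_functional \<Omega> T f v"
    by (auto simp: is_arg_min_linorder)
  have "ip (R u) (R v) = ip f (R v)" if v: "v \<in> X" for v
  proof -
    define p r where "p = ip (R u) (R v) - ip f (R v)" and "r = ip (R v) (R v)"
    have r: "0 \<le> r" unfolding r_def by (rule ip_square_nonneg)
    have V: "u \<in> V0 \<Omega> T" "v \<in> V0 \<Omega> T" using u v X_V0 by auto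
    have ineq: "0 \<le> c * p + c\<^sup>2 / 2 * r" for c
      using le[OF X_lin[OF u v, of c]] unfolding ls_functional_lin[OF f V] p_def r_def by linarith
    \<comment> \<open>The step c = -p k is a descent step short enough for the linear gain to
      outweigh the quadratic term; the summand 1 covers r = 0.\<close>
    define k where "k = 1 / (r + 1)"
    have k: "0 < k" "k * r < 1" using r by (auto simp: k_def)
    have "0 \<le> (- (p * k)) * p + (- (p * k))\<^sup>2 / 2 * r" by (rule ineq)
    also have "\<dots> = p\<^sup>2 * (k * (k * r / 2 - 1))" by (simp add: power2_eq_square algebra_simps)
    finally have "0 \<le> p\<^sup>2 * (k * (k * r / 2 - 1))" .
    have "k * (k * r / 2 - 1) < 0" using k by (intro mult_pos_neg) auto
    then have "p = 0"
      using \<open>0 \<le> p\<^sup>2 * (k * (k * r / 2 - 1))\<close> mult_pos_neg[of "p\<^sup>2" "k * (k * r / 2 - 1)"] by fastforce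
    then show ?thesis by (simp add: p_def)
  qed
  then show "variational_solution \<Omega> T f X u" using u variational_solution_iff[OF f] by blast
next
  assume "variational_solution \<Omega> T f X u"
  from variational_solution_iff[OF f, THEN iffD1, OF this]
  have *: "u \<in> X \<and> (\<forall>v\<in>X. ip (R u) (R v) = ip f (R v))" .
  then have u: "u \<in> X" by (rule conjunct1)
  have eq: "ip (R u) (R v) = ip f (R v)" if "v \<in> X" for v using * that by auto
  have "ls_functional \<Omega> T f u \<le> ls_functional \<Omega> T f v" if v: "v \<in> X" for v
  proof -
    have d: "(\<lambda>z. v z - u z) \<in> X" by (rule X_diff[OF v u])
    have "ls_functional \<Omega> T f v = ls_functional \<Omega> T f (\<lambda>z. u z + 1 * (v z - u z))" by simp
    also have "\<dots> = ls_functional \<Omega> T f u + 1 / 2 * ip (R (\<lambda>z. v z - u z)) (R (\<lambda>z. v z - u z))"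
      using ls_functional_lin[OF f, of u "\<lambda>z. v z - u z" 1] u d X_V0 eq[OF d] by auto
    finally show ?thesis using ip_square_nonneg[of "R (\<lambda>z. v z - u z)"] by simp
  qed
  then show "is_arg_min (ls_functional \<Omega> T f) (\<lambda>v. v \<in> X) u"
    using u by (simp add: is_arg_min_linorder)
qed

text \<open>The form is symmetric, so Pythagoras applies: u - vh is the sum of the error u - uh and
  the discrete difference uh - vh, which are orthogonal in the residual inner product. The error is
  therefore the shorter one in the residual norm, and only the square root of the continuity
  constant 2 remains.\<close>

lemma Cea:
  assumes f: "f \<in> L2 (cylinder \<Omega> T)" and uh: "variational_solution \<Omega> T f X uh"
    and u: "variational_solution \<Omega> T f (V0 \<Omega> T) u" and vh: "vh \<in> X"
  shows "V0_norm \<Omega> T (\<lambda>z. u z - uh z) \<le> sqrt 2 * V0_norm \<Omega> T (\<lambda>z. u z - vh z)"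
proof -
  let ?w = "\<lambda>z. u z - uh z" and ?d = "\<lambda>z. uh z - vh z" and ?e = "\<lambda>z. u z - vh z"
  have uhX: "uh \<in> X" and uV: "u \<in> V0 \<Omega> T" using uh u by (auto simp: variational_solution_def)
  have d: "?d \<in> X" by (rule X_diff[OF uhX vh])
  have V: "uh \<in> V0 \<Omega> T" "vh \<in> V0 \<Omega> T" "?d \<in> V0 \<Omega> T" using uhX vh d X_V0 by auto
  have w: "?w \<in> V0 \<Omega> T" using V0_lin[OF T \<Omega> uV V(1), of "-1"] by simp
  have e: "?e \<in> V0 \<Omega> T" using V0_lin[OF T \<Omega> uV V(2), of "-1"] by simp
  have "form_A \<Omega> T u ?d = form_F \<Omega> T f ?d" using u V(3) by (simp add: variational_solution_def)
  moreover have "form_A \<Omega> T uh ?d = form_F \<Omega> T f ?d" using uh d by (simp add: variational_solution_def)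
  ultimately have "ip (R u) (R ?d) = ip (R uh) (R ?d)"
    using form_A_residual[OF uV V(3)] form_A_residual[OF V(1,3)] by simp
  then have orth: "ip (R ?w) (R ?d) = 0"
    using ip_R_lin[OF uV V(1) residual_L2[OF V(3)], of "-1"] by simp
  have "(V0_norm \<Omega> T ?w)\<^sup>2 \<le> ip (R ?w) (R ?w)"
    using V0_norm_le_residual[OF T \<Omega> w] by (simp add: power2_eq_square)
  also have "\<dots> \<le> ip (R (\<lambda>z. ?w z + 1 * ?d z)) (R (\<lambda>z. ?w z + 1 * ?d z))"
    unfolding ip_R_square[OF w V(3)] using orth ip_square_nonneg[of "R ?d"] by simp
  also have "\<dots> = ip (R ?e) (R ?e)" by simp
  also have "\<dots> \<le> 2 * (V0_norm \<Omega> T ?e)\<^sup>2"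
    using residual_le_V0_norm[OF e] by (simp add: power2_eq_square)
  finally have "(V0_norm \<Omega> T ?w)\<^sup>2 \<le> (sqrt 2 * V0_norm \<Omega> T ?e)\<^sup>2" by (simp add: power_mult_distrib)
  then show ?thesis by (rule power2_le_imp_le) (simp add: V0_norm_nonneg)
qed

text \<open>The difference of two solutions is orthogonal to itself in the residual inner product,
  so stability makes its norm 0. Equality as functions depends on the concrete space X.\<close>

lemma variational_solution_unique_AE:
  assumes f: "f \<in> L2 (cylinder \<Omega> T)" and u: "variational_solution \<Omega> T f X u" "variational_solution \<Omega> T f X v"
  shows "AE z in lborel. z \<in> cylinder \<Omega> T \<longrightarrow> u z = v z"
proof -
  let ?d = "\<lambda>z. u z - v z"
  have uv: "u \<in> X" "v \<in> X" using u by (auto simp: variational_solution_def)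
  have d: "?d \<in> X" by (rule X_diff[OF uv])
  have V: "u \<in> V0 \<Omega> T" "v \<in> V0 \<Omega> T" "?d \<in> V0 \<Omega> T" using uv d X_V0 by auto
  have "ip (R u) (R ?d) = ip (R v) (R ?d)"
    using u d variational_solution_iff[OF f] by simp
  then have "ip (R ?d) (R ?d) = 0"
    using ip_R_lin[OF V(1,2) residual_L2[OF V(3)], of "-1"] by simp
  then have "(V0_norm \<Omega> T ?d)\<^sup>2 \<le> 0"
    using V0_norm_le_residual[OF T \<Omega> V(3)] by (simp add: power2_eq_square)
  then have "V0_norm \<Omega> T ?d = 0" by simp
  from V0_norm_zero[OF T \<Omega> V(3) this] show ?thesis by simp
qed

end

text \<open>By induction on the number of spanning functions: enlarging the
  span by one function enlarges the subspace by at most one direction \<open>e\<close>.\<close>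

lemma galerkin_exists:
  fixes b :: "'i \<Rightarrow> 'a::euclidean_space \<times> real \<Rightarrow> real"
  assumes "finite I" "galerkin \<Omega> T X" "X \<subseteq> fun_span I b" "g \<in> L2 (cylinder \<Omega> T)"
  shows "\<exists>u\<in>X. \<forall>v\<in>X. (LINT z:cylinder \<Omega> T|lborel. residual \<Omega> T u z * residual \<Omega> T v z) =
      (LINT z:cylinder \<Omega> T|lborel. g z * residual \<Omega> T v z)"
  using assms
proof (induction I arbitrary: X g rule: finite_induct)
  case empty
  interpret galerkin \<Omega> T X by fact
  have X0: "v = (\<lambda>z. 0)" if "v \<in> X" for v using that empty(2) by (auto simp: fun_span_def)
  have "ip h (R v) = 0" if "v \<in> X" "h \<in> L2 (cylinder \<Omega> T)" for v h
    using ip_R_lin[of v v h "-1"] that X_V0 X0[OF that(1)] by (auto simp: ip_commute)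
  then show ?case using X_zero RX empty(3) by (intro bexI[of _ "\<lambda>z. 0"]) auto
next
  case (insert i I)
  interpret galerkin \<Omega> T X by fact
  define Y where "Y = X \<inter> fun_span I b"
  interpret Y: galerkin \<Omega> T Y
  proof
    show "Y \<subseteq> V0 \<Omega> T" using X_V0 by (auto simp: Y_def)
    show "(\<lambda>z. 0) \<in> Y" using X_zero by (auto simp: Y_def fun_span_def intro!: image_eqI[of _ _ "\<lambda>_. 0"])
    fix u v c assume uv: "u \<in> Y" "v \<in> Y"
    then obtain c1 c2 where c: "u = (\<lambda>x. \<Sum>i\<in>I. c1 i * b i x)" "v = (\<lambda>x. \<Sum>i\<in>I. c2 i * b i x)"
      by (auto simp: Y_def fun_span_def)
    have "(\<lambda>z. u z + c * v z) = (\<lambda>x. \<Sum>i\<in>I. (c1 i + c * c2 i) * b i x)"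
      unfolding c by (auto simp: fun_eq_iff sum.distrib sum_distrib_left algebra_simps)
    then have "(\<lambda>z. u z + c * v z) \<in> fun_span I b"
      unfolding fun_span_def by (rule range_eqI[of _ _ "\<lambda>i. c1 i + c * c2 i"])
    then show "(\<lambda>z. u z + c * v z) \<in> Y" using uv X_lin by (auto simp: Y_def)
  qed (rule T, rule \<Omega>)
  have IH: "\<exists>u\<in>Y. \<forall>v\<in>Y. ip (R u) (R v) = ip g (R v)" if "g \<in> L2 (cylinder \<Omega> T)" for g
    by (rule insert.IH[OF Y.galerkin_axioms _ that]) (simp add: Y_def)
  show ?case
  proof (cases "X = Y")
    case True
    then show ?thesis using IH[OF insert.prems(3)] by blast
  next
    case False
    then obtain e where e: "e \<in> X" "e \<notin> fun_span I b" by (auto simp: Y_def)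
    obtain ce where ce: "e = (\<lambda>x. \<Sum>j\<in>insert i I. ce j * b j x)"
      using e(1) insert.prems(2) by (auto simp: fun_span_def)
    have ce0: "ce i \<noteq> 0"
    proof
      assume "ce i = 0"
      then have "e = (\<lambda>x. \<Sum>j\<in>I. ce j * b j x)" using ce insert.hyps by simp
      then show False using e(2) by (auto simp: fun_span_def)
    qed
    \<comment> \<open>The multiple of e is chosen to cancel the coefficient of the new function
      \<open>b i\<close>.\<close>
    have split: "\<exists>c. (\<lambda>z. v z + c * e z) \<in> Y" if v: "v \<in> X" for v
    proof -
      obtain cv where cv: "v = (\<lambda>x. \<Sum>j\<in>insert i I. cv j * b j x)"
        using v insert.prems(2) by (auto simp: fun_span_def)
      let ?c = "- cv i / ce i"
      have "v z + ?c * e z = (\<Sum>j\<in>I. (cv j + ?c * ce j) * b j z)" for z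
      proof -
        have "v z + ?c * e z = (\<Sum>j\<in>insert i I. (cv j + ?c * ce j) * b j z)"
          unfolding cv ce by (simp only: distrib_right sum.distrib sum_distrib_left mult.assoc)
        also have "\<dots> = (\<Sum>j\<in>I. (cv j + ?c * ce j) * b j z)"
          using insert.hyps ce0 by simp
        finally show ?thesis .
      qed
      then have "(\<lambda>z. v z + ?c * e z) \<in> fun_span I b"
        unfolding fun_span_def by (intro image_eqI[of _ _ "\<lambda>j. cv j + ?c * ce j"]) auto
      then show ?thesis using X_lin[OF v e(1)] unfolding Y_def by blast
    qed
    obtain p where p: "p \<in> Y" "\<And>v. v \<in> Y \<Longrightarrow> ip (R p) (R v) = ip (R e) (R v)"
      using IH[OF RX[OF e(1)]] by blast
    obtain u0 where u0: "u0 \<in> Y" "\<And>v. v \<in> Y \<Longrightarrow> ip (R u0) (R v) = ip g (R v)"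
      using IH[OF insert.prems(3)] by blast
    have YX: "Y \<subseteq> X" by (auto simp: Y_def)
    \<comment> \<open>A Gram-Schmidt step in the residual inner product: e minus its projection onto
      Y.\<close>
    define q where "q = (\<lambda>z. e z + (-1) * p z)"
    have q: "q \<in> X" unfolding q_def using e(1) p(1) YX by (intro X_lin) auto
    have inV: "v \<in> V0 \<Omega> T" if "v \<in> X" for v using that X_V0 by blast
    have q_orth: "ip (R q) (R v) = 0" if "v \<in> Y" for v
      unfolding q_def using ip_R_lin[OF inV[OF e(1)] inV[of p] RX[of v], of "-1"] p that YX by auto
    define s t where "s = ip (R q) (R q)" and "t = ip g (R q)"
    \<comment> \<open>If s = 0, then the residual of q has norm 0, so t = 0 by Cauchy-Schwarz, and
      the default value 0 of t / 0 is the right coefficient.\<close>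
    have st: "t / s * s = t"
    proof (cases "s = 0")
      case True
      then have "L2_norm (cylinder \<Omega> T) (R q) = 0"
        by (simp add: s_def L2_norm_def power2_eq_square)
      then show ?thesis using L2_Cauchy_Schwarz[OF insert.prems(3) RX[OF q]] by (simp add: t_def)
    qed simp
    define u where "u = (\<lambda>z. u0 z + t / s * q z)"
    have u: "u \<in> X" unfolding u_def using u0(1) YX q by (intro X_lin) auto
    have "ip (R u) (R v) = ip g (R v)" if v: "v \<in> X" for v
    proof -
      obtain c where c: "(\<lambda>z. v z + c * e z) \<in> Y" using split[OF v] by blast
      \<comment> \<open>Then v = y - c q with y in Y, so testing with v reduces to testing with Y
        and with q.\<close>
      define y where "y = (\<lambda>z. (v z + c * e z) + (- c) * p z)"
      have y: "y \<in> Y" unfolding y_def by (rule Y.X_lin[OF c p(1)])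
      have vy: "v = (\<lambda>z. y z + (- c) * q z)" by (auto simp: y_def q_def fun_eq_iff algebra_simps)
      have yX: "y \<in> X" using y YX by blast
      have lin: "ip h (R v) = ip h (R y) + (- c) * ip h (R q)" if "h \<in> L2 (cylinder \<Omega> T)" for h
        using ip_R_lin[OF inV[OF yX] inV[OF q] that, of "- c"] unfolding vy[symmetric] by (simp add: ip_commute)
      have u0X: "u0 \<in> X" using u0(1) YX by blast
      have 1: "ip (R u) (R y) = ip g (R y)"
        unfolding u_def ip_R_lin[OF inV[OF u0X] inV[OF q] RX[OF yX]] using u0(2)[OF y] q_orth[OF y] by simp
      have 2: "ip (R u) (R q) = t"
        unfolding u_def ip_R_lin[OF inV[OF u0X] inV[OF q] RX[OF q]] ip_commute[of "R u0" "R q"] q_orth[OF u0(1)]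
          s_def[symmetric] st by simp
      show ?thesis using lin[OF RX[OF u]] lin[OF insert.prems(3)] 1 2 by (simp add: t_def)
    qed
    then show ?thesis using u by blast
  qed
qed

section \<open>Weak derivatives of locally Lipschitz functions\<close>

text \<open>Increments in a single direction, bounded uniformly on compact sets: exactly the
  domination that difference quotients of u require under an integral against a test
  function.\<close>

definition directionally_Lipschitz :: "'a::euclidean_space set \<Rightarrow> 'a \<Rightarrow> ('a \<Rightarrow> real) \<Rightarrow> bool" where
  "directionally_Lipschitz U b u \<longleftrightarrow> (\<forall>K. compact K \<and> K \<subseteq> U \<longrightarrow>
     (\<exists>L \<delta>. 0 < \<delta> \<and> (\<forall>x\<in>K. \<forall>h. \<bar>h\<bar> < \<delta> \<longrightarrow> \<bar>u (x + h *\<^sub>R b) - u x\<bar> \<le> L * \<bar>h\<bar>)))"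

lemma line_derivative:
  assumes "v differentiable (at (x + t *\<^sub>R b))"
  shows "((\<lambda>t. v (x + t *\<^sub>R b)) has_real_derivative dpartial b v (x + t *\<^sub>R b)) (at t)"
proof -
  have d: "(v has_derivative frechet_derivative v (at (x + t *\<^sub>R b))) (at (x + t *\<^sub>R b))"
    using assms frechet_derivative_works by blast
  have l: "((\<lambda>t. x + t *\<^sub>R b) has_derivative (\<lambda>h. h *\<^sub>R b)) (at t)"
    by (auto intro!: derivative_eq_intros)
  have "((\<lambda>t. v (x + t *\<^sub>R b)) has_derivative (\<lambda>h. frechet_derivative v (at (x + t *\<^sub>R b)) (h *\<^sub>R b))) (at t)"
    by (rule has_derivative_compose[OF l d])
  moreover have "frechet_derivative v (at (x + t *\<^sub>R b)) (h *\<^sub>R b) = dpartial b v (x + t *\<^sub>R b) * h" for h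
    using linear_cmul[OF has_derivative_linear[OF d], of h b] by (simp add: dpartial_def)
  ultimately show ?thesis by (simp add: has_field_derivative_def)
qed

lemma difference_quotient_tendsto:
  assumes "v differentiable (at x)"
  shows "((\<lambda>h. (v (x + h *\<^sub>R b) - v x) / h) \<longlongrightarrow> dpartial b v x) (at 0)"
  using line_derivative[of v x 0 b] assms by (simp add: has_field_derivative_iff)

lemma compact_thickening:
  assumes "compact K" "open U" "K \<subseteq> (U :: 'a::euclidean_space set)"
  obtains e where "0 < e" "compact {x + y | x y. x \<in> K \<and> y \<in> cball 0 e}" "{x + y | x y. x \<in> K \<and> y \<in> cball 0 e} \<subseteq> U"
proof -
  obtain e where e: "e > 0" "(\<Union>x\<in>K. cball x e) \<subseteq> U"
    using compact_subset_open_imp_cball_epsilon_subset[OF assms] by blast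
  have "{x + y | x y. x \<in> K \<and> y \<in> cball 0 e} \<subseteq> (\<Union>x\<in>K. cball x e)"
    by (auto simp: dist_norm)
  then show thesis using e compact_sums[OF assms(1) compact_cball[of 0 e]] that by auto
qed

lemma mem_thickening: "x \<in> K \<Longrightarrow> norm y \<le> e \<Longrightarrow> x + y \<in> {x + y | x y. x \<in> K \<and> y \<in> cball 0 e}"
  by auto

text \<open>The mean value theorem on segments; the thickened compact set contains these segments
  and bounds the derivative on them.\<close>

lemma directionally_Lipschitz_C1:
  assumes U: "open U" and v: "\<And>x. x \<in> U \<Longrightarrow> v differentiable (at x)" "continuous_on U (dpartial b v)"
    and b: "b \<in> Basis"
  shows "directionally_Lipschitz U b v"
  unfolding directionally_Lipschitz_def
proof (intro allI impI, elim conjE)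
  fix K assume K: "compact K" "K \<subseteq> U"
  obtain e where e: "0 < e" "compact {x + y | x y. x \<in> K \<and> y \<in> cball 0 e}" "{x + y | x y. x \<in> K \<and> y \<in> cball 0 e} \<subseteq> U"
    using compact_thickening[OF K(1) U K(2)] by blast
  define K' where "K' = {x + y | x y. x \<in> K \<and> y \<in> cball 0 e}"
  have K': "compact K'" "K' \<subseteq> U" using e by (auto simp: K'_def)
  have "bounded (dpartial b v ` K')"
    using K' v(2) by (intro compact_imp_bounded compact_continuous_image) (auto intro: continuous_on_subset)
  then obtain M where M: "\<And>x. x \<in> K' \<Longrightarrow> \<bar>dpartial b v x\<bar> \<le> M"
    unfolding bounded_real by blast
  have "\<bar>v (x + h *\<^sub>R b) - v x\<bar> \<le> M * \<bar>h\<bar>" if x: "x \<in> K" and h: "\<bar>h\<bar> < e" for x h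
  proof -
    have inK: "x + t *\<^sub>R b \<in> K'" if "t \<in> {- e<..<e}" for t
      using mem_thickening[OF x, of "t *\<^sub>R b" e] that b by (simp add: K'_def abs_le_iff)
    have "norm (v (x + h *\<^sub>R b) - v (x + 0 *\<^sub>R b)) \<le> M * norm (h - 0)"
    proof (rule field_differentiable_bound[where S = "{- e<..<e}" and f = "\<lambda>t. v (x + t *\<^sub>R b)"])
      fix t assume t: "t \<in> {- e<..<e}"
      have "v differentiable (at (x + t *\<^sub>R b))" using inK[OF t] K'(2) v(1) by blast
      then show "((\<lambda>t. v (x + t *\<^sub>R b)) has_real_derivative dpartial b v (x + t *\<^sub>R b)) (at t within {- e<..<e})"
        by (rule has_field_derivative_at_within[OF line_derivative])
      show "norm (dpartial b v (x + t *\<^sub>R b)) \<le> M" using M[OF inK[OF t]] by simp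
    qed (use h e(1) in auto)
    then show ?thesis by simp
  qed
  then show "\<exists>L \<delta>. 0 < \<delta> \<and> (\<forall>x\<in>K. \<forall>h. \<bar>h\<bar> < \<delta> \<longrightarrow> \<bar>v (x + h *\<^sub>R b) - v x\<bar> \<le> L * \<bar>h\<bar>)"
    using e(1) by blast
qed

text \<open>Integration by parts for difference quotients is translation invariance; the Lipschitz bound
  justifies the passage to the limit.\<close>

lemma weak_derivative_directionally_Lipschitz:
  assumes U: "open U" and b: "b \<in> Basis" and u: "continuous_on U u"
    and lip: "directionally_Lipschitz U b u"
    and der: "AE x in lborel. x \<in> U \<longrightarrow> ((\<lambda>h. (u (x + h *\<^sub>R b) - u x) / h) \<longlongrightarrow> w x) (at 0)"
    and w: "set_borel_measurable lborel U w"
  shows "weak_derivative U [b] u w"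
  unfolding weak_derivative_def
proof
  fix \<phi> assume p: "\<phi> \<in> test_functions U"
  obtain K where K: "compact K" "K \<subseteq> U" "\<And>x. x \<notin> K \<Longrightarrow> \<phi> x = 0"
    using p unfolding test_functions_def by auto
  obtain e where e: "0 < e" "compact {x + y | x y. x \<in> K \<and> y \<in> cball 0 e}" "{x + y | x y. x \<in> K \<and> y \<in> cball 0 e} \<subseteq> U"
    using compact_thickening[OF K(1) U K(2)] by blast
  define K' where "K' = {x + y | x y. x \<in> K \<and> y \<in> cball 0 e}"
  have K': "compact K'" "K' \<subseteq> U" using e by (auto simp: K'_def)
  have KK': "K \<subseteq> K'" unfolding K'_def using e(1) by force
  define u0 where "u0 x = indicator U x * u x" for x
  have u0m: "u0 \<in> borel_measurable borel"
    unfolding u0_def using borel_measurable_continuous_on_indicator[OF _ u] U by simp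
  have \<phi>m: "\<phi> \<in> borel_measurable borel" by (rule test_functions_measurable[OF p])
  have trans_m: "(\<lambda>x. f (x + c)) \<in> borel_measurable borel" if "f \<in> borel_measurable borel" for f :: "'a \<Rightarrow> real" and c
    by (rule measurable_compose[OF _ that]) simp
  have "bounded (u ` K')"
    using K' u by (intro compact_imp_bounded compact_continuous_image) (auto intro: continuous_on_subset)
  then obtain B where B: "\<And>x. x \<in> K' \<Longrightarrow> \<bar>u x\<bar> \<le> B" unfolding bounded_real by blast
  have B0: "\<bar>u0 x\<bar> \<le> \<bar>B\<bar>" if "x \<in> K'" for x using B[OF that] K'(2) that by (auto simp: u0_def)
  from lip[unfolded directionally_Lipschitz_def, rule_format, OF conjI[OF K(1,2)]]
  obtain L \<delta> where L0: "0 < \<delta>" "\<forall>x\<in>K. \<forall>h. \<bar>h\<bar> < \<delta> \<longrightarrow> \<bar>u (x + h *\<^sub>R b) - u x\<bar> \<le> L * \<bar>h\<bar>" by blast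
  then have L: "0 < \<delta>" "\<And>x h. x \<in> K \<Longrightarrow> \<bar>h\<bar> < \<delta> \<Longrightarrow> \<bar>u (x + h *\<^sub>R b) - u x\<bar> \<le> L * \<bar>h\<bar>" by auto
  obtain C where C: "0 < C" "\<And>x. \<bar>\<phi> x\<bar> \<le> C" using test_functions_bounded[OF p] by blast
  obtain M where M: "0 < M" "\<And>x. \<bar>dpartial b \<phi> x\<bar> \<le> M"
    using test_functions_bounded[OF test_functions_dpartial[OF p b]] by blast
  have \<phi>lip: "\<bar>\<phi> (x + h *\<^sub>R b) - \<phi> x\<bar> \<le> M * \<bar>h\<bar>" for x h
  proof -
    have "norm (\<phi> (x + h *\<^sub>R b) - \<phi> (x + 0 *\<^sub>R b)) \<le> M * norm (h - 0)"
      by (rule field_differentiable_bound[where S = UNIV and f = "\<lambda>t. \<phi> (x + t *\<^sub>R b)"])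
        (use line_derivative[OF test_functions_differentiable[OF p]] M in auto)
    then show ?thesis by simp
  qed
  \<comment> \<open>Small enough for shifts of the support to stay in the thickened set and for the
    Lipschitz bound to apply; the shift by 2 makes both inequalities strict for every n.\<close>
  define h where "h n = min e \<delta> / real (n + 2)" for n
  have h: "0 < h n" "h n < e" "h n < \<delta>" for n
  proof -
    have "min e \<delta> * 1 < min e \<delta> * real (n + 2)" using e(1) L(1) by (intro mult_strict_left_mono) auto
    then have "h n < min e \<delta>" unfolding h_def by (subst pos_divide_less_eq) simp_all
    then show "h n < e" "h n < \<delta>" by auto
    show "0 < h n" using e(1) L(1) by (simp add: h_def)
  qed
  have h_lim: "h \<longlonglongrightarrow> 0" unfolding h_def
    using LIMSEQ_ignore_initial_segment[OF lim_const_over_n[of "min e \<delta>"], of 2] by simp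
  have h_at: "filterlim h (at 0) sequentially" "filterlim (\<lambda>n. - h n) (at 0) sequentially"
    using h_lim h(1) tendsto_minus[OF h_lim] by (auto simp: filterlim_at less_imp_neq[THEN not_sym] intro!: always_eventually)
  have shift: "x \<in> K'" if "x + t *\<^sub>R b \<in> K" "\<bar>t\<bar> \<le> e" for x t
    using mem_thickening[OF that(1), of "- t *\<^sub>R b" e] that(2) b by (simp add: K'_def)
  have \<phi>shift0: "\<phi> (x + h n *\<^sub>R b) = 0" if "x \<notin> K'" for x n
    using shift[of x "h n"] K(3) h[of n] that by fastforce
  have iT: "integrable lborel (\<lambda>x. u0 x * \<phi> (x + h n *\<^sub>R b))" for n
  proof (rule integrable_compact_support[OF _ K'(1), where B = "\<bar>B\<bar> * C"])
    show "(\<lambda>x. u0 x * \<phi> (x + h n *\<^sub>R b)) \<in> borel_measurable borel"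
      by (intro borel_measurable_times u0m trans_m \<phi>m)
    fix x show "x \<notin> K' \<Longrightarrow> u0 x * \<phi> (x + h n *\<^sub>R b) = 0" using \<phi>shift0 by simp
    show "\<bar>u0 x * \<phi> (x + h n *\<^sub>R b)\<bar> \<le> \<bar>B\<bar> * C"
      using B0[of x] C \<phi>shift0[of x n] by (cases "x \<in> K'") (auto simp: abs_mult intro!: mult_mono)
  qed
  have i0: "integrable lborel (\<lambda>x. u0 x * \<phi> x)"
  proof (rule integrable_compact_support[OF _ K(1), where B = "\<bar>B\<bar> * C"])
    show "(\<lambda>x. u0 x * \<phi> x) \<in> borel_measurable borel" by (intro borel_measurable_times u0m \<phi>m)
    fix x show "x \<notin> K \<Longrightarrow> u0 x * \<phi> x = 0" using K(3) by simp
    show "\<bar>u0 x * \<phi> x\<bar> \<le> \<bar>B\<bar> * C"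
      using B0[of x] C K(3)[of x] KK' by (cases "x \<in> K") (auto simp: abs_mult intro!: mult_mono)
  qed
  have iS: "integrable lborel (\<lambda>x. u0 (x - h n *\<^sub>R b) * \<phi> x)"
    and eqS: "(LINT x|lborel. u0 (x - h n *\<^sub>R b) * \<phi> x) = (LINT x|lborel. u0 x * \<phi> (x + h n *\<^sub>R b))" for n
    using integrable_translate[OF iT[of n], of "- (h n *\<^sub>R b)"]
      integral_translate[of "\<lambda>x. u0 x * \<phi> (x + h n *\<^sub>R b)" "- (h n *\<^sub>R b)"] iT[of n] by auto
  \<comment> \<open>Integration by parts for increments: translating the variable moves the shift
    from \<phi> to \<open>u0\<close>, with the opposite sign.\<close>
  have parts: "(LINT x|lborel. u0 x * ((\<phi> (x + h n *\<^sub>R b) - \<phi> x) / h n)) =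
      (LINT x|lborel. ((u0 (x - h n *\<^sub>R b) - u0 x) / h n) * \<phi> x)" for n
  proof -
    have "(LINT x|lborel. u0 x * ((\<phi> (x + h n *\<^sub>R b) - \<phi> x) / h n)) =
        (LINT x|lborel. (u0 x * \<phi> (x + h n *\<^sub>R b) - u0 x * \<phi> x) / h n)"
      by (simp add: right_diff_distrib)
    also have "\<dots> = ((LINT x|lborel. u0 x * \<phi> (x + h n *\<^sub>R b)) - (LINT x|lborel. u0 x * \<phi> x)) / h n"
      using iT[of n] i0 by simp
    also have "\<dots> = ((LINT x|lborel. u0 (x - h n *\<^sub>R b) * \<phi> x) - (LINT x|lborel. u0 x * \<phi> x)) / h n"
      by (simp only: eqS)
    also have "\<dots> = (LINT x|lborel. (u0 (x - h n *\<^sub>R b) * \<phi> x - u0 x * \<phi> x) / h n)"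
      using iS[of n] i0 by simp
    also have "\<dots> = (LINT x|lborel. ((u0 (x - h n *\<^sub>R b) - u0 x) / h n) * \<phi> x)"
      by (simp add: left_diff_distrib)
    finally show ?thesis .
  qed
  have indK: "integrable lborel (\<lambda>x. c * indicator S x)" if "compact S" for S :: "'a set" and c :: real
    using emeasure_bounded_finite[OF compact_imp_bounded[OF that]] compact_imp_closed[OF that]
    by (intro integrable_mult_right integrable_real_indicator) auto
  have lim_left: "(\<lambda>n. LINT x|lborel. u0 x * ((\<phi> (x + h n *\<^sub>R b) - \<phi> x) / h n)) \<longlonglongrightarrow> (LINT x|lborel. u0 x * dpartial b \<phi> x)"
  proof (rule integral_dominated_convergence[where w = "\<lambda>x. (\<bar>B\<bar> * M) * indicator K' x"])
    show "(\<lambda>x. u0 x * dpartial b \<phi> x) \<in> borel_measurable lborel"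
      using u0m test_functions_measurable[OF test_functions_dpartial[OF p b]] by simp
    show "(\<lambda>x. u0 x * ((\<phi> (x + h n *\<^sub>R b) - \<phi> x) / h n)) \<in> borel_measurable lborel" for n
      using u0m trans_m[OF \<phi>m] \<phi>m by simp
    show "AE x in lborel. (\<lambda>n. u0 x * ((\<phi> (x + h n *\<^sub>R b) - \<phi> x) / h n)) \<longlonglongrightarrow> u0 x * dpartial b \<phi> x"
      by (intro AE_I2 tendsto_mult tendsto_const filterlim_compose[OF difference_quotient_tendsto[OF test_functions_differentiable[OF p]] h_at(1)])
    show "AE x in lborel. norm (u0 x * ((\<phi> (x + h n *\<^sub>R b) - \<phi> x) / h n)) \<le> (\<bar>B\<bar> * M) * indicator K' x" for n
    proof (rule AE_I2)
      fix x
      show "norm (u0 x * ((\<phi> (x + h n *\<^sub>R b) - \<phi> x) / h n)) \<le> (\<bar>B\<bar> * M) * indicator K' x"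
      proof (cases "x \<in> K'")
        case True
        have "\<bar>(\<phi> (x + h n *\<^sub>R b) - \<phi> x) / h n\<bar> \<le> M"
          using \<phi>lip[of x "h n"] h(1)[of n] by (simp add: abs_divide pos_divide_le_eq)
        from mult_mono[OF B0[OF True] this abs_ge_zero abs_ge_zero] show ?thesis
          using True by (simp add: abs_mult)
      next
        case False
        then show ?thesis using \<phi>shift0[of x n] K(3)[of x] KK' by auto
      qed
    qed
  qed (rule indK[OF K'(1)])
  have wm: "(\<lambda>x. indicator U x * w x) \<in> borel_measurable borel" using w by (simp add: set_borel_measurable_def)
  \<comment> \<open>The increment is now backward: (u(x - h) - u(x)) / h is minus the difference
    quotient at -h, which produces the sign of the weak derivative.\<close>
  have lim_right: "(\<lambda>n. LINT x|lborel. ((u0 (x - h n *\<^sub>R b) - u0 x) / h n) * \<phi> x) \<longlonglongrightarrow> (LINT x|lborel. - (indicator U x * w x) * \<phi> x)"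
  proof (rule integral_dominated_convergence[where w = "\<lambda>x. (\<bar>L\<bar> * C) * indicator K x"])
    show "(\<lambda>x. - (indicator U x * w x) * \<phi> x) \<in> borel_measurable lborel"
      unfolding measurable_lborel2 by (intro borel_measurable_times[OF borel_measurable_uminus[OF wm] \<phi>m])
    have "(\<lambda>x. u0 (x - h n *\<^sub>R b)) \<in> borel_measurable borel" for n
      using trans_m[OF u0m, of "- (h n *\<^sub>R b)"] by simp
    then show "(\<lambda>x. ((u0 (x - h n *\<^sub>R b) - u0 x) / h n) * \<phi> x) \<in> borel_measurable lborel" for n
      using u0m \<phi>m by simp
    have inU: "x - h n *\<^sub>R b \<in> U" if "x \<in> K" for x n
    proof -
      have "x - h n *\<^sub>R b \<in> K'" using shift[of "x - h n *\<^sub>R b" "h n"] that h[of n] by simp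
      then show ?thesis using K'(2) by blast
    qed
    show "AE x in lborel. (\<lambda>n. ((u0 (x - h n *\<^sub>R b) - u0 x) / h n) * \<phi> x) \<longlonglongrightarrow> - (indicator U x * w x) * \<phi> x"
      using der
    proof eventually_elim
      case (elim x)
      show ?case
      proof (cases "x \<in> K")
        case True
        then have xU: "x \<in> U" using K(2) by blast
        have "(\<lambda>n. (u (x + (- h n) *\<^sub>R b) - u x) / (- h n)) \<longlonglongrightarrow> w x"
          using filterlim_compose[OF elim[rule_format, OF xU] h_at(2)] .
        then have "(\<lambda>n. - ((u (x + (- h n) *\<^sub>R b) - u x) / (- h n)) * \<phi> x) \<longlonglongrightarrow> - w x * \<phi> x"
          by (intro tendsto_intros)
        then show ?thesis using True xU inU by (simp add: u0_def)
      qed (simp add: K(3))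
    qed
    show "AE x in lborel. norm (((u0 (x - h n *\<^sub>R b) - u0 x) / h n) * \<phi> x) \<le> (\<bar>L\<bar> * C) * indicator K x" for n
    proof (rule AE_I2)
      fix x
      show "norm (((u0 (x - h n *\<^sub>R b) - u0 x) / h n) * \<phi> x) \<le> (\<bar>L\<bar> * C) * indicator K x"
      proof (cases "x \<in> K")
        case True
        then have xU: "x \<in> U" using K(2) by blast
        have "\<bar>u (x + (- h n) *\<^sub>R b) - u x\<bar> \<le> L * h n" using L(2)[OF True, of "- h n"] h[of n] by simp
        also have "\<dots> \<le> \<bar>L\<bar> * h n" using h(1)[of n] by (intro mult_right_mono) auto
        finally have "\<bar>(u0 (x - h n *\<^sub>R b) - u0 x) / h n\<bar> \<le> \<bar>L\<bar>"
          using inU[OF True, of n] xU h(1)[of n] by (simp add: u0_def abs_divide pos_divide_le_eq)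
        from mult_mono[OF this C(2) abs_ge_zero abs_ge_zero, of x] show ?thesis
          using True by (simp add: abs_mult)
      qed (simp add: K(3))
    qed
  qed (rule indK[OF K(1)])
  have "(LINT x|lborel. u0 x * dpartial b \<phi> x) = (LINT x|lborel. - (indicator U x * w x) * \<phi> x)"
    using lim_left lim_right unfolding parts by (rule LIMSEQ_unique)
  also have "\<dots> = - (LINT x|lborel. indicator U x * w x * \<phi> x)"
    by (simp add: mult.assoc)
  finally show "(LINT x:U|lborel. u x * dpartials [b] \<phi> x) = (- 1) ^ length [b] * (LINT x:U|lborel. w x * \<phi> x)"
    by (simp add: set_lebesgue_integral_def u0_def mult.assoc)
qed

lemma weak_derivative_C1:
  assumes U: "open U" and v: "\<And>x. x \<in> U \<Longrightarrow> v differentiable (at x)" "continuous_on U (dpartial b v)"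
    and b: "b \<in> Basis"
  shows "weak_derivative U [b] v (dpartial b v)"
proof (rule weak_derivative_directionally_Lipschitz[OF U b])
  show "continuous_on U v"
    using v(1) by (intro continuous_at_imp_continuous_on ballI differentiable_imp_continuous_within)
  show "directionally_Lipschitz U b v" by (rule directionally_Lipschitz_C1[OF U v b])
  show "AE x in lborel. x \<in> U \<longrightarrow> ((\<lambda>h. (v (x + h *\<^sub>R b) - v x) / h) \<longlongrightarrow> dpartial b v x) (at 0)"
    using difference_quotient_tendsto[OF v(1)] by simp
  show "set_borel_measurable lborel U (dpartial b v)"
    unfolding set_borel_measurable_def using borel_measurable_continuous_on_indicator[OF _ v(2)] U by simp
qed

section \<open>Mollification\<close>

definition convolution :: "('a::euclidean_space \<Rightarrow> real) \<Rightarrow> ('a \<Rightarrow> real) \<Rightarrow> 'a \<Rightarrow> real" where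
  "convolution k p x = (LINT y|lborel. k (x - y) * p y)"

lemma lborel_integral_reflect:
  fixes f :: "'a::euclidean_space \<Rightarrow> real"
  assumes "f \<in> borel_measurable borel"
  shows "(LINT y|lborel. f (x - y)) = (LINT y|lborel. f y)"
proof -
  have "lborel = density (distr lborel borel (\<lambda>y. x + (-1) *\<^sub>R y)) (\<lambda>_. ennreal (\<bar>-1\<bar> ^ DIM('a)))"
    by (rule lborel_affine) simp
  then have "lborel = distr lborel borel (\<lambda>y. x - y)" by (simp add: density_1)
  then have "(LINT y|lborel. f y) = (LINT y|distr lborel borel (\<lambda>y. x - y). f y)" by (simp only:)
  also have "\<dots> = (LINT y|lborel. f (x - y))" using assms by (intro integral_distr) auto
  finally show ?thesis by simp
qed

lemma convolution_commute:
  assumes "continuous_on UNIV k" "continuous_on UNIV p"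
  shows "convolution k p x = convolution p k x"
proof -
  have "(\<lambda>y. k (x - y) * p y) \<in> borel_measurable borel"
    by (intro borel_measurable_continuous_onI continuous_intros continuous_on_compose2[OF assms(1)] assms(2)) auto
  from lborel_integral_reflect[OF this, of x] show ?thesis
    by (simp add: convolution_def mult.commute)
qed

text \<open>Derivatives fall on the first factor. With the mollifier in that place the convolution
  is smooth; with the factors exchanged its gradient is the mollified gradient. The compact support
  of p reduces the integral to a box, where differentiation under the integral applies.\<close>

lemma convolution_differentiable:
  fixes k p :: "'a::euclidean_space \<Rightarrow> real"
  assumes k: "\<And>x. k differentiable (at x)" "\<And>c. c \<in> Basis \<Longrightarrow> continuous_on UNIV (dpartial c k)"
    and p: "continuous_on UNIV p" "\<And>y. y \<notin> cbox a b \<Longrightarrow> p y = 0"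
  shows "convolution k p differentiable (at x)"
    and "c \<in> Basis \<Longrightarrow> dpartial c (convolution k p) x = convolution (dpartial c k) p x"
proof -
  have kc: "continuous_on UNIV k"
    using k(1) by (intro continuous_at_imp_continuous_on ballI differentiable_imp_continuous_within)
  have eq: "convolution q p x = integral (cbox a b) (\<lambda>y. q (x - y) * p y)" if q: "continuous_on UNIV q" for q x
  proof -
    have c: "continuous_on S (\<lambda>y. q (x - y) * p y)" for S
      by (intro continuous_intros continuous_on_compose2[OF q] continuous_on_subset[OF p(1)]) auto
    have "convolution q p x = (LINT y:cbox a b|lborel. q (x - y) * p y)"
      unfolding convolution_def set_lebesgue_integral_def using p(2)
      by (intro Bochner_Integration.integral_cong) (auto simp: indicator_def)
    also have "\<dots> = integral (cbox a b) (\<lambda>y. q (x - y) * p y)"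
      by (intro set_borel_integral_eq_integral borel_integrable_compact[unfolded real_scaleR_def[symmetric], folded set_integrable_def] c)
        auto
    finally show ?thesis .
  qed
  \<comment> \<open>The Leibniz rule asks for the derivative in x as a continuous family of bounded
    linear maps.\<close>
  define D where "D x y = (\<Sum>c\<in>Basis. (dpartial c k (x - y) * p y) *\<^sub>R blinfun_inner_left c)" for x y :: 'a
  have kd: "(k has_derivative (\<lambda>h. \<Sum>c\<in>Basis. dpartial c k x * (h \<bullet> c))) (at x)" for x
  proof -
    have d: "(k has_derivative frechet_derivative k (at x)) (at x)" using k(1) frechet_derivative_works by blast
    have lin: "linear (frechet_derivative k (at x))" using d by (rule has_derivative_linear)
    have "frechet_derivative k (at x) h = (\<Sum>c\<in>Basis. dpartial c k x * (h \<bullet> c))" for h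
    proof -
      have "frechet_derivative k (at x) h = frechet_derivative k (at x) (\<Sum>c\<in>Basis. (h \<bullet> c) *\<^sub>R c)"
        by (simp add: euclidean_representation)
      also have "\<dots> = (\<Sum>c\<in>Basis. (h \<bullet> c) * frechet_derivative k (at x) c)"
        by (simp add: linear_sum[OF lin] linear_cmul[OF lin])
      finally show ?thesis by (simp add: dpartial_def mult.commute)
    qed
    then show ?thesis using d by presburger
  qed
  have main: "((\<lambda>x. integral (cbox a b) (\<lambda>y. k (x - y) * p y)) has_derivative integral (cbox a b) (D x)) (at x within UNIV)" for x
  proof (rule leibniz_rule)
    fix x y
    have "((\<lambda>x. k (x - y)) has_derivative (\<lambda>h. \<Sum>c\<in>Basis. dpartial c k (x - y) * (h \<bullet> c))) (at x)"
      by (rule has_derivative_compose[OF _ kd]) (auto intro!: derivative_eq_intros)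
    then have "((\<lambda>x. k (x - y) * p y) has_derivative (\<lambda>h. (\<Sum>c\<in>Basis. dpartial c k (x - y) * (h \<bullet> c)) * p y)) (at x)"
      by (rule has_derivative_mult_left)
    moreover have "(\<lambda>h. (\<Sum>c\<in>Basis. dpartial c k (x - y) * (h \<bullet> c)) * p y) = blinfun_apply (D x y)"
      by (auto simp: fun_eq_iff D_def blinfun.sum_left blinfun.scaleR_left sum_distrib_left sum_distrib_right algebra_simps)
    ultimately show "((\<lambda>x. k (x - y) * p y) has_derivative blinfun_apply (D x y)) (at x within UNIV)" by simp
  next
    fix x show "(\<lambda>y. k (x - y) * p y) integrable_on cbox a b"
      by (intro integrable_continuous continuous_intros continuous_on_compose2[OF kc] continuous_on_subset[OF p(1)]) auto
  next
    show "continuous_on (UNIV \<times> cbox a b) (\<lambda>(x, y). D x y)"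
      unfolding D_def split_beta
      by (intro continuous_intros continuous_on_compose2[OF k(2)] continuous_on_compose2[OF p(1)]) auto
  qed auto
  have Dint: "D x integrable_on cbox a b" for x
    unfolding D_def
    by (intro integrable_continuous continuous_intros continuous_on_compose2[OF k(2)] continuous_on_subset[OF p(1)]) auto
  have ap: "blinfun_apply (integral (cbox a b) (D x)) c = convolution (dpartial c k) p x" if c: "c \<in> Basis" for c
  proof -
    have "blinfun_apply (integral (cbox a b) (D x)) c = integral (cbox a b) (\<lambda>y. blinfun_apply (D x y) c)"
      using integral_linear[OF Dint blinfun.bounded_linear_left[of c]] by (simp add: comp_def)
    also have "\<dots> = integral (cbox a b) (\<lambda>y. dpartial c k (x - y) * p y)"
      using c by (simp add: D_def blinfun.sum_left blinfun.scaleR_left inner_Basis if_distrib sum.delta cong: if_cong)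
    also have "\<dots> = convolution (dpartial c k) p x" by (rule eq[OF k(2)[OF c], symmetric])
    finally show ?thesis .
  qed
  have d: "(convolution k p has_derivative integral (cbox a b) (D x)) (at x)"
    using main[of x] unfolding eq[OF kc, symmetric] by simp
  then show "convolution k p differentiable (at x)" by (auto simp: differentiable_def)
  show "c \<in> Basis \<Longrightarrow> dpartial c (convolution k p) x = convolution (dpartial c k) p x"
    unfolding dpartial_eq[OF d] by (rule ap)
qed

lemma convolution_smooth:
  assumes "Cinf_on UNIV k" "continuous_on UNIV p" "\<And>y. y \<notin> cbox a b \<Longrightarrow> p y = 0"
  shows "Cinf_on UNIV (convolution k p)"
proof -
  have "smooth_upto False n UNIV (convolution k p)" if "Cinf_on UNIV k" for n k
    using that
  proof (induction n arbitrary: k)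
    case (Suc n)
    have d: "k differentiable (at x)" for x using Suc.prems unfolding Cinf_on_def by (auto dest: spec[of _ "[]"])
    have c: "continuous_on UNIV (dpartial c k)" if "c \<in> Basis" for c
    proof -
      have "dpartial c k differentiable (at x)" for x
        using Cinf_on_dpartial[OF Suc.prems that] unfolding Cinf_on_def by (auto dest: spec[of _ "[]"])
      then show ?thesis by (intro continuous_at_imp_continuous_on ballI differentiable_imp_continuous_within)
    qed
    have "dpartial c (convolution k p) = convolution (dpartial c k) p" if "c \<in> Basis" for c
      using convolution_differentiable(2)[OF d c assms(2,3) that] by (auto simp: fun_eq_iff)
    then show ?case
      using convolution_differentiable(1)[OF d c assms(2,3)] Suc.IH[OF Cinf_on_dpartial[OF Suc.prems]] by simp
  qed simp
  then show ?thesis using assms(1) by (simp add: Cinf_on_smooth_upto)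
qed

text \<open>Thickening the support by 1 brings both points into one compact set as soon as one of
  them lies in the support.\<close>

lemma uniformly_continuous_compact_support:
  fixes g :: "'a::euclidean_space \<Rightarrow> real"
  assumes g: "continuous_on UNIV g" and K: "compact K" "\<And>x. x \<notin> K \<Longrightarrow> g x = 0" and e: "e > 0"
  obtains d where "0 < d" "\<And>x y. dist x y < d \<Longrightarrow> \<bar>g x - g y\<bar> < e"
proof -
  let ?K = "{x + y | x y. x \<in> K \<and> y \<in> cball 0 1}"
  have "uniformly_continuous_on ?K g"
    using compact_sums[OF K(1) compact_cball[of 0 1]] g
    by (intro compact_uniformly_continuous) (auto intro: continuous_on_subset)
  from this[unfolded uniformly_continuous_on_def, rule_format, OF e]
  obtain d where d: "d > 0" "\<forall>x\<in>?K. \<forall>y\<in>?K. dist y x < d \<longrightarrow> dist (g y) (g x) < e" by blast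
  have inK: "y \<in> ?K" if "x \<in> K" "dist x y < 1" for x y
    using mem_thickening[of x K "y - x" 1] that by (simp add: dist_norm norm_minus_commute)
  have "\<bar>g x - g y\<bar> < e" if xy: "dist x y < min d 1" for x y
  proof (cases "x \<in> K \<or> y \<in> K")
    case True
    then have "x \<in> ?K" "y \<in> ?K"
      using inK[of x x] inK[of x y] inK[of y x] inK[of y y] xy by (auto simp: dist_commute)
    then show ?thesis using d(2)[rule_format, of y x] xy by (auto simp: dist_real_def)
  qed (use K(2) e in simp)
  then show thesis using that[of "min d 1"] d(1) by auto
qed

text \<open>g and its partial derivatives are uniformly continuous by compact support, so averaging
  at a small scale changes them by at most \<open>e\<close>. A scale small enough for the thickened
  support of g to stay in U keeps the support inside.\<close>

lemma mollification:
  fixes g :: "'a::euclidean_space \<Rightarrow> real"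
  assumes g: "\<And>x. g differentiable (at x)" "\<And>b. b \<in> Basis \<Longrightarrow> continuous_on UNIV (dpartial b g)"
    and K: "compact K" "K \<subseteq> U" "\<And>x. x \<notin> K \<Longrightarrow> g x = 0" and U: "open U" and e: "e > 0"
  obtains \<phi> where "\<phi> \<in> test_functions U" "\<And>x. \<bar>\<phi> x - g x\<bar> \<le> e"
    "\<And>x b. b \<in> Basis \<Longrightarrow> \<bar>dpartial b \<phi> x - dpartial b g x\<bar> \<le> e"
proof -
  have gc: "continuous_on UNIV g"
    using g(1) by (intro continuous_at_imp_continuous_on ballI differentiable_imp_continuous_within)
  have g'0: "dpartial b g x = 0" if "x \<notin> K" for b x
    by (rule dpartial_zero_outside[OF compact_imp_closed[OF K(1)] K(3) that])
  obtain d0 where d0: "0 < d0" "\<And>x y. dist x y < d0 \<Longrightarrow> \<bar>g x - g y\<bar> < e"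
    using uniformly_continuous_compact_support[OF gc K(1,3) e] by blast
  have "\<forall>b\<in>Basis. \<exists>d>0. \<forall>x y. dist x y < d \<longrightarrow> \<bar>dpartial b g x - dpartial b g y\<bar> < e"
    using uniformly_continuous_compact_support[OF g(2) K(1) g'0 e] by blast
  then obtain d where d: "\<And>b. b \<in> Basis \<Longrightarrow> 0 < d b"
    "\<And>b x y. b \<in> Basis \<Longrightarrow> dist x y < d b \<Longrightarrow> \<bar>dpartial b g x - dpartial b g y\<bar> < e" by metis
  obtain r0 where r0: "0 < r0" "compact {x + y | x y. x \<in> K \<and> y \<in> cball 0 r0}" "{x + y | x y. x \<in> K \<and> y \<in> cball 0 r0} \<subseteq> U"
    using compact_thickening[OF K(1) U K(2)] by blast
  define r1 where "r1 = min r0 (min d0 (Min (d ` Basis)))"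
  have r1: "0 < r1" "r1 \<le> r0" "r1 \<le> d0" "\<And>b. b \<in> Basis \<Longrightarrow> r1 \<le> d b"
    using r0(1) d0(1) d(1) by (auto simp: r1_def min_le_iff_disj intro!: Min_le)
  \<comment> \<open>Points of the cube of half-width r have l1-norm at most \<open>DIM('a)\<close>
    times r, that is r1 / 2, so the cube lies in the ball of radius r1.\<close>
  define r where "r = r1 / (2 * real DIM('a))"
  have r: "0 < r" using r1(1) by (simp add: r_def)
  define \<rho> where "\<rho> = box_bump (- (r *\<^sub>R One)) (r *\<^sub>R One :: 'a)"
  have \<rho>t: "\<rho> \<in> test_functions UNIV" unfolding \<rho>_def by (rule box_bump_test) simp
  have \<rho>C: "Cinf_on UNIV \<rho>" using \<rho>t by (simp add: test_functions_def)
  have \<rho>c: "continuous_on UNIV \<rho>" by (rule test_functions_continuous[OF \<rho>t])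
  have \<rho>i: "integrable lborel \<rho>" by (rule test_functions_integrable[OF \<rho>t])
  have \<rho>0: "0 \<le> \<rho> x" for x unfolding \<rho>_def by (rule box_bump_nonneg)
  have \<rho>z: "\<rho> x = 0" if "x \<notin> cbox (- (r *\<^sub>R One)) (r *\<^sub>R One)" for x
    using that box_subset_cbox[of "- (r *\<^sub>R One)" "r *\<^sub>R One"] unfolding \<rho>_def by (auto simp: box_bump_eq_0)
  have \<rho>n: "norm x < r1" if "\<rho> x \<noteq> 0" for x
  proof -
    have "x \<in> cbox (- (r *\<^sub>R One)) (r *\<^sub>R One)" using \<rho>z that by blast
    then have "\<bar>x \<bullet> i\<bar> \<le> r" if "i \<in> Basis" for i using that by (force simp: mem_box abs_le_iff)
    then have "norm x \<le> (\<Sum>i\<in>(Basis::'a set). r)" by (intro order_trans[OF norm_le_l1] sum_mono)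
    also have "\<dots> = r1 / 2" by (simp add: r_def)
    finally show ?thesis using r1(1) by simp
  qed
  define m where "m = (LINT x|lborel. \<rho> x)"
  have m: "0 < m"
  proof -
    have "m \<noteq> 0"
    proof
      assume "m = 0"
      then have "AE x in lborel. \<rho> x = 0" using integral_nonneg_eq_0_iff_AE[OF \<rho>i] \<rho>0 by (auto simp: m_def)
      then have "AE x in lborel. x \<notin> box (- (r *\<^sub>R One)) (r *\<^sub>R One :: 'a)"
        by eventually_elim (auto simp: \<rho>_def box_bump_eq_0)
      then have "box (- (r *\<^sub>R One)) (r *\<^sub>R One :: 'a) \<in> null_sets lborel"
        using AE_iff_null_sets[of "box (- (r *\<^sub>R One)) (r *\<^sub>R One :: 'a)" lborel] by auto
      then have "negligible (box (- (r *\<^sub>R One)) (r *\<^sub>R One :: 'a))"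
        by (simp only: negligible_iff_null_sets null_sets_completionI)
      then have "box (- (r *\<^sub>R One)) (r *\<^sub>R One :: 'a) = {}" by (simp only: negligible_interval)
      moreover have "0 \<in> box (- (r *\<^sub>R One)) (r *\<^sub>R One :: 'a)" using r by (auto simp: mem_box)
      ultimately show False by blast
    qed
    moreover have "0 \<le> m" using \<rho>0 by (simp add: m_def)
    ultimately show ?thesis by simp
  qed
  define k where "k x = (1 / m) * \<rho> x" for x
  have kC: "Cinf_on UNIV k" using \<rho>C unfolding Cinf_on_smooth_upto k_def[abs_def]
    by (intro allI smooth_upto_mult smooth_upto_const open_UNIV) auto
  have kc: "continuous_on UNIV k" unfolding k_def by (intro continuous_intros \<rho>c)
  have kz: "k x = 0" if "x \<notin> cbox (- (r *\<^sub>R One)) (r *\<^sub>R One)" for x using \<rho>z[OF that] by (simp add: k_def)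
  have ki: "integrable lborel k" "(LINT x|lborel. k x) = 1"
    using \<rho>i m by (auto simp: k_def[abs_def] m_def)
  have k0: "0 \<le> k x" for x using \<rho>0 m by (simp add: k_def)
  have close: "\<bar>convolution q k x - q x\<bar> \<le> e"
    if q: "continuous_on UNIV q" "\<And>x y. dist x y < r1 \<Longrightarrow> \<bar>q x - q y\<bar> < e" for q x
  proof -
    have i: "integrable lborel (\<lambda>y. q (x - y) * k y)"
    proof -
      have c: "continuous_on UNIV (\<lambda>y. q (x - y) * k y)"
        by (intro continuous_intros continuous_on_compose2[OF q(1)] kc) auto
      have z: "q (x - y) * k y = 0" if "y \<notin> cbox (- (r *\<^sub>R One)) (r *\<^sub>R One)" for y using kz[OF that] by simp
      obtain B where "0 < B" "\<And>y. \<bar>q (x - y) * k y\<bar> \<le> B"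
        using bounded_if_compact_support[OF c compact_cbox z] by blast
      then show ?thesis
        by (intro integrable_compact_support[OF borel_measurable_continuous_onI[OF c] compact_cbox, of "- (r *\<^sub>R One)" "r *\<^sub>R One"])
          (auto simp: kz)
    qed
    have "convolution q k x - q x = (LINT y|lborel. q (x - y) * k y - q x * k y)"
      using i ki by (simp add: convolution_def)
    also have "\<bar>\<dots>\<bar> \<le> (LINT y|lborel. e * k y)"
    proof (rule order_trans[OF integral_abs_bound integral_mono])
      show "integrable lborel (\<lambda>y. \<bar>q (x - y) * k y - q x * k y\<bar>)" using i ki by auto
      show "integrable lborel (\<lambda>y. e * k y)" using ki by simp
      fix y
      have "\<bar>q (x - y) - q x\<bar> * k y \<le> e * k y"
      proof (cases "k y = 0")
        case False
        then have "norm y < r1" using \<rho>n by (simp add: k_def)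
        then have "\<bar>q (x - y) - q x\<bar> < e" by (intro q(2)) (simp add: dist_norm)
        then show ?thesis using k0[of y] by (intro mult_right_mono) auto
      qed simp
      then show "\<bar>q (x - y) * k y - q x * k y\<bar> \<le> e * k y"
        using k0[of y] by (simp add: left_diff_distrib[symmetric] abs_mult)
    qed
    also have "\<dots> = e" using ki by simp
    finally show ?thesis .
  qed
  define \<phi> where "\<phi> = convolution k g"
  \<comment> \<open>As k convolved with g the function is smooth; as g convolved with k it averages
    nearby values of g. The two readings give the two halves of the claim.\<close>
  have \<phi>eq: "\<phi> = convolution g k" unfolding \<phi>_def using convolution_commute[OF kc gc] by (auto simp: fun_eq_iff)
  obtain R where R: "K \<subseteq> cbox (- R) R" using bounded_subset_cbox_symmetric[OF compact_imp_bounded[OF K(1)]] by blast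
  have gz: "g y = 0" if "y \<notin> cbox (- R) R" for y using K(3) R that by blast
  have C: "Cinf_on UNIV \<phi>" unfolding \<phi>_def by (rule convolution_smooth[OF kC gc gz])
  have "\<phi> x = 0" if x: "x \<notin> {x + y | x y. x \<in> K \<and> y \<in> cball 0 r0}" for x
  proof -
    have "k (x - y) * g y = 0" for y
    proof (rule ccontr)
      assume "k (x - y) * g y \<noteq> 0"
      then have "y \<in> K" "norm (x - y) < r1" using K(3) \<rho>n by (auto simp: k_def)
      then have "x \<in> {x + y | x y. x \<in> K \<and> y \<in> cball 0 r0}" using r1(2) mem_thickening[of y K "x - y" r0] by simp
      then show False using x by blast
    qed
    then have "convolution k g x = (LINT y|(lborel :: 'a measure). 0)"
      unfolding convolution_def by (intro Bochner_Integration.integral_cong refl)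
    then show ?thesis by (simp add: \<phi>_def)
  qed
  then have "\<phi> \<in> test_functions U" unfolding test_functions_def using C r0 by blast
  moreover have "\<bar>\<phi> x - g x\<bar> \<le> e" for x unfolding \<phi>eq using d0(2) r1(3) by (intro close gc) auto
  moreover have "\<bar>dpartial b \<phi> x - dpartial b g x\<bar> \<le> e" if b: "b \<in> Basis" for b x
  proof -
    have dd: "\<bar>dpartial b g x - dpartial b g y\<bar> < e" if "dist x y < r1" for x y
      using d(2)[OF b, of x y] r1(4)[OF b] that by simp
    have "dpartial b (convolution g k) x = convolution (dpartial b g) k x"
      by (rule convolution_differentiable(2)[OF g kc kz b])
    then show ?thesis using close[OF g(2)[OF b] dd, of x] by (simp add: \<phi>eq)
  qed
  ultimately show thesis by (rule that)
qed

section \<open>Functions with zero boundary values\<close>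

text \<open>\<open>soft e\<close> is a smooth approximation of the identity that vanishes on \<open>[-e,e]\<close> and has
  derivatives bounded uniformly in \<open>e\<close>.\<close>

definition soft :: "real \<Rightarrow> real \<Rightarrow> real" where
  "soft e y = y * exp_inv 1 ((y / e)\<^sup>2 - 1)"

text \<open>\<open>[:0, 0, 1:]\<close> stands for exp(-1/t) / t^2, the derivative of exp(-1/t); the
  last factor is the inner derivative.\<close>

definition soft' :: "real \<Rightarrow> real \<Rightarrow> real" where
  "soft' e y = exp_inv 1 ((y / e)\<^sup>2 - 1) + y * (exp_inv [:0, 0, 1:] ((y / e)\<^sup>2 - 1) * (2 * y / e\<^sup>2))"

lemma soft_has_derivative:
  assumes "e > 0" shows "(soft e has_real_derivative soft' e y) (at y)"
proof -
  have "((\<lambda>y. (y / e)\<^sup>2 - 1) has_real_derivative 2 * y / e\<^sup>2) (at y)"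
    using assms by (auto intro!: derivative_eq_intros simp: power2_eq_square field_simps)
  from DERIV_chain2[OF exp_inv_has_derivative[of 1] this]
  have "((\<lambda>y. exp_inv 1 ((y / e)\<^sup>2 - 1)) has_real_derivative exp_inv [:0, 0, 1:] ((y / e)\<^sup>2 - 1) * (2 * y / e\<^sup>2)) (at y)"
    by simp
  from DERIV_mult[OF DERIV_ident this] show ?thesis
    by (simp add: soft_def[abs_def] soft'_def algebra_simps)
qed

lemma exp_inv_continuous: "continuous_on S (exp_inv p)"
  using exp_inv_has_derivative by (meson DERIV_isCont continuous_at_imp_continuous_on)

lemma soft'_continuous: "e > 0 \<Longrightarrow> continuous_on S (soft' e)"
  unfolding soft'_def[abs_def]
  by (intro continuous_intros continuous_on_compose2[OF exp_inv_continuous[of UNIV]]) auto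

lemma soft_zero: "e > 0 \<Longrightarrow> \<bar>y\<bar> < e \<Longrightarrow> soft e y = 0" "e > 0 \<Longrightarrow> \<bar>y\<bar> < e \<Longrightarrow> soft' e y = 0"
proof -
  assume "e > 0" "\<bar>y\<bar> < e"
  then have "y\<^sup>2 \<le> e\<^sup>2" using abs_le_square_iff[of y e] by simp
  then have "(y / e)\<^sup>2 \<le> 1" using \<open>e > 0\<close> by (simp add: power_divide)
  then show "soft e y = 0" "soft' e y = 0" by (auto simp: soft_def soft'_def exp_inv_def)
qed

text \<open>In the variable w the parameter e disappears, so a bound in w is uniform in e, and e
  tending to 0 for fixed y \<noteq> 0 means w tending to 0.\<close>

lemma soft'_formula:
  assumes "e > 0" "(y / e)\<^sup>2 > 1"
  defines "w \<equiv> 1 / ((y / e)\<^sup>2 - 1)"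
  shows "soft' e y = exp (- w) + 2 * (w + w\<^sup>2) * exp (- w)"
proof -
  define t where "t = (y / e)\<^sup>2 - 1"
  have t: "t > 0" using assms(2) by (simp add: t_def)
  have wt: "w = 1 / t" by (simp add: w_def t_def)
  have y: "y * (2 * y / e\<^sup>2) = 2 * (t + 1)" by (simp add: t_def power_divide power2_eq_square)
  have "y * (exp_inv [:0, 0, 1:] t * (2 * y / e\<^sup>2)) = exp_inv [:0, 0, 1:] t * (y * (2 * y / e\<^sup>2))"
    by (simp add: mult.left_commute)
  also have "\<dots> = ((1 / t) * (1 / t) * exp (- 1 / t)) * (2 * (t + 1))"
    unfolding y using t by (simp add: exp_inv_def)
  also have "\<dots> = ((1 / t) * (1 / t) * (2 * (t + 1))) * exp (- w)"
    unfolding wt by (simp only: mult_ac minus_divide_left)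
  also have "(1 / t) * (1 / t) * (2 * (t + 1)) = 2 * (w + w\<^sup>2)"
    unfolding wt using t by (simp add: field_simps power2_eq_square)
  finally have e2: "y * (exp_inv [:0, 0, 1:] t * (2 * y / e\<^sup>2)) = 2 * (w + w\<^sup>2) * exp (- w)" .
  have e1: "exp_inv 1 t = exp (- w)" using t by (simp add: exp_inv_def wt)
  show ?thesis unfolding soft'_def t_def[symmetric] e1 e2 ..
qed

lemma soft_bounds:
  assumes "e > 0"
  shows "\<bar>soft e y - y\<bar> \<le> \<bar>y\<bar>" "\<bar>soft' e y\<bar> \<le> 7"
proof -
  have "\<bar>exp_inv 1 s - 1\<bar> \<le> 1" for s using exp_inv_1(1,2)[of s] by auto
  from mult_left_mono[OF this abs_ge_zero[of y]] show "\<bar>soft e y - y\<bar> \<le> \<bar>y\<bar>"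
    by (simp add: soft_def abs_mult[symmetric] algebra_simps)
  show "\<bar>soft' e y\<bar> \<le> 7"
  proof (cases "(y / e)\<^sup>2 > 1")
    case True
    define w where "w = 1 / ((y / e)\<^sup>2 - 1)"
    have w: "0 < w" using True by (simp add: w_def)
    have E: "1 + w + w\<^sup>2 / 2 \<le> exp w" using exp_lower_Taylor_quadratic[of w] w by simp
    have em: "exp w * exp (- w) = 1" by (simp add: exp_minus)
    \<comment> \<open>With the factor 6 each coefficient is dominated by that of the quadratic
      Taylor bound for exp w; adding exp(-w) \<le> 1 gives 7.\<close>
    have "2 * (w + w\<^sup>2) \<le> 6 * (1 + w + w\<^sup>2 / 2)" using w by (simp add: algebra_simps)
    also have "\<dots> \<le> 6 * exp w" using E by (intro mult_left_mono) auto
    finally have "2 * (w + w\<^sup>2) \<le> 6 * exp w" .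
    define S where "S = 2 * (w + w\<^sup>2) * exp (- w)"
    from mult_right_mono[OF \<open>2 * (w + w\<^sup>2) \<le> 6 * exp w\<close>, of "exp (- w)"] have "S \<le> 6"
      using em by (simp add: mult.assoc S_def)
    moreover have "exp (- w) \<le> 1" using w by simp
    moreover have "0 \<le> S" using w by (simp add: S_def)
    moreover have "soft' e y = exp (- w) + S" unfolding S_def w_def by (rule soft'_formula[OF assms True])
    ultimately show ?thesis using exp_gt_zero[of "- w"] by linarith
  qed (simp add: soft'_def exp_inv_def)
qed

lemma soft_tendsto:
  assumes "y \<noteq> 0"
  shows "(\<lambda>n. soft (1 / real (Suc n)) y) \<longlonglongrightarrow> y" "(\<lambda>n. soft' (1 / real (Suc n)) y) \<longlonglongrightarrow> 1"
proof -
  let ?t = "\<lambda>n. (y / (1 / real (Suc n)))\<^sup>2 - 1"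
  have ft: "filterlim ?t at_top sequentially"
  proof -
    have "filterlim (\<lambda>n. y\<^sup>2 * (real (Suc n))\<^sup>2) at_top sequentially"
      using assms by (intro filterlim_tendsto_pos_mult_at_top[OF tendsto_const] filterlim_pow_at_top
          filterlim_compose[OF filterlim_real_sequentially filterlim_Suc]) auto
    then have "filterlim (\<lambda>n. - 1 + y\<^sup>2 * (real (Suc n))\<^sup>2) at_top sequentially"
      by (rule filterlim_tendsto_add_at_top[OF tendsto_const])
    moreover have "(\<lambda>n. - 1 + y\<^sup>2 * (real (Suc n))\<^sup>2) = ?t"
      by (simp add: fun_eq_iff power_mult_distrib del: of_nat_Suc)
    ultimately show ?thesis by (simp only:)
  qed
  then have w: "(\<lambda>n. 1 / ?t n) \<longlonglongrightarrow> 0"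
    using tendsto_inverse_0_at_top[OF ft] by (simp add: inverse_eq_divide)
  have pos: "\<forall>\<^sub>F n in sequentially. ?t n > 0" using ft unfolding filterlim_at_top_dense by (rule spec)
  have ex: "(\<lambda>n. exp (- (1 / ?t n))) \<longlonglongrightarrow> 1"
    using tendsto_exp[OF tendsto_minus[OF w]] by simp
  have "(\<lambda>n. y * exp (- (1 / ?t n))) \<longlonglongrightarrow> y * 1" by (intro tendsto_intros ex)
  then have "(\<lambda>n. y * exp (- (1 / ?t n))) \<longlonglongrightarrow> y" by simp
  then show "(\<lambda>n. soft (1 / real (Suc n)) y) \<longlonglongrightarrow> y"
    by (rule Lim_transform_eventually) (use pos in \<open>eventually_elim, simp add: soft_def exp_inv_def\<close>)
  have "(\<lambda>n. exp (- (1 / ?t n)) + 2 * (1 / ?t n + (1 / ?t n)\<^sup>2) * exp (- (1 / ?t n))) \<longlonglongrightarrow> 1 + 2 * (0 + 0\<^sup>2) * 1"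
    by (intro tendsto_intros ex w)
  then have "(\<lambda>n. exp (- (1 / ?t n)) + 2 * (1 / ?t n + (1 / ?t n)\<^sup>2) * exp (- (1 / ?t n))) \<longlonglongrightarrow> 1" by simp
  then show "(\<lambda>n. soft' (1 / real (Suc n)) y) \<longlonglongrightarrow> 1"
    by (rule Lim_transform_eventually) (use pos in \<open>eventually_elim, subst soft'_formula, simp_all\<close>)
qed

lemma L2_norm_tendsto_0:
  fixes U :: "'a::euclidean_space set"
  assumes U: "U \<in> sets borel" "bounded U"
    and f: "\<And>n. f n \<in> L2 U" and B: "\<And>n x. x \<in> U \<Longrightarrow> \<bar>f n x\<bar> \<le> B"
    and lim: "\<And>x. x \<in> U \<Longrightarrow> (\<lambda>n. f n x) \<longlonglongrightarrow> 0"
  shows "(\<lambda>n. L2_norm U (f n)) \<longlonglongrightarrow> 0"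
proof -
  have "(\<lambda>n. LINT x|lborel. indicator U x *\<^sub>R (f n x)\<^sup>2) \<longlonglongrightarrow> (LINT x|(lborel :: 'a measure). 0)"
  proof (rule integral_dominated_convergence[where w = "\<lambda>x. B\<^sup>2 * indicator U x"])
    show "(\<lambda>x. indicator U x *\<^sub>R (f n x)\<^sup>2) \<in> borel_measurable lborel" for n
      by (rule borel_measurable_integrable[OF L2_square[OF f, unfolded set_integrable_def]])
    show "integrable lborel (\<lambda>x. B\<^sup>2 * indicator U x)"
      using emeasure_bounded_finite[OF U(2)] U(1) by (intro integrable_mult_right integrable_real_indicator) auto
    show "AE x in lborel. (\<lambda>n. indicator U x *\<^sub>R (f n x)\<^sup>2) \<longlonglongrightarrow> 0"
    proof (rule AE_I2)
      fix x
      show "(\<lambda>n. indicator U x *\<^sub>R (f n x)\<^sup>2) \<longlonglongrightarrow> 0"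
        using tendsto_power[OF lim, of x 2] by (cases "x \<in> U") auto
    qed
    show "AE x in lborel. norm (indicator U x *\<^sub>R (f n x)\<^sup>2) \<le> B\<^sup>2 * indicator U x" for n
    proof (rule AE_I2)
      fix x
      show "norm (indicator U x *\<^sub>R (f n x)\<^sup>2) \<le> B\<^sup>2 * indicator U x"
        using power_mono[OF B[of x n] abs_ge_zero, of 2] by (cases "x \<in> U") auto
    qed
  qed simp
  from tendsto_real_sqrt[OF this] show ?thesis
    by (simp add: L2_norm_def set_lebesgue_integral_def)
qed

lemma continuous_L2:
  fixes U :: "'a::euclidean_space set"
  assumes "open U" "bounded U" "continuous_on U g" "\<And>x. x \<in> U \<Longrightarrow> \<bar>g x\<bar> \<le> B"
  shows "g \<in> L2 U"
proof (rule L2_bounded[OF _ _ assms(2,4)])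
  show "set_borel_measurable lborel U g"
    unfolding set_borel_measurable_def
    using borel_measurable_continuous_on_indicator[OF _ assms(3)] assms(1) by simp
qed (use assms in auto)

text \<open>The functions \<open>soft e v\<close> have compact support in \<open>U\<close>; their gradients converge to
  \<open>\<nabla>v\<close> off the zero set of \<open>v\<close> and to \<open>0\<close> on it.\<close>

lemma sobolev1_0_C1:
  fixes U :: "'a::euclidean_space set"
  assumes U: "open U" "bounded U"
    and v: "\<And>x. x \<in> U \<Longrightarrow> v differentiable (at x)" "\<And>b. b \<in> Basis \<Longrightarrow> continuous_on U (dpartial b v)"
    and B: "\<And>x. x \<in> U \<Longrightarrow> \<bar>v x\<bar> \<le> B" and M: "\<And>b x. b \<in> Basis \<Longrightarrow> x \<in> U \<Longrightarrow> \<bar>dpartial b v x\<bar> \<le> M"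
    and vanish: "\<And>e. e > 0 \<Longrightarrow> compact {x \<in> U. e \<le> \<bar>v x\<bar>}"
  shows "v \<in> sobolev1_0 U"
proof -
  have vc: "continuous_on U v"
    using v(1) by (intro continuous_at_imp_continuous_on ballI differentiable_imp_continuous_within)
  have vL: "v \<in> L2 U" by (rule continuous_L2[OF U vc B])
  have vbL: "dpartial b v \<in> L2 U" if "b \<in> Basis" for b by (rule continuous_L2[OF U v(2)[OF that] M[OF that]])
  have "\<exists>\<phi>. \<phi> \<in> test_functions U \<and> (\<forall>x\<in>U. \<bar>\<phi> x - soft e (v x)\<bar> \<le> e) \<and>
      (\<forall>b\<in>Basis. \<forall>x\<in>U. \<bar>dpartial b \<phi> x - soft' e (v x) * dpartial b v x\<bar> \<le> e)" if e: "e > 0" for e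
  proof -
    define K where "K = {x \<in> U. e \<le> \<bar>v x\<bar>}"
    have K: "compact K" "K \<subseteq> U" using vanish[OF e] by (auto simp: K_def)
    \<comment> \<open>Off K the values of v are below e in modulus, so the cutoff is 0 there. Glued
      with 0 outside U it is continuously differentiable on the whole space with compact support in
      U.\<close>
    define g where "g x = (if x \<in> U then soft e (v x) else 0)" for x
    have g0: "g x = 0" if "x \<notin> K" for x
      using that soft_zero(1)[OF e, of "v x"] by (auto simp: g_def K_def)
    have gd: "(g has_derivative (\<lambda>h. frechet_derivative v (at x) h * soft' e (v x))) (at x)" if x: "x \<in> U" for x
    proof -
      have "(v has_derivative frechet_derivative v (at x)) (at x)" using v(1)[OF x] frechet_derivative_works by blast
      moreover have "(soft e has_derivative (\<lambda>h. h * soft' e (v x))) (at (v x))"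
        using soft_has_derivative[OF e, of "v x"] by (simp add: has_field_derivative_def mult_commute_abs)
      ultimately have "((\<lambda>x. soft e (v x)) has_derivative (\<lambda>h. frechet_derivative v (at x) h * soft' e (v x))) (at x)"
        by (rule has_derivative_compose)
      then show ?thesis
        by (subst has_derivative_cong_open[OF U(1) x, where g = "\<lambda>x. soft e (v x)"]) (auto simp: g_def)
    qed
    have cK: "open (- K)" using compact_imp_closed[OF K(1)] by auto
    have gdiff: "g differentiable (at x)" for x
    proof (cases "x \<in> U")
      case True
      then show ?thesis using gd by (auto simp: differentiable_def)
    next
      case False
      then have "x \<in> - K" using K(2) by auto
      then show ?thesis
        by (subst differentiable_cong_open[OF cK, where g = "\<lambda>_. 0"]) (auto simp: g0)
    qed
    have gb: "dpartial b g x = soft' e (v x) * dpartial b v x" if "x \<in> U" for b x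
      using dpartial_eq[OF gd[OF that], of b] by (simp add: dpartial_def)
    have gb0: "dpartial b g x = 0" if "x \<in> - K" for b x
      using dpartial_zero_outside[OF compact_imp_closed[OF K(1)] g0] that by auto
    have gc: "continuous_on UNIV (dpartial b g)" if b: "b \<in> Basis" for b
    proof -
      have "continuous_on U (\<lambda>x. soft' e (v x) * dpartial b v x)"
        by (intro continuous_intros v(2)[OF b] continuous_on_compose2[OF soft'_continuous[OF e, of UNIV] vc]) auto
      then have "continuous_on U (dpartial b g)" using gb by (simp cong: continuous_on_cong)
      moreover have "continuous_on (- K) (dpartial b g)"
        by (rule continuous_on_eq[OF continuous_on_const[of _ 0]]) (simp add: gb0)
      ultimately have "continuous_on (U \<union> - K) (dpartial b g)" using U(1) cK by (intro continuous_on_open_Un)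
      moreover have "U \<union> - K = UNIV" using K(2) by auto
      ultimately show ?thesis by simp
    qed
    obtain \<phi> where p: "\<phi> \<in> test_functions U" "\<And>x. \<bar>\<phi> x - g x\<bar> \<le> e"
      "\<And>x b. b \<in> Basis \<Longrightarrow> \<bar>dpartial b \<phi> x - dpartial b g x\<bar> \<le> e"
      using mollification[OF gdiff gc K g0 U(1) e] by blast
    have "\<bar>\<phi> x - soft e (v x)\<bar> \<le> e" if "x \<in> U" for x using p(2)[of x] that by (simp add: g_def)
    moreover have "\<bar>dpartial b \<phi> x - soft' e (v x) * dpartial b v x\<bar> \<le> e" if "b \<in> Basis" "x \<in> U" for b x
      using p(3)[OF that(1), of x] by (simp only: gb[OF that(2)])
    ultimately show ?thesis using p(1) by blast
  qed
  \<comment> \<open>One null sequence serves both as cutoff level and as mollification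
    error.\<close>
  then have "\<forall>n. \<exists>\<phi>. \<phi> \<in> test_functions U \<and> (\<forall>x\<in>U. \<bar>\<phi> x - soft (1 / real (Suc n)) (v x)\<bar> \<le> 1 / real (Suc n)) \<and>
      (\<forall>b\<in>Basis. \<forall>x\<in>U. \<bar>dpartial b \<phi> x - soft' (1 / real (Suc n)) (v x) * dpartial b v x\<bar> \<le> 1 / real (Suc n))"
    by simp
  then obtain \<phi> where \<phi>: "\<And>n. \<phi> n \<in> test_functions U"
    "\<And>n x. x \<in> U \<Longrightarrow> \<bar>\<phi> n x - soft (1 / real (Suc n)) (v x)\<bar> \<le> 1 / real (Suc n)"
    "\<And>n b x. b \<in> Basis \<Longrightarrow> x \<in> U \<Longrightarrow> \<bar>dpartial b (\<phi> n) x - soft' (1 / real (Suc n)) (v x) * dpartial b v x\<bar> \<le> 1 / real (Suc n)"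
    by metis
  have e_lim: "(\<lambda>n. 1 / real (Suc n)) \<longlonglongrightarrow> 0" using LIMSEQ_Suc[OF lim_1_over_n] by simp
  have e1: "1 / real (Suc n) \<le> 1" for n by simp
  have near: "(\<lambda>n. a n) \<longlonglongrightarrow> l" if "\<And>n. \<bar>a n - b n\<bar> \<le> 1 / real (Suc n)" "b \<longlonglongrightarrow> l" for a b :: "nat \<Rightarrow> real" and l
  proof -
    have "(\<lambda>n. a n - b n) \<longlonglongrightarrow> 0"
      by (rule Lim_null_comparison[OF _ e_lim]) (use that(1) in auto)
    from tendsto_add[OF this that(2)] show ?thesis by simp
  qed
  have lim0: "(\<lambda>n. L2_norm U (\<lambda>x. \<phi> n x - v x)) \<longlonglongrightarrow> 0"
  proof (rule L2_norm_tendsto_0[where B = "1 + B"])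
    show "(\<lambda>x. \<phi> n x - v x) \<in> L2 U" for n by (rule L2_diff[OF test_functions_L2[OF \<phi>(1) U(1)] vL])
    fix n x assume x: "x \<in> U"
    have "\<bar>\<phi> n x - soft (1 / real (Suc n)) (v x)\<bar> \<le> 1" using \<phi>(2)[OF x, of n] e1[of n] by linarith
    then show "\<bar>\<phi> n x - v x\<bar> \<le> 1 + B"
      using soft_bounds(1)[of "1 / real (Suc n)" "v x"] B[OF x] by simp
  next
    fix x assume x: "x \<in> U"
    have "(\<lambda>n. soft (1 / real (Suc n)) (v x)) \<longlonglongrightarrow> v x"
      using soft_tendsto(1)[of "v x"] by (cases "v x = 0") (auto simp: soft_def)
    from near[OF \<phi>(2)[OF x] this] show "(\<lambda>n. \<phi> n x - v x) \<longlonglongrightarrow> 0"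
      by (simp add: LIM_zero_iff)
  qed (use U in auto)
  have deriv: "\<exists>w\<in>L2 U. weak_derivative U [b] v w \<and> (\<lambda>n. L2_norm U (\<lambda>x. dpartial b (\<phi> n) x - w x)) \<longlonglongrightarrow> 0"
    if b: "b \<in> Basis" for b
  proof -
    \<comment> \<open>The derivative of the cutoff is 0 at 0, so on the zero set of v the gradients
      of the approximations tend to 0 and not to the classical derivative.\<close>
    define w where "w x = (if v x = 0 then 0 else dpartial b v x)" for x
    have wL: "w \<in> L2 U"
    proof (rule L2_bounded[OF _ _ U(2), where B = "\<bar>M\<bar>"])
      have vm: "(\<lambda>x. indicator U x * v x) \<in> borel_measurable borel"
        using vL by (simp add: L2_iff_sqint sqint_def)
      have m: "(\<lambda>x. indicator U x * dpartial b v x) \<in> borel_measurable borel"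
        using vbL[OF b] by (simp add: L2_iff_sqint sqint_def)
      have "(\<lambda>x. if indicator U x * v x = 0 then 0 else indicator U x * dpartial b v x) \<in> borel_measurable borel"
        using borel_measurable_eq[OF vm borel_measurable_const[of 0]]
        by (rule measurable_If[OF borel_measurable_const m])
      moreover have "(\<lambda>x. if indicator U x * v x = 0 then 0 else indicator U x * dpartial b v x) = (\<lambda>x. indicator U x *\<^sub>R w x)"
        by (auto simp: w_def fun_eq_iff)
      ultimately show "set_borel_measurable lborel U w" by (simp add: set_borel_measurable_def)
      show "x \<in> U \<Longrightarrow> \<bar>w x\<bar> \<le> \<bar>M\<bar>" for x using M[OF b, of x] by (auto simp: w_def)
    qed (use U in auto)
    have \<phi>bt: "dpartial b (\<phi> n) \<in> test_functions U" for n by (rule test_functions_dpartial[OF \<phi>(1) b])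
    have lim1: "(\<lambda>n. L2_norm U (\<lambda>x. dpartial b (\<phi> n) x - w x)) \<longlonglongrightarrow> 0"
    \<comment> \<open>The summand 1 bounds the mollification error; of the 8 multiples of the
      gradient bound, 7 come from \<open>soft'\<close> and one from w.\<close>
    proof (rule L2_norm_tendsto_0[where B = "1 + 8 * \<bar>M\<bar>"])
      show "(\<lambda>x. dpartial b (\<phi> n) x - w x) \<in> L2 U" for n by (rule L2_diff[OF test_functions_L2[OF \<phi>bt U(1)] wL])
      fix n x assume x: "x \<in> U"
      have "\<bar>dpartial b (\<phi> n) x - soft' (1 / real (Suc n)) (v x) * dpartial b v x\<bar> \<le> 1"
        using \<phi>(3)[OF b x, of n] e1[of n] by linarith
      moreover have "\<bar>soft' (1 / real (Suc n)) (v x) * dpartial b v x\<bar> \<le> 7 * \<bar>M\<bar>"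
        using soft_bounds(2)[of "1 / real (Suc n)" "v x"] M[OF b x] unfolding abs_mult by (intro mult_mono) auto
      moreover have "\<bar>w x\<bar> \<le> \<bar>M\<bar>" using M[OF b x] by (auto simp: w_def)
      ultimately show "\<bar>dpartial b (\<phi> n) x - w x\<bar> \<le> 1 + 8 * \<bar>M\<bar>" by linarith
    next
      fix x assume x: "x \<in> U"
      have "(\<lambda>n. soft' (1 / real (Suc n)) (v x) * dpartial b v x) \<longlonglongrightarrow> w x"
      proof (cases "v x = 0")
        case True
        then show ?thesis by (simp add: w_def soft'_def exp_inv_def)
      next
        case False
        then show ?thesis using tendsto_mult_right[OF soft_tendsto(2)[OF False], of "dpartial b v x"] by (simp add: w_def)
      qed
      from near[OF \<phi>(3)[OF b x] this] show "(\<lambda>n. dpartial b (\<phi> n) x - w x) \<longlonglongrightarrow> 0"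
        by (simp add: LIM_zero_iff)
    qed (use U in auto)
    \<comment> \<open>Integration by parts holds for each \<phi> n and passes to the L2-limits, so
      the limit of the gradients is a weak derivative of v.\<close>
    have "weak_derivative U [b] v w" unfolding weak_derivative_def
    proof
      fix \<zeta> assume c: "\<zeta> \<in> test_functions U"
      have cb: "dpartial b \<zeta> \<in> test_functions U" by (rule test_functions_dpartial[OF c b])
      have E: "(LINT x:U|lborel. \<phi> n x * dpartial b \<zeta> x) = - (LINT x:U|lborel. dpartial b (\<phi> n) x * \<zeta> x)" for n
        using weak_derivative_C1[OF U(1) test_functions_differentiable[OF \<phi>(1)] test_functions_continuous[OF \<phi>bt] b, of n] c
        unfolding weak_derivative_def by force
      have L1: "(\<lambda>n. LINT x:U|lborel. \<phi> n x * dpartial b \<zeta> x) \<longlonglongrightarrow> (LINT x:U|lborel. v x * dpartial b \<zeta> x)"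
        by (rule L2_weak_limit[OF test_functions_L2[OF \<phi>(1) U(1)] vL test_functions_L2[OF cb U(1)] lim0])
      have L2: "(\<lambda>n. - (LINT x:U|lborel. dpartial b (\<phi> n) x * \<zeta> x)) \<longlonglongrightarrow> - (LINT x:U|lborel. w x * \<zeta> x)"
        by (intro tendsto_minus L2_weak_limit[OF test_functions_L2[OF \<phi>bt U(1)] wL test_functions_L2[OF c U(1)] lim1])
      have "(LINT x:U|lborel. v x * dpartial b \<zeta> x) = - (LINT x:U|lborel. w x * \<zeta> x)"
        by (rule LIMSEQ_unique[OF L1[unfolded E] L2])
      then show "(LINT x:U|lborel. v x * dpartials [b] \<zeta> x) = (- 1) ^ length [b] * (LINT x:U|lborel. w x * \<zeta> x)"
        by simp
    qed
    then show ?thesis using wL lim1 by blast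
  qed
  have "\<exists>w\<in>L2 U. weak_derivative U bs v w" if "set bs \<subseteq> Basis" "length bs \<le> 1" for bs
  proof (cases bs)
    case Nil
    then show ?thesis using vL by (intro bexI[of _ v]) (auto simp: weak_derivative_def)
  next
    case (Cons b bs')
    then show ?thesis using that deriv[of b] by auto
  qed
  then have "v \<in> sobolev 1 U" using vL by (simp add: sobolev_def)
  then show ?thesis unfolding sobolev1_0_def using \<phi>(1) lim0 deriv by blast
qed

section \<open>Univariate B-splines\<close>

locale knots =
  fixes p :: nat and \<xi> :: "real list"
  assumes open_knots: "open_knot_vector p \<xi>"
begin

definition m where "m = num_bsplines p \<xi>"

lemma knots_props:
  shows length_knots: "length \<xi> = m + p + 1" and sorted_knots: "sorted \<xi>"
    and knot_first: "\<xi> ! 0 = 0" and knot_last: "\<xi> ! (m + p) = 1"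
proof -
  obtain n where n: "length \<xi> = n + p + 1" "sorted \<xi>" "\<forall>i\<le>p. \<xi> ! i = 0 \<and> \<xi> ! (n + i) = 1"
    using open_knots unfolding open_knot_vector_def by blast
  then have "m = n" by (simp add: m_def num_bsplines_def)
  then show "length \<xi> = m + p + 1" "sorted \<xi>" "\<xi> ! 0 = 0" "\<xi> ! (m + p) = 1" using n by auto
qed

lemma knot_mono: "i \<le> j \<Longrightarrow> j \<le> m + p \<Longrightarrow> \<xi> ! i \<le> \<xi> ! j"
  using sorted_knots length_knots by (auto intro: sorted_nth_mono)

lemma knot_bounds: "i \<le> m + p \<Longrightarrow> 0 \<le> \<xi> ! i" "i \<le> m + p \<Longrightarrow> \<xi> ! i \<le> 1"
  using knot_mono[of 0 i] knot_mono[of i "m + p"] knot_first knot_last by auto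

text \<open>The greatest index whose knot is at most x steps over repeated knots, so its span is
  nonempty.\<close>

lemma span_right_open:
  assumes "0 \<le> x" "x < 1"
  obtains i where "i < m + p" "\<xi> ! i \<le> x" "x < \<xi> ! (i + 1)"
proof -
  define i where "i = (GREATEST i. i \<le> m + p \<and> \<xi> ! i \<le> x)"
  have ex: "0 \<le> m + p \<and> \<xi> ! 0 \<le> x" using assms knot_first by simp
  have i: "i \<le> m + p \<and> \<xi> ! i \<le> x"
    unfolding i_def using GreatestI_nat[of "\<lambda>i. i \<le> m + p \<and> \<xi> ! i \<le> x" 0 "m + p"] ex by simp
  have "i \<noteq> m + p" using i knot_last assms by auto
  then have lt: "i < m + p" using i by simp
  have "\<not> \<xi> ! (i + 1) \<le> x"
  proof
    assume "\<xi> ! (i + 1) \<le> x"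
    then have "i + 1 \<le> i"
      unfolding i_def using lt Greatest_le_nat[of "\<lambda>i. i \<le> m + p \<and> \<xi> ! i \<le> x" "i + 1" "m + p"] by (simp add: i_def)
    then show False by simp
  qed
  then show thesis using that[of i] i lt by auto
qed

text \<open>The first occurrence of the knot 1 ends the last nonempty span, the one that is closed
  at 1 by convention.\<close>

lemma last_span:
  obtains i where "i < m + p" "\<xi> ! i < 1" "\<xi> ! (i + 1) = 1"
proof -
  define j where "j = (LEAST j. \<xi> ! j = 1)"
  have j: "\<xi> ! j = 1" unfolding j_def by (rule LeastI[of _ "m + p"]) (rule knot_last)
  have jle: "j \<le> m + p" unfolding j_def by (rule Least_le) (rule knot_last)
  have "j \<noteq> 0"
  proof
    assume "j = 0"
    then show False using j knot_first by simp
  qed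
  then obtain i where i: "j = Suc i" using not0_implies_Suc by blast
  have "\<xi> ! i \<noteq> 1" using not_less_Least[of i "\<lambda>j. \<xi> ! j = 1"] i by (auto simp: j_def[symmetric])
  moreover have "\<xi> ! i \<le> 1" using knot_bounds(2)[of i] jle i by simp
  ultimately show thesis using that[of i] i j jle by auto
qed

lemma span_closed:
  assumes "x \<in> {0..1}"
  obtains i where "i < m + p" "\<xi> ! i < \<xi> ! (i + 1)" "\<xi> ! i \<le> x" "x \<le> \<xi> ! (i + 1)"
proof (cases "x < 1")
  case True
  then show thesis using span_right_open[of x] assms that by (metis atLeastAtMost_iff less_eq_real_def order_le_less_trans)
next
  case False
  then have "x = 1" using assms by simp
  then show thesis using last_span that by (metis less_eq_real_def)
qed

text \<open>On a cell the Cox--de Boor recursion makes all splines polynomials.\<close>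

definition cell :: "real set \<Rightarrow> bool" where
  "cell J \<longleftrightarrow> (\<forall>i<m + p. \<exists>c. \<forall>x\<in>J. bspline \<xi> 0 i x = c)"

lemma cell_span:
  assumes i: "i < m + p" shows "cell {\<xi> ! i..<\<xi> ! (i + 1)}"
  unfolding cell_def
proof (intro allI impI)
  fix j assume j: "j < m + p"
  have "bspline \<xi> 0 j x = (if j = i then 1 else 0)" if x: "x \<in> {\<xi> ! i..<\<xi> ! (i + 1)}" for x
  proof -
    have x1: "x \<noteq> 1" using x knot_bounds(2)[of "i + 1"] i by auto
    consider "j < i" | "j = i" | "j > i" by linarith
    then show ?thesis
    proof cases
      case 1
      then have "\<xi> ! (j + 1) \<le> \<xi> ! i" using i by (intro knot_mono) auto
      then show ?thesis using x x1 1 by auto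
    next
      case 3
      then have "\<xi> ! (i + 1) \<le> \<xi> ! j" using j by (intro knot_mono) auto
      then show ?thesis using x x1 3 by auto
    qed (use x in auto)
  qed
  then show "\<exists>c. \<forall>x\<in>{\<xi> ! i..<\<xi> ! (i + 1)}. bspline \<xi> 0 j x = c" by blast
qed

text \<open>By the convention for degree 0 the point 1 belongs to the last nonempty span, so
  continuity up to 1 can be read off on this cell.\<close>

lemma cell_last:
  assumes i: "i < m + p" "\<xi> ! i < 1" "\<xi> ! (i + 1) = 1" shows "cell {\<xi> ! i<..1}"
  unfolding cell_def
proof (intro allI impI)
  fix j assume j: "j < m + p"
  have "bspline \<xi> 0 j x = (if j = i then 1 else 0)" if x: "x \<in> {\<xi> ! i<..1}" for x
  proof -
    consider "j < i" | "j = i" | "j > i" by linarith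
    then show ?thesis
    proof cases
      case 1
      then have "\<xi> ! (j + 1) \<le> \<xi> ! i" using i by (intro knot_mono) auto
      then show ?thesis using x i 1 by auto
    next
      case 3
      then have "\<xi> ! (i + 1) \<le> \<xi> ! j" using j by (intro knot_mono) auto
      moreover have "\<xi> ! j \<le> 1" "\<xi> ! (j + 1) \<le> 1" using knot_bounds(2) j by auto
      ultimately show ?thesis using x i 3 by auto
    qed (use x i in auto)
  qed
  then show "\<exists>c. \<forall>x\<in>{\<xi> ! i<..1}. bspline \<xi> 0 j x = c" by blast
qed

lemma cell_subset: "cell J \<Longrightarrow> J' \<subseteq> J \<Longrightarrow> cell J'"
  unfolding cell_def by (meson subsetD)

text \<open>Composition with \<eta> serves scaled time, the coordinates, and the coordinates of the
  inverse geometry map alike. The recursion descends to the splines of degree 0 with indices i to i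
  + q; the index bound provides a knot span for each of them.\<close>

lemma bspline_smooth_on_cell:
  fixes \<eta> :: "'a::euclidean_space \<Rightarrow> real"
  assumes "cell J" "open U" "smooth_upto c n U \<eta>" "\<And>x. x \<in> U \<Longrightarrow> \<eta> x \<in> J" "i + q < m + p"
  shows "smooth_upto c n U (\<lambda>x. bspline \<xi> q i (\<eta> x))"
  using assms(5)
proof (induction q arbitrary: i)
  case 0
  then obtain k where "\<And>x. x \<in> J \<Longrightarrow> bspline \<xi> 0 i x = k" using assms(1) unfolding cell_def by auto
  then have "bspline \<xi> 0 i (\<eta> x) = k" if "x \<in> U" for x using assms(4)[OF that] by blast
  then show ?case by (subst smooth_upto_cong[OF assms(2), where g = "\<lambda>_. k"]) auto
next
  case (Suc q)
  have IH: "smooth_upto c n U (\<lambda>x. bspline \<xi> q i (\<eta> x))" "smooth_upto c n U (\<lambda>x. bspline \<xi> q (i + 1) (\<eta> x))"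
    using Suc.IH[of i] Suc.IH[of "i + 1"] Suc.prems by auto
  have "smooth_upto c n U (\<lambda>x. ((\<eta> x - \<xi> ! i) * (1 / (\<xi> ! (i + q + 1) - \<xi> ! i))) * bspline \<xi> q i (\<eta> x)
     + ((\<xi> ! (i + q + 2) - \<eta> x) * (1 / (\<xi> ! (i + q + 2) - \<xi> ! (i + 1)))) * bspline \<xi> q (i + 1) (\<eta> x))"
    by (intro smooth_upto_add smooth_upto_mult smooth_upto_diff smooth_upto_const IH assms(2,3))
  then show ?case by (simp only: bspline.simps divide_inverse mult_1)
qed

lemma bspline_continuous_on_cell:
  assumes "cell J" "i + q < m + p"
  shows "continuous_on J (bspline \<xi> q i)"
  using assms(2)
proof (induction q arbitrary: i)
  case 0
  then obtain k where k: "\<And>x. x \<in> J \<Longrightarrow> bspline \<xi> 0 i x = k" using assms(1) unfolding cell_def by auto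
  show ?case by (rule continuous_on_eq[OF continuous_on_const[of _ k]]) (use k in simp)
next
  case (Suc q)
  have IH: "continuous_on J (bspline \<xi> q i)" "continuous_on J (bspline \<xi> q (i + 1))"
    using Suc.IH[of i] Suc.IH[of "i + 1"] Suc.prems by auto
  have "continuous_on J (\<lambda>x. ((x - \<xi> ! i) * (1 / (\<xi> ! (i + q + 1) - \<xi> ! i))) * bspline \<xi> q i x
     + ((\<xi> ! (i + q + 2) - x) * (1 / (\<xi> ! (i + q + 2) - \<xi> ! (i + 1)))) * bspline \<xi> q (i + 1) x)"
    by (intro continuous_intros IH)
  moreover have "(\<lambda>x. ((x - \<xi> ! i) * (1 / (\<xi> ! (i + q + 1) - \<xi> ! i))) * bspline \<xi> q i x
     + ((\<xi> ! (i + q + 2) - x) * (1 / (\<xi> ! (i + q + 2) - \<xi> ! (i + 1)))) * bspline \<xi> q (i + 1) x) = bspline \<xi> (Suc q) i"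
    by (rule ext) (simp only: bspline.simps divide_inverse mult_1)
  ultimately show ?case by (simp only:)
qed

text \<open>Near an endpoint the interval [0,1] stays within a single cell, where the splines are
  polynomials whatever the multiplicities of the interior knots.\<close>

lemma bspline_continuous_at_ends:
  assumes "i < m" "x = 0 \<or> x = 1"
  shows "continuous (at x within {0..1}) (bspline \<xi> p i)"
proof -
  have ip: "i + p < m + p" using assms(1) by simp
  have "\<exists>V J. open V \<and> x \<in> V \<and> x \<in> J \<and> V \<inter> {0..1} \<subseteq> J \<and> cell J"
  proof (cases "x = 0")
    case True
    obtain j where j: "j < m + p" "\<xi> ! j \<le> 0" "0 < \<xi> ! (j + 1)" using span_right_open[of 0] by auto
    have "0 \<le> \<xi> ! j" using knot_bounds(1)[of j] j by simp
    then have "open {..<\<xi> ! (j + 1)} \<and> x \<in> {..<\<xi> ! (j + 1)} \<and> x \<in> {\<xi> ! j..<\<xi> ! (j + 1)} \<and>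
        {..<\<xi> ! (j + 1)} \<inter> {0..1} \<subseteq> {\<xi> ! j..<\<xi> ! (j + 1)} \<and> cell {\<xi> ! j..<\<xi> ! (j + 1)}"
      using cell_span[OF j(1)] j True by auto
    then show ?thesis by blast
  next
    case False
    then have x: "x = 1" using assms(2) by simp
    obtain j where j: "j < m + p" "\<xi> ! j < 1" "\<xi> ! (j + 1) = 1" using last_span by blast
    have "open {\<xi> ! j<..} \<and> x \<in> {\<xi> ! j<..} \<and> x \<in> {\<xi> ! j<..1} \<and> {\<xi> ! j<..} \<inter> {0..1} \<subseteq> {\<xi> ! j<..1} \<and> cell {\<xi> ! j<..1}"
      using cell_last[OF j] j x by auto
    then show ?thesis by blast
  qed
  then obtain V J where VJ: "open V" "x \<in> V" "x \<in> J" "V \<inter> {0..1} \<subseteq> J" "cell J" by blast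
  have "continuous (at x within (V \<inter> {0..1})) (bspline \<xi> p i)"
    using bspline_continuous_on_cell[OF VJ(5) ip] VJ(3,4)
    by (meson continuous_on_eq_continuous_within continuous_within_subset)
  moreover have "at x within (V \<inter> {0..1}) = at x within {0..1}"
    by (rule at_within_nhd[OF VJ(2,1)]) auto
  ultimately show ?thesis by simp
qed

lemma bspline_continuous_closed:
  assumes "i < m" "continuous_on {0<..<1} (bspline \<xi> p i)"
  shows "continuous_on {0..1} (bspline \<xi> p i)"
  unfolding continuous_on_eq_continuous_within
proof
  fix x :: real assume x: "x \<in> {0..1}"
  show "continuous (at x within {0..1}) (bspline \<xi> p i)"
  proof (cases "x = 0 \<or> x = 1")
    case False
    then have "x \<in> {0<..<1}" using x by auto
    then have "continuous (at x) (bspline \<xi> p i)"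
      using assms(2) by (simp add: continuous_on_eq_continuous_at)
    then show ?thesis by (rule continuous_at_imp_continuous_at_within)
  qed (rule bspline_continuous_at_ends[OF assms(1)])
qed

lemma bspline_zero_closed:
  assumes "i < m" "\<And>x. x \<in> {0<..<1} \<Longrightarrow> bspline \<xi> p i x = 0" "x \<in> {0..1}"
  shows "bspline \<xi> p i x = 0"
proof -
  have "continuous_on {0<..<1} (bspline \<xi> p i)"
    by (rule continuous_on_eq[OF continuous_on_const[of _ 0]]) (use assms(2) in simp)
  then have c: "continuous_on (closure {0<..<1}) (bspline \<xi> p i)"
    using bspline_continuous_closed[OF assms(1)] by simp
  show ?thesis
    by (rule continuous_constant_on_closure[OF c]) (use assms in auto)
qed

end

section \<open>Piecewise Lipschitz functions\<close>

lemma continuous_le_on_closure_within: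
  fixes f :: "'a::metric_space \<Rightarrow> real"
  assumes "continuous_on S f" "A \<subseteq> S" "\<And>x. x \<in> A \<Longrightarrow> f x \<le> c" "x \<in> closure A" "x \<in> S"
  shows "f x \<le> c"
proof -
  obtain a where a: "\<And>n. a n \<in> A" "a \<longlonglongrightarrow> x" using assms(4) unfolding closure_sequential by blast
  have "(\<lambda>n. f (a n)) \<longlonglongrightarrow> f x"
    by (rule continuous_on_tendsto_compose[OF assms(1) a(2) assms(5)], rule always_eventually)
      (use a(1) assms(2) in blast)
  then show ?thesis by (rule LIMSEQ_le_const2) (use a(1) assms(3) in auto)
qed

text \<open>Convexity keeps the segment from x to y inside S. Along it the closed elements have
  finitely many closed preimages that cover the unit interval, and Lipschitz bounds on such pieces
  combine with the same constant.\<close>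

lemma piecewise_Lipschitz:
  fixes f :: "'a::euclidean_space \<Rightarrow> real"
  assumes S: "convex S" "continuous_on S f" and fin: "finite \<E>" and cover: "S \<subseteq> (\<Union>E\<in>\<E>. closure E)"
    and E: "\<And>E. E \<in> \<E> \<Longrightarrow> E \<subseteq> S" "\<And>E x y. E \<in> \<E> \<Longrightarrow> x \<in> E \<Longrightarrow> y \<in> E \<Longrightarrow> \<bar>f x - f y\<bar> \<le> C * dist x y"
    and C: "0 \<le> C" and xy: "x \<in> S" "y \<in> S"
  shows "\<bar>f x - f y\<bar> \<le> C * dist x y"
proof -
  \<comment> \<open>Continuity first extends the bound to the closures within S, since only the
    closures cover S.\<close>
  have cl: "\<bar>f x - f y\<bar> \<le> C * dist x y" if "E0 \<in> \<E>" "x \<in> closure E0" "y \<in> closure E0" "x \<in> S" "y \<in> S" for E0 x y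
  proof -
    have c: "continuous_on (S \<times> S) (\<lambda>z. \<bar>f (fst z) - f (snd z)\<bar> - C * dist (fst z) (snd z))"
      by (intro continuous_intros continuous_on_compose2[OF S(2)]) auto
    have "\<bar>f (fst (x, y)) - f (snd (x, y))\<bar> - C * dist (fst (x, y)) (snd (x, y)) \<le> 0"
      by (rule continuous_le_on_closure_within[OF c, of "E0 \<times> E0"])
        (use E[OF that(1)] that in \<open>auto simp: closure_Times\<close>)
    then show ?thesis by simp
  qed
  define \<gamma> where "\<gamma> t = x + t *\<^sub>R (y - x)" for t :: real
  have \<gamma>S: "\<gamma> t \<in> S" if "t \<in> {0..1}" for t
  proof -
    have "(1 - t) *\<^sub>R x + t *\<^sub>R y \<in> S" using S(1) xy that unfolding convex_alt by auto
    then show ?thesis by (simp add: \<gamma>_def algebra_simps)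
  qed
  have \<gamma>c: "continuous_on T \<gamma>" for T unfolding \<gamma>_def by (intro continuous_intros)
  define U where "U E = {t \<in> {0..1}. \<gamma> t \<in> closure E}" for E
  have "(C * dist x y)-lipschitz_on {0..1} (f \<circ> \<gamma>)"
  proof (rule lipschitz_on_closed_Union[where I = \<E> and U = U])
    fix E0 assume E0: "E0 \<in> \<E>"
    show "closed (U E0)"
      unfolding U_def using continuous_closed_preimage[OF \<gamma>c closed_atLeastAtMost closed_closure, of 0 1 E0]
      by (simp add: vimage_def Int_def)
    show "(C * dist x y)-lipschitz_on (U E0) (f \<circ> \<gamma>)"
    proof (rule lipschitz_onI)
      fix s t assume st: "s \<in> U E0" "t \<in> U E0"
      have "\<bar>f (\<gamma> s) - f (\<gamma> t)\<bar> \<le> C * dist (\<gamma> s) (\<gamma> t)"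
        using st \<gamma>S by (intro cl[OF E0]) (auto simp: U_def)
      also have "dist (\<gamma> s) (\<gamma> t) = dist s t * dist x y"
      proof -
        have "\<gamma> s - \<gamma> t = (s - t) *\<^sub>R (y - x)" by (simp add: \<gamma>_def algebra_simps)
        then show ?thesis by (simp add: dist_norm norm_minus_commute)
      qed
      finally show "dist ((f \<circ> \<gamma>) s) ((f \<circ> \<gamma>) t) \<le> C * dist x y * dist s t"
        by (simp add: dist_real_def mult_ac)
    qed (use C in simp)
  next
    show "{0..1} \<subseteq> (\<Union>E\<in>\<E>. U E)"
    proof
      fix t :: real assume t: "t \<in> {0..1}"
      then obtain E0 where "E0 \<in> \<E>" "\<gamma> t \<in> closure E0" using \<gamma>S[OF t] cover by blast
      then show "t \<in> (\<Union>E\<in>\<E>. U E)" using t by (auto simp: U_def)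
    qed
  qed (use fin C in auto)
  from lipschitz_onD[OF this, of 0 1] have "dist (f (\<gamma> 0)) (f (\<gamma> 1)) \<le> C * dist x y * dist (0::real) 1" by simp
  then show ?thesis by (simp add: \<gamma>_def dist_real_def)
qed

lemma frechet_derivative_bound:
  assumes "f differentiable (at x)" "\<And>b. b \<in> Basis \<Longrightarrow> \<bar>dpartial b f x\<bar> \<le> M"
  shows "\<bar>frechet_derivative f (at x) (h :: 'a::euclidean_space)\<bar> \<le> (real DIM('a) * M) * norm h"
proof -
  have lin: "linear (frechet_derivative f (at x))"
    using assms(1) frechet_derivative_works has_derivative_linear by blast
  have "frechet_derivative f (at x) h = frechet_derivative f (at x) (\<Sum>c\<in>Basis. (h \<bullet> c) *\<^sub>R c)"
    by (simp add: euclidean_representation)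
  also have "\<dots> = (\<Sum>c\<in>Basis. (h \<bullet> c) * dpartial c f x)"
    by (simp add: linear_sum[OF lin] linear_cmul[OF lin] dpartial_def)
  also have "\<bar>\<dots>\<bar> \<le> (\<Sum>c\<in>(Basis::'a set). norm h * M)"
    using assms(2) Basis_le_norm
    by (intro order_trans[OF sum_abs] sum_mono) (auto simp: abs_mult intro!: mult_mono)
  finally show ?thesis by (simp add: mult_ac)
qed

lemma convex_Lipschitz:
  fixes f :: "'a::euclidean_space \<Rightarrow> real"
  assumes "convex S" "\<And>x. x \<in> S \<Longrightarrow> (f has_derivative f' x) (at x)" "\<And>x h. x \<in> S \<Longrightarrow> \<bar>f' x h\<bar> \<le> C * norm h"
    "x \<in> S" "y \<in> S"
  shows "\<bar>f x - f y\<bar> \<le> C * dist x y"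
proof -
  have "norm (f x - f y) \<le> C * norm (x - y)"
  proof (rule differentiable_bound[OF assms(1)])
    fix z assume z: "z \<in> S"
    show "(f has_derivative f' z) (at z within S)" by (rule has_derivative_at_withinI[OF assms(2)[OF z]])
    show "onorm (f' z) \<le> C" by (rule onorm_le) (use assms(3)[OF z] in simp)
  qed (use assms in auto)
  then show ?thesis by (simp add: dist_norm)
qed

lemma smooth_upto_continuous:
  assumes "smooth_upto c (Suc n) U f" shows "continuous_on U f"
  using assms by (auto intro!: continuous_at_imp_continuous_on differentiable_imp_continuous_within)

section \<open>B-splines in time\<close>

context knots
begin

definition spans :: "real set set" where
  "spans = (\<lambda>i. {\<xi> ! i<..<\<xi> ! (i + 1)}) ` {i. i < m + p \<and> \<xi> ! i < \<xi> ! (i + 1)}"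

lemma finite_spans: "finite spans"
  unfolding spans_def by simp

lemma spans_cell: "J \<in> spans \<Longrightarrow> cell J"
  unfolding spans_def using cell_span by (auto intro!: cell_subset[OF cell_span])

lemma spans_props: "J \<in> spans \<Longrightarrow> open J" "J \<in> spans \<Longrightarrow> convex J" "J \<in> spans \<Longrightarrow> J \<subseteq> {0<..<1}" "J \<in> spans \<Longrightarrow> bounded J"
proof -
  assume "J \<in> spans"
  then obtain i where i: "J = {\<xi> ! i<..<\<xi> ! (i + 1)}" "i < m + p" by (auto simp: spans_def)
  have "0 \<le> \<xi> ! i" "\<xi> ! (i + 1) \<le> 1" using knot_bounds(1)[of i] knot_bounds(2)[of "i + 1"] i(2) by auto
  then show "open J" "convex J" "J \<subseteq> {0<..<1}" "bounded J" using i(1) by auto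
qed

text \<open>A continuous piecewise polynomial has bounded derivative on its finitely many spans, so
  it is Lipschitz across the knots. Its weak derivative is then the one taken span by span, the
  images of the knots forming a finite set.\<close>

lemma time_weak_derivative:
  assumes i: "i < m" and cont: "continuous_on {0..1} (bspline \<xi> p i)" and T: "0 < T"
  shows "\<exists>w\<in>L2 {0<..<T}. weak_derivative {0<..<T} [1] (\<lambda>t. bspline \<xi> p i (t / T)) w"
proof -
  let ?B = "bspline \<xi> p i" and ?I = "{0<..<T}"
  define u where "u t = ?B (t / T)" for t
  define JT where "JT J = {t. t / T \<in> J}" for J
  have JT_open: "open (JT J)" if "open J" for J
  proof -
    have "continuous_on UNIV (\<lambda>t. t / T)" using T by (intro continuous_intros) auto
    from open_vimage[OF that this] show ?thesis by (simp add: JT_def vimage_def)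
  qed
  have JT_I: "JT J \<subseteq> ?I" if "J \<in> spans" for J
    using spans_props(3)[OF that] T by (auto simp: JT_def dest!: subsetD simp: field_simps)
  have sm: "smooth_upto True n (JT J) u" if J: "J \<in> spans" for J n
  proof -
    have o: "open (JT J)" by (rule JT_open[OF spans_props(1)[OF J]])
    have "(\<lambda>t. t / T) ` JT J \<subseteq> {0..1}" using spans_props(3)[OF J] by (auto simp: JT_def)
    from bounded_subset[OF bounded_closed_interval this] have bd: "bounded ((\<lambda>t. t / T) ` JT J)" .
    have "smooth_upto True n (JT J) (\<lambda>t. t / T)"
    proof (cases n)
      case 0
      then show ?thesis using bd by simp
    next
      case (Suc k)
      have d: "((\<lambda>t. t / T) has_real_derivative 1 / T) (at t)" for t
        using T by (auto intro!: derivative_eq_intros)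
      have "dpartial 1 (\<lambda>t. t / T) = (\<lambda>_. 1 / T)" by (rule ext, rule dpartial_real_eq[OF d])
      moreover have "(\<lambda>t. t / T) differentiable (at t)" for t using d by (auto simp: real_differentiable_def)
      ultimately show ?thesis using Suc bd by simp
    qed
    then show ?thesis unfolding u_def
      using i by (intro bspline_smooth_on_cell[OF spans_cell[OF J] o]) (auto simp: JT_def)
  qed
  define N where "N = (\<Union>J\<in>spans. JT J)"
  have No: "open N" unfolding N_def using JT_open spans_props(1) by blast
  have NI: "N \<subseteq> ?I" unfolding N_def using JT_I by blast
  have Ndiff: "u differentiable (at t)" if t: "t \<in> N" for t
    using t sm[of _ "Suc 0"] unfolding N_def by auto
  have Ncont: "continuous_on N (dpartial 1 u)"
    unfolding N_def
  proof (rule continuous_on_open_UN)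
    fix J assume "J \<in> spans"
    then show "open (JT J)" "continuous_on (JT J) (dpartial 1 u)"
      using JT_open spans_props(1) sm[of J "Suc (Suc 0)"] by (auto intro: smooth_upto_continuous[of True 0])
  qed
  have "\<exists>M. \<forall>t\<in>N. \<bar>dpartial 1 u t\<bar> \<le> M"
  proof -
    have "bounded (\<Union>J\<in>spans. dpartial 1 u ` JT J)"
      using finite_spans sm[of _ "Suc 0"] by (intro bounded_UN ballI) auto
    then have "bounded (dpartial 1 u ` N)" by (simp add: N_def image_UN)
    then show ?thesis unfolding bounded_real by blast
  qed
  then obtain M where M: "\<And>t. t \<in> N \<Longrightarrow> \<bar>dpartial 1 u t\<bar> \<le> M" by blast
  define w where "w t = (if t \<in> N then dpartial 1 u t else 0)" for t
  have N_ae: "AE t in lborel. t \<in> ?I \<longrightarrow> t \<in> N"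
  proof -
    have "?I - N \<subseteq> (\<lambda>i. T * \<xi> ! i) ` {..m + p}"
    proof
      fix t assume t: "t \<in> ?I - N"
      then have "t / T \<in> {0..1}" using T by (auto simp: field_simps)
      then obtain i where i: "i < m + p" "\<xi> ! i < \<xi> ! (i + 1)" "\<xi> ! i \<le> t / T" "t / T \<le> \<xi> ! (i + 1)" using span_closed by blast
      have "{\<xi> ! i<..<\<xi> ! (i + 1)} \<in> spans" using i(1,2) by (auto simp: spans_def)
      then have "t \<notin> JT {\<xi> ! i<..<\<xi> ! (i + 1)}" using t unfolding N_def by blast
      then have "t / T \<notin> {\<xi> ! i<..<\<xi> ! (i + 1)}" by (simp add: JT_def)
      then have "t / T = \<xi> ! i \<or> t / T = \<xi> ! (i + 1)" using i by auto
      then have "t = T * \<xi> ! i \<or> t = T * \<xi> ! (i + 1)" using T by (auto simp: field_simps)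
      then show "t \<in> (\<lambda>i. T * \<xi> ! i) ` {..m + p}" using i by auto
    qed
    then have "finite (?I - N)" by (rule finite_subset) simp
    then have "?I - N \<in> null_sets lborel" by (rule finite_imp_null_set_lborel)
    from AE_not_in[OF this] show ?thesis by eventually_elim auto
  qed
  have wm: "w \<in> borel_measurable borel"
  proof -
    have "(\<lambda>t. indicator N t *\<^sub>R dpartial 1 u t) \<in> borel_measurable borel"
      by (rule borel_measurable_continuous_on_indicator[OF _ Ncont]) (use No in simp)
    moreover have "(\<lambda>t. indicator N t *\<^sub>R dpartial 1 u t) = w" by (auto simp: w_def fun_eq_iff)
    ultimately show ?thesis by simp
  qed
  have wL: "w \<in> L2 ?I"
  proof (rule L2_bounded[where B = "\<bar>M\<bar>"])
    show "set_borel_measurable lborel ?I w" using wm by (simp add: set_borel_measurable_def)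
    show "\<bar>w t\<bar> \<le> \<bar>M\<bar>" for t using M[of t] by (auto simp: w_def)
  qed auto
  have uc: "continuous_on {0..T} u" unfolding u_def using T
    by (intro continuous_on_compose2[OF cont] continuous_intros) (auto simp: field_simps)
  define C where "C = real DIM(real) * \<bar>M\<bar>"
  have lip: "\<bar>u s - u t\<bar> \<le> C * dist s t" if st: "s \<in> ?I" "t \<in> ?I" for s t
  proof (rule piecewise_Lipschitz[where S = ?I and \<E> = "JT ` spans"])
    show "continuous_on ?I u" by (rule continuous_on_subset[OF uc]) auto
    show "?I \<subseteq> (\<Union>E\<in>JT ` spans. closure E)"
    proof
      fix t assume t: "t \<in> ?I"
      then have "t / T \<in> {0..1}" using T by (auto simp: field_simps)
      then obtain i where i: "i < m + p" "\<xi> ! i < \<xi> ! (i + 1)" "\<xi> ! i \<le> t / T" "t / T \<le> \<xi> ! (i + 1)" using span_closed by blast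
      have "JT {\<xi> ! i<..<\<xi> ! (i + 1)} = {T * \<xi> ! i<..<T * \<xi> ! (i + 1)}" using T by (auto simp: JT_def field_simps)
      moreover have "t \<in> closure {T * \<xi> ! i<..<T * \<xi> ! (i + 1)}" using i T by (simp add: field_simps)
      moreover have "{\<xi> ! i<..<\<xi> ! (i + 1)} \<in> spans" using i by (auto simp: spans_def)
      ultimately show "t \<in> (\<Union>E\<in>JT ` spans. closure E)" by (metis UN_I imageI)
    qed
    fix E s t assume E: "E \<in> JT ` spans"
    then obtain J where J: "J \<in> spans" "E = JT J" by blast
    show "E \<subseteq> ?I" using JT_I J by blast
    assume st: "s \<in> E" "t \<in> E"
    have cv: "convex E"
    proof -
      have "linear (\<lambda>t. t / T)" by (simp add: linear_iff add_divide_distrib)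
      from convex_linear_vimage[OF this spans_props(2)[OF J(1)]] show ?thesis by (simp add: J(2) JT_def vimage_def)
    qed
    show "\<bar>u s - u t\<bar> \<le> C * dist s t"
    proof (rule convex_Lipschitz[OF cv _ _ st])
      fix x assume x: "x \<in> E"
      then have xN: "x \<in> N" using J by (auto simp: N_def)
      show "(u has_derivative frechet_derivative u (at x)) (at x)" using Ndiff[OF xN] frechet_derivative_works by blast
      show "\<bar>frechet_derivative u (at x) h\<bar> \<le> C * norm h" for h
        unfolding C_def using frechet_derivative_bound[OF Ndiff[OF xN], of "\<bar>M\<bar>" h] M[OF xN] by auto
    qed
  qed (use finite_spans st in \<open>auto simp: C_def\<close>)
  have "weak_derivative ?I [1] u w"
  proof (rule weak_derivative_directionally_Lipschitz)
    show "continuous_on ?I u" by (rule continuous_on_subset[OF uc]) auto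
    show "set_borel_measurable lborel ?I w" using wm by (simp add: set_borel_measurable_def)
    show "AE t in lborel. t \<in> ?I \<longrightarrow> ((\<lambda>h. (u (t + h *\<^sub>R 1) - u t) / h) \<longlongrightarrow> w t) (at 0)"
      using N_ae
    proof eventually_elim
      case (elim t)
      then show ?case using difference_quotient_tendsto[OF Ndiff, of t 1] by (auto simp: w_def)
    qed
    show "directionally_Lipschitz ?I 1 u" unfolding directionally_Lipschitz_def
    proof (intro allI impI, elim conjE)
      fix K assume K: "compact K" "K \<subseteq> ?I"
      obtain e where e0: "0 < e" "compact {x + y | x y. x \<in> K \<and> y \<in> cball 0 e}"
          "{x + y | x y. x \<in> K \<and> y \<in> cball 0 e} \<subseteq> ?I"
        by (rule compact_thickening[OF K(1) open_greaterThanLessThan K(2)]) (rule that)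
      note e = e0(1,3)
      have "\<bar>u (x + h *\<^sub>R 1) - u x\<bar> \<le> C * \<bar>h\<bar>" if "x \<in> K" "\<bar>h\<bar> < e" for x h
      proof -
        have "x + h \<in> ?I" using mem_thickening[OF that(1), of h e] that(2) e(2) by (simp add: subset_iff)
        moreover have "x \<in> ?I" using that K(2) by blast
        ultimately show ?thesis using lip[of "x + h" x] by (simp add: dist_real_def)
      qed
      then show "\<exists>L \<delta>. 0 < \<delta> \<and> (\<forall>x\<in>K. \<forall>h. \<bar>h\<bar> < \<delta> \<longrightarrow> \<bar>u (x + h *\<^sub>R 1) - u x\<bar> \<le> L * \<bar>h\<bar>)"
        using e(1) by blast
    qed
  qed auto
  then show ?thesis using wL unfolding u_def by blast
qed

end

section \<open>The push-forward of spatial splines\<close>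

lemma Basis_axis: "b \<in> (Basis :: (real^'d) set) \<Longrightarrow> \<exists>k. b = axis k 1"
  by (auto simp: Basis_vec_def)

lemma axis_Basis: "axis k 1 \<in> (Basis :: (real^'d) set)"
  by (simp add: axis_in_Basis_iff)

lemma has_derivative_vec:
  fixes f :: "'a::real_normed_vector \<Rightarrow> real^'d"
  assumes "\<And>k. ((\<lambda>x. f x $ k) has_derivative (\<lambda>h. f' h $ k)) (at x)"
  shows "(f has_derivative f') (at x)"
  unfolding has_derivative_componentwise_within[of f f' x UNIV]
proof
  fix i :: "real^'d" assume "i \<in> Basis"
  then obtain k where k: "i = axis k 1" using Basis_axis by blast
  show "((\<lambda>x. f x \<bullet> i) has_derivative (\<lambda>x. f' x \<bullet> i)) (at x)"
    using assms[of k] by (simp add: k inner_axis)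
qed

lemma continuous_on_det:
  fixes M :: "'a::topological_space \<Rightarrow> real^'d^'d"
  assumes "\<And>i j. continuous_on S (\<lambda>x. M x $ i $ j)"
  shows "continuous_on S (\<lambda>x. det (M x))"
  unfolding det_def by (intro continuous_on_sum continuous_on_mult continuous_on_const continuous_on_prod assms)

lemma matrix_inv_right_mult: "invertible (A :: real^'d^'d) \<Longrightarrow> A ** matrix_inv A = mat 1"
  unfolding invertible_def matrix_inv_def by (rule conjunct1[OF someI_ex])

lemma frechet_derivative_vec:
  fixes f :: "real^'d \<Rightarrow> real"
  assumes "f differentiable (at x)"
  shows "frechet_derivative f (at x) h = (\<Sum>j\<in>UNIV. dpartial (axis j 1) f x * h $ j)"
proof -
  have lin: "linear (frechet_derivative f (at x))"
    using assms frechet_derivative_works has_derivative_linear by blast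
  have h: "h = (\<Sum>j\<in>UNIV. h $ j *\<^sub>R axis j 1)"
    by (simp add: vec_eq_iff axis_def if_distrib sum.delta cong: if_cong)
  have "frechet_derivative f (at x) h = frechet_derivative f (at x) (\<Sum>j\<in>UNIV. h $ j *\<^sub>R axis j 1)"
    using h by simp
  also have "\<dots> = (\<Sum>j\<in>UNIV. h $ j * dpartial (axis j 1) f x)"
    by (simp add: linear_sum[OF lin] linear_cmul[OF lin] dpartial_def)
  finally show ?thesis by (simp add: mult.commute)
qed

locale spline_geometry =
  fixes p :: "'d::finite \<Rightarrow> nat" and \<Xi> :: "'d \<Rightarrow> real list" and F :: "real^'d \<Rightarrow> real^'d"
  assumes knots: "\<And>k. open_knot_vector (p k) (\<Xi> k)"
    and splines_C1: "\<And>g. g \<in> space_splines p \<Xi> \<Longrightarrow> C1_on (box 0 1) g"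
    and F_spline: "\<And>k. \<exists>g\<in>space_splines p \<Xi>. \<forall>\<eta>\<in>closure (box 0 1). F \<eta> $ k = g \<eta>"
    and F_inj: "inj_on F (box 0 1)"
    and F_invertible: "\<And>\<eta>. \<eta> \<in> box 0 1 \<Longrightarrow> invertible (matrix (frechet_derivative F (at \<eta>)))"
    and inverse_bounded: "\<And>E k. E \<in> mesh_elements \<Xi> \<Longrightarrow>
           bounded_derivatives_on (F ` E) (\<lambda>x. inv_into (box 0 1) F x $ k)"
begin

sublocale K: knots "p k" "\<Xi> k" for k
  by unfold_locales (rule knots)

abbreviation W :: "(real^'d) set" where "W \<equiv> box 0 1"
abbreviation \<Omega> :: "(real^'d) set" where "\<Omega> \<equiv> F ` W"
abbreviation G :: "real^'d \<Rightarrow> real^'d" where "G \<equiv> inv_into W F"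

section \<open>Continuity of tensor-product splines up to the boundary of the cube\<close>

lemma finite_space_index: "finite (space_index p \<Xi>)"
proof -
  have "space_index p \<Xi> = PiE UNIV (\<lambda>k. {..<num_bsplines (p k) (\<Xi> k)})"
    by (auto simp: space_index_def PiE_def extensional_def)
  then show ?thesis by (simp add: finite_PiE)
qed

lemma space_bspline_in: "i \<in> space_index p \<Xi> \<Longrightarrow> space_bspline p \<Xi> i \<in> space_splines p \<Xi>"
  unfolding space_splines_def fun_span_def
proof (rule range_eqI[of _ _ "\<lambda>j. if j = i then 1 else 0"], rule ext)
  fix x assume i: "i \<in> space_index p \<Xi>"
  have "(\<Sum>j\<in>space_index p \<Xi>. (if j = i then 1 else 0) * space_bspline p \<Xi> j x)
      = (\<Sum>j\<in>space_index p \<Xi>. if j = i then space_bspline p \<Xi> j x else 0)"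
    by (rule sum.cong) simp_all
  also have "\<dots> = space_bspline p \<Xi> i x"
    using i by (simp only: sum.delta[OF finite_space_index] if_True)
  finally show "space_bspline p \<Xi> i x = (\<Sum>j\<in>space_index p \<Xi>. (if j = i then 1 else 0) * space_bspline p \<Xi> j x)"
    by (rule sym)
qed

text \<open>The regularity hypothesis concerns only the open cube. If some univariate factor
  vanishes on (0,1), the product is 0 up to the boundary. Otherwise the other variables are frozen
  at points where their factors are nonzero, which shows each factor continuous on (0,1); at the
  endpoints every B-spline is continuous.\<close>

lemma space_bspline_continuous:
  assumes i: "i \<in> space_index p \<Xi>"
  shows "continuous_on (cbox 0 1) (space_bspline p \<Xi> i)"
proof -
  let ?B = "\<lambda>k. bspline (\<Xi> k) (p k) (i k)"
  have im: "i k < K.m k" for k using i by (simp add: space_index_def K.m_def)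
  show ?thesis
  proof (cases "\<exists>l. \<forall>x\<in>{0<..<1}. ?B l x = 0")
    case True
    then obtain l where l: "\<And>x. x \<in> {0<..<1} \<Longrightarrow> ?B l x = 0" by blast
    have "space_bspline p \<Xi> i \<eta> = 0" if "\<eta> \<in> cbox 0 1" for \<eta>
    proof -
      have "?B l (\<eta> $ l) = 0" by (rule K.bspline_zero_closed[OF im l]) (use that in \<open>auto simp: mem_box_cart\<close>)
      then show ?thesis unfolding space_bspline_def by (intro prod_zero) auto
    qed
    then show ?thesis by (intro continuous_on_eq[OF continuous_on_const[of _ 0]]) auto
  next
    case False
    then have "\<forall>l. \<exists>x. x \<in> {0<..<1} \<and> ?B l x \<noteq> 0" by blast
    then obtain z where z: "\<And>l. z l \<in> {0<..<1}" "\<And>l. ?B l (z l) \<noteq> 0" by metis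
    have cW: "continuous_on W (space_bspline p \<Xi> i)"
      using splines_C1[OF space_bspline_in[OF i]] unfolding C1_on_def
      by (intro continuous_at_imp_continuous_on ballI differentiable_imp_continuous_within) auto
    have "continuous_on {0..1} (?B k)" for k
    proof (rule K.bspline_continuous_closed[OF im])
      define c where "c = (\<Prod>l\<in>UNIV - {k}. ?B l (z l))"
      have c: "c \<noteq> 0" using z(2) by (simp add: c_def)
      let ?e = "\<lambda>t. (\<chi> l. if l = k then t else z l) :: real^'d"
      have e: "space_bspline p \<Xi> i (?e t) = ?B k t * c" for t
        unfolding space_bspline_def c_def by (subst prod.remove[of UNIV k]) auto
      have ce: "continuous_on S ?e" for S
      proof (rule continuous_on_vec_lambda)
        fix l show "continuous_on S (\<lambda>t. if l = k then t else z l)"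
          by (cases "l = k") (simp_all add: continuous_on_id continuous_on_const)
      qed
      have "continuous_on {0<..<1} (\<lambda>t. space_bspline p \<Xi> i (?e t))"
        by (rule continuous_on_compose2[OF cW ce]) (use z(1) in \<open>auto simp: mem_box_cart\<close>)
      then have "continuous_on {0<..<1} (\<lambda>t. (?B k t * c) / c)" unfolding e
        by (rule continuous_on_divide[OF _ continuous_on_const]) (use c in simp)
      moreover have "(\<lambda>t. (?B k t * c) / c) = ?B k" by (rule ext) (use c in simp)
      ultimately show "continuous_on {0<..<1} (?B k)" by (simp only:)
    qed
    then have "continuous_on (cbox 0 1) (\<lambda>\<eta> :: real^'d. ?B k (\<eta> $ k))" for k
      by (rule continuous_on_compose2[OF _ continuous_on_component[OF continuous_on_id]]) (auto simp: mem_box_cart)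
    then show ?thesis unfolding space_bspline_def[abs_def] by (rule continuous_on_prod)
  qed
qed

lemma spline_continuous: "g \<in> space_splines p \<Xi> \<Longrightarrow> continuous_on (cbox 0 1) g"
  unfolding space_splines_def fun_span_def
  by (auto intro!: continuous_intros space_bspline_continuous)

lemma spline_bounded:
  assumes "g \<in> space_splines p \<Xi>"
  obtains B where "\<And>\<eta>. \<eta> \<in> cbox 0 1 \<Longrightarrow> \<bar>g \<eta>\<bar> \<le> B"
proof -
  have "bounded (g ` cbox 0 1)"
    using spline_continuous[OF assms] by (intro compact_imp_bounded compact_continuous_image) auto
  then show thesis using that unfolding bounded_real by blast
qed

lemma closure_W: "closure W = cbox 0 1"
proof -
  have "W \<noteq> {}" by (simp add: interval_ne_empty_cart)
  then show ?thesis by (simp add: closure_box)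
qed

lemma W_cbox: "W \<subseteq> cbox 0 1"
  using closure_W closure_subset by blast

section \<open>The mesh of the parameter cube\<close>

definition element :: "('d \<Rightarrow> nat) \<Rightarrow> (real^'d) set" where
  "element i = box (\<chi> k. \<Xi> k ! i k) (\<chi> k. \<Xi> k ! (i k + 1))"

definition element_index :: "('d \<Rightarrow> nat) set" where
  "element_index = {i. \<forall>k. i k < K.m k + p k \<and> \<Xi> k ! i k < \<Xi> k ! (i k + 1)}"

lemma mesh_elements_eq: "mesh_elements \<Xi> = element ` element_index"
  unfolding mesh_elements_def element_def element_index_def using K.length_knots by auto

lemma finite_mesh: "finite (mesh_elements \<Xi>)"
proof -
  have "element_index \<subseteq> PiE UNIV (\<lambda>k. {..<K.m k + p k})"
    by (auto simp: element_index_def PiE_def extensional_def)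
  then have "finite element_index" by (rule finite_subset) (simp add: finite_PiE)
  then show ?thesis by (simp add: mesh_elements_eq)
qed

lemma mesh_element_props:
  assumes "E \<in> mesh_elements \<Xi>"
  shows "open E" "convex E" "bounded E" "E \<subseteq> W"
proof -
  obtain i where i: "E = element i" "i \<in> element_index" using assms by (auto simp: mesh_elements_eq)
  then show "open E" "convex E" "bounded E" by (auto simp: element_def)
  show "E \<subseteq> W"
  proof
    fix x assume "x \<in> E"
    then have x: "\<Xi> k ! i k < x $ k" "x $ k < \<Xi> k ! (i k + 1)" for k using i(1) by (auto simp: element_def mem_box_cart)
    have ik: "i k < K.m k + p k" for k using i(2) unfolding element_index_def by blast
    have "0 \<le> \<Xi> k ! i k" "\<Xi> k ! (i k + 1) \<le> 1" for k
      by (rule K.knot_bounds(1), use ik[of k] in linarith, rule K.knot_bounds(2), use ik[of k] in linarith)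
    then show "x \<in> W" using x unfolding mem_box_cart zero_index one_index by (meson order_le_less_trans order_less_le_trans)
  qed
qed

lemma mesh_index:
  assumes "x \<in> cbox 0 1"
  obtains i where "i \<in> element_index" "\<And>k. \<Xi> k ! i k \<le> x $ k" "\<And>k. x $ k \<le> \<Xi> k ! (i k + 1)"
proof -
  have "\<exists>i. i < K.m k + p k \<and> \<Xi> k ! i < \<Xi> k ! (i + 1) \<and> \<Xi> k ! i \<le> x $ k \<and> x $ k \<le> \<Xi> k ! (i + 1)" for k
    using K.span_closed[of "x $ k" k] assms by (auto simp: mem_box_cart)
  then obtain i where "\<And>k. i k < K.m k + p k \<and> \<Xi> k ! i k < \<Xi> k ! (i k + 1) \<and> \<Xi> k ! i k \<le> x $ k \<and> x $ k \<le> \<Xi> k ! (i k + 1)"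
    by metis
  then show thesis using that[of i] by (auto simp: element_index_def)
qed

lemma mesh_cover: "W \<subseteq> (\<Union>E\<in>mesh_elements \<Xi>. closure E)"
proof
  fix x assume "x \<in> W"
  then obtain i where i: "i \<in> element_index" "\<And>k. \<Xi> k ! i k \<le> x $ k" "\<And>k. x $ k \<le> \<Xi> k ! (i k + 1)"
    using mesh_index W_cbox by blast
  have "element i \<noteq> {}" using i(1) unfolding element_def by (auto simp: interval_ne_empty_cart element_index_def)
  then have "closure (element i) = cbox (\<chi> k. \<Xi> k ! i k) (\<chi> k. \<Xi> k ! (i k + 1))"
    unfolding element_def by (simp add: closure_box)
  then have "x \<in> closure (element i)" using i(2,3) by (simp add: mem_box_cart)
  then show "x \<in> (\<Union>E\<in>mesh_elements \<Xi>. closure E)" using i(1) by (auto simp: mesh_elements_eq)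
qed

text \<open>A point of the cube outside all open elements has a coordinate equal to a knot, so it
  lies on one of finitely many hyperplanes.\<close>

lemma negligible_skeleton: "negligible (W - \<Union>(mesh_elements \<Xi>))"
proof (rule negligible_subset)
  show "negligible (\<Union>k. \<Union>j\<in>{..K.m k + p k}. {x :: real^'d. x \<bullet> axis k 1 = \<Xi> k ! j})"
  proof -
    have h: "negligible {x :: real^'d. x \<bullet> axis k 1 = c}" for k c
      by (rule negligible_standard_hyperplane[OF axis_Basis])
    have "negligible (\<Union>j\<in>{..K.m k + p k}. {x :: real^'d. x \<bullet> axis k 1 = \<Xi> k ! j})" for k
      by (rule negligible_Union) (use h in auto)
    then show ?thesis by (intro negligible_Union) auto
  qed
  show "W - \<Union>(mesh_elements \<Xi>) \<subseteq> (\<Union>k. \<Union>j\<in>{..K.m k + p k}. {x :: real^'d. x \<bullet> axis k 1 = \<Xi> k ! j})"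
  proof
    fix x assume x: "x \<in> W - \<Union>(mesh_elements \<Xi>)"
    then obtain i where i: "i \<in> element_index" "\<And>k. \<Xi> k ! i k \<le> x $ k" "\<And>k. x $ k \<le> \<Xi> k ! (i k + 1)"
      using mesh_index W_cbox by blast
    have "x \<notin> element i" using x i(1) by (auto simp: mesh_elements_eq)
    then obtain k where "\<not> (\<Xi> k ! i k < x $ k \<and> x $ k < \<Xi> k ! (i k + 1))"
      by (auto simp: element_def mem_box_cart)
    then have "x $ k = \<Xi> k ! i k \<or> x $ k = \<Xi> k ! (i k + 1)" using i(2,3)[of k] by linarith
    moreover have "i k < K.m k + p k" using i(1) unfolding element_index_def by blast
    then have "i k \<in> {..K.m k + p k}" "i k + 1 \<in> {..K.m k + p k}" by simp_all
    moreover have "x \<bullet> axis k 1 = x $ k" by (simp add: inner_axis)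
    ultimately have "\<exists>j\<in>{..K.m k + p k}. x \<bullet> axis k 1 = \<Xi> k ! j" by (metis (no_types))
    then show "x \<in> (\<Union>k. \<Union>j\<in>{..K.m k + p k}. {x :: real^'d. x \<bullet> axis k 1 = \<Xi> k ! j})" by blast
  qed
qed

text \<open>Stated for a composition, so that it covers both the splines themselves and their
  composition with the inverse geometry map.\<close>

lemma spline_smooth_on_element:
  assumes E: "E \<in> mesh_elements \<Xi>" and U: "open U" and H: "\<And>k. smooth_upto c n U (\<lambda>x. H x $ k)" "\<And>x. x \<in> U \<Longrightarrow> H x \<in> E"
    and g: "g \<in> space_splines p \<Xi>"
  shows "smooth_upto c n U (\<lambda>x. g (H x))"
proof -
  obtain i where i: "E = element i" "i \<in> element_index" using E by (auto simp: mesh_elements_eq)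
  obtain a where a: "g = (\<lambda>x. \<Sum>j\<in>space_index p \<Xi>. a j * space_bspline p \<Xi> j x)"
    using g by (auto simp: space_splines_def fun_span_def)
  have B: "smooth_upto c n U (\<lambda>x. bspline (\<Xi> k) (p k) (j k) (H x $ k))" if "j \<in> space_index p \<Xi>" for j k
  proof (rule K.bspline_smooth_on_cell[OF _ U H(1)])
    show "K.cell k {\<Xi> k ! i k..<\<Xi> k ! (i k + 1)}" using i(2) by (intro K.cell_span) (auto simp: element_index_def)
    show "H x $ k \<in> {\<Xi> k ! i k..<\<Xi> k ! (i k + 1)}" if "x \<in> U" for x
      using H(2)[OF that] i(1) by (auto simp: element_def mem_box_cart less_imp_le)
    show "j k + p k < K.m k + p k" using that by (simp add: space_index_def K.m_def)
  qed
  show ?thesis unfolding a space_bspline_def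
    by (intro smooth_upto_sum[OF U] smooth_upto_mult[OF U] smooth_upto_const smooth_upto_prod[OF U] B)
qed

lemma coordinate_smooth: "bounded E \<Longrightarrow> smooth_upto True n E (\<lambda>x :: real^'d. x $ k)"
proof -
  assume "bounded E"
  then have bd: "bounded ((\<lambda>x. x $ k) ` E)" using bounded_linear_image[OF _ bounded_linear_vec_nth] by blast
  have d: "((\<lambda>x :: real^'d. x $ k) has_derivative (\<lambda>h. h $ k)) (at x)" for x
    by (rule bounded_linear_imp_has_derivative[OF bounded_linear_vec_nth])
  have "dpartial b (\<lambda>x. x $ k) = (\<lambda>_. b $ k)" for b :: "real^'d" by (rule ext, rule dpartial_eq[OF d])
  moreover have "(\<lambda>x :: real^'d. x $ k) differentiable (at x)" for x using d by (auto simp: differentiable_def)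
  ultimately show ?thesis using bd by (cases n) auto
qed

lemma spline_smooth:
  assumes "E \<in> mesh_elements \<Xi>" "g \<in> space_splines p \<Xi>"
  shows "smooth_upto True n E g"
  using spline_smooth_on_element[OF assms(1) mesh_element_props(1)[OF assms(1)], where H = "\<lambda>x. x", OF coordinate_smooth[OF mesh_element_props(3)[OF assms(1)]] _ assms(2)]
  by simp

section \<open>The geometry map, its Jacobian and its inverse\<close>

definition Fk :: "'d \<Rightarrow> real^'d \<Rightarrow> real" where
  "Fk k = (SOME g. g \<in> space_splines p \<Xi> \<and> (\<forall>\<eta>\<in>closure W. F \<eta> $ k = g \<eta>))"

text \<open>F is tied to splines on the closed cube only, whereas derivatives refer to
  neighbourhoods. At points of the open cube the components of F therefore have the derivatives of
  these splines.\<close>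

lemma Fk: "Fk k \<in> space_splines p \<Xi>" "\<eta> \<in> cbox 0 1 \<Longrightarrow> F \<eta> $ k = Fk k \<eta>"
proof -
  have "\<exists>g. g \<in> space_splines p \<Xi> \<and> (\<forall>\<eta>\<in>closure W. F \<eta> $ k = g \<eta>)" using F_spline[of k] by blast
  from someI_ex[OF this] have *: "Fk k \<in> space_splines p \<Xi> \<and> (\<forall>\<eta>\<in>closure W. F \<eta> $ k = Fk k \<eta>)"
    unfolding Fk_def .
  then show "Fk k \<in> space_splines p \<Xi>" by blast
  show "\<eta> \<in> cbox 0 1 \<Longrightarrow> F \<eta> $ k = Fk k \<eta>" using * by (simp add: closure_W)
qed

lemma spline_differentiable: "g \<in> space_splines p \<Xi> \<Longrightarrow> \<eta> \<in> W \<Longrightarrow> g differentiable (at \<eta>)"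
  and spline_dpartial_continuous: "g \<in> space_splines p \<Xi> \<Longrightarrow> b \<in> Basis \<Longrightarrow> continuous_on W (dpartial b g)"
  using splines_C1 by (auto simp: C1_on_def)

definition J :: "real^'d \<Rightarrow> real^'d^'d" where
  "J \<eta> = (\<chi> i j. dpartial (axis j 1) (Fk i) \<eta>)"

lemma F_has_derivative:
  assumes "\<eta> \<in> W" shows "(F has_derivative (\<lambda>h. J \<eta> *v h)) (at \<eta>)"
proof (rule has_derivative_vec)
  fix k
  have "(Fk k has_derivative frechet_derivative (Fk k) (at \<eta>)) (at \<eta>)"
    using spline_differentiable[OF Fk(1) assms] frechet_derivative_works by blast
  moreover have "frechet_derivative (Fk k) (at \<eta>) = (\<lambda>h. (J \<eta> *v h) $ k)"
    using frechet_derivative_vec[OF spline_differentiable[OF Fk(1) assms]]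
    by (auto simp: fun_eq_iff J_def matrix_vector_mult_def)
  ultimately have "(Fk k has_derivative (\<lambda>h. (J \<eta> *v h) $ k)) (at \<eta>)" by simp
  then show "((\<lambda>x. F x $ k) has_derivative (\<lambda>h. (J \<eta> *v h) $ k)) (at \<eta>)"
    by (subst has_derivative_cong_open[OF open_box assms, where g = "Fk k"]) (use Fk(2) W_cbox in auto)
qed

lemma J_invertible: "\<eta> \<in> W \<Longrightarrow> invertible (J \<eta>)"
  using F_invertible[of \<eta>] frechet_derivative_at[OF F_has_derivative, of \<eta>] by (metis matrix_of_matrix_vector_mul)

lemma J_continuous: "continuous_on W (\<lambda>\<eta>. J \<eta> $ i $ j)"
  unfolding J_def using spline_dpartial_continuous[OF Fk(1) axis_Basis] by simp

lemma F_continuous: "continuous_on W F"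
  using F_has_derivative by (meson continuous_at_imp_continuous_on has_derivative_continuous)

text \<open>Invariance of domain; it makes \<Omega> and the images of the elements open.\<close>

lemma open_image: "open V \<Longrightarrow> V \<subseteq> W \<Longrightarrow> open (F ` V)"
  by (rule invariance_of_domain[OF continuous_on_subset[OF F_continuous] _ inj_on_subset[OF F_inj]])

lemma open_\<Omega>: "open \<Omega>"
  by (rule open_image) auto

lemma bounded_\<Omega>: "bounded \<Omega>"
proof -
  have "\<exists>B. \<forall>\<eta>\<in>W. \<bar>F \<eta> $ k\<bar> \<le> B" for k
  proof -
    obtain B where "\<And>\<eta>. \<eta> \<in> cbox 0 1 \<Longrightarrow> \<bar>Fk k \<eta>\<bar> \<le> B" using spline_bounded[OF Fk(1)] by blast
    then show ?thesis using Fk(2) W_cbox by (intro exI[of _ B]) auto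
  qed
  then obtain B where B: "\<And>k \<eta>. \<eta> \<in> W \<Longrightarrow> \<bar>F \<eta> $ k\<bar> \<le> B k" by metis
  have "norm (F \<eta>) \<le> (\<Sum>k\<in>UNIV. B k)" if "\<eta> \<in> W" for \<eta>
    by (rule order_trans[OF norm_le_l1_cart sum_mono]) (rule B[OF that])
  then show ?thesis unfolding bounded_iff by blast
qed

lemma G_F: "\<eta> \<in> W \<Longrightarrow> G (F \<eta>) = \<eta>"
  by (rule inv_into_f_f[OF F_inj])

lemma F_G: "x \<in> \<Omega> \<Longrightarrow> F (G x) = x" and G_W: "x \<in> \<Omega> \<Longrightarrow> G x \<in> W"
  by (auto intro: f_inv_into_f inv_into_into)

lemma G_has_derivative:
  assumes "x \<in> \<Omega>" shows "(G has_derivative (\<lambda>h. matrix_inv (J (G x)) *v h)) (at x)"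
proof -
  have "(G has_derivative (\<lambda>h. matrix_inv (J (G x)) *v h)) (at (F (G x)))"
  proof (rule has_derivative_inverse_strong[OF open_box G_W[OF assms] F_continuous G_F F_has_derivative[OF G_W[OF assms]]])
    have "J (G x) ** matrix_inv (J (G x)) = mat 1"
      by (rule matrix_inv_right_mult[OF J_invertible[OF G_W[OF assms]]])
    then show "(\<lambda>h. J (G x) *v h) \<circ> (\<lambda>h. matrix_inv (J (G x)) *v h) = id"
      by (auto simp: fun_eq_iff matrix_vector_mul_assoc)
  qed
  then show ?thesis by (simp add: F_G[OF assms])
qed

lemma G_continuous: "continuous_on \<Omega> G"
  using G_has_derivative by (meson continuous_at_imp_continuous_on has_derivative_continuous)

lemma Gk_has_derivative:
  assumes "x \<in> \<Omega>" shows "((\<lambda>x. G x $ k) has_derivative (\<lambda>h. (matrix_inv (J (G x)) *v h) $ k)) (at x)"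
  by (rule bounded_linear.has_derivative[OF bounded_linear_vec_nth G_has_derivative[OF assms]])

lemma Gk_dpartial: "x \<in> \<Omega> \<Longrightarrow> dpartial b (\<lambda>x. G x $ k) x = (matrix_inv (J (G x)) *v b) $ k"
  by (rule dpartial_eq[OF Gk_has_derivative])

text \<open>Cramer's rule writes the inverse Jacobian applied to b through quotients of
  determinants, whose continuity is evident.\<close>

lemma Gk_dpartial_continuous: "continuous_on \<Omega> (dpartial b (\<lambda>x. G x $ k))"
proof -
  let ?N = "\<lambda>x. (\<chi> i l. if l = k then b $ i else J (G x) $ i $ l) :: real^'d^'d"
  have Jc: "continuous_on \<Omega> (\<lambda>x. J (G x) $ i $ l)" for i l
    by (rule continuous_on_compose2[OF J_continuous G_continuous]) (use G_W in auto)
  have d0: "det (J (G x)) \<noteq> 0" if "x \<in> \<Omega>" for x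
    using J_invertible[OF G_W[OF that]] by (simp add: invertible_det_nz)
  have "continuous_on \<Omega> (\<lambda>x. det (?N x) / det (J (G x)))"
  proof (intro continuous_on_divide continuous_on_det Jc ballI d0)
    fix i l show "continuous_on \<Omega> (\<lambda>x. ?N x $ i $ l)" using Jc[of i l] by (cases "l = k") auto
  qed
  moreover have "det (?N x) / det (J (G x)) = dpartial b (\<lambda>x. G x $ k) x" if x: "x \<in> \<Omega>" for x
  proof -
    have "J (G x) *v (matrix_inv (J (G x)) *v b) = b"
      using matrix_inv_right_mult[OF J_invertible[OF G_W[OF x]]] by (simp add: matrix_vector_mul_assoc)
    then have "matrix_inv (J (G x)) *v b = (\<chi> k. det (\<chi> i l. if l = k then b $ i else J (G x) $ i $ l) / det (J (G x)))"
      using cramer[OF d0[OF x]] by blast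
    then have "(matrix_inv (J (G x)) *v b) $ k = (\<chi> k. det (\<chi> i l. if l = k then b $ i else J (G x) $ i $ l) / det (J (G x))) $ k"
      by (rule arg_cong)
    then show ?thesis by (simp add: Gk_dpartial[OF x])
  qed
  ultimately show ?thesis by (simp cong: continuous_on_cong)
qed

section \<open>Push-forwards of splines and their first derivatives\<close>

definition push :: "(real^'d \<Rightarrow> real) \<Rightarrow> real^'d \<Rightarrow> real" where
  "push s x = (if x \<in> \<Omega> then s (G x) else 0)"

lemma push_has_derivative:
  assumes s: "s \<in> space_splines p \<Xi>" and x: "x \<in> \<Omega>"
  shows "(push s has_derivative (\<lambda>h. \<Sum>k\<in>UNIV. dpartial (axis k 1) s (G x) * (matrix_inv (J (G x)) *v h) $ k)) (at x)"
proof -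
  have "(s has_derivative frechet_derivative s (at (G x))) (at (G x))"
    using spline_differentiable[OF s G_W[OF x]] frechet_derivative_works by blast
  from has_derivative_compose[OF G_has_derivative[OF x] this]
  have "((\<lambda>x. s (G x)) has_derivative (\<lambda>h. frechet_derivative s (at (G x)) (matrix_inv (J (G x)) *v h))) (at x)" .
  then have "((\<lambda>x. s (G x)) has_derivative (\<lambda>h. \<Sum>k\<in>UNIV. dpartial (axis k 1) s (G x) * (matrix_inv (J (G x)) *v h) $ k)) (at x)"
    by (simp add: frechet_derivative_vec[OF spline_differentiable[OF s G_W[OF x]]])
  then show ?thesis
    by (subst has_derivative_cong_open[OF open_\<Omega> x, where g = "\<lambda>x. s (G x)"]) (auto simp: push_def)
qed

lemma push_differentiable: "s \<in> space_splines p \<Xi> \<Longrightarrow> x \<in> \<Omega> \<Longrightarrow> push s differentiable (at x)"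
  using push_has_derivative by (auto simp: differentiable_def)

text \<open>By the chain rule, from C1 splines and the C1 inverse map. Continuity of the gradient
  across element interfaces is what allows elementwise second derivatives to be weak ones.\<close>

lemma push_dpartial_continuous:
  assumes s: "s \<in> space_splines p \<Xi>" shows "continuous_on \<Omega> (dpartial b (push s))"
proof -
  have "continuous_on \<Omega> (\<lambda>x. \<Sum>k\<in>UNIV. dpartial (axis k 1) s (G x) * dpartial b (\<lambda>x. G x $ k) x)"
    by (intro continuous_on_sum continuous_on_mult Gk_dpartial_continuous
        continuous_on_compose2[OF spline_dpartial_continuous[OF s axis_Basis] G_continuous]) (use G_W in auto)
  moreover have "(\<Sum>k\<in>UNIV. dpartial (axis k 1) s (G x) * dpartial b (\<lambda>x. G x $ k) x) = dpartial b (push s) x" if "x \<in> \<Omega>" for x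
    unfolding dpartial_eq[OF push_has_derivative[OF s that]] by (simp add: Gk_dpartial[OF that])
  ultimately show ?thesis by (simp cong: continuous_on_cong)
qed

lemma push_continuous: "s \<in> space_splines p \<Xi> \<Longrightarrow> continuous_on \<Omega> (push s)"
  using push_differentiable by (intro continuous_at_imp_continuous_on ballI differentiable_imp_continuous_within)

text \<open>The piecewise bounds on the inverse map enter here and only here: on the image of an
  element the push-forward is a polynomial in the components of that map.\<close>

lemma push_smooth:
  assumes s: "s \<in> space_splines p \<Xi>" and E: "E \<in> mesh_elements \<Xi>"
  shows "smooth_upto True n (F ` E) (push s)"
proof -
  have o: "open (F ` E)" by (rule open_image[OF mesh_element_props(1,4)[OF E]])
  have "smooth_upto True n (F ` E) (\<lambda>x. s (G x))"
  proof (rule spline_smooth_on_element[OF E o _ _ s])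
    show "smooth_upto True n (F ` E) (\<lambda>x. G x $ k)" for k
      by (rule bounded_derivatives_on_smooth_upto[OF inverse_bounded[OF E]])
    show "x \<in> F ` E \<Longrightarrow> G x \<in> E" for x using mesh_element_props(4)[OF E] G_F by auto
  qed
  then show ?thesis
    by (subst smooth_upto_cong[OF o, where g = "\<lambda>x. s (G x)"]) (use mesh_element_props(4)[OF E] in \<open>auto simp: push_def\<close>)
qed

section \<open>The union of the mapped elements, which has full measure in the domain\<close>

definition regular :: "(real^'d) set" where
  "regular = (\<Union>E\<in>mesh_elements \<Xi>. F ` E)"

lemma open_regular: "open regular"
  unfolding regular_def using open_image mesh_element_props(1,4) by blast

text \<open>Differentiable maps send null sets to null sets, so the skeleton of the mesh has a null
  image.\<close>

lemma AE_regular: "AE x in lborel. x \<in> \<Omega> \<longrightarrow> x \<in> regular"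
proof -
  have "F differentiable_on (W - \<Union>(mesh_elements \<Xi>))"
    using F_has_derivative by (auto simp: differentiable_on_def differentiable_def intro: has_derivative_at_withinI)
  then have "negligible (F ` (W - \<Union>(mesh_elements \<Xi>)))"
    by (rule negligible_differentiable_image_negligible[OF order_refl negligible_skeleton])
  moreover have "\<Omega> - regular \<subseteq> F ` (W - \<Union>(mesh_elements \<Xi>))" unfolding regular_def by blast
  ultimately have "negligible (\<Omega> - regular)" by (rule negligible_subset)
  then have "\<Omega> - regular \<in> null_sets lebesgue" by (simp only: negligible_iff_null_sets)
  then have "\<Omega> - regular \<in> null_sets lborel"
    using open_\<Omega> open_regular by (auto simp: null_sets_def)
  from AE_not_in[OF this] show ?thesis by eventually_elim auto
qed

lemma bounded_on_regular:
  assumes "\<And>E. E \<in> mesh_elements \<Xi> \<Longrightarrow> bounded (f ` F ` E)"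
  obtains M :: real where "0 \<le> M" "\<And>x. x \<in> regular \<Longrightarrow> \<bar>f x\<bar> \<le> M"
proof -
  have "bounded (\<Union>E\<in>mesh_elements \<Xi>. f ` F ` E)" using finite_mesh assms by (intro bounded_UN ballI)
  then have "bounded (f ` regular)" by (simp add: regular_def image_UN)
  then obtain M where M: "0 < M" "\<And>x. x \<in> regular \<Longrightarrow> \<bar>f x\<bar> \<le> M" unfolding bounded_pos by auto
  then show thesis using that[of M] by auto
qed

text \<open>The elements are dense in the cube, so the bound extends by continuity of f composed
  with F.\<close>

lemma bound_extends:
  assumes f: "continuous_on \<Omega> f" and M: "\<And>x. x \<in> regular \<Longrightarrow> \<bar>f x\<bar> \<le> (M::real)" and x: "x \<in> \<Omega>"
  shows "\<bar>f x\<bar> \<le> M"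
proof -
  have Gx: "G x \<in> W" by (rule G_W[OF x])
  then obtain E where E: "E \<in> mesh_elements \<Xi>" "G x \<in> closure E" using mesh_cover by blast
  have "continuous_on W (\<lambda>\<eta>. \<bar>f (F \<eta>)\<bar>)"
    by (intro continuous_intros continuous_on_compose2[OF f F_continuous]) auto
  then have "\<bar>f (F (G x))\<bar> \<le> M"
    by (rule continuous_le_on_closure_within[OF _ mesh_element_props(4)[OF E(1)] _ E(2) Gx])
      (use M E(1) in \<open>auto simp: regular_def\<close>)
  then show ?thesis by (simp add: F_G[OF x])
qed

lemma push_dpartial_bounded:
  assumes s: "s \<in> space_splines p \<Xi>" and b: "b \<in> Basis"
  obtains M where "0 \<le> M" "\<And>x. x \<in> \<Omega> \<Longrightarrow> \<bar>dpartial b (push s) x\<bar> \<le> M"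
proof -
  have "bounded (dpartial b (push s) ` F ` E)" if "E \<in> mesh_elements \<Xi>" for E
    using push_smooth[OF s that, of "Suc 0"] b by auto
  from bounded_on_regular[OF this] obtain M where "0 \<le> M" "\<And>x. x \<in> regular \<Longrightarrow> \<bar>dpartial b (push s) x\<bar> \<le> M" by blast
  then show thesis using that[of M] bound_extends[OF push_dpartial_continuous[OF s]] by blast
qed

lemma push_bound:
  assumes "s \<in> space_splines p \<Xi>"
  obtains B where "\<And>x. x \<in> \<Omega> \<Longrightarrow> \<bar>push s x\<bar> \<le> B"
proof -
  obtain B where "\<And>\<eta>. \<eta> \<in> cbox 0 1 \<Longrightarrow> \<bar>s \<eta>\<bar> \<le> B" using spline_bounded[OF assms] by blast
  then show thesis using that[of B] G_W W_cbox by (auto simp: push_def)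
qed

lemma push_L2: "s \<in> space_splines p \<Xi> \<Longrightarrow> push s \<in> L2 \<Omega>"
  using push_bound continuous_L2[OF open_\<Omega> bounded_\<Omega> push_continuous] by metis

text \<open>The gradient of a push-forward is Lipschitz on the parameter domain, hence locally Lipschitz on
  \<open>\<Omega>\<close>; together with piecewise smoothness this yields the second derivatives.\<close>

lemma push_dpartial_Lipschitz:
  assumes s: "s \<in> space_splines p \<Xi>" and b: "b \<in> Basis"
  obtains C where "0 \<le> C" "\<And>\<eta> \<zeta>. \<eta> \<in> W \<Longrightarrow> \<zeta> \<in> W \<Longrightarrow> \<bar>dpartial b (push s) (F \<eta>) - dpartial b (push s) (F \<zeta>)\<bar> \<le> C * dist \<eta> \<zeta>"
proof -
  let ?u = "dpartial b (push s)"
  have sm: "smooth_upto True n (F ` E) ?u" if "E \<in> mesh_elements \<Xi>" for n E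
    using push_smooth[OF s that, of "Suc n"] b by simp
  have "\<exists>M\<ge>0. \<forall>x\<in>regular. \<bar>dpartial c ?u x\<bar> \<le> M" if c: "c \<in> Basis" for c
  proof -
    have "bounded (dpartial c ?u ` F ` E)" if "E \<in> mesh_elements \<Xi>" for E
      using sm[OF that, of "Suc 0"] c by auto
    from bounded_on_regular[OF this] show ?thesis by metis
  qed
  then obtain M where M: "\<And>c. c \<in> Basis \<Longrightarrow> 0 \<le> M c" "\<And>c x. c \<in> Basis \<Longrightarrow> x \<in> regular \<Longrightarrow> \<bar>dpartial c ?u x\<bar> \<le> M c"
    by metis
  define M1 where "M1 = (\<Sum>c\<in>Basis. M c)"
  have M1: "\<bar>dpartial c ?u x\<bar> \<le> M1" if "c \<in> Basis" "x \<in> regular" for c x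
    using M(2)[OF that] member_le_sum[of c Basis M] M(1) that by (auto simp: M1_def)
  have M1_0: "0 \<le> M1" unfolding M1_def by (intro sum_nonneg M(1))
  have "\<exists>M. \<forall>E\<in>mesh_elements \<Xi>. \<forall>\<eta>\<in>E. \<bar>J \<eta> $ i $ j\<bar> \<le> M" for i j
  proof -
    have "bounded (\<Union>E\<in>mesh_elements \<Xi>. dpartial (axis j 1) (Fk i) ` E)"
      using finite_mesh spline_smooth[OF _ Fk(1), of _ "Suc 0" i] axis_Basis[of j] by (intro bounded_UN ballI) auto
    then show ?thesis unfolding bounded_real by (auto simp: J_def)
  qed
  then obtain Jm where Jm: "\<And>i j E \<eta>. E \<in> mesh_elements \<Xi> \<Longrightarrow> \<eta> \<in> E \<Longrightarrow> \<bar>J \<eta> $ i $ j\<bar> \<le> Jm i j" by metis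
  define J1 where "J1 = (\<Sum>i\<in>UNIV. \<Sum>j\<in>UNIV. \<bar>Jm i j\<bar>)"
  have J1: "norm (J \<eta> *v h) \<le> J1 * norm h" if "E \<in> mesh_elements \<Xi>" "\<eta> \<in> E" for E \<eta> h
  proof -
    have "norm (J \<eta> *v h) \<le> (\<Sum>i\<in>UNIV. \<bar>(J \<eta> *v h) $ i\<bar>)" by (rule norm_le_l1_cart)
    also have "\<dots> \<le> (\<Sum>i\<in>UNIV. \<Sum>j\<in>UNIV. \<bar>Jm i j\<bar> * norm h)"
      unfolding matrix_vector_mult_def vec_lambda_beta
    proof (intro sum_mono order_trans[OF sum_abs])
      fix i j
      have "\<bar>J \<eta> $ i $ j\<bar> \<le> \<bar>Jm i j\<bar>" using Jm[OF that, of i j] by linarith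
      then show "\<bar>J \<eta> $ i $ j * h $ j\<bar> \<le> \<bar>Jm i j\<bar> * norm h"
        unfolding abs_mult by (intro mult_mono component_le_norm_cart) auto
    qed
    finally show ?thesis by (simp add: J1_def sum_distrib_right)
  qed
  have J1_0: "0 \<le> J1" unfolding J1_def by (intro sum_nonneg) auto
  define D where "D = real DIM(real^'d) * M1"
  have D0: "0 \<le> D" unfolding D_def using M1_0 by simp
  \<comment> \<open>Chain rule: D bounds the gradient of the pushed-forward derivative on the images
    of the elements, and J1 bounds the Jacobian of F on the elements.\<close>
  define C where "C = D * J1"
  have C0: "0 \<le> C" unfolding C_def using D0 J1_0 by simp
  have "\<bar>?u (F \<eta>) - ?u (F \<zeta>)\<bar> \<le> C * dist \<eta> \<zeta>" if "\<eta> \<in> W" "\<zeta> \<in> W" for \<eta> \<zeta>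
  proof (rule piecewise_Lipschitz[where S = W and \<E> = "mesh_elements \<Xi>", OF convex_box(2) _ finite_mesh mesh_cover _ _ C0 that])
    show "continuous_on W (\<lambda>\<eta>. ?u (F \<eta>))"
      by (rule continuous_on_compose2[OF push_dpartial_continuous[OF s] F_continuous]) auto
    fix E assume E: "E \<in> mesh_elements \<Xi>"
    show "E \<subseteq> W" by (rule mesh_element_props(4)[OF E])
    fix x y assume xy: "x \<in> E" "y \<in> E"
    show "\<bar>?u (F x) - ?u (F y)\<bar> \<le> C * dist x y"
    proof (rule convex_Lipschitz[OF mesh_element_props(2)[OF E] _ _ xy])
      fix z assume z: "z \<in> E"
      then have zW: "z \<in> W" using mesh_element_props(4)[OF E] by blast
      have Fz: "F z \<in> regular" using z E by (auto simp: regular_def)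
      have ud: "?u differentiable (at (F z))" using sm[OF E, of "Suc 0"] z by auto
      then have "(?u has_derivative frechet_derivative ?u (at (F z))) (at (F z))" using frechet_derivative_works by blast
      from has_derivative_compose[OF F_has_derivative[OF zW] this]
      show "((\<lambda>\<eta>. ?u (F \<eta>)) has_derivative (\<lambda>h. frechet_derivative ?u (at (F z)) (J z *v h))) (at z)" .
      fix h
      have "\<bar>frechet_derivative ?u (at (F z)) (J z *v h)\<bar> \<le> D * norm (J z *v h)"
        unfolding D_def by (rule frechet_derivative_bound[OF ud M1[OF _ Fz]])
      also have "\<dots> \<le> D * (J1 * norm h)" by (rule mult_left_mono[OF J1[OF E z] D0])
      finally show "\<bar>frechet_derivative ?u (at (F z)) (J z *v h)\<bar> \<le> C * norm h" by (simp add: C_def mult.assoc)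
    qed
  qed
  then show thesis using that C0 by blast
qed

text \<open>The Lipschitz bound at hand is in terms of parameters. The components of the inverse map
  are C1 on \<Omega> and so locally Lipschitz in direction c, and their sum controls the distance of
  the parameters.\<close>

lemma push_dpartial_directionally_Lipschitz:
  assumes s: "s \<in> space_splines p \<Xi>" and b: "b \<in> Basis" and c: "c \<in> Basis"
  shows "directionally_Lipschitz \<Omega> c (dpartial b (push s))"
  unfolding directionally_Lipschitz_def
proof (intro allI impI, elim conjE)
  let ?u = "dpartial b (push s)"
  fix Q assume Q: "compact Q" "Q \<subseteq> \<Omega>"
  obtain C where C: "0 \<le> C" "\<And>\<eta> \<zeta>. \<eta> \<in> W \<Longrightarrow> \<zeta> \<in> W \<Longrightarrow> \<bar>?u (F \<eta>) - ?u (F \<zeta>)\<bar> \<le> C * dist \<eta> \<zeta>"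
    using push_dpartial_Lipschitz[OF s b] by blast
  have "directionally_Lipschitz \<Omega> c (\<lambda>x. G x $ k)" for k
    by (rule directionally_Lipschitz_C1[OF open_\<Omega> _ Gk_dpartial_continuous c])
      (use Gk_has_derivative in \<open>auto simp: differentiable_def\<close>)
  then have "\<forall>k. \<exists>L \<delta>. 0 < \<delta> \<and> (\<forall>x\<in>Q. \<forall>h. \<bar>h\<bar> < \<delta> \<longrightarrow> \<bar>G (x + h *\<^sub>R c) $ k - G x $ k\<bar> \<le> L * \<bar>h\<bar>)"
    using Q unfolding directionally_Lipschitz_def by blast
  then obtain L \<delta> where L: "\<And>k. 0 < \<delta> k" "\<And>k x h. x \<in> Q \<Longrightarrow> \<bar>h\<bar> < \<delta> k \<Longrightarrow> \<bar>G (x + h *\<^sub>R c) $ k - G x $ k\<bar> \<le> L k * \<bar>h\<bar>"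
    by metis
  obtain e where e0: "0 < e" "compact {x + y | x y. x \<in> Q \<and> y \<in> cball 0 e}" "{x + y | x y. x \<in> Q \<and> y \<in> cball 0 e} \<subseteq> \<Omega>"
    by (rule compact_thickening[OF Q(1) open_\<Omega> Q(2)]) (rule that)
  define d where "d = min e (Min (range \<delta>))"
  have d: "0 < d" "d \<le> e" "\<And>k. d \<le> \<delta> k"
    using e0(1) L(1) by (auto simp: d_def min_le_iff_disj)
  have "\<bar>?u (x + h *\<^sub>R c) - ?u x\<bar> \<le> (C * (\<Sum>k\<in>UNIV. L k)) * \<bar>h\<bar>" if x: "x \<in> Q" and h: "\<bar>h\<bar> < d" for x h
  proof -
    have x\<Omega>: "x \<in> \<Omega>" using x Q(2) by blast
    have y\<Omega>: "x + h *\<^sub>R c \<in> \<Omega>"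
      using mem_thickening[OF x, of "h *\<^sub>R c" e] h d(2) c e0(3) by (auto dest!: subsetD)
    have "\<bar>?u (x + h *\<^sub>R c) - ?u x\<bar> \<le> C * dist (G (x + h *\<^sub>R c)) (G x)"
      using C(2)[OF G_W[OF y\<Omega>] G_W[OF x\<Omega>]] by (simp add: F_G[OF y\<Omega>] F_G[OF x\<Omega>])
    also have "dist (G (x + h *\<^sub>R c)) (G x) \<le> (\<Sum>k\<in>UNIV. \<bar>G (x + h *\<^sub>R c) $ k - G x $ k\<bar>)"
      unfolding dist_norm by (rule order_trans[OF norm_le_l1_cart]) simp
    also have "\<dots> \<le> (\<Sum>k\<in>UNIV. L k * \<bar>h\<bar>)"
      using h d(3) by (intro sum_mono L(2)[OF x]) (meson order_less_le_trans)
    finally show ?thesis using C(1) by (simp add: sum_distrib_right[symmetric] mult.assoc mult_left_mono)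
  qed
  then show "\<exists>L \<delta>. 0 < \<delta> \<and> (\<forall>x\<in>Q. \<forall>h. \<bar>h\<bar> < \<delta> \<longrightarrow> \<bar>?u (x + h *\<^sub>R c) - ?u x\<bar> \<le> L * \<bar>h\<bar>)"
    using d(1) by blast
qed

text \<open>Almost every point lies in the image of an element, where the difference quotients of
  the gradient converge classically; the local Lipschitz bound makes this limit a weak
  derivative.\<close>

lemma push_second_derivative:
  assumes s: "s \<in> space_splines p \<Xi>" and b: "b \<in> Basis" and c: "c \<in> Basis"
  shows "\<exists>w\<in>L2 \<Omega>. weak_derivative \<Omega> [c] (dpartial b (push s)) w"
proof -
  let ?u = "dpartial b (push s)"
  have sm: "smooth_upto True n (F ` E) ?u" if "E \<in> mesh_elements \<Xi>" for n E
    using push_smooth[OF s that, of "Suc n"] b by simp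
  have ud: "?u differentiable (at x)" if "x \<in> regular" for x
    using that sm[of _ "Suc 0"] by (auto simp: regular_def)
  have cc: "continuous_on regular (dpartial c ?u)"
    unfolding regular_def
  proof (rule continuous_on_open_UN)
    fix E assume E: "E \<in> mesh_elements \<Xi>"
    show "open (F ` E)" by (rule open_image[OF mesh_element_props(1,4)[OF E]])
    have "smooth_upto True (Suc 0) (F ` E) (dpartial c ?u)" using sm[OF E, of "Suc (Suc 0)"] c by auto
    then show "continuous_on (F ` E) (dpartial c ?u)" by (rule smooth_upto_continuous)
  qed
  have "bounded (dpartial c ?u ` F ` E)" if "E \<in> mesh_elements \<Xi>" for E
    using sm[OF that, of "Suc 0"] c by auto
  from bounded_on_regular[OF this] obtain M where M: "0 \<le> M" "\<And>x. x \<in> regular \<Longrightarrow> \<bar>dpartial c ?u x\<bar> \<le> M" by blast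
  define w where "w x = (if x \<in> regular then dpartial c ?u x else 0)" for x
  have wm: "w \<in> borel_measurable borel"
  proof -
    have "(\<lambda>x. indicator regular x *\<^sub>R dpartial c ?u x) \<in> borel_measurable borel"
      by (rule borel_measurable_continuous_on_indicator[OF _ cc]) (use open_regular in simp)
    moreover have "(\<lambda>x. indicator regular x *\<^sub>R dpartial c ?u x) = w" by (auto simp: w_def fun_eq_iff)
    ultimately show ?thesis by simp
  qed
  have sw: "set_borel_measurable lborel \<Omega> w"
    unfolding set_borel_measurable_def measurable_lborel2 real_scaleR_def
    by (rule borel_measurable_times[OF borel_measurable_indicator wm]) (use open_\<Omega> in simp)
  have "weak_derivative \<Omega> [c] ?u w"
  proof (rule weak_derivative_directionally_Lipschitz[OF open_\<Omega> c push_dpartial_continuous[OF s] push_dpartial_directionally_Lipschitz[OF s b c] _ sw])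
    show "AE x in lborel. x \<in> \<Omega> \<longrightarrow> ((\<lambda>h. (?u (x + h *\<^sub>R c) - ?u x) / h) \<longlongrightarrow> w x) (at 0)"
      using AE_regular
    proof eventually_elim
      case (elim x)
      then show ?case using difference_quotient_tendsto[OF ud, of x c] by (auto simp: w_def)
    qed
  qed
  moreover have "w \<in> L2 \<Omega>"
    by (rule L2_bounded[OF sw _ bounded_\<Omega>, where B = M]) (use M open_\<Omega> in \<open>auto simp: w_def\<close>)
  ultimately show ?thesis by blast
qed

lemma push_weak_derivative:
  assumes s: "s \<in> space_splines p \<Xi>" and bs: "set bs \<subseteq> Basis" "length bs \<le> 2"
  shows "\<exists>w\<in>L2 \<Omega>. weak_derivative \<Omega> bs (push s) w"
proof -
  have first: "weak_derivative \<Omega> [b] (push s) (dpartial b (push s))" if "b \<in> Basis" for b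
    by (rule weak_derivative_C1[OF open_\<Omega> push_differentiable[OF s] push_dpartial_continuous[OF s] that])
  have firstL: "dpartial b (push s) \<in> L2 \<Omega>" if "b \<in> Basis" for b
    using push_dpartial_bounded[OF s that] continuous_L2[OF open_\<Omega> bounded_\<Omega> push_dpartial_continuous[OF s]] by metis
  consider "bs = []" | b where "bs = [b]" "b \<in> Basis" | b c where "bs = [b, c]" "b \<in> Basis" "c \<in> Basis"
    using bs by (cases bs; cases "tl bs") (auto simp: numeral_2_eq_2)
  then show ?thesis
  proof cases
    case 1
    then show ?thesis using push_L2[OF s] by (intro bexI[of _ "push s"]) (auto simp: weak_derivative_def)
  next
    case 2
    then show ?thesis using first firstL by blast
  next
    case 3
    obtain w where w: "w \<in> L2 \<Omega>" "weak_derivative \<Omega> [c] (dpartial b (push s)) w"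
      using push_second_derivative[OF s 3(2,3)] by blast
    \<comment> \<open>\<open>dpartials [b, c]\<close> differentiates the test function in direction
      c first. So b is moved to the push-forward with \<open>dpartial c \<phi>\<close> as test
      function, and c afterwards.\<close>
    have "weak_derivative \<Omega> [b, c] (push s) w" unfolding weak_derivative_def
    proof
      fix \<phi> assume p: "\<phi> \<in> test_functions \<Omega>"
      have "(LINT x:\<Omega>|lborel. push s x * dpartial b (dpartial c \<phi>) x) = - (LINT x:\<Omega>|lborel. dpartial b (push s) x * dpartial c \<phi> x)"
        using first[OF 3(2)] test_functions_dpartial[OF p 3(3)] unfolding weak_derivative_def by force
      moreover have "(LINT x:\<Omega>|lborel. dpartial b (push s) x * dpartial c \<phi> x) = - (LINT x:\<Omega>|lborel. w x * \<phi> x)"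
        using w(2) p unfolding weak_derivative_def by force
      ultimately show "(LINT x:\<Omega>|lborel. push s x * dpartials [b, c] \<phi> x) = (- 1) ^ length [b, c] * (LINT x:\<Omega>|lborel. w x * \<phi> x)"
        by simp
    qed
    then show ?thesis using w(1) 3(1) by blast
  qed
qed

lemma push_sobolev: "s \<in> space_splines p \<Xi> \<Longrightarrow> push s \<in> sobolev 2 \<Omega>"
  using push_weak_derivative push_L2 by (auto simp: sobolev_def)

text \<open>A spline that vanishes on the frontier is at least e in modulus only on a compact subset
  of the open cube. Its image under F is a compact subset of \<Omega>, whatever F does on the
  frontier, and compactness of these sets is the criterion for zero boundary values.\<close>

lemma push_sobolev1_0:
  assumes s: "s \<in> space_splines p \<Xi>" and zero: "\<And>\<eta>. \<eta> \<in> frontier W \<Longrightarrow> s \<eta> = 0"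
  shows "push s \<in> sobolev1_0 \<Omega>"
proof -
  obtain B where B: "\<And>x. x \<in> \<Omega> \<Longrightarrow> \<bar>push s x\<bar> \<le> B" using push_bound[OF s] by blast
  have "\<forall>b\<in>Basis. \<exists>M\<ge>0. \<forall>x\<in>\<Omega>. \<bar>dpartial b (push s) x\<bar> \<le> M"
    using push_dpartial_bounded[OF s] by metis
  then obtain M where M: "\<And>b. b \<in> Basis \<Longrightarrow> 0 \<le> M b" "\<And>b x. b \<in> Basis \<Longrightarrow> x \<in> \<Omega> \<Longrightarrow> \<bar>dpartial b (push s) x\<bar> \<le> M b" by metis
  have M1: "\<bar>dpartial b (push s) x\<bar> \<le> (\<Sum>b\<in>Basis. M b)" if "b \<in> Basis" "x \<in> \<Omega>" for b x
    using M(2)[OF that] member_le_sum[of b Basis M] M(1) that by auto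
  show ?thesis
  proof (rule sobolev1_0_C1[OF open_\<Omega> bounded_\<Omega> push_differentiable[OF s] push_dpartial_continuous[OF s] B M1])
    fix e :: real assume e: "e > 0"
    let ?Q = "{\<eta> \<in> cbox 0 1. e \<le> \<bar>s \<eta>\<bar>}"
    have "closed ?Q"
    proof -
      have "continuous_on (cbox 0 1) (\<lambda>\<eta>. \<bar>s \<eta>\<bar>)" by (intro continuous_intros spline_continuous[OF s])
      from continuous_closed_preimage[OF this closed_cbox closed_atLeast, of e]
      show ?thesis by (simp add: vimage_def Int_def)
    qed
    then have "compact ?Q" using compact_Int_closed[OF compact_cbox, of ?Q 0 1] by (simp add: Int_def conj_ac)
    moreover have "?Q \<subseteq> W"
    proof
      fix \<eta> assume h: "\<eta> \<in> ?Q"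
      show "\<eta> \<in> W"
      proof (rule ccontr)
        assume "\<eta> \<notin> W"
        then have "\<eta> \<in> frontier W" using h closure_W interior_open[OF open_box, of "0 :: real^'d" 1] unfolding frontier_def by blast
        then show False using zero h e by auto
      qed
    qed
    ultimately have "compact (F ` ?Q)"
      by (intro compact_continuous_image continuous_on_subset[OF F_continuous])
    moreover have "{x \<in> \<Omega>. e \<le> \<bar>push s x\<bar>} = F ` ?Q"
    proof
      show "{x \<in> \<Omega>. e \<le> \<bar>push s x\<bar>} \<subseteq> F ` ?Q"
      proof
        fix x assume "x \<in> {x \<in> \<Omega>. e \<le> \<bar>push s x\<bar>}"
        then have x: "x \<in> \<Omega>" "e \<le> \<bar>s (G x)\<bar>" by (auto simp: push_def)
        then show "x \<in> F ` ?Q" using G_W[OF x(1)] W_cbox F_G[OF x(1)] by (intro image_eqI[of _ _ "G x"]) auto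
      qed
      show "F ` ?Q \<subseteq> {x \<in> \<Omega>. e \<le> \<bar>push s x\<bar>}"
      proof
        fix x assume "x \<in> F ` ?Q"
        then obtain \<eta> where n: "x = F \<eta>" "\<eta> \<in> ?Q" by blast
        then have "\<eta> \<in> W" using \<open>?Q \<subseteq> W\<close> by blast
        then show "x \<in> {x \<in> \<Omega>. e \<le> \<bar>push s x\<bar>}" using n G_F[of \<eta>] by (simp add: push_def)
      qed
    qed
    ultimately show "compact {x \<in> \<Omega>. e \<le> \<bar>push s x\<bar>}" by simp
  qed
qed

end

section \<open>The discrete space\<close>

lemma weak_derivative_sum:
  assumes "finite I" "open U" "set bs \<subseteq> Basis" "\<And>i. i \<in> I \<Longrightarrow> f i \<in> L2 U" "\<And>i. i \<in> I \<Longrightarrow> w i \<in> L2 U"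
    "\<And>i. i \<in> I \<Longrightarrow> weak_derivative U bs (f i) (w i)"
  shows "weak_derivative U bs (\<lambda>x. \<Sum>i\<in>I. a i * f i x) (\<lambda>x. \<Sum>i\<in>I. a i * w i x)"
  using assms(1,4-6)
proof (induction I rule: finite_induct)
  case empty
  then show ?case by (simp add: weak_derivative_def)
next
  case (insert i I)
  have "weak_derivative U bs (\<lambda>x. (\<Sum>i\<in>I. a i * f i x) + a i * f i x) (\<lambda>x. (\<Sum>i\<in>I. a i * w i x) + a i * w i x)"
    by (rule weak_derivative_lin[OF assms(2,3)]) (use insert in \<open>auto intro!: L2_sum L2_cmult\<close>)
  then show ?case using insert(1,2) by (simp add: add.commute)
qed

lemma L2_norm_sum_le:
  assumes "finite I" "\<And>i. i \<in> I \<Longrightarrow> f i \<in> L2 U"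
  shows "L2_norm U (\<lambda>x. \<Sum>i\<in>I. a i * f i x) \<le> (\<Sum>i\<in>I. \<bar>a i\<bar> * L2_norm U (f i))"
  using assms
proof (induction I rule: finite_induct)
  case empty
  then show ?case by (simp add: L2_norm_def)
next
  case (insert i I)
  have "L2_norm U (\<lambda>x. a i * f i x + (\<Sum>i\<in>I. a i * f i x)) \<le> L2_norm U (\<lambda>x. a i * f i x) + L2_norm U (\<lambda>x. \<Sum>i\<in>I. a i * f i x)"
    by (rule L2_norm_triangle) (use insert in \<open>auto intro!: L2_sum L2_cmult\<close>)
  then show ?case using insert by (simp add: L2_norm_cmult)
qed

text \<open>The set where two continuous functions differ is open, and a nonempty open set is not
  null.\<close>

lemma AE_eq_imp_eq_on_open:
  fixes f g :: "'a::euclidean_space \<Rightarrow> real"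
  assumes "open U" "continuous_on U f" "continuous_on U g" "AE z in lborel. z \<in> U \<longrightarrow> f z = g z" "z \<in> U"
  shows "f z = g z"
proof (rule ccontr)
  assume ne: "f z \<noteq> g z"
  let ?S = "{z \<in> U. f z - g z \<in> - {0}}"
  have o: "open ?S"
  proof -
    have "open (U \<inter> (\<lambda>z. f z - g z) -` (- {0}))"
      by (rule continuous_open_preimage[OF continuous_on_diff[OF assms(2,3)] assms(1)]) (rule open_Compl[OF closed_singleton])
    moreover have "U \<inter> (\<lambda>z. f z - g z) -` (- {0}) = ?S" by blast
    ultimately show ?thesis by (simp only:)
  qed
  have "AE z in lborel. z \<notin> ?S" using assms(4) by eventually_elim auto
  then have "?S \<in> null_sets lborel" by (subst AE_iff_null_sets) (use o in auto)
  then have "negligible ?S" by (simp add: negligible_iff_null_sets null_sets_completionI)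
  moreover have "?S \<noteq> {}" using ne assms(5) by auto
  ultimately show False using open_not_negligible[OF o] by blast
qed

locale spacetime_geometry = spline_geometry p \<Xi> F + Tm: knots q \<xi>
  for p :: "'d::finite \<Rightarrow> nat" and \<Xi> F q \<xi> +
  fixes T :: real
  assumes T: "0 < T" and time_continuous: "\<And>g. g \<in> time_splines q \<xi> \<Longrightarrow> continuous_on {0..1} g"
begin

abbreviation (input) I where "I \<equiv> space_index p \<Xi>"
abbreviation (input) S where "S \<equiv> space_bspline p \<Xi>"
abbreviation (input) X where "X \<equiv> Vh0 p \<Xi> q \<xi> F T"

section \<open>Space-time splines through their coefficients\<close>

definition \<theta> :: "(('d \<Rightarrow> nat) \<times> nat \<Rightarrow> real) \<Rightarrow> ('d \<Rightarrow> nat) \<Rightarrow> real \<Rightarrow> real" where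
  "\<theta> c i \<tau> = (\<Sum>j<Tm.m. c (i, j) * bspline \<xi> q j \<tau>)"

definition slice :: "(('d \<Rightarrow> nat) \<times> nat \<Rightarrow> real) \<Rightarrow> real \<Rightarrow> real^'d \<Rightarrow> real" where
  "slice c \<tau> \<eta> = (\<Sum>i\<in>I. \<theta> c i \<tau> * S i \<eta>)"

text \<open>Set to 0 off the cylinder in the same way as the elements of \<open>Vh0\<close>, so that
  equality as functions is available.\<close>

definition field :: "(('d \<Rightarrow> nat) \<times> nat \<Rightarrow> real) \<Rightarrow> (real^'d) \<times> real \<Rightarrow> real" where
  "field c z = (if snd z \<in> {0<..<T} then push (slice c (snd z / T)) (fst z) else 0)"

definition admissible :: "(('d \<Rightarrow> nat) \<times> nat \<Rightarrow> real) \<Rightarrow> bool" where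
  "admissible c \<longleftrightarrow> (\<forall>\<eta>\<in>frontier W. \<forall>\<tau>\<in>{0..1}. slice c \<tau> \<eta> = 0) \<and> (\<forall>\<eta>\<in>W. slice c 0 \<eta> = 0)"

lemma bspline_in_time:
  assumes j: "j < Tm.m" shows "bspline \<xi> q j \<in> time_splines q \<xi>"
  unfolding time_splines_def fun_span_def
proof (rule range_eqI[of _ _ "\<lambda>i. if i = j then 1 else 0"], rule ext)
  fix x
  have "(\<Sum>i<num_bsplines q \<xi>. (if i = j then 1 else 0) * bspline \<xi> q i x)
      = (\<Sum>i<num_bsplines q \<xi>. if i = j then bspline \<xi> q i x else 0)"
    by (rule sum.cong) simp_all
  also have "\<dots> = bspline \<xi> q j x" using j unfolding Tm.m_def by (simp add: sum.delta)
  finally show "bspline \<xi> q j x = (\<Sum>i<num_bsplines q \<xi>. (if i = j then 1 else 0) * bspline \<xi> q i x)"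
    by (rule sym)
qed

lemma \<theta>_continuous: "continuous_on {0..1} (\<theta> c i)"
  unfolding \<theta>_def
  by (intro continuous_on_sum continuous_on_mult continuous_on_const time_continuous bspline_in_time) simp

lemma \<theta>_scaled_continuous: "continuous_on {0..T} (\<lambda>t. \<theta> c i (t / T))"
  by (rule continuous_on_compose2[OF \<theta>_continuous]) (use T in \<open>auto intro!: continuous_intros\<close>)

lemma \<theta>_L2: "(\<lambda>t. \<theta> c i (t / T)) \<in> L2 {0<..<T}"
proof -
  have "bounded ((\<lambda>t. \<theta> c i (t / T)) ` {0..T})"
    by (intro compact_imp_bounded compact_continuous_image \<theta>_scaled_continuous) simp
  then obtain B where "\<And>t. t \<in> {0..T} \<Longrightarrow> \<bar>\<theta> c i (t / T)\<bar> \<le> B" unfolding bounded_real by blast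
  moreover have "continuous_on {0<..<T} (\<lambda>t. \<theta> c i (t / T))"
    by (rule continuous_on_subset[OF \<theta>_scaled_continuous]) auto
  ultimately show ?thesis by (intro continuous_L2[where B = B]) auto
qed

lemma \<theta>_weak_derivative: "\<exists>w\<in>L2 {0<..<T}. weak_derivative {0<..<T} [1] (\<lambda>t. \<theta> c i (t / T)) w"
proof -
  have "\<forall>j\<in>{..<Tm.m}. \<exists>w\<in>L2 {0<..<T}. weak_derivative {0<..<T} [1] (\<lambda>t. bspline \<xi> q j (t / T)) w"
    using Tm.time_weak_derivative[OF _ time_continuous[OF bspline_in_time] T] by simp
  then obtain w where w: "\<And>j. j \<in> {..<Tm.m} \<Longrightarrow> w j \<in> L2 {0<..<T}"
      "\<And>j. j \<in> {..<Tm.m} \<Longrightarrow> weak_derivative {0<..<T} [1] (\<lambda>t. bspline \<xi> q j (t / T)) (w j)" by metis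
  have B: "(\<lambda>t. bspline \<xi> q j (t / T)) \<in> L2 {0<..<T}" if j: "j \<in> {..<Tm.m}" for j
  proof -
    have "\<theta> (\<lambda>(_, l). if l = j then 1 else 0) i \<tau> = bspline \<xi> q j \<tau>" for \<tau>
    proof -
      have "(\<Sum>l<Tm.m. (if l = j then 1 else 0) * bspline \<xi> q l \<tau>) = (\<Sum>l<Tm.m. if l = j then bspline \<xi> q l \<tau> else 0)"
        by (rule sum.cong) simp_all
      then show ?thesis using j unfolding \<theta>_def by (simp add: sum.delta)
    qed
    then show ?thesis using \<theta>_L2[of "\<lambda>(_, l). if l = j then 1 else 0" i] by simp
  qed
  have "weak_derivative {0<..<T} [1] (\<lambda>t. \<theta> c i (t / T)) (\<lambda>t. \<Sum>j<Tm.m. c (i, j) * w j t)"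
    unfolding \<theta>_def by (rule weak_derivative_sum[OF finite_lessThan _ _ B w]) auto
  moreover have "(\<lambda>t. \<Sum>j<Tm.m. c (i, j) * w j t) \<in> L2 {0<..<T}" by (intro L2_sum L2_cmult w)
  ultimately show ?thesis by blast
qed

lemma slice_in: "slice c \<tau> \<in> space_splines p \<Xi>"
  unfolding space_splines_def fun_span_def slice_def by (rule range_eqI[of _ _ "\<lambda>i. \<theta> c i \<tau>"]) simp

lemma slice_eq: "(\<Sum>(i, j)\<in>I \<times> {..<Tm.m}. c (i, j) * (S i \<eta> * bspline \<xi> q j \<tau>)) = slice c \<tau> \<eta>"
  unfolding slice_def \<theta>_def sum.cartesian_product[symmetric] sum_distrib_right
  by (intro sum.cong refl) (simp add: mult_ac)

lemma push_slice: "push (slice c \<tau>) x = (\<Sum>i\<in>I. \<theta> c i \<tau> * push (S i) x)"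
  by (simp add: push_def slice_def)

lemma field_eq: "(x, t) \<in> cylinder \<Omega> T \<Longrightarrow> field c (x, t) = (\<Sum>i\<in>I. \<theta> c i (t / T) * push (S i) x)"
  by (simp add: field_def push_slice)

lemma inverse_geo_map:
  assumes "x \<in> \<Omega>" "t \<in> {0<..<T}"
  shows "inv_into (W \<times> {0<..<1}) (geo_map F T) (x, t) = (G x, t / T)"
proof (rule inv_into_f_eq)
  show "inj_on (geo_map F T) (W \<times> {0<..<1})"
    using F_inj T by (auto simp: inj_on_def geo_map_def)
  show "(G x, t / T) \<in> W \<times> {0<..<1}" using G_W[OF assms(1)] assms(2) T by simp
  show "geo_map F T (G x, t / T) = (x, t)" using F_G[OF assms(1)] T by (simp add: geo_map_def)
qed

text \<open>Passes from functions to coefficients, on which the field depends linearly. Each slice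
  is a spatial spline whose coefficients \<theta> carry the whole dependence on time.\<close>

lemma Vh0_eq: "X = field ` {c. admissible c}"
proof -
  let ?P = "\<lambda>g. (\<lambda>z. if z \<in> cylinder \<Omega> T then g (inv_into (W \<times> {0<..<1}) (geo_map F T) z) else 0)"
  let ?g = "\<lambda>c (\<eta>, \<tau>). slice c \<tau> \<eta>"
  have sp: "spacetime_splines p \<Xi> q \<xi> = range ?g"
  proof -
    have "(\<Sum>ij\<in>I \<times> {..<Tm.m}. c ij * (case ij of (i, j) \<Rightarrow> \<lambda>(\<eta>, \<tau>). S i \<eta> * bspline \<xi> q j \<tau>) z) = ?g c z" for c z
    proof -
      obtain \<eta> \<tau> where z: "z = (\<eta>, \<tau>)" by (cases z)
      have "(\<Sum>ij\<in>I \<times> {..<Tm.m}. c ij * (case ij of (i, j) \<Rightarrow> \<lambda>(\<eta>, \<tau>). S i \<eta> * bspline \<xi> q j \<tau>) z)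
          = (\<Sum>(i, j)\<in>I \<times> {..<Tm.m}. c (i, j) * (S i \<eta> * bspline \<xi> q j \<tau>))"
        unfolding z by (rule sum.cong) auto
      then show ?thesis unfolding slice_eq by (simp add: z)
    qed
    then show ?thesis unfolding spacetime_splines_def fun_span_def Tm.m_def by simp
  qed
  have fld: "?P (?g c) = field c" for c
  proof
    fix z :: "(real^'d) \<times> real"
    obtain x t where z: "z = (x, t)" by (cases z)
    show "?P (?g c) z = field c z"
    proof (cases "x \<in> \<Omega> \<and> t \<in> {0<..<T}")
      case True
      then have "inv_into (W \<times> {0<..<1}) (geo_map F T) (x, t) = (G x, t / T)" by (intro inverse_geo_map) auto
      then show ?thesis using True unfolding z field_def push_def by simp
    next
      case False
      then show ?thesis unfolding z field_def push_def by auto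
    qed
  qed
  have adm: "(\<forall>z\<in>frontier W \<times> {0..1}. ?g c z = 0) \<and> (\<forall>z\<in>W \<times> {0}. ?g c z = 0) \<longleftrightarrow> admissible c" for c
    unfolding admissible_def by auto
  have "X = {?P g | g. g \<in> range ?g \<and> (\<forall>z\<in>frontier W \<times> {0..1}. g z = 0) \<and> (\<forall>z\<in>W \<times> {0}. g z = 0)}"
    unfolding Vh0_def sp by (rule refl)
  also have "\<dots> = {?P (?g c) | c. admissible c}" unfolding adm[symmetric] by blast
  also have "\<dots> = field ` {c. admissible c}" unfolding fld by blast
  finally show ?thesis .
qed

section \<open>Membership of the discrete space in \<open>V0\<close>\<close>

lemma tensor_L2:
  assumes "\<And>i. i \<in> I \<Longrightarrow> A i \<in> L2 \<Omega>" "\<And>i. i \<in> I \<Longrightarrow> g i \<in> L2 {0<..<T}"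
  shows "(\<lambda>z. \<Sum>i\<in>I. A i (fst z) * g i (snd z)) \<in> L2 (cylinder \<Omega> T)"
  using assms by (intro L2_sum L2_tensor)

lemma push_S_L2: "i \<in> I \<Longrightarrow> push (S i) \<in> L2 \<Omega>"
  by (rule push_L2[OF space_bspline_in])

lemma field_L2: "field c \<in> L2 (cylinder \<Omega> T)"
proof -
  have "(\<lambda>z. \<Sum>i\<in>I. push (S i) (fst z) * \<theta> c i (snd z / T)) \<in> L2 (cylinder \<Omega> T)"
    by (rule tensor_L2[OF push_S_L2 \<theta>_L2])
  moreover have "(\<lambda>z. indicator (cylinder \<Omega> T) z * (\<Sum>i\<in>I. push (S i) (fst z) * \<theta> c i (snd z / T)))
      = (\<lambda>z. indicator (cylinder \<Omega> T) z * field c z)"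
    using field_eq[of _ _ c] by (auto simp: fun_eq_iff indicator_def mult.commute)
  ultimately show ?thesis unfolding L2_iff_sqint by simp
qed

text \<open>Boundary values vanish for a whole slice, though not for every basis function in it.
  Membership in \<open>sobolev1_0\<close> is therefore shown slice by slice, while the jointly
  measurable derivatives are assembled from those of the basis functions.\<close>

lemma field_L2_H1_0_H2:
  assumes "admissible c" shows "field c \<in> L2_H1_0_H2 \<Omega> T"
proof -
  have slice: "(\<lambda>x. field c (x, t)) = push (slice c (t / T))" if "t \<in> {0<..<T}" for t
    using that by (simp add: field_def fun_eq_iff)
  have "(\<lambda>x. field c (x, t)) \<in> sobolev1_0 \<Omega> \<inter> sobolev 2 \<Omega>" if t: "t \<in> {0<..<T}" for t
  proof -
    have "slice c (t / T) \<eta> = 0" if "\<eta> \<in> frontier W" for \<eta>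
      using assms that t T unfolding admissible_def by simp
    then show ?thesis unfolding slice[OF t] using push_sobolev1_0[OF slice_in] push_sobolev[OF slice_in] by blast
  qed
  moreover have "\<exists>w\<in>L2 (cylinder \<Omega> T). weak_space_derivative \<Omega> T bs (field c) w"
    if bs: "set bs \<subseteq> Basis" "length bs \<le> 2" for bs
  proof -
    have "\<forall>i\<in>I. \<exists>w\<in>L2 \<Omega>. weak_derivative \<Omega> bs (push (S i)) w"
      using push_weak_derivative[OF space_bspline_in bs] by blast
    then obtain w where w: "\<And>i. i \<in> I \<Longrightarrow> w i \<in> L2 \<Omega>" "\<And>i. i \<in> I \<Longrightarrow> weak_derivative \<Omega> bs (push (S i)) (w i)" by metis
    let ?w = "\<lambda>z. \<Sum>i\<in>I. w i (fst z) * \<theta> c i (snd z / T)"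
    have "weak_derivative \<Omega> bs (\<lambda>x. field c (x, t)) (\<lambda>x. ?w (x, t))" if t: "t \<in> {0<..<T}" for t
      unfolding slice[OF t] push_slice[abs_def] fst_conv snd_conv
    proof -
      have "weak_derivative \<Omega> bs (\<lambda>x. \<Sum>i\<in>I. \<theta> c i (t / T) * push (S i) x) (\<lambda>x. \<Sum>i\<in>I. \<theta> c i (t / T) * w i x)"
        by (rule weak_derivative_sum[OF finite_space_index open_\<Omega> bs(1) push_S_L2 w])
      then show "weak_derivative \<Omega> bs (\<lambda>x. \<Sum>i\<in>I. \<theta> c i (t / T) * push (S i) x) (\<lambda>x. \<Sum>i\<in>I. w i x * \<theta> c i (t / T))"
        by (simp only: mult.commute[of "w _ _"])
    qed
    moreover have "?w \<in> L2 (cylinder \<Omega> T)" by (rule tensor_L2[OF w(1) \<theta>_L2])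
    ultimately show ?thesis unfolding weak_space_derivative_def by (intro bexI[of _ ?w] AE_I2 impI)
  qed
  ultimately show ?thesis using field_L2 by (simp add: L2_H1_0_H2_def)
qed

text \<open>For fixed x the field is a linear combination of the functions \<theta>, so one weak
  derivative for each \<theta> serves all x at once.\<close>

lemma field_H1_L2: "field c \<in> H1_L2 \<Omega> T"
proof -
  obtain w where w: "\<And>i. w i \<in> L2 {0<..<T}" "\<And>i. weak_derivative {0<..<T} [1] (\<lambda>t. \<theta> c i (t / T)) (w i)"
    using \<theta>_weak_derivative[of c] by metis
  let ?w = "\<lambda>z. \<Sum>i\<in>I. push (S i) (fst z) * w i (snd z)"
  have "(LINT t:{0<..<T}|lborel. field c (x, t) * deriv \<phi> t) = - (LINT t:{0<..<T}|lborel. ?w (x, t) * \<phi> t)"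
    if p: "\<phi> \<in> test_functions {0<..<T}" and x: "x \<in> \<Omega>" for \<phi> x
  proof -
    have "weak_derivative {0<..<T} [1] (\<lambda>t. \<Sum>i\<in>I. push (S i) x * \<theta> c i (t / T)) (\<lambda>t. \<Sum>i\<in>I. push (S i) x * w i t)"
      by (rule weak_derivative_sum[OF finite_space_index _ _ \<theta>_L2 w]) auto
    then have "(LINT t:{0<..<T}|lborel. (\<Sum>i\<in>I. push (S i) x * \<theta> c i (t / T)) * dpartials [1] \<phi> t)
        = - (LINT t:{0<..<T}|lborel. ?w (x, t) * \<phi> t)"
      using p unfolding weak_derivative_def by force
    moreover have "(LINT t:{0<..<T}|lborel. field c (x, t) * deriv \<phi> t)
        = (LINT t:{0<..<T}|lborel. (\<Sum>i\<in>I. push (S i) x * \<theta> c i (t / T)) * dpartials [1] \<phi> t)"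
    proof (rule set_lebesgue_integral_cong)
      show "\<forall>t. t \<in> {0<..<T} \<longrightarrow> field c (x, t) * deriv \<phi> t = (\<Sum>i\<in>I. push (S i) x * \<theta> c i (t / T)) * dpartials [1] \<phi> t"
        using x test_functions_deriv_eq[OF p] by (simp add: field_eq mult.commute dpartials_def)
    qed simp
    ultimately show ?thesis by (rule trans[rotated])
  qed
  then have "weak_time_derivative \<Omega> T (field c) ?w" unfolding weak_time_derivative_def by auto
  moreover have "?w \<in> L2 (cylinder \<Omega> T)" by (rule tensor_L2[OF push_S_L2 w(1)])
  ultimately show ?thesis using field_L2 by (auto simp: H1_L2_def)
qed

text \<open>The slices themselves form the continuous representative: they depend on time only
  through finitely many continuous coefficients.\<close>

lemma field_zero_initial_trace:
  assumes "admissible c" shows "zero_initial_trace \<Omega> T (field c)"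
  unfolding zero_initial_trace_def
proof (intro exI[of _ "\<lambda>t. push (slice c (t / T))"] conjI ballI)
  fix t assume t: "t \<in> {0..T}"
  show "push (slice c (t / T)) \<in> L2 \<Omega>" by (rule push_L2[OF slice_in])
  let ?N = "\<lambda>s. \<Sum>i\<in>I. \<bar>\<theta> c i (s / T) - \<theta> c i (t / T)\<bar> * L2_norm \<Omega> (push (S i))"
  show "((\<lambda>s. L2_norm \<Omega> (\<lambda>x. push (slice c (s / T)) x - push (slice c (t / T)) x)) \<longlongrightarrow> 0) (at t within {0..T})"
  proof (rule tendsto_sandwich[where f = "\<lambda>_. 0" and h = ?N])
    have d: "push (slice c (s / T)) x - push (slice c (t / T)) x = (\<Sum>i\<in>I. (\<theta> c i (s / T) - \<theta> c i (t / T)) * push (S i) x)" for s x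
      by (simp add: push_slice sum_subtractf left_diff_distrib)
    show "\<forall>\<^sub>F s in at t within {0..T}. L2_norm \<Omega> (\<lambda>x. push (slice c (s / T)) x - push (slice c (t / T)) x) \<le> ?N s"
      unfolding d by (rule always_eventually, rule allI, rule L2_norm_sum_le[OF finite_space_index push_S_L2])
    have "((\<lambda>s. \<theta> c i (s / T)) \<longlongrightarrow> \<theta> c i (t / T)) (at t within {0..T})" for i
      using \<theta>_scaled_continuous[of c i] t unfolding continuous_on_def by blast
    from tendsto_mult[OF tendsto_rabs_zero[OF LIM_zero[OF this]] tendsto_const]
    have h: "((\<lambda>s. \<bar>\<theta> c i (s / T) - \<theta> c i (t / T)\<bar> * L2_norm \<Omega> (push (S i))) \<longlongrightarrow> 0 * L2_norm \<Omega> (push (S i))) (at t within {0..T})" for i .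
    have "(?N \<longlongrightarrow> (\<Sum>i\<in>I. 0 * L2_norm \<Omega> (push (S i)))) (at t within {0..T})" by (rule tendsto_sum) (rule h)
    then show "(?N \<longlongrightarrow> 0) (at t within {0..T})" by simp
    show "\<forall>\<^sub>F s in at t within {0..T}. 0 \<le> L2_norm \<Omega> (\<lambda>x. push (slice c (s / T)) x - push (slice c (t / T)) x)"
      by (rule always_eventually, rule allI, rule L2_norm_nonneg)
  qed (rule tendsto_const)
next
  show "AE t in lborel. t \<in> {0<..<T} \<longrightarrow> (AE x in lborel. x \<in> \<Omega> \<longrightarrow> push (slice c (t / T)) x = field c (x, t))"
    by (simp add: field_def)
  have "push (slice c (0 / T)) x = 0" if "x \<in> \<Omega>" for x
    using assms G_W[OF that] unfolding admissible_def push_def by simp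
  then show "AE x in lborel. x \<in> \<Omega> \<longrightarrow> push (slice c (0 / T)) x = 0" by simp
qed

lemma Vh0_V0: "X \<subseteq> V0 \<Omega> T"
  unfolding Vh0_eq V0_def using field_L2_H1_0_H2 field_H1_L2 field_zero_initial_trace by auto

section \<open>The discrete space as a Galerkin space; existence and uniqueness of the discrete
  solution\<close>

lemma slice_lin: "slice (\<lambda>ij. c ij + k * d ij) \<tau> \<eta> = slice c \<tau> \<eta> + k * slice d \<tau> \<eta>"
  by (simp add: slice_def \<theta>_def distrib_right sum.distrib sum_distrib_left sum_distrib_right mult.assoc)

lemma field_lin: "field (\<lambda>ij. c ij + k * d ij) z = field c z + k * field d z"
  by (simp add: field_def push_def slice_lin)

sublocale galerkin \<Omega> T X
proof
  show "0 < T" "open \<Omega>" "X \<subseteq> V0 \<Omega> T" by (fact T open_\<Omega> Vh0_V0)+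
  have s0: "slice (\<lambda>_. 0) \<tau> \<eta> = 0" for \<tau> \<eta> by (simp add: slice_def \<theta>_def)
  then have "field (\<lambda>_. 0) = (\<lambda>z. 0)" by (simp add: field_def push_def fun_eq_iff)
  moreover have "admissible (\<lambda>_. 0)" by (simp add: admissible_def s0)
  ultimately show "(\<lambda>z. 0) \<in> X" unfolding Vh0_eq by (metis imageI mem_Collect_eq)
  fix u v k assume "u \<in> X" "v \<in> X"
  then obtain c d where cd: "u = field c" "admissible c" "v = field d" "admissible d" unfolding Vh0_eq by blast
  have "admissible (\<lambda>ij. c ij + k * d ij)" using cd(2,4) by (simp add: admissible_def slice_lin)
  then show "(\<lambda>z. u z + k * v z) \<in> X"
    unfolding Vh0_eq cd(1,3) by (intro image_eqI[of _ _ "\<lambda>ij. c ij + k * d ij"]) (simp_all add: field_lin fun_eq_iff)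
qed

text \<open>The spanning functions may violate the boundary and initial conditions; existence of the
  Galerkin solution asks only that X be contained in the span of a finite family.\<close>

lemma Vh0_fun_span:
  "X \<subseteq> fun_span (I \<times> {..<Tm.m})
     (\<lambda>(i, j) z. push (S i) (fst z) * (if snd z \<in> {0<..<T} then bspline \<xi> q j (snd z / T) else 0))"
proof
  let ?b = "\<lambda>(i, j) z. push (S i) (fst z) * (if snd z \<in> {0<..<T} then bspline \<xi> q j (snd z / T) else 0)"
  fix v assume "v \<in> X"
  then obtain c where c: "v = field c" unfolding Vh0_eq by blast
  have "field c z = (\<Sum>ij\<in>I \<times> {..<Tm.m}. c ij * ?b ij z)" for z
  proof (cases "snd z \<in> {0<..<T}")
    case True
    have "(\<Sum>ij\<in>I \<times> {..<Tm.m}. c ij * ?b ij z)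
        = (\<Sum>(i, j)\<in>I \<times> {..<Tm.m}. c (i, j) * (push (S i) (fst z) * bspline \<xi> q j (snd z / T)))"
      using True by (intro sum.cong) auto
    also have "\<dots> = (\<Sum>i\<in>I. \<theta> c i (snd z / T) * push (S i) (fst z))"
      unfolding \<theta>_def sum.cartesian_product[symmetric] sum_distrib_right by (intro sum.cong refl) (simp add: mult_ac)
    finally show ?thesis using True by (simp add: field_def push_slice)
  next
    case False
    then have "c ij * ?b ij z = 0" for ij by (cases ij) (simp only: case_prod_conv if_False mult_zero_right)
    then have "(\<Sum>ij\<in>I \<times> {..<Tm.m}. c ij * ?b ij z) = 0" by (rule sum.neutral[OF ballI])
    then show ?thesis using False by (simp only: field_def if_False)
  qed
  then have "v = (\<lambda>z. \<Sum>ij\<in>I \<times> {..<Tm.m}. c ij * ?b ij z)" unfolding c by (rule ext)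
  then show "v \<in> fun_span (I \<times> {..<Tm.m}) ?b" unfolding fun_span_def by (rule range_eqI[of _ _ c])
qed

lemma field_continuous: "continuous_on (cylinder \<Omega> T) (field c)"
proof -
  have "continuous_on (cylinder \<Omega> T) (\<lambda>z. \<theta> c i (snd z / T) * push (S i) (fst z))" if "i \<in> I" for i
  proof (rule continuous_on_mult)
    show "continuous_on (cylinder \<Omega> T) (\<lambda>z. \<theta> c i (snd z / T))"
      by (rule continuous_on_compose2[OF \<theta>_scaled_continuous continuous_on_snd[OF continuous_on_id]]) auto
    show "continuous_on (cylinder \<Omega> T) (\<lambda>z. push (S i) (fst z))"
      by (rule continuous_on_compose2[OF push_continuous[OF space_bspline_in[OF that]] continuous_on_fst[OF continuous_on_id]]) auto
  qed
  then have "continuous_on (cylinder \<Omega> T) (\<lambda>z. \<Sum>i\<in>I. \<theta> c i (snd z / T) * push (S i) (fst z))"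
    by (rule continuous_on_sum)
  then show ?thesis by (rule continuous_on_eq) (use field_eq in auto)
qed

text \<open>Agreement almost everywhere becomes equality, because discrete functions are continuous
  on the open cylinder and 0 elsewhere.\<close>

lemma variational_solution_unique:
  assumes f: "f \<in> L2 (cylinder \<Omega> T)" and u: "variational_solution \<Omega> T f X u" "variational_solution \<Omega> T f X v"
  shows "u = v"
proof
  fix z
  have "u \<in> X" "v \<in> X" using u by (auto simp: variational_solution_def)
  then obtain c d where cd: "u = field c" "v = field d" unfolding Vh0_eq by blast
  show "u z = v z"
  proof (cases "z \<in> cylinder \<Omega> T")
    case True
    have o: "open (cylinder \<Omega> T)" by (intro open_Times open_\<Omega>) simp
    show ?thesis
      using AE_eq_imp_eq_on_open[OF o field_continuous field_continuous _ True, of c d]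
        variational_solution_unique_AE[OF f u] unfolding cd by blast
  next
    case False
    then show ?thesis unfolding cd field_def push_def by (cases z) auto
  qed
qed

lemma variational_solution_exists:
  assumes f: "f \<in> L2 (cylinder \<Omega> T)"
  shows "\<exists>u. variational_solution \<Omega> T f X u"
  using galerkin_exists[OF _ galerkin_axioms Vh0_fun_span f] finite_space_index
  unfolding variational_solution_iff[OF f] by blast

end

theorem proposition3:
  fixes p_s :: "'d::finite \<Rightarrow> nat" and \<Xi>_s :: "'d \<Rightarrow> real list"
    and p_t :: nat and \<Xi>_t :: "real list"
    and F :: "real^'d \<Rightarrow> real^'d" and \<Omega> :: "(real^'d) set" and T :: real
    and f :: "(real^'d) \<times> real \<Rightarrow> real"
  assumes "0 < T"
    and "\<And>k. open_knot_vector (p_s k) (\<Xi>_s k)" and "open_knot_vector p_t \<Xi>_t"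
    and "\<And>k. 2 \<le> p_s k" and "\<And>g. g \<in> space_splines p_s \<Xi>_s \<Longrightarrow> C1_on (box 0 1) g"
    and "1 \<le> p_t" and "\<And>g. g \<in> time_splines p_t \<Xi>_t \<Longrightarrow> continuous_on {0..1} g"
    and "\<And>k. \<exists>g\<in>space_splines p_s \<Xi>_s. \<forall>\<eta>\<in>closure (box 0 1). F \<eta> $ k = g \<eta>"
    and "\<Omega> = F ` box 0 1"
    and "inj_on F (box 0 1)"
    and "\<And>\<eta>. \<eta> \<in> box 0 1 \<Longrightarrow> invertible (matrix (frechet_derivative F (at \<eta>)))"
    and "\<And>E k. E \<in> mesh_elements \<Xi>_s \<Longrightarrow>
           bounded_derivatives_on (F ` E) (\<lambda>x. inv_into (box 0 1) F x $ k)"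
    and "f \<in> L2 (\<Omega> \<times> {0<..<T})"
  shows "(\<forall>u\<^sub>h. is_arg_min (ls_functional \<Omega> T f) (\<lambda>v. v \<in> Vh0 p_s \<Xi>_s p_t \<Xi>_t F T) u\<^sub>h
               \<longleftrightarrow> variational_solution \<Omega> T f (Vh0 p_s \<Xi>_s p_t \<Xi>_t F T) u\<^sub>h)
       \<and> (\<exists>!u\<^sub>h. variational_solution \<Omega> T f (Vh0 p_s \<Xi>_s p_t \<Xi>_t F T) u\<^sub>h)
       \<and> (\<forall>u\<^sub>h u. variational_solution \<Omega> T f (Vh0 p_s \<Xi>_s p_t \<Xi>_t F T) u\<^sub>h
               \<and> variational_solution \<Omega> T f (V0 \<Omega> T) u
            \<longrightarrow> V0_norm \<Omega> T (\<lambda>z. u z - u\<^sub>h z)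
                  \<le> sqrt 2 * (INF v\<^sub>h\<in>Vh0 p_s \<Xi>_s p_t \<Xi>_t F T. V0_norm \<Omega> T (\<lambda>z. u z - v\<^sub>h z)))"
proof -
  interpret spacetime_geometry p_s \<Xi>_s F p_t \<Xi>_t T
    by unfold_locales (use assms in blast)+
  note \<Omega>_eq = assms(9)
  have f: "f \<in> L2 (cylinder (F ` box 0 1) T)" using assms(13) by (simp only: \<Omega>_eq)
  show ?thesis unfolding \<Omega>_eq
  proof (intro conjI allI impI)
    show "is_arg_min (ls_functional (F ` box 0 1) T f) (\<lambda>v. v \<in> Vh0 p_s \<Xi>_s p_t \<Xi>_t F T) u
      \<longleftrightarrow> variational_solution (F ` box 0 1) T f (Vh0 p_s \<Xi>_s p_t \<Xi>_t F T) u" for u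
      by (rule arg_min_iff_variational[OF f])
    show "\<exists>!u. variational_solution (F ` box 0 1) T f (Vh0 p_s \<Xi>_s p_t \<Xi>_t F T) u"
      using variational_solution_exists[OF f] variational_solution_unique[OF f] by blast
    fix u\<^sub>h u assume "variational_solution (F ` box 0 1) T f (Vh0 p_s \<Xi>_s p_t \<Xi>_t F T) u\<^sub>h
      \<and> variational_solution (F ` box 0 1) T f (V0 (F ` box 0 1) T) u"
    then have "V0_norm (F ` box 0 1) T (\<lambda>z. u z - u\<^sub>h z) \<le> sqrt 2 * V0_norm (F ` box 0 1) T (\<lambda>z. u z - v z)"
      if "v \<in> Vh0 p_s \<Xi>_s p_t \<Xi>_t F T" for v
      using Cea[OF f _ _ that] by blast
    \<comment> \<open>Division by \<surd>2 turns the estimate into a lower bound for the set of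
      best-approximation errors, which is nonempty because it contains the one for 0.\<close>
    then have "V0_norm (F ` box 0 1) T (\<lambda>z. u z - u\<^sub>h z) / sqrt 2
        \<le> (INF v\<in>Vh0 p_s \<Xi>_s p_t \<Xi>_t F T. V0_norm (F ` box 0 1) T (\<lambda>z. u z - v z))"
      using X_zero by (intro cINF_greatest) (auto simp: field_simps)
    then show "V0_norm (F ` box 0 1) T (\<lambda>z. u z - u\<^sub>h z)
        \<le> sqrt 2 * (INF v\<in>Vh0 p_s \<Xi>_s p_t \<Xi>_t F T. V0_norm (F ` box 0 1) T (\<lambda>z. u z - v z))"
      by (simp add: field_simps)
  qed
qed

end
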